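(* Let $X$ be a ball quasi-Banach function space on $\mathbb{R}^n$ and $p_-\in(0,\infty)$ be such that, for any given $p\in(0,p_-)$ and $u\in(1,\infty)$, there exists a positive constant $C$ such that, for any sequence $\{f_j\}_{j\in\mathbb{N}}$ of measurable functions on $\mathbb{R}^n$, $$\left\|\left\{\sum_{j\in\mathbb{N}}[\mathcal{M}(f_j)]^u\right\}^{1/u}\right\|_{X^{1/p}}\le C\left\|\left(\sum_{j\in\mathbb{N}}|f_j|^u\right)^{1/u}\right\|_{X^{1/p}}.$$ Let $\delta\in(0,1]$, $q\in(1,\infty)$, $s\in(\frac{n}{p_-}-n-\delta,\infty)\cap\mathbb{Z}_+$, $K$ be an $s$-order standard kernel with regularity $\delta$, $T$ an $s$-order Calderón–Zygmund singular integral operator with kernel $K$, $\widetilde K(x,y):=K(y,x)$ for any $x\neq y$, and $\widetilde T$ the $s$-order modified Calderón–Zygmund operator with kernel $\widetilde K$. Then $\widetilde T$ is bounded on $\mathcal{L}_{X,q,s}(\mathbb{R}^n)$, namely, there exists a positive constant $C$ such that, for any $f\in\mathcal{L}_{X,q,s}(\mathbb{R}^n)$, $$\|\widetilde T(f)\|_{\mathcal{L}_{X,q,s}(\mathbb{R}^n)}\le C\|f\|_{\mathcal{L}_{X,q,s}(\mathbb{R}^n)},$$ if and only if $T$ has the vanishing moments up to order $s$.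
   Context: Notation: $\mathbb{Z}_+=\{0,1,2,\ldots\}$; $B(x,r)=\{y\in\mathbb{R}^n:|x-y|<r\}$; balls are sets $B(x,r)$ with $x\in\mathbb{R}^n$, $r\in(0,\infty)$; $\mathcal{P}_s(\mathbb{R}^n)$ is the set of polynomials on $\mathbb{R}^n$ of total degree at most $s$; $\frac{1}{|E|}\int_E$ is also written as an average integral; $\mathcal{M}(f)(x):=\sup_{B\ni x}\frac1{|B|}\int_B|f(y)|\,dy$ (supremum over balls $B$ containing $x$) is the Hardy–Littlewood maximal operator. Ball quasi-Banach function space: a quasi-normed linear space $X$ of measurable functions on $\mathbb{R}^n$, with quasi-norm $\|\cdot\|_X$ which makes sense for all measurable functions, such that (i) $\|f\|_X=0$ implies $f=0$ a.e.; (ii) $|g|\le|f|$ a.e. implies $\|g\|_X\le\|f\|_X$; (iii) $0\le f_m\uparrow f$ a.e. implies $\|f_m\|_X\uparrow\|f\|_X$; (iv) $\mathbf{1}_B\in X$ for any ball $B$. For $t\in(0,\infty)$, $X^t:=\{f \text{ measurable}: |f|^t\in X\}$ with $\|f\|_{X^t}:=\|\,|f|^t\,\|_X^{1/t}$. Campanato space: for a ball $B$ and locally integrable $g$, $P_B^{(s)}(g)$ is the unique element of $\mathcal{P}_s(\mathbb{R}^n)$ with $\int_B[g-P_B^{(s)}(g)]P\,dx=0$ for all $P\in\mathcal{P}_s(\mathbb{R}^n)$. $\mathcal{L}_{X,q,s}(\mathbb{R}^n)$ is the set of all $f\in L^q_{\mathrm{loc}}(\mathbb{R}^n)$ with $\|f\|_{\mathcal{L}_{X,q,s}(\mathbb{R}^n)}:=\sup_B\frac{|B|}{\|\mathbf{1}_B\|_X}\{\frac1{|B|}\int_B|f-P_B^{(s)}(f)|^q\,dx\}^{1/q}<\infty$,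 the supremum over all balls $B$. This seminorm vanishes on $\mathcal{P}_s(\mathbb{R}^n)$; by abuse of notation $f$ is identified with $f+\mathcal{P}_s(\mathbb{R}^n)$ in this space. Standard kernel: a measurable function $K$ on $\{(x,y)\in\mathbb{R}^n\times\mathbb{R}^n:x\ne y\}$ is an $s$-order standard kernel with regularity $\delta$ if there is a constant $C>0$ such that, for any $\gamma\in\mathbb{Z}_+^n$ with $|\gamma|\le s$ (with $\partial_{(1)}^\gamma$, $\partial_{(2)}^\gamma$ the partial derivatives in the first and the second variable, which are assumed to exist): $|\partial_{(i)}^\gamma K(x,y)|\le C|x-y|^{-n-|\gamma|}$ for $i\in\{1,2\}$ and $x\ne y$; and, whenever $x\neq y$ and $|x-y|\ge2|y-z|$, both $|\partial_{(2)}^\gamma K(x,y)-\partial_{(2)}^\gamma K(x,z)|$ and $|\partial_{(1)}^\gamma K(y,x)-\partial_{(1)}^\gamma K(z,x)|$ are at most $C\frac{|y-z|^\delta}{|x-y|^{n+|\gamma|+\delta}}$. Calderón–Zygmund operator: a linear operator $T$ is an $s$-order Calderón–Zygmund singular integral operator with kernel $K$ if $T$ is bounded on $L^2(\mathbb{R}^n)$ and, for any $f\in L^2(\mathbb{R}^n)$ and almost every $x$, $T(f)(x)=\lim_{\eta\to0^+}\int_{\mathbb{R}^n\setminus B(x,\eta)}K(x,y)f(y)\,dy$. $T$ has the vanishing moments up to order $s$ if, for any $a\in L^2(\mathbb{R}^n)$ with compact support and $\int a(x)x^\gamma\,dx=0$ for all $|\gamma|\le s$, one has $T^*(x^\gamma):=\int_{\mathbb{R}^n}T(a)(x)x^\gamma\,dx=0$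 for all $|\gamma|\le s$. Modified operator: for a ball $B_0=B(x_0,r_0)$ and $f\in L^1_{\mathrm{loc}}(\mathbb{R}^n)$ satisfying $$(\star)\quad \int_{\mathbb{R}^n\setminus B(x,r)}\frac{|f(y)-P^{(s)}_{B(x,r)}(f)(y)|}{|x-y|^{n+s+\delta}}\,dy<\infty\ \text{ for every ball } B(x,r),$$ let $\widetilde T_{B_0}(f)(x):=\lim_{\eta\to0^+}\int_{\mathbb{R}^n\setminus B(x,\eta)}\Big[\widetilde K(x,y)-\sum_{|\gamma|\le s}\frac{\partial_{(1)}^\gamma\widetilde K(x_0,y)}{\gamma!}(x-x_0)^\gamma\mathbf{1}_{\mathbb{R}^n\setminus B_0}(y)\Big]f(y)\,dy$ for almost every $x$. Standing assumption: $\widetilde K$ is also the kernel of an $s$-order Calderón–Zygmund singular integral operator. It is known that every $f$ in the space of the claim satisfies $(\star)$ and that $\widetilde T_{B_0}(f)-\widetilde T_{B_1}(f)\in\mathcal{P}_s(\mathbb{R}^n)$ (up to a null set) for any balls $B_0,B_1$; $\widetilde T$ denotes $\widetilde T_{B_0}$ for any choice of $B_0$. *)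

theory Defs
  imports "HOL-Analysis.Analysis"
begin

text \<open>
  Functions on \<open>\<real>\<^sup>n\<close> are complex-valued maps on \<open>real ^ 'n\<close>, and ``measurable'' means Lebesgue
  measurable. A quasi-normed function space \<open>X\<close> whose quasi-norm makes sense for all measurable
  functions is given by that quasi-norm \<open>N\<close>, with values in \<open>[0,\<infinity>]\<close>; as a set,
  \<open>X = {f. f\<close> measurable and \<open>N f < \<infinity>}\<close>.
\<close>

section \<open>Powers of extended nonnegative reals\<close>

text \<open>Only used for \<open>a > 0\<close>.\<close>

definition ennpowr :: "ennreal \<Rightarrow> real \<Rightarrow> ennreal" where
  "ennpowr x a = (if x = top then top else ennreal (enn2real x powr a))"

section \<open>Ball quasi-Banach function spaces\<close>

definition ball_quasi_banach :: "((real ^ 'n \<Rightarrow> complex) \<Rightarrow> ennreal) \<Rightarrow> bool" where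
  "ball_quasi_banach N \<longleftrightarrow>
     (\<forall>c. \<forall>f \<in> borel_measurable lebesgue. N (\<lambda>x. c * f x) = ennreal (norm c) * N f) \<and>
     (\<exists>\<kappa>::real. \<kappa> \<ge> 1 \<and> (\<forall>f \<in> borel_measurable lebesgue. \<forall>g \<in> borel_measurable lebesgue.
        N (\<lambda>x. f x + g x) \<le> ennreal \<kappa> * (N f + N g))) \<and>
     (\<forall>f \<in> borel_measurable lebesgue. N f = 0 \<longrightarrow> (AE x in lebesgue. f x = 0)) \<and>
     (\<forall>f \<in> borel_measurable lebesgue. \<forall>g \<in> borel_measurable lebesgue.
        (AE x in lebesgue. norm (g x) \<le> norm (f x)) \<longrightarrow> N g \<le> N f) \<and>
     (\<forall>(g :: nat \<Rightarrow> real ^ 'n \<Rightarrow> real) f.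
        (\<forall>m. g m \<in> borel_measurable lebesgue) \<and> f \<in> borel_measurable lebesgue \<and>
        (AE x in lebesgue. (\<forall>m. 0 \<le> g m x) \<and> incseq (\<lambda>m. g m x) \<and> (\<lambda>m. g m x) \<longlonglongrightarrow> f x) \<longrightarrow>
        incseq (\<lambda>m. N (\<lambda>x. of_real (g m x))) \<and>
        (\<lambda>m. N (\<lambda>x. of_real (g m x))) \<longlonglongrightarrow> N (\<lambda>x. of_real (f x))) \<and>
     (\<forall>c r. r > 0 \<longrightarrow> N (indicator (ball c r)) < top)"

text \<open>
  The quasi-norm of a function with values in \<open>[0,\<infinity>]\<close>, such as a maximal function. Since
  the quasi-norm is monotone and definite, a function that is infinite on a set of positive measure
  cannot belong to \<open>X\<close>.
\<close>

definition ext_norm :: "((real ^ 'n \<Rightarrow> complex) \<Rightarrow> ennreal) \<Rightarrow> (real ^ 'n \<Rightarrow> ennreal) \<Rightarrow> ennreal" where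
  "ext_norm N g =
     (if AE x in lebesgue. g x < top then N (\<lambda>x. complex_of_real (enn2real (g x))) else top)"

text \<open>The quasi-norm of \<open>X\<^sup>t\<close>, applied to the modulus \<open>g = \<bar>f\<bar>\<close> of a function.\<close>

definition convexification_norm ::
  "((real ^ 'n \<Rightarrow> complex) \<Rightarrow> ennreal) \<Rightarrow> real \<Rightarrow> (real ^ 'n \<Rightarrow> ennreal) \<Rightarrow> ennreal" where
  "convexification_norm N t g = ennpowr (ext_norm N (\<lambda>x. ennpowr (g x) t)) (1 / t)"

definition hl_maximal :: "(real ^ 'n \<Rightarrow> complex) \<Rightarrow> real ^ 'n \<Rightarrow> ennreal" where
  "hl_maximal f x =
     (SUP (c, r) \<in> {(c, r). 0 < r \<and> x \<in> ball c r}.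
        (\<integral>\<^sup>+ y \<in> ball c r. ennreal (norm (f y)) \<partial>lebesgue) / emeasure lebesgue (ball c r))"

definition fefferman_stein :: "((real ^ 'n \<Rightarrow> complex) \<Rightarrow> ennreal) \<Rightarrow> real \<Rightarrow> bool" where
  "fefferman_stein N p0 \<longleftrightarrow>
     (\<forall>p u. 0 < p \<and> p < p0 \<and> 1 < u \<longrightarrow>
       (\<exists>C::real. C > 0 \<and>
         (\<forall>f :: nat \<Rightarrow> real ^ 'n \<Rightarrow> complex. (\<forall>j. f j \<in> borel_measurable lebesgue) \<longrightarrow>
            convexification_norm N (1 / p) (\<lambda>x. ennpowr (\<Sum>j. ennpowr (hl_maximal (f j) x) u) (1 / u))
            \<le> ennreal C * convexification_norm N (1 / p)
                 (\<lambda>x. ennpowr (\<Sum>j. ennpowr (ennreal (norm (f j x))) u) (1 / u)))))"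

section \<open>Multi-indices, polynomials, partial derivatives\<close>

definition mi_abs :: "('n::finite \<Rightarrow> nat) \<Rightarrow> nat" where
  "mi_abs \<gamma> = (\<Sum>i\<in>UNIV. \<gamma> i)"

definition mi_fact :: "('n::finite \<Rightarrow> nat) \<Rightarrow> real" where
  "mi_fact \<gamma> = (\<Prod>i\<in>UNIV. fact (\<gamma> i))"

definition mi_pow :: "real ^ 'n \<Rightarrow> ('n \<Rightarrow> nat) \<Rightarrow> real" where
  "mi_pow x \<gamma> = (\<Prod>i\<in>UNIV. (x $ i) ^ \<gamma> i)"

lemma finite_mi_abs_le: "finite {\<gamma> :: 'n::finite \<Rightarrow> nat. mi_abs \<gamma> \<le> s}"
proof -
  have "\<gamma> i \<le> s" if "mi_abs \<gamma> \<le> s" for \<gamma> :: "'n \<Rightarrow> nat" and i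
    using member_le_sum[of i UNIV \<gamma>] that by (simp add: mi_abs_def)
  then have "{\<gamma> :: 'n \<Rightarrow> nat. mi_abs \<gamma> \<le> s} \<subseteq> PiE UNIV (\<lambda>_. {..s})"
    by (simp add: subset_eq PiE_def)
  then show ?thesis
    by (rule finite_subset) (simp add: finite_PiE)
qed

definition poly_space :: "nat \<Rightarrow> (real ^ 'n \<Rightarrow> complex) set" where
  "poly_space s = {P. \<exists>c :: ('n \<Rightarrow> nat) \<Rightarrow> complex.
     P = (\<lambda>x. \<Sum>\<gamma> | mi_abs \<gamma> \<le> s. c \<gamma> * of_real (mi_pow x \<gamma>))}"

definition partial :: "'n \<Rightarrow> (real ^ 'n \<Rightarrow> complex) \<Rightarrow> real ^ 'n \<Rightarrow> complex" where
  "partial i f x = vector_derivative (\<lambda>t. f (x + t *\<^sub>R axis i 1)) (at 0)"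

text \<open>
  \<open>foldr partial [i\<^sub>1, \<dots>, i\<^sub>k] f\<close> is the iterated partial derivative of \<open>f\<close> in the directions
  \<open>i\<^sub>k, \<dots>, i\<^sub>1\<close>; all of them are required to exist on \<open>S\<close> for \<open>k \<le> s\<close>.
\<close>

definition partials_exist_on :: "nat \<Rightarrow> (real ^ 'n) set \<Rightarrow> (real ^ 'n \<Rightarrow> complex) \<Rightarrow> bool" where
  "partials_exist_on s S f \<longleftrightarrow>
     (\<forall>js i. \<forall>x \<in> S. length js < s \<longrightarrow>
        (\<lambda>t. foldr partial js f (x + t *\<^sub>R axis i 1)) differentiable (at (0::real)))"

text \<open>
  \<open>\<partial>\<^sup>\<gamma>\<close> is \<open>\<partial>\<^sub>1\<close> iterated \<open>\<gamma>\<^sub>1\<close> times, composed with \<open>\<partial>\<^sub>2\<close> iterated \<open>\<gamma>\<^sub>2\<close> times, and so on, for one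
  fixed enumeration of the coordinates. The index type carries no order, hence the choice; for the
  kernels below, whose derivatives are continuous in the variable of differentiation, the
  enumeration is immaterial.
\<close>

definition coords :: "'n::finite list" where
  "coords = (SOME js. distinct js \<and> set js = UNIV)"

definition mpartial :: "('n \<Rightarrow> nat) \<Rightarrow> (real ^ 'n \<Rightarrow> complex) \<Rightarrow> real ^ 'n \<Rightarrow> complex" where
  "mpartial \<gamma> f = foldr (\<lambda>i. partial i ^^ \<gamma> i) coords f"

section \<open>Campanato spaces\<close>

definition campanato_proj ::
  "nat \<Rightarrow> (real ^ 'n) set \<Rightarrow> (real ^ 'n \<Rightarrow> complex) \<Rightarrow> real ^ 'n \<Rightarrow> complex" where
  "campanato_proj s B g =
     (THE P. P \<in> poly_space s \<and> (\<forall>Q \<in> poly_space s. (LINT x:B|lebesgue. (g x - P x) * Q x) = 0))"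

definition Lq_loc :: "real \<Rightarrow> (real ^ 'n \<Rightarrow> complex) set" where
  "Lq_loc q = {f \<in> borel_measurable lebesgue.
     \<forall>S. compact S \<longrightarrow> set_integrable lebesgue S (\<lambda>x. norm (f x) powr q)}"

text \<open>
  The supremum runs over all balls. For \<open>f \<in> Lq_loc q\<close> the integral is finite, and
  \<open>0 < N (indicator (ball c r)) < \<infinity>\<close> in a ball quasi-Banach function space.
\<close>

definition campanato_norm ::
  "((real ^ 'n \<Rightarrow> complex) \<Rightarrow> ennreal) \<Rightarrow> real \<Rightarrow> nat \<Rightarrow> (real ^ 'n \<Rightarrow> complex) \<Rightarrow> ennreal" where
  "campanato_norm N q s f =
     (SUP (c, r) \<in> {(c, r). 0 < r}.
        emeasure lebesgue (ball c r) / N (indicator (ball c r)) *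
        ennreal ((1 / measure lebesgue (ball c r) *
          (LINT x:ball c r|lebesgue. norm (f x - campanato_proj s (ball c r) f x) powr q)) powr (1 / q)))"

definition campanato ::
  "((real ^ 'n \<Rightarrow> complex) \<Rightarrow> ennreal) \<Rightarrow> real \<Rightarrow> nat \<Rightarrow> (real ^ 'n \<Rightarrow> complex) set" where
  "campanato N q s = {f \<in> Lq_loc q. campanato_norm N q s f < top}"

section \<open>Standard kernels and Calderon--Zygmund operators\<close>

text \<open>The values \<open>K x x\<close> on the diagonal are irrelevant throughout.\<close>

definition standard_kernel :: "nat \<Rightarrow> real \<Rightarrow> (real ^ 'n \<Rightarrow> real ^ 'n \<Rightarrow> complex) \<Rightarrow> bool" where
  "standard_kernel s \<delta> K \<longleftrightarrow>
     (\<lambda>(x, y). K x y) \<in> borel_measurable (lebesgue_on {(x, y). x \<noteq> y}) \<and>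
     (\<forall>y. partials_exist_on s (- {y}) (\<lambda>x. K x y)) \<and>
     (\<forall>x. partials_exist_on s (- {x}) (\<lambda>y. K x y)) \<and>
     (\<exists>C::real. C > 0 \<and>
       (\<forall>\<gamma>. mi_abs \<gamma> \<le> s \<longrightarrow>
         (\<forall>x y. x \<noteq> y \<longrightarrow>
            norm (mpartial \<gamma> (\<lambda>u. K u y) x) \<le> C / norm (x - y) ^ (CARD('n) + mi_abs \<gamma>) \<and>
            norm (mpartial \<gamma> (\<lambda>v. K x v) y) \<le> C / norm (x - y) ^ (CARD('n) + mi_abs \<gamma>)) \<and>
         (\<forall>x y z. x \<noteq> y \<and> norm (x - y) \<ge> 2 * norm (y - z) \<longrightarrow>
            norm (mpartial \<gamma> (\<lambda>v. K x v) y - mpartial \<gamma> (\<lambda>v. K x v) z)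
              \<le> C * (norm (y - z) powr \<delta> / norm (x - y) powr (real CARD('n) + real (mi_abs \<gamma>) + \<delta>)) \<and>
            norm (mpartial \<gamma> (\<lambda>u. K u x) y - mpartial \<gamma> (\<lambda>u. K u x) z)
              \<le> C * (norm (y - z) powr \<delta> / norm (x - y) powr (real CARD('n) + real (mi_abs \<gamma>) + \<delta>)))))"

definition L2 :: "(real ^ 'n \<Rightarrow> complex) set" where
  "L2 = {f \<in> borel_measurable lebesgue. integrable lebesgue (\<lambda>x. (norm (f x))\<^sup>2)}"

definition L2_norm :: "(real ^ 'n \<Rightarrow> complex) \<Rightarrow> real" where
  "L2_norm f = sqrt (LINT x|lebesgue. (norm (f x))\<^sup>2)"

text \<open>
  Elements of \<open>L\<^sup>2\<close> are represented by functions, so linearity holds almost everywhere. That \<open>T\<close>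
  respects equality almost everywhere follows from the integral representation.
\<close>

definition cz_operator ::
  "nat \<Rightarrow> real \<Rightarrow> (real ^ 'n \<Rightarrow> real ^ 'n \<Rightarrow> complex) \<Rightarrow>
   ((real ^ 'n \<Rightarrow> complex) \<Rightarrow> real ^ 'n \<Rightarrow> complex) \<Rightarrow> bool" where
  "cz_operator s \<delta> K T \<longleftrightarrow>
     standard_kernel s \<delta> K \<and>
     (\<forall>a b. \<forall>f \<in> L2. \<forall>g \<in> L2.
        AE x in lebesgue. T (\<lambda>y. a * f y + b * g y) x = a * T f x + b * T g x) \<and>
     (\<exists>C::real. \<forall>f \<in> L2. T f \<in> L2 \<and> L2_norm (T f) \<le> C * L2_norm f) \<and>
     (\<forall>f \<in> L2. AE x in lebesgue.
        ((\<lambda>\<eta>. LINT y:- ball x \<eta>|lebesgue. K x y * f y) \<longlongrightarrow> T f x) (at_right 0))"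

definition vanishing_moments ::
  "nat \<Rightarrow> ((real ^ 'n \<Rightarrow> complex) \<Rightarrow> real ^ 'n \<Rightarrow> complex) \<Rightarrow> bool" where
  "vanishing_moments s T \<longleftrightarrow>
     (\<forall>a \<in> L2. (\<exists>S. compact S \<and> (\<forall>x. x \<notin> S \<longrightarrow> a x = 0)) \<and>
        (\<forall>\<gamma>. mi_abs \<gamma> \<le> s \<longrightarrow> (LINT x|lebesgue. a x * of_real (mi_pow x \<gamma>)) = 0) \<longrightarrow>
        (\<forall>\<gamma>. mi_abs \<gamma> \<le> s \<longrightarrow> (LINT x|lebesgue. T a x * of_real (mi_pow x \<gamma>)) = 0))"

text \<open>
  The modified operator \<open>f \<mapsto> \<T>\<^bsub>B\<^sub>0\<^esub> f\<close> with kernel \<open>K\<close> and \<open>B\<^sub>0 = B(x\<^sub>0, r\<^sub>0)\<close>. For \<open>f\<close> in the Campanato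
  space the limit exists for almost every \<open>x\<close>; the value elsewhere is immaterial.
\<close>

definition modified_cz ::
  "nat \<Rightarrow> (real ^ 'n \<Rightarrow> real ^ 'n \<Rightarrow> complex) \<Rightarrow> real ^ 'n \<Rightarrow> real \<Rightarrow>
   (real ^ 'n \<Rightarrow> complex) \<Rightarrow> real ^ 'n \<Rightarrow> complex" where
  "modified_cz s K x0 r0 f x =
     Lim (at_right 0) (\<lambda>\<eta>. LINT y:- ball x \<eta>|lebesgue.
       (K x y - (\<Sum>\<gamma> | mi_abs \<gamma> \<le> s.
          mpartial \<gamma> (\<lambda>u. K u y) x0 / of_real (mi_fact \<gamma>) * of_real (mi_pow (x - x0) \<gamma>) *
          indicator (- ball x0 r0) y)) * f y)"

end

theory Submission
  imports Defs
begin

text \<open>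
  Let \<open>n = CARD('n)\<close>, let \<open>N\<close> be the quasi-norm, and write \<open>F = modified_cz s (\<lambda>x y. K y x) x0 r0 f\<close>.
  The modified operator is the transpose of \<open>T\<close> on the test functions that it can see: if \<open>a\<close> has
  bounded support and vanishing moments up to order \<open>s\<close>, then \<open>\<integral> F a = \<integral> f (T a)\<close>. The subtracted Taylor
  polynomials of the kernel make the integral defining \<open>F\<close> converge and disappear against \<open>a\<close>
  (\<open>modified_cz_dual\<close>, \<open>modified_cz_dual_poly\<close>). Both directions follow from this identity.

  Necessity. A monomial \<open>f\<close> of degree at most \<open>s\<close> has Campanato norm \<open>0\<close>. So has \<open>F\<close>, which therefore
  agrees almost everywhere on each ball with a polynomial of degree at most \<open>s\<close>; hence
  \<open>\<integral> f (T a) = \<integral> F a = 0\<close> (\<open>vanishing_moments_of_bounded\<close>).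

  Sufficiency. By duality of \<open>L\<^sup>q\<close> and \<open>L\<^sup>q\<^sup>'\<close>, the oscillation of \<open>F\<close> on a ball \<open>B = B(c,r)\<close> is governed by
  \<open>\<integral> F a\<close> for \<open>a\<close> supported in \<open>B\<close> with vanishing moments. As \<open>T a\<close> has vanishing moments too, this is
  \<open>\<integral> (f - P\<^sub>B f) (T a)\<close>. On \<open>2B\<close> one uses the boundedness of \<open>T\<close> on \<open>L\<^sup>q\<^sup>'\<close>. Away from \<open>2B\<close>, Taylor expansion
  of the kernel at \<open>c\<close> gives \<open>\<bar>T a (y)\<bar> \<le> C r\<^sup>s\<^sup>+\<^sup>\<delta> \<bar>y - c\<bar>\<^sup>-\<^sup>n\<^sup>-\<^sup>s\<^sup>-\<^sup>\<delta> \<integral> \<bar>a\<bar>\<close>, which beats the growth of the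
  averages of \<open>\<bar>f - P\<^sub>B f\<bar>\<close> over \<open>2\<^sup>k B\<close> (\<open>atom_pairing\<close>). That growth is controlled by the vector-valued
  maximal inequality for a single indicator function: if \<open>p\<close> is below \<open>p_minus\<close>, the quasi-norm of \<open>1\<^sub>B\<close> grows
  at most by the factor \<open>C 2\<^sup>k\<^sup>n\<^sup>/\<^sup>p\<close> when \<open>B\<close> is replaced by \<open>2\<^sup>k B\<close>. The lower bound on \<open>s\<close> permits a \<open>p\<close> with \<open>n / p - n < s + \<delta>\<close> (\<open>bqb_ball_growth\<close>, \<open>campanato_telescope\<close>).

  Two facts about singular integrals support this. An operator bounded on \<open>L\<^sup>2\<close> is bounded on \<open>L\<^sup>p\<close> for
  \<open>1 < p < \<infinity>\<close>: below \<open>2\<close> by a Calderon--Zygmund decomposition over stopping balls, above \<open>2\<close> by duality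
  with the operator of the transposed kernel (\<open>Lp_boundedness\<close>). And the principal value of an \<open>L\<^sup>q\<close>
  function with bounded support exists almost everywhere, by Cotlar's bound for the maximal truncation
  (\<open>pv_extension\<close>); this gives a meaning to \<open>F\<close>.
\<close>

section \<open>Lebesgue measure and the maximal function\<close>

text \<open>Short notation, mostly for integrals with respect to Lebesgue measure.\<close>

abbreviation (input) Lmeas :: "('a::euclidean_space \<Rightarrow> 'b::topological_space) set" where
  "Lmeas \<equiv> borel_measurable lebesgue"

abbreviation (input) vol :: "'a::euclidean_space set \<Rightarrow> ennreal" where
  "vol \<equiv> emeasure lebesgue"

abbreviation (input) Lint :: "('a::euclidean_space \<Rightarrow> 'b::{banach,second_countable_topology}) \<Rightarrow> bool" where
  "Lint \<equiv> integrable lebesgue"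

abbreviation (input) Lintegral :: "('a::euclidean_space \<Rightarrow> 'b::{banach,second_countable_topology}) \<Rightarrow> 'b" (binder "\<L>" 60) where
  "Lintegral \<equiv> integral\<^sup>L lebesgue"

abbreviation (input) proj :: "nat \<Rightarrow> real ^ 'n \<Rightarrow> real \<Rightarrow> (real ^ 'n \<Rightarrow> complex) \<Rightarrow> real ^ 'n \<Rightarrow> complex" where
  "proj s c r \<equiv> campanato_proj s (ball c r)"

abbreviation (input) leb2 :: "('a::euclidean_space \<times> 'b::euclidean_space) measure" where
  "leb2 \<equiv> lebesgue \<Otimes>\<^sub>M lebesgue"

abbreviation (input) seq_tendsto :: "(nat \<Rightarrow> 'a::topological_space) \<Rightarrow> 'a \<Rightarrow> bool" (infixr "---->" 60) where
  "X ----> l \<equiv> X \<longlonglongrightarrow> l"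

abbreviation (input) lebesgue_AE :: "('a::euclidean_space \<Rightarrow> bool) \<Rightarrow> bool" (binder "AEL " 10) where
  "lebesgue_AE P \<equiv> AE x in lebesgue. P x"

abbreviation (input) ball_int :: "('a::euclidean_space \<Rightarrow> complex) \<Rightarrow> 'a \<Rightarrow> real \<Rightarrow> ennreal" where
  "ball_int f c r \<equiv> (\<integral>\<^sup>+ y \<in> ball c r. ennreal (norm (f y)) \<partial>lebesgue)"

abbreviation (input) ind :: "'a set \<Rightarrow> 'a \<Rightarrow> 'b::zero_neq_one" where
  "ind \<equiv> indicator"

abbreviation (input) lebesgue_nn_integral :: "('a::euclidean_space \<Rightarrow> ennreal) \<Rightarrow> ennreal" (binder "\<I>" 10) where
  "lebesgue_nn_integral \<equiv> nn_integral lebesgue"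

lemmas Lintegrable_add = Bochner_Integration.integrable_add
lemmas Lintegrable_bound = Bochner_Integration.integrable_bound
lemmas Lintegrable_cong = Bochner_Integration.integrable_cong
lemmas Lintegrable_diff = Bochner_Integration.integrable_diff
lemmas Lintegral_add = Bochner_Integration.integral_add
lemmas Lintegral_cong = Bochner_Integration.integral_cong
lemmas Lintegral_diff = Bochner_Integration.integral_diff
lemmas Lintegral_nonneg = Bochner_Integration.integral_nonneg
lemmas Lintegral_sum = Bochner_Integration.integral_sum


lemma emeasure_lebesgue_ball:
 fixes c :: "real ^ 'n"
 assumes "0 <= r"
 shows "vol (ball c r) = ennreal (unit_ball_vol (real CARD('n)) * r ^ CARD('n))"
  and "emeasure lborel (ball c r) = ennreal (unit_ball_vol (real CARD('n)) * r ^ CARD('n))" using emeasure_ball[OF assms, of c] by simp_all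

lemma measure_lebesgue_ball:
 fixes c :: "real ^ 'n"
 assumes "0 <= r"
 shows "measure lebesgue (ball c r) = unit_ball_vol (real CARD('n)) * r ^ CARD('n)" using content_ball[OF assms, of c] by simp

lemma emeasure_ball_pos_finite:
 fixes c :: "real ^ 'n"
 assumes "0 < r"
 shows "vol (ball c r) ~= 0" "vol (ball c r) ~= top" using assms unit_ball_vol_pos[of "real CARD('n)"] by (simp_all only: emeasure_lebesgue_ball less_imp_le ennreal_eq_0_iff not_le ennreal_neq_top) auto

lemma sets_lebesgue_ball [measurable]: "ball c r : sets lebesgue" by simp

lemma ennreal_div_mult_cancel: "b ~= 0 ==> b ~= top ==> a / b * b = (a::ennreal)" using ennreal_mult_divide_eq[of b a] by (simp add: divide_ennreal_def mult_ac)

lemma sigma_finite_lebesgue: "sigma_finite_measure (lebesgue :: 'a::euclidean_space measure)" proof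
 obtain A :: "'a set set" where A: "countable A" "A \<subseteq> sets lborel" "\<Union>A = space lborel"
   "\<forall>a\<in>A. emeasure lborel a ~= \<infinity>" using lborel.sigma_finite_countable by auto
 show "\<exists>A :: 'a set set. countable A & A \<subseteq> sets lebesgue & \<Union>A = space lebesgue & (\<forall>a\<in>A. vol a ~= \<infinity>)" by (rule exI[where x=A]) (use A in "auto simp: subset_eq")
qed

lemma pair_sigma_finite_lebesgue:
 "pair_sigma_finite (lebesgue :: 'a::euclidean_space measure) (lebesgue :: 'b::euclidean_space measure)" unfolding pair_sigma_finite_def by (intro conjI sigma_finite_lebesgue)

lemma borel_measurable_pair_lebesgue:
 fixes f :: "'a::euclidean_space \<times> 'b::euclidean_space => 'c::topological_space"
 assumes "f : borel_measurable borel"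
 shows "f : borel_measurable leb2" proof -
 have "(%z. (fst z, snd z)) : (lebesgue \<Otimes>\<^sub>M lebesgue :: ('a \<times> 'b) measure) \<rightarrow>\<^sub>M borel \<Otimes>\<^sub>M borel" proof (rule measurable_Pair)
  show "fst : lebesgue \<Otimes>\<^sub>M lebesgue \<rightarrow>\<^sub>M (borel :: 'a measure)" by (rule measurable_compose[OF measurable_fst]) (simp add: measurable_completion)
  show "snd : lebesgue \<Otimes>\<^sub>M lebesgue \<rightarrow>\<^sub>M (borel :: 'b measure)" by (rule measurable_compose[OF measurable_snd]) (simp add: measurable_completion)
 qed
 from measurable_compose[OF this, of f borel] assms show ?thesis by (simp add: borel_prod)
qed

text \<open>Hoelder's inequality for upper integrals. Bounds in place of norms spare the case of infinite norms.\<close>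

lemma holder_nn_integral:
 fixes f g :: "'a => complex"
 assumes [measurable]: "f : borel_measurable M" "g : borel_measurable M"
  and p: "1 < p" "1 / p + 1 / p' = 1" and AB: "0 <= A" "0 <= B"
  and f: "(\<integral>\<^sup>+x. ennreal (norm (f x) powr p) \<partial>M) <= ennreal (A powr p)"
  and g: "(\<integral>\<^sup>+x. ennreal (norm (g x) powr p') \<partial>M) <= ennreal (B powr p')"
 shows "(\<integral>\<^sup>+x. ennreal (norm (f x) * norm (g x)) \<partial>M) <= ennreal (A * B)" proof -
 have p': "1 < p'" using p by (smt (verit) divide_less_eq_1_pos divide_nonpos_pos zero_less_divide_1_iff le_divide_eq_1_pos divide_le_0_1_iff)
 show ?thesis proof (cases "A = 0 \<or> B = 0")
  case True
  have "AE x in M. norm (f x) * norm (g x) = 0" proof (cases "A = 0")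
   case True
   then have "(\<integral>\<^sup>+x. ennreal (norm (f x) powr p) \<partial>M) = 0" using f p by simp
   then have "AE x in M. ennreal (norm (f x) powr p) = 0" by (subst (asm) nn_integral_0_iff_AE) auto
   then show ?thesis by eventually_elim (simp add: ennreal_eq_0_iff)
  next
   case False
   then have "(\<integral>\<^sup>+x. ennreal (norm (g x) powr p') \<partial>M) = 0" using True g p' by simp
   then have "AE x in M. ennreal (norm (g x) powr p') = 0" by (subst (asm) nn_integral_0_iff_AE) auto
   then show ?thesis by eventually_elim (simp add: ennreal_eq_0_iff)
  qed
  then have "(\<integral>\<^sup>+x. ennreal (norm (f x) * norm (g x)) \<partial>M) = (\<integral>\<^sup>+x. 0 \<partial>M)" by (intro nn_integral_cong_AE) auto
  then show ?thesis by simp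
 next
  case False
  then have A: "0 < A" and B: "0 < B" using AB by auto
  have pt: "norm (f x) * norm (g x) <=
    (A * B / p / A powr p) * (norm (f x) powr p) + (A * B / p' / B powr p') * (norm (g x) powr p')" for x proof -
   have "(norm (f x) / A) * (norm (g x) / B) <= (norm (f x) / A) powr p / p + (norm (g x) / B) powr p' / p'" using A B p p' by (intro Youngs_inequality) auto
   then have "A * B * ((norm (f x) / A) * (norm (g x) / B)) <= A * B * ((norm (f x) / A) powr p / p + (norm (g x) / B) powr p' / p')" using A B by (intro mult_left_mono) auto
   then show ?thesis using A B by (simp add: powr_divide field_simps)
  qed
  have "(\<integral>\<^sup>+x. ennreal (norm (f x) * norm (g x)) \<partial>M) <=
   (\<integral>\<^sup>+x. ennreal (A * B / p / A powr p) * ennreal (norm (f x) powr p)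
    + ennreal (A * B / p' / B powr p') * ennreal (norm (g x) powr p') \<partial>M)" proof (intro nn_integral_mono)
   fix x
   show "ennreal (norm (f x) * norm (g x)) <= ennreal (A * B / p / A powr p) * ennreal (norm (f x) powr p)
    + ennreal (A * B / p' / B powr p') * ennreal (norm (g x) powr p')" using ennreal_leI[OF pt[of x]] A B p p' by (simp add: ennreal_mult'[symmetric] ennreal_plus[symmetric] del: ennreal_plus)
  qed
  also have "... = ennreal (A * B / p / A powr p) * (\<integral>\<^sup>+x. ennreal (norm (f x) powr p) \<partial>M)
    + ennreal (A * B / p' / B powr p') * (\<integral>\<^sup>+x. ennreal (norm (g x) powr p') \<partial>M)" by (subst nn_integral_add) (auto simp: nn_integral_cmult)
  also have "... <= ennreal (A * B / p / A powr p) * ennreal (A powr p)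
    + ennreal (A * B / p' / B powr p') * ennreal (B powr p')" by (intro add_mono mult_left_mono f g) auto
  also have "... = ennreal (A * B * (1 / p + 1 / p'))" using A B p(1) p' by (simp flip: ennreal_mult ennreal_plus add: algebra_simps)
  finally show ?thesis using p by simp
 qed
qed

text \<open>Decompose the complement of \<open>B(c,r)\<close> into the annuli \<open>2\<^sup>k r \<le> \<bar>y - c\<bar> < 2\<^sup>k\<^sup>+\<^sup>1 r\<close>.\<close>

lemma nn_integral_annuli:
 fixes h :: "real ^ 'n => ennreal"
 assumes [measurable]: "h : Lmeas" and r: "0 < r" and \<beta>: "0 <= \<beta>"
 shows "(\<I> y. h y * ennreal (1 / norm (y - c) powr \<beta>) * ind (- ball c r) y)
  <= (\<Sum>k. ennreal (1 / (2 ^ k * r) powr \<beta>) * (\<I> y. h y * ind (ball c (2 ^ (k + 1) * r)) y))" proof -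
 have pt: "h y * ennreal (1 / norm (y - c) powr \<beta>) * ind (- ball c r) y
   <= (\<Sum>k. ennreal (1 / (2 ^ k * r) powr \<beta>) * (h y * ind (ball c (2 ^ (k + 1) * r)) y))" for y proof (cases "y : ball c r")
  case False
  then have d: "r <= norm (y - c)" by (simp add: dist_norm norm_minus_commute)
  obtain m where m: "norm (y - c) / r < 2 ^ m" using real_arch_pow[of 2 "norm (y - c) / r"] by auto
  define m0 where "m0 = (LEAST m. norm (y - c) / r < 2 ^ m)"
  have m0: "norm (y - c) / r < 2 ^ m0" unfolding m0_def by (rule LeastI[of _ m]) (rule m)
  have "m0 ~= 0" using m0 d r by (auto simp: field_simps intro!: Nat.gr0I)
  then obtain k where k: "m0 = Suc k" by (cases m0) auto
  have "\<not> norm (y - c) / r < 2 ^ k" using not_less_Least[of k "%m. norm (y - c) / r < 2 ^ m"] k m0_def by auto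
  then have lo: "2 ^ k * r <= norm (y - c)" and hi: "norm (y - c) < 2 ^ (k+1) * r" using m0 k r by (auto simp: field_simps)
  have "(2 ^ k * r) powr \<beta> <= norm (y - c) powr \<beta>" using lo r \<beta> by (intro powr_mono2) auto
  then have "1 / norm (y - c) powr \<beta> <= 1 / (2 ^ k * r) powr \<beta>" using r d by (intro divide_left_mono mult_pos_pos) auto
  then have "h y * ennreal (1 / norm (y - c) powr \<beta>) * ind (- ball c r) y
   <= ennreal (1 / (2 ^ k * r) powr \<beta>) * (h y * ind (ball c (2 ^ (k + 1) * r)) y)" using hi False by (auto simp: dist_norm norm_minus_commute mult.commute indicator_def intro!: mult_left_mono ennreal_leI)
  also have "... <= (\<Sum>k. ennreal (1 / (2 ^ k * r) powr \<beta>) * (h y * ind (ball c (2 ^ (k + 1) * r)) y))" using sum_le_suminf[OF summableI, of "{k}" "%k. ennreal (1 / (2 ^ k * r) powr \<beta>) * (h y * ind (ball c (2 ^ (k + 1) * r)) y)"] by simp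
  finally show ?thesis .
 qed simp
 have "(\<I> y. h y * ennreal (1 / norm (y - c) powr \<beta>) * ind (- ball c r) y)
  <= (\<I> y. (\<Sum>k. ennreal (1 / (2 ^ k * r) powr \<beta>) * (h y * ind (ball c (2 ^ (k + 1) * r)) y)))" by (intro nn_integral_mono pt)
 also have "... = (\<Sum>k. ennreal (1 / (2 ^ k * r) powr \<beta>) * (\<I> y. h y * ind (ball c (2 ^ (k + 1) * r)) y))" by (subst nn_integral_suminf, measurable, subst nn_integral_cmult, measurable)
 finally show ?thesis .
qed

lemma geometric_powr_summable:
 assumes "0 < (a::real)"
 shows "summable (%k::nat. 2 powr (- a * real k))"  proof -
 have "(%k::nat. 2 powr (- a * real k)) = (%k. (2 powr (-a)) ^ k)" by (auto simp: powr_powr powr_realpow[symmetric])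
 moreover have "2 powr (-a) < 1" using assms powr_less_mono[of "-a" 0 2] by simp
 ultimately show ?thesis by (simp add: summable_geometric)
qed

definition tail_const :: "'n::finite itself => real => real" where
 "tail_const _ \<delta> = unit_ball_vol (real CARD('n)) * 2 ^ CARD('n) * (\<Sum>k::nat. 2 powr (- \<delta> * real k))"

lemma tail_const_nonneg: "0 < \<delta> ==> 0 <= tail_const TYPE('n::finite) \<delta>" unfolding tail_const_def by (intro mult_nonneg_nonneg suminf_nonneg geometric_powr_summable) auto

text \<open>The annuli contribute a geometric series with ratio \<open>2\<^sup>-\<^sup>\<delta>\<close>, whose sum is part of \<open>tail_const\<close>.\<close>

lemma nn_integral_tail:
 fixes h :: "real ^ 'n => ennreal"
 assumes [measurable]: "h : Lmeas" and r: "0 < r" and \<delta>: "0 < \<delta>"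
  and M: "!!\<rho>. r <= \<rho> ==> (\<I> y. h y * ind (ball c \<rho>) y) <= M * vol (ball c \<rho>)"
 shows "(\<I> y. h y * ennreal (1 / norm (y - c) powr (real CARD('n) + \<delta>)) * ind (- ball c r) y)
  <= ennreal (tail_const TYPE('n) \<delta> / r powr \<delta>) * M" proof -
 let ?n = "CARD('n)" and ?V = "unit_ball_vol (real CARD('n))"
 have V: "0 <= ?V" by simp
 have "(\<I> y. h y * ennreal (1 / norm (y - c) powr (real ?n + \<delta>)) * ind (- ball c r) y)
  <= (\<Sum>k. ennreal (1 / (2 ^ k * r) powr (real ?n + \<delta>)) * (\<I> y. h y * ind (ball c (2 ^ (k + 1) * r)) y))" by (rule nn_integral_annuli) (use r \<delta> in auto)
 also have "... <= (\<Sum>k. ennreal (?V * 2 ^ ?n / r powr \<delta> * 2 powr (- \<delta> * real k)) * M)" proof (intro suminf_le summableI)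
  fix k :: nat
  have r1: "r <= 2 ^ (k + 1) * r" using r one_le_power[of 2 "k+1"] by (simp del: power_Suc)
  have "(2 ^ k * r) powr (real ?n + \<delta>) = (2 ^ k * r) powr real ?n * (2 ^ k * r) powr \<delta>" by (rule powr_add)
  also have "(2 ^ k * r) powr real ?n = (2 ^ k * r) ^ ?n" using r by (intro powr_realpow) auto
  also have "(2 ^ k * r) powr \<delta> = (2 ^ k) powr \<delta> * r powr \<delta>" using r by (simp add: powr_mult)
  also have "(2 ^ k :: real) powr \<delta> = (2 powr real k) powr \<delta>" by (subst powr_realpow) auto
  also have "... = 2 powr (\<delta> * real k)" by (simp only: powr_powr mult.commute)
  finally have pw: "(2 ^ k * r) powr (real ?n + \<delta>) = (2 ^ k * r) ^ ?n * (2 powr (\<delta> * real k) * r powr \<delta>)" .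
  have "2 powr (- \<delta> * real k) = 1 / 2 powr (\<delta> * real k)" by (simp add: powr_minus_divide)
  then have eq: "1 / (2 ^ k * r) powr (real ?n + \<delta>) * (?V * (2 ^ (k+1) * r) ^ ?n) = ?V * 2 ^ ?n / r powr \<delta> * 2 powr (- \<delta> * real k)" using r unfolding pw by (simp add: power_mult_distrib field_simps)
  have "ennreal (1 / (2 ^ k * r) powr (real ?n + \<delta>)) * (\<I> y. h y * ind (ball c (2 ^ (k + 1) * r)) y)
   <= ennreal (1 / (2 ^ k * r) powr (real ?n + \<delta>)) * (M * ennreal (?V * (2 ^ (k+1) * r) ^ ?n))" using M[OF r1] r by (intro mult_left_mono) (auto simp: emeasure_lebesgue_ball)
  also have "... = ennreal (1 / (2 ^ k * r) powr (real ?n + \<delta>) * (?V * (2 ^ (k+1) * r) ^ ?n)) * M" using r by (subst ennreal_mult) (auto simp: mult_ac)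
  finally show "ennreal (1 / (2 ^ k * r) powr (real ?n + \<delta>)) * (\<I> y. h y * ind (ball c (2 ^ (k + 1) * r)) y)
   <= ennreal (?V * 2 ^ ?n / r powr \<delta> * 2 powr (- \<delta> * real k)) * M" unfolding eq .
 qed
 also have "... = (\<Sum>k. ennreal (?V * 2 ^ ?n / r powr \<delta> * 2 powr (- \<delta> * real k))) * M" by simp
 also have "(\<Sum>k. ennreal (?V * 2 ^ ?n / r powr \<delta> * 2 powr (- \<delta> * real k))) =
  ennreal (\<Sum>k. ?V * 2 ^ ?n / r powr \<delta> * 2 powr (- \<delta> * real k))" by (intro suminf_ennreal2 summable_mult geometric_powr_summable \<delta>) (use V in auto)
 also have "(\<Sum>k. ?V * 2 ^ ?n / r powr \<delta> * 2 powr (- \<delta> * real k)) = tail_const TYPE('n) \<delta> / r powr \<delta>" by (subst suminf_mult) (use geometric_powr_summable[OF \<delta>] in "auto simp: tail_const_def")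
 finally show ?thesis .
qed

lemma hl_maximal_ge:
 fixes f :: "real ^ 'n => complex"
 assumes "0 < r" "x : ball c r"
 shows "(\<I> y. ennreal (norm (f y)) * ind (ball c r) y) <= hl_maximal f x * vol (ball c r)" proof -
 let ?E = "vol (ball c r)"
 have E: "?E ~= 0" "?E ~= top" using assms(1) by (rule emeasure_ball_pos_finite)+
 have "(ball_int f c r) / ?E <= hl_maximal f x" unfolding hl_maximal_def by (rule SUP_upper2[of "(c, r)"]) (use assms in auto)
 then have "(ball_int f c r) / ?E * ?E <= hl_maximal f x * ?E" by (rule mult_right_mono) simp
 moreover have "(ball_int f c r) / ?E * ?E = (ball_int f c r)" using E by (rule ennreal_div_mult_cancel)
 ultimately show ?thesis by simp
qed

lemma hl_maximal_le_bound:
 fixes f :: "real ^ 'n => complex"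
 assumes "!!y. norm (f y) <= M"
 shows "hl_maximal f x <= ennreal M" unfolding hl_maximal_def proof (rule SUP_least, clarify)
 fix c :: "real ^ 'n" and r :: real assume r: "0 < r"
 let ?E = "vol (ball c r)"
 have E: "?E ~= 0" "?E ~= top" using r by (rule emeasure_ball_pos_finite)+
 have "(ball_int f c r) <= (\<integral>\<^sup>+ y \<in> ball c r. ennreal M \<partial>lebesgue)" using assms by (intro nn_integral_mono) (auto simp: indicator_def intro!: ennreal_leI)
 also have "... = ennreal M * ?E" by (simp add: nn_integral_cmult_indicator)
 finally show "(ball_int f c r) / ?E <= ennreal M" using E divide_right_mono_ennreal[of _ "ennreal M * ?E" ?E] ennreal_mult_divide_eq[of ?E "ennreal M"] by simp
qed

lemma open_hl_maximal_superlevel: "open {x. t < hl_maximal f x}" proof (subst open_subopen, intro ballI)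
 fix x assume "x : {x. t < hl_maximal f x}"
 then obtain c r where cr: "0 < r" "x : ball c r"
  "t < (ball_int f c r) / vol (ball c r)" unfolding hl_maximal_def by (auto simp: less_SUP_iff)
 have "t < hl_maximal f z" if "z : ball c r" for z unfolding hl_maximal_def less_SUP_iff using that cr by (intro bexI[of _ "(c, r)"]) auto
 then show "\<exists>T. open T & x : T & T \<subseteq> {x. t < hl_maximal f x}" using cr by (intro exI[of _ "ball c r"]) auto
qed

lemma borel_measurable_hl_maximal [measurable]: "hl_maximal f : borel_measurable borel" by (rule borel_measurableI_greater) (simp add: borel_open open_hl_maximal_superlevel)

lemma borel_measurable_hl_maximal_lebesgue [measurable]: "hl_maximal f : Lmeas" using borel_measurable_hl_maximal[of f] by (simp add: measurable_completion)

lemma vitali_compact: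
 fixes S :: "('a::euclidean_space) set"
 assumes "compact S" and "!!x. x : S ==> 0 < r x & x : ball (a x) (r x)"
 obtains C where "finite C" "C \<subseteq> S" "pairwise (%i j. disjnt (ball (a i) (r i)) (ball (a j) (r j))) C"
  "S \<subseteq> (\<Union>i\<in>C. ball (a i) (5 * r i))" proof -
 obtain K where K: "K \<subseteq> S" "finite K" "S \<subseteq> (\<Union>i\<in>K. ball (a i) (r i))" by (rule compactE_image[OF assms(1), of S "%i. ball (a i) (r i)"]) (use assms(2) in auto)
 have r: "0 < r i & r i <= Max (insert 0 (r ` K))" if "i : K" for i using that K assms(2) by auto
 show ?thesis proof (rule Vitali_covering_lemma_balls[OF K(3) r])
  fix C assume "countable C" "C \<subseteq> K"
  "pairwise (%i j. disjnt (ball (a i) (r i)) (ball (a j) (r j))) C"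
  "S \<subseteq> (\<Union>i\<in>C. ball (a i) (5 * r i))"
  then show ?thesis using K by (intro that[of C]) (auto intro: finite_subset)
 qed
qed

lemma nn_integral_sum_disjoint_le:
 assumes "finite C" and [measurable]: "h : borel_measurable M" "!!i. i : C ==> E i : sets M"
  and d: "disjoint_family_on E C"
 shows "(\<Sum>i\<in>C. \<integral>\<^sup>+x. h x * ind (E i) x \<partial>M) <= (\<integral>\<^sup>+x. h x \<partial>M)" proof -
 have "(\<Sum>i\<in>C. \<integral>\<^sup>+x. h x * ind (E i) x \<partial>M) = (\<integral>\<^sup>+x. (\<Sum>i\<in>C. h x * ind (E i) x) \<partial>M)" by (subst nn_integral_sum) auto
 also have "... <= (\<integral>\<^sup>+x. h x \<partial>M)" proof (intro nn_integral_mono)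
  fix x
  have "(\<Sum>i\<in>C. ind (E i) x) <= (1::ennreal)" proof (cases "\<exists>i\<in>C. x : E i")
   case True
   then obtain i where i: "i : C" "x : E i" by auto
   have "(\<Sum>j\<in>C. ind (E j) x) = (\<Sum>j\<in>C. if j = i then 1 else (0::ennreal))" using i d by (intro sum.cong) (auto simp: indicator_def disjoint_family_on_def)
   then show ?thesis using i \<open>finite C\<close> by simp
  qed (simp add: indicator_def)
  then have "h x * (\<Sum>i\<in>C. ind (E i) x) <= h x * 1" by (intro mult_left_mono) auto
  then show "(\<Sum>i\<in>C. h x * ind (E i) x) <= h x" by (simp add: sum_distrib_left)
 qed
 finally show ?thesis .
qed

text \<open>A compact part of the superlevel set is covered by the fivefold dilates of finitely many disjoint
  balls with large average. The factor \<open>5\<^sup>n\<close> is the cost of the dilation.\<close>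

lemma hl_maximal_weak_type:
 fixes f :: "real ^ 'n => complex"
 assumes [measurable]: "f : Lmeas" and t: "0 < t"
 shows "ennreal t * vol {x. ennreal t < hl_maximal f x} <= 5 ^ CARD('n) * (\<I> x. ennreal (norm (f x)))" proof -
 let ?O = "{x. ennreal t < hl_maximal f x}"
 let ?I = "\<integral>\<^sup>+x. ennreal (norm (f x)) \<partial>lebesgue"
 have compact_case: "ennreal t * vol S <= 5 ^ CARD('n) * ?I" if S: "compact S" "S \<subseteq> ?O" for S proof -
  have "\<exists>c r. 0 < r & x : ball c r & ennreal t * vol (ball c r) <= (ball_int f c r)"
   if "x : S" for x proof -
   have "ennreal t < hl_maximal f x" using that S by auto
   then obtain c r where cr: "0 < r" "x : ball c r"
    "ennreal t < (ball_int f c r) / vol (ball c r)" unfolding hl_maximal_def by (auto simp: less_SUP_iff)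
   let ?E = "vol (ball c r)"
   have E: "?E ~= 0" "?E ~= top" using cr(1) by (rule emeasure_ball_pos_finite)+
   have "ennreal t * ?E <= (ball_int f c r) / ?E * ?E" using cr by (intro mult_right_mono) auto
   also have "... = (ball_int f c r)" using E by (rule ennreal_div_mult_cancel)
   finally show ?thesis using cr by blast
  qed
  then have "\<forall>x\<in>S. \<exists>c r. 0 < r & x : ball c r & ennreal t * vol (ball c r) <= (ball_int f c r)" by blast
  then obtain a r where ar': "\<forall>x\<in>S. 0 < r x & x : ball (a x) (r x) &
   ennreal t * vol (ball (a x) (r x)) <= (\<integral>\<^sup>+ y \<in> ball (a x) (r x). ennreal (norm (f y)) \<partial>lebesgue)" unfolding bchoice_iff by blast
  have ar: "!!x. x : S ==> 0 < r x & x : ball (a x) (r x)"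
   "!!x. x : S ==> ennreal t * vol (ball (a x) (r x)) <= (\<integral>\<^sup>+ y \<in> ball (a x) (r x). ennreal (norm (f y)) \<partial>lebesgue)" using ar' by auto
  obtain C where C: "finite C" "C \<subseteq> S" "pairwise (%i j. disjnt (ball (a i) (r i)) (ball (a j) (r j))) C"
   "S \<subseteq> (\<Union>i\<in>C. ball (a i) (5 * r i))" using vitali_compact[OF S(1) ar(1)] by blast
  have "vol S <= (\<Sum>i\<in>C. vol (ball (a i) (5 * r i)))" by (rule order_trans[OF emeasure_mono[OF C(4)] emeasure_subadditive_finite]) (use C in auto)
  also have "... = (\<Sum>i\<in>C. 5 ^ CARD('n) * vol (ball (a i) (r i)))" proof (intro sum.cong refl)
   fix i assume "i : C"
   then have "0 < r i" using ar C by blast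
   then show "vol (ball (a i) (5 * r i)) = 5 ^ CARD('n) * vol (ball (a i) (r i))" by (simp add: emeasure_lebesgue_ball power_mult_distrib ennreal_mult' mult_ac
    flip: ennreal_numeral ennreal_power)
  qed
  finally have "ennreal t * vol S <= ennreal t * (\<Sum>i\<in>C. 5 ^ CARD('n) * vol (ball (a i) (r i)))" by (rule mult_left_mono) simp
  also have "... = 5 ^ CARD('n) * (\<Sum>i\<in>C. ennreal t * vol (ball (a i) (r i)))" by (simp add: sum_distrib_left mult_ac)
  also have "... <= 5 ^ CARD('n) * (\<Sum>i\<in>C. \<integral>\<^sup>+ y \<in> ball (a i) (r i). ennreal (norm (f y)) \<partial>lebesgue)" using ar C by (intro mult_left_mono sum_mono) auto
  also have "... <= 5 ^ CARD('n) * ?I" using C by (intro mult_left_mono nn_integral_sum_disjoint_le)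
    (auto simp: disjoint_family_on_def pairwise_def disjnt_def)
  finally show ?thesis .
 qed
 have "open ?O" by (rule open_hl_maximal_superlevel)
 then obtain S where S: "!!n. compact (S n)" "!!n. S n \<subseteq> ?O" "!!n. S n \<subseteq> interior (S (Suc n))" "\<Union>(range S) = ?O" using open_Union_compact_subsets[of ?O] by (metis (no_types, lifting) image_cong)
 have inc: "incseq S" using S(3) interior_subset by (intro incseq_SucI) blast
 have "ennreal t * vol ?O = ennreal t * (SUP n. vol (S n))" using SUP_emeasure_incseq[OF _ inc, of lebesgue] S by (auto simp: image_subset_iff lmeasurable_compact fmeasurableD)
 also have "... = (SUP n. ennreal t * vol (S n))" by (simp add: SUP_mult_left_ennreal)
 also have "... <= 5 ^ CARD('n) * ?I" by (intro SUP_least compact_case S)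
 finally show ?thesis .
qed


lemma borel_measurable_lebesgueI: "f : borel_measurable borel ==> f : Lmeas" by (simp add: measurable_completion)

lemma measurable_norm_powr [measurable]: "(%y::'a::euclidean_space. ennreal (1 / norm (y - c) powr \<beta>)) : Lmeas" by (rule borel_measurable_lebesgueI) measurable

lemma sets_lebesgue_compl_ball [measurable]: "- ball c r : sets lebesgue" by simp

section \<open>Bounded functions with bounded support\<close>

text \<open>The \<open>p\<close>-th power of the \<open>L\<^sup>p\<close> norm; without the root it is additive over disjoint supports.\<close>

definition lpow :: "real => ('a::euclidean_space => complex) => ennreal" where
 "lpow p f = (\<I> x. ennreal (norm (f x) powr p))"

text \<open>A class dense in \<open>L\<^sup>p\<close> for every finite \<open>p\<close> and contained in the domain \<open>L2\<close> of the operators.\<close>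

definition Linf_c :: "('a::euclidean_space => complex) set" where
 "Linf_c = {f : Lmeas.
  \<exists>M R. (\<forall>x. norm (f x) <= M) & (\<forall>x. x ~: ball 0 R --> f x = 0)}"

lemma Linf_c_measurable: "f : Linf_c ==> f : Lmeas" by (simp add: Linf_c_def)

lemma Linf_cE:
 assumes "f : Linf_c"
 obtains M R where "0 < M" "0 < R" "!!x. norm (f x) <= M" "!!x. x ~: ball 0 R ==> f x = 0" proof -
 obtain M R where MR: "!!x. norm (f x) <= M" "!!x. x ~: ball 0 R ==> f x = 0" using assms by (auto simp: Linf_c_def)
 show ?thesis proof (rule that[of "max M 1" "max R 1"])
  show "norm (f x) <= max M 1" for x using MR(1)[of x] by simp
  show "f x = 0" if "x ~: ball 0 (max R 1)" for x using MR(2)[of x] that by simp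
 qed auto
qed

lemma Linf_cI:
 assumes "f : Lmeas" "!!x. norm (f x) <= M" "!!x. x ~: ball 0 R ==> f x = 0"
 shows "f : Linf_c" using assms by (auto simp: Linf_c_def)

lemma Linf_c_dominated:
 assumes g: "g : Linf_c" and f: "f : Lmeas" and le: "!!x. norm (f x) <= c * norm (g x)" and c: "0 <= c"
 shows "f : Linf_c" proof -
 obtain M R where MR: "!!x. norm (g x) <= M" "!!x. x ~: ball 0 R ==> g x = 0" using g by (rule Linf_cE) blast
 show ?thesis proof (rule Linf_cI[OF f, of "c * M" R])
  show "norm (f x) <= c * M" for x using le[of x] mult_left_mono[OF MR(1)[of x] c] by linarith
  show "f x = 0" if "x ~: ball 0 R" for x using le[of x] MR(2)[OF that] by simp
 qed
qed

lemma Linf_c_indicator: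
 assumes "f : Linf_c" and [measurable]: "S : sets lebesgue"
 shows "(%x. ind S x * f x) : Linf_c" proof (rule Linf_c_dominated[OF assms(1), of _ 1])
 note [measurable] = Linf_c_measurable[OF assms(1)]
 show "(%x. ind S x * f x) : Lmeas" by measurable
qed (auto simp: indicator_def)

lemma Linf_c_cmult:
 assumes "f : Linf_c"
 shows "(%x. a * f x) : Linf_c" proof (rule Linf_c_dominated[OF assms, of _ "norm a"])
 note [measurable] = Linf_c_measurable[OF assms]
 show "(%x. a * f x) : Lmeas" by measurable
qed (auto simp: norm_mult)

lemma Linf_c_add:
 assumes "f : Linf_c" "g : Linf_c"
 shows "(%x. f x + g x) : Linf_c" proof -
 note [measurable] = assms[THEN Linf_c_measurable]
 obtain M R where f: "!!x. norm (f x) <= M" "!!x. x ~: ball 0 R ==> f x = 0" using assms(1) by (rule Linf_cE) blast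
 obtain M' R' where g: "!!x. norm (g x) <= M'" "!!x. x ~: ball 0 R' ==> g x = 0" using assms(2) by (rule Linf_cE) blast
 show ?thesis proof (rule Linf_cI[of _ "M + M'" "max R R'"])
  show "(%x. f x + g x) : Lmeas" by measurable
  show "norm (f x + g x) <= M + M'" for x using f(1)[of x] g(1)[of x] norm_triangle_ineq[of "f x" "g x"] by linarith
  show "f x + g x = 0" if "x ~: ball 0 (max R R')" for x using f(2)[of x] g(2)[of x] that by simp
 qed
qed

lemma Linf_c_diff:
 assumes "f : Linf_c" "g : Linf_c"
 shows "(%x. f x - g x) : Linf_c" using Linf_c_add[OF assms(1) Linf_c_cmult[OF assms(2), of "-1"]] by simp

lemma Linf_c_zero: "(%x. 0) : Linf_c" by (rule Linf_cI[of _ 0 0]) auto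

lemma Linf_c_sum:
 assumes "!!i. i : I ==> f i : Linf_c"
 shows "(%x. \<Sum>i\<in>I. f i x) : Linf_c" using assms by (induction I rule: infinite_finite_induct) (auto intro: Linf_c_add Linf_c_zero)

lemma integrable_bounded_ball:
 fixes f :: "'a::euclidean_space => 'b::{banach,second_countable_topology}"
 assumes f: "f : Lmeas" "!!x. norm (f x) <= M" "!!x. x ~: ball c R ==> f x = 0"
 shows "Lint f" proof (rule Lintegrable_bound[where f="%x. M * ind (ball c R) x"])
 have "vol (ball c R) < \<infinity>" using emeasure_lborel_ball_finite[of c R] by simp
 then show "Lint (%x. M * ind (ball c R) x)" by (intro integrable_mult_right) simp
 have "0 <= M" using f(2)[of undefined] norm_ge_zero[of "f undefined"] by linarith
 then show "AEL x. norm (f x) <= norm (M * ind (ball c R) x)" using f(2,3) by (intro AE_I2) (auto simp: indicator_def)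
qed (use f in auto)

lemma Linf_c_integrable:
 assumes "f : Linf_c"
 shows "Lint f" proof -
 obtain M R where "!!x. norm (f x) <= M" "!!x. x ~: ball 0 R ==> f x = 0" using assms by (rule Linf_cE) blast
 then show ?thesis by (rule integrable_bounded_ball[OF Linf_c_measurable[OF assms]])
qed

lemma Linf_c_integrable_powr:
 assumes "f : Linf_c" "0 < p"
 shows "Lint (%x. norm (f x) powr p)" proof -
 note [measurable] = Linf_c_measurable[OF assms(1)]
 obtain M R where f: "0 < M" "!!x. norm (f x) <= M" "!!x. x ~: ball 0 R ==> f x = 0" using assms(1) by (rule Linf_cE) blast
 show ?thesis proof (rule integrable_bounded_ball[of _ "M powr p" 0 R])
  show "norm (norm (f x) powr p) <= M powr p" for x using f assms(2) by (auto intro!: powr_mono2)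
  show "norm (f x) powr p = 0" if "x ~: ball 0 R" for x using f(3)[OF that] by simp
 qed measurable
qed

lemma lpow_finite: "f : Linf_c ==> 0 < p ==> lpow p f < top" using Linf_c_integrable_powr[of f p] unfolding lpow_def integrable_iff_bounded by simp

lemma L2_iff_lpow: "f : L2 \<longleftrightarrow> f : Lmeas & lpow 2 f < top" by (auto simp: L2_def lpow_def integrable_iff_bounded powr_numeral)

lemma Linf_c_L2: "f : Linf_c ==> f : L2" by (simp add: L2_iff_lpow lpow_finite Linf_c_measurable)

lemma lpow_mono:
 assumes "!!x. norm (f x) <= norm (g x)" "0 <= p"
 shows "lpow p f <= lpow p g" unfolding lpow_def using assms by (intro nn_integral_mono ennreal_leI powr_mono2) auto

lemma lpow_indicator:
 assumes "0 < p"
 shows "lpow p (%x. ind S x * f x) = (\<I> x. ennreal (norm (f x) powr p) * ind S x)" unfolding lpow_def using assms by (intro nn_integral_cong) (auto simp: indicator_def)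

section \<open>Standard kernels of order zero and their operators\<close>

definition trunc :: "(real ^ 'n => real ^ 'n => complex) => real => (real ^ 'n => complex) => real ^ 'n => complex" where
 "trunc K \<eta> f x = (LINT y:- ball x \<eta>|lebesgue. K x y * f y)"

locale cz_kernel =
 fixes K :: "real ^ 'n => real ^ 'n => complex" and A \<delta> :: real
 assumes A_pos: "0 < A" and \<delta>_pos: "0 < \<delta>"
  and K_measurable: "(%(x, y). K x y) : borel_measurable borel"
  and K_diag: "K x x = 0"
  and size: "norm (K x y) <= A / norm (x - y) ^ CARD('n)"
  and reg1: "x ~= y ==> 2 * norm (x - z) <= norm (x - y) ==>
   norm (K x y - K z y) <= A * (norm (x - z) powr \<delta> / norm (x - y) powr (real CARD('n) + \<delta>))"
  and reg2: "x ~= y ==> 2 * norm (y - z) <= norm (x - y) ==>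
   norm (K x y - K x z) <= A * (norm (y - z) powr \<delta> / norm (x - y) powr (real CARD('n) + \<delta>))"
begin

lemma K_section_measurable [measurable]: "K x : Lmeas" proof -
 have "(%y. (%(x, y). K x y) (x, y)) : borel_measurable borel" by (rule measurable_compose[OF _ K_measurable]) (simp flip: borel_prod)
 then show ?thesis by (simp add: measurable_completion)
qed

lemma K_section2_measurable [measurable]: "(%x. K x y) : Lmeas" proof -
 have "(%x. (%(x, y). K x y) (x, y)) : borel_measurable borel" by (rule measurable_compose[OF _ K_measurable]) (simp flip: borel_prod)
 then show ?thesis by (simp add: measurable_completion)
qed

lemma swap: "cz_kernel (%x y. K y x) A \<delta>" proof
 have "(%z. (%(x, y). K x y) (snd z, fst z)) : borel_measurable borel" by (rule measurable_compose[OF _ K_measurable]) (simp flip: borel_prod)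
 then show "(%(x, y). K y x) : borel_measurable borel" by (simp add: case_prod_beta)
 show "norm (K y x) <= A / norm (x - y) ^ CARD('n)" for x y using size[of y x] by (simp add: norm_minus_commute)
 show "norm (K y x - K y z) <= A * (norm (x - z) powr \<delta> / norm (x - y) powr (real CARD('n) + \<delta>))"
  if "x ~= y" "2 * norm (x - z) <= norm (x - y)" for x y z using reg2[of y x z] that by (simp add: norm_minus_commute)
 show "norm (K y x - K z x) <= A * (norm (y - z) powr \<delta> / norm (x - y) powr (real CARD('n) + \<delta>))"
  if "x ~= y" "2 * norm (y - z) <= norm (x - y)" for x y z using reg1[of y x z] that by (simp add: norm_minus_commute)
qed (use A_pos \<delta>_pos K_diag in auto)

lemma K_off:
 assumes "0 < \<eta>" "y ~: ball x \<eta>"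
 shows "norm (K x y) <= A / \<eta> ^ CARD('n)" proof -
 have "\<eta> <= norm (x - y)" using assms by (simp add: dist_norm)
 then have "A / norm (x - y) ^ CARD('n) <= A / \<eta> ^ CARD('n)" using assms A_pos by (intro divide_left_mono power_mono mult_pos_pos zero_less_power) auto
 then show ?thesis using size[of x y] by simp
qed

lemma trunc_integrable:
 assumes f: "Lint f" and \<eta>: "0 < \<eta>"
 shows "Lint (%y. K x y * (ind (- ball x \<eta>) y * f y))" proof (rule Lintegrable_bound[where f="%y. (A / \<eta> ^ CARD('n)) * norm (f y)"])
 note [measurable] = borel_measurable_integrable[OF f]
 show "Lint (%y. (A / \<eta> ^ CARD('n)) * norm (f y))" using f by (intro integrable_mult_right integrable_norm)
 show "(%y. K x y * (ind (- ball x \<eta>) y * f y)) : Lmeas" by measurable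
 show "AEL y. norm (K x y * (ind (- ball x \<eta>) y * f y)) <= norm ((A / \<eta> ^ CARD('n)) * norm (f y))" proof (rule AE_I2)
  fix y
  show "norm (K x y * (ind (- ball x \<eta>) y * f y)) <= norm ((A / \<eta> ^ CARD('n)) * norm (f y))" proof (cases "y : ball x \<eta>")
   case False
   have "norm (K x y) * norm (f y) <= (A / \<eta> ^ CARD('n)) * norm (f y)" by (intro mult_right_mono K_off \<eta> False) simp
   then have "norm (K x y) * norm (f y) <= \<bar>(A / \<eta> ^ CARD('n)) * norm (f y)\<bar>" by linarith
   then show ?thesis using False by (simp add: norm_mult abs_mult)
  qed simp
 qed
qed

lemma trunc_eq: "trunc K \<eta> f x = (\<L> y. K x y * (ind (- ball x \<eta>) y * f y))" unfolding trunc_def set_lebesgue_integral_def by (intro Lintegral_cong) (auto simp: indicator_def)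

end

locale cz_op = cz_kernel K A \<delta>
 for K :: "real ^ 'n => real ^ 'n => complex" and A \<delta> +
 fixes T :: "(real ^ 'n => complex) => real ^ 'n => complex" and B :: real
 assumes T_L2: "f : L2 ==> T f : L2"
  and T_lin: "f : L2 ==> g : L2 ==> AEL x. T (%y. a * f y + b * g y) x = a * T f x + b * T g x"
  and T_bdd: "f : L2 ==> lpow 2 (T f) <= ennreal B * lpow 2 f"
  and B_nonneg: "0 <= B"
  and T_pv: "f : L2 ==> AEL x. ((%\<eta>. trunc K \<eta> f x) \<longlongrightarrow> T f x) (at_right 0)"
begin

lemma T_measurable: "f : L2 ==> T f : Lmeas" using T_L2 by (simp add: L2_def)

text \<open>Away from the support of \<open>f\<close> the truncations are eventually constant.\<close>

lemma T_off_support: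
 assumes "f : L2"
 shows "AEL x. (\<exists>\<epsilon>>0. \<forall>y\<in>ball x \<epsilon>. f y = 0) --> T f x = (\<L> y. K x y * f y)" using T_pv[OF assms] proof eventually_elim
 case (elim x)
 show ?case proof (intro impI, elim exE conjE)
  fix \<epsilon> :: real assume \<epsilon>: "0 < \<epsilon>" "\<forall>y\<in>ball x \<epsilon>. f y = 0"
  have "eventually (%\<eta>. trunc K \<eta> f x = (\<L> y. K x y * f y)) (at_right 0)" proof (rule eventually_at_rightI[OF _ \<epsilon>(1)])
   fix \<eta> assume \<eta>: "\<eta> : {0<..<\<epsilon>}"
   show "trunc K \<eta> f x = (\<L> y. K x y * f y)" unfolding trunc_eq using \<eta> \<epsilon>(2) by (intro Lintegral_cong) (auto simp: indicator_def)
  qed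
  then have "((%\<eta>. trunc K \<eta> f x) \<longlongrightarrow> (\<L> y. K x y * f y)) (at_right 0)" by (rule tendsto_eventually)
  then show "T f x = (\<L> y. K x y * f y)" using elim tendsto_unique[of "at_right (0::real)"] by (meson trivial_limit_at_right_real)
 qed
qed

lemma T_zero: "AEL x. T (%y. 0) x = 0" using T_lin[of "%y. 0" "%y. 0" 0 0] Linf_c_L2[OF Linf_c_zero] by simp

lemma T_add: "f : L2 ==> g : L2 ==> AEL x. T (%y. f y + g y) x = T f x + T g x" using T_lin[of f g 1 1] by simp

lemma T_diff: "f : L2 ==> g : L2 ==> AEL x. T (%y. f y - g y) x = T f x - T g x" using T_lin[of f g 1 "-1"] by simp

lemma T_sum:
 assumes "finite I" "!!i. i : I ==> f i : Linf_c"
 shows "AEL x. T (%y. \<Sum>i\<in>I. f i y) x = (\<Sum>i\<in>I. T (f i) x)" using assms proof (induction I rule: finite_induct)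
 case empty
 then show ?case using T_zero by simp
next
 case (insert i I)
 have "AEL x. T (%y. \<Sum>i\<in>I. f i y) x = (\<Sum>i\<in>I. T (f i) x)" using insert by auto
 moreover have "AEL x. T (%y. f i y + (\<Sum>i\<in>I. f i y)) x = T (f i) x + T (%y. \<Sum>i\<in>I. f i y) x" using insert by (intro T_add Linf_c_L2 Linf_c_sum) auto
 ultimately show ?case by eventually_elim (use insert in simp)
qed

text \<open>Cotlar's inequality before averaging. For \<open>z\<close> close to \<open>x\<close>, the truncated integral at \<open>x\<close> differs from
  \<open>T (f 1\<^sub>-\<^sub>B) (z)\<close> only by the regularity of the kernel, and \<open>T (f 1\<^sub>-\<^sub>B) = T f - T (f 1\<^sub>B)\<close>.\<close>

lemma trunc_le_average:
 assumes f: "f : Linf_c" and \<eta>: "0 < \<eta>" and M: "0 <= M"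
  and avg: "!!\<rho>. \<eta> <= \<rho> ==> (\<I> y. ennreal (norm (f y)) * ind (ball x \<rho>) y) <= ennreal M * vol (ball x \<rho>)"
 shows "AEL z. z : ball x (\<eta> / 2) -->
  norm (trunc K \<eta> f x) <= A * tail_const TYPE('n) \<delta> * M + norm (T f z) + norm (T (%y. ind (ball x \<eta>) y * f y) z)" proof -
 let ?f1 = "%y. ind (ball x \<eta>) y * f y" and ?f2 = "%y. ind (- ball x \<eta>) y * f y"
 have [measurable]: "f : Lmeas" using f by (rule Linf_c_measurable)
 have f1: "?f1 : Linf_c" by (intro Linf_c_indicator f) simp
 have f2: "?f2 : Linf_c" by (intro Linf_c_indicator f) simp
 have sum: "(%y. ?f1 y + ?f2 y) = f" by (auto simp: indicator_def)
 have "AEL z. T f z = T ?f1 z + T ?f2 z" using T_add[OF Linf_c_L2[OF f1] Linf_c_L2[OF f2]] unfolding sum .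
 moreover have "AEL z. (\<exists>\<epsilon>>0. \<forall>y\<in>ball z \<epsilon>. ?f2 y = 0) --> T ?f2 z = (\<L> y. K z y * ?f2 y)" by (rule T_off_support[OF Linf_c_L2[OF f2]])
 ultimately show ?thesis proof eventually_elim
  case (elim z)
  show ?case proof
   assume z: "z : ball x (\<eta> / 2)"
   have sub: "ball z (\<eta>/2) \<subseteq> ball x \<eta>" proof
    fix y assume "y : ball z (\<eta>/2)"
    then show "y : ball x \<eta>" using z dist_triangle[of x y z] by simp
   qed
   then have T2: "T ?f2 z = (\<L> y. K z y * ?f2 y)" using elim(2) \<eta> by (auto intro!: exI[of _ "\<eta>/2"] simp: indicator_def)
   have i1: "Lint (%y. K x y * ?f2 y)" by (rule trunc_integrable[OF Linf_c_integrable[OF f] \<eta>])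
   have "Lint (%y. K z y * (ind (- ball z (\<eta>/2)) y * ?f2 y))" by (rule trunc_integrable[OF Linf_c_integrable[OF f2]]) (use \<eta> in simp)
   also have "(%y. K z y * (ind (- ball z (\<eta>/2)) y * ?f2 y)) = (%y. K z y * ?f2 y)" using sub by (intro ext) (auto simp: indicator_def simp del: mem_ball)
   finally have i2: "Lint (%y. K z y * ?f2 y)" .
   have pt: "ennreal (norm (K x y * ?f2 y - K z y * ?f2 y)) <=
    ennreal (A * \<eta> powr \<delta>) * (ennreal (norm (f y)) * ennreal (1 / norm (y - x) powr (real CARD('n) + \<delta>)) * ind (- ball x \<eta>) y)" for y proof (cases "y : ball x \<eta>")
    case False
    then have d: "\<eta> <= norm (x - y)" by (simp add: dist_norm)
    have dz: "norm (x - z) <= \<eta> / 2" using z by (simp add: dist_norm)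
    have "norm (K x y - K z y) <= A * (norm (x - z) powr \<delta> / norm (x - y) powr (real CARD('n) + \<delta>))" using d dz \<eta> by (intro reg1) auto
    also have "... <= A * (\<eta> powr \<delta> / norm (x - y) powr (real CARD('n) + \<delta>))" using dz \<eta> A_pos \<delta>_pos by (intro mult_left_mono divide_right_mono powr_mono2) auto
    finally have "norm (K x y - K z y) * norm (f y) <= A * (\<eta> powr \<delta> / norm (x - y) powr (real CARD('n) + \<delta>)) * norm (f y)" by (rule mult_right_mono) simp
    moreover have "norm (K x y * ?f2 y - K z y * ?f2 y) = norm (K x y - K z y) * norm (f y)" using False by (simp flip: left_diff_distrib add: norm_mult)
    ultimately show ?thesis using False A_pos \<eta> by (simp add: ennreal_mult'[symmetric] norm_minus_commute mult_ac)
   qed simp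
   have "ennreal (norm (trunc K \<eta> f x - T ?f2 z)) = ennreal (norm (\<L> y. K x y * ?f2 y - K z y * ?f2 y))" unfolding T2 trunc_eq using i1 i2 by simp
   also have "... <= (\<I> y. ennreal (norm (K x y * ?f2 y - K z y * ?f2 y)))" using i1 i2 by (intro integral_norm_bound_ennreal) auto
   also have "... <= (\<I> y. ennreal (A * \<eta> powr \<delta>) * (ennreal (norm (f y)) * ennreal (1 / norm (y - x) powr (real CARD('n) + \<delta>)) * ind (- ball x \<eta>) y))" by (intro nn_integral_mono pt)
   also have "... = ennreal (A * \<eta> powr \<delta>) * (\<I> y. ennreal (norm (f y)) * ennreal (1 / norm (y - x) powr (real CARD('n) + \<delta>)) * ind (- ball x \<eta>) y)" by (rule nn_integral_cmult) measurable
   also have "... <= ennreal (A * \<eta> powr \<delta>) * (ennreal (tail_const TYPE('n) \<delta> / \<eta> powr \<delta>) * ennreal M)" by (intro mult_left_mono nn_integral_tail \<eta> \<delta>_pos avg) auto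
   also have "... = ennreal (A * \<eta> powr \<delta> * (tail_const TYPE('n) \<delta> / \<eta> powr \<delta> * M))" using A_pos tail_const_nonneg[OF \<delta>_pos, where 'n='n] M by (simp add: ennreal_mult'[symmetric] ennreal_mult[symmetric])
   also have "A * \<eta> powr \<delta> * (tail_const TYPE('n) \<delta> / \<eta> powr \<delta> * M) = A * tail_const TYPE('n) \<delta> * M" using \<eta> by simp
   finally have "norm (trunc K \<eta> f x - T ?f2 z) <= A * tail_const TYPE('n) \<delta> * M" using A_pos tail_const_nonneg[OF \<delta>_pos, where 'n='n] M by (subst (asm) ennreal_le_iff) auto
   moreover have "T ?f2 z = T f z - T ?f1 z" using elim(1) by simp
   ultimately show "norm (trunc K \<eta> f x) <= A * tail_const TYPE('n) \<delta> * M + norm (T f z) + norm (T ?f1 z)" using norm_triangle_ineq[of "trunc K \<eta> f x - T ?f2 z" "T f z - T ?f1 z"] norm_triangle_ineq4[of "T f z" "T ?f1 z"] by simp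
  qed
 qed
qed

end


lemma measurable_lpow [measurable (raw)]: "f : Lmeas ==> (%x. ennreal (norm (f x) powr p)) : Lmeas"
 for f :: "'a::euclidean_space => complex" by measurable

lemma jensen_ball:
 fixes f :: "real ^ 'n => complex"
 assumes [measurable]: "f : Lmeas" and q: "1 < q" and r: "0 < r" and h: "0 <= h"
  and le: "(\<I> y. ennreal (norm (f y) powr q) * ind (ball c r) y) <= ennreal h * vol (ball c r)"
 shows "(\<I> y. ennreal (norm (f y)) * ind (ball c r) y) <= ennreal (h powr (1 / q)) * vol (ball c r)" proof -
 define m where "m = unit_ball_vol (real CARD('n)) * r ^ CARD('n)"
 have m: "0 < m" and Em: "vol (ball c r) = ennreal m" using r unit_ball_vol_pos[of "real CARD('n)"] by (simp_all add: m_def emeasure_lebesgue_ball)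
 have "(\<I> y. ennreal (norm (ind (ball c r) y * f y) * norm (ind (ball c r) y :: complex)))
   <= ennreal ((h * m) powr (1 / q) * m powr (1 - 1 / q))" proof (rule holder_nn_integral[where p=q and p'="1 / (1 - 1 / q)"])
  have "(\<I> x. ennreal (norm (ind (ball c r) x * f x) powr q)) =
   (\<I> y. ennreal (norm (f y) powr q) * ind (ball c r) y)" using q by (intro nn_integral_cong) (auto simp: indicator_def)
  also have "... <= ennreal (h * m)" using le h m by (simp add: Em ennreal_mult)
  also have "h * m = ((h * m) powr (1 / q)) powr q" using q h m by (simp add: powr_powr)
  finally show "(\<I> x. ennreal (norm (ind (ball c r) x * f x) powr q)) <= ennreal (((h * m) powr (1 / q)) powr q)" .
  have "(\<I> x. ennreal (norm (ind (ball c r) x :: complex) powr (1 / (1 - 1 / q)))) = (\<I> x. ind (ball c r) x)" by (intro nn_integral_cong) (auto simp: indicator_def)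
  also have "... = ennreal m" using Em by simp
  also have "m = (m powr (1 - 1 / q)) powr (1 / (1 - 1 / q))" using q m by (simp add: powr_powr)
  finally show "(\<I> x. ennreal (norm (ind (ball c r) x :: complex) powr (1 / (1 - 1 / q)))) <= ennreal ((m powr (1 - 1 / q)) powr (1 / (1 - 1 / q)))" by simp
  show "(%x. ind (ball c r) x * f x) : Lmeas" by measurable
  show "(%x. ind (ball c r) x :: complex) : Lmeas" by measurable
 qed (use q h m in auto)
 also have "(h * m) powr (1 / q) * m powr (1 - 1 / q) = h powr (1 / q) * m" using m by (simp add: powr_mult mult.assoc flip: powr_add)
 also have "(\<I> y. ennreal (norm (ind (ball c r) y * f y) * norm (ind (ball c r) y :: complex)))
   = (\<I> y. ennreal (norm (f y)) * ind (ball c r) y)" by (intro nn_integral_cong) (auto simp: indicator_def)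
 finally show ?thesis using m by (simp add: Em ennreal_mult)
qed

lemma powr_add_le:
 assumes "0 <= a" "0 <= b" "0 <= c" "0 < (q::real)"
 shows "(a + b + c) powr q <= 3 powr q * (a powr q + b powr q + c powr q)" proof -
 define m where "m = max a (max b c)"
 have "(a + b + c) powr q <= (3 * m) powr q" using assms by (intro powr_mono2) (auto simp: m_def)
 also have "... = 3 powr q * m powr q" by (simp add: powr_mult)
 also have "m powr q <= a powr q + b powr q + c powr q" using powr_ge_zero[of a q] powr_ge_zero[of b q] powr_ge_zero[of c q] by (auto simp: m_def max_def)
 finally show ?thesis by simp
qed

definition hl_power :: "real => (real ^ 'n => complex) => real ^ 'n => ennreal" where
 "hl_power q f = hl_maximal (%y. complex_of_real (norm (f y) powr q))"

lemma hl_power_measurable [measurable]: "hl_power q f : Lmeas" unfolding hl_power_def by measurable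

lemma hl_power_ge:
 fixes f :: "real ^ 'n => complex"
 assumes "0 < r" "x : ball c r"
 shows "(\<I> y. ennreal (norm (f y) powr q) * ind (ball c r) y) <= hl_power q f x * vol (ball c r)" using hl_maximal_ge[OF assms, of "%y. complex_of_real (norm (f y) powr q)"] by (simp add: hl_power_def)

lemma hl_power_weak:
 fixes f :: "real ^ 'n => complex"
 assumes [measurable]: "f : Lmeas" and t: "0 < t"
 shows "ennreal t * vol {x. ennreal t < hl_power q f x} <= 5 ^ CARD('n) * lpow q f" using hl_maximal_weak_type[OF _ t, of "%y. complex_of_real (norm (f y) powr q)"] by (simp add: hl_power_def lpow_def)

lemma ennreal_less_addD:
 assumes "t < a + (b::ennreal)" shows "t / 2 < a \<or> t / 2 < b" proof (rule ccontr)
 assume "\<not> ?thesis"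
 then have "a <= t / 2" "b <= t / 2" by (auto simp: not_less)
 then have "a + b <= t / 2 + t / 2" by (rule add_mono)
 also have "t / 2 + t / 2 = t" by (simp add: divide_ennreal_def mult_2_right[symmetric] mult.assoc ennreal_inverse_mult flip: distrib_left)
   (metis ennreal_inverse_mult ennreal_divide_times ennreal_mult_divide_eq divide_ennreal_def mult.assoc ennreal_numeral ennreal_neq_top zero_neq_numeral)
 finally show False using assms by simp
qed

lemma weak_type_add:
 assumes [measurable]: "f : borel_measurable M" "g : borel_measurable M"
  and a: "0 < a" "0 < b" and C: "0 <= C" "0 <= D"
  and f: "!!t. 0 < t ==> ennreal t * emeasure M {x : space M. ennreal t < f x} <= P"
  and g: "!!t. 0 < t ==> ennreal t * emeasure M {x : space M. ennreal t < g x} <= Q"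
  and t: "0 < t"
 shows "ennreal t * emeasure M {x : space M. ennreal t < ennreal a * f x + ennreal b * g x} <= ennreal (2 * a) * P + ennreal (2 * b) * Q" proof -
 have imp: "ennreal s < h" if "ennreal t / 2 < ennreal c * h" "s = t / (2 * c)" "0 < c" for c s h proof (cases h)
  case (real r)
  have "ennreal (t / 2) < ennreal (c * r)" using that real t by (simp add: ennreal_divide_numeral[symmetric] ennreal_mult')
  then have "t / 2 < c * r" using t by (subst (asm) ennreal_less_iff) auto
  moreover have "t / 2 = c * s" using that(2,3) by simp
  ultimately have "c * s < c * r" by linarith
  then have "s < r" using that(3) by simp
  moreover have "0 <= s" using that t by simp
  ultimately show ?thesis using real by (simp add: ennreal_less_iff)
 qed (use that in auto)
 have "{x : space M. ennreal t < ennreal a * f x + ennreal b * g x} \<subseteq>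
  {x : space M. ennreal (t / (2 * a)) < f x} \<union> {x : space M. ennreal (t / (2 * b)) < g x}" using ennreal_less_addD imp a by blast
 then have "emeasure M {x : space M. ennreal t < ennreal a * f x + ennreal b * g x} <=
  emeasure M {x : space M. ennreal (t / (2 * a)) < f x} + emeasure M {x : space M. ennreal (t / (2 * b)) < g x}" by (intro order_trans[OF emeasure_mono emeasure_subadditive]) auto
 then have "ennreal t * emeasure M {x : space M. ennreal t < ennreal a * f x + ennreal b * g x} <=
  ennreal t * (emeasure M {x : space M. ennreal (t / (2 * a)) < f x} + emeasure M {x : space M. ennreal (t / (2 * b)) < g x})" by (rule mult_left_mono) simp
 also have "... = ennreal t * emeasure M {x : space M. ennreal (t / (2 * a)) < f x} + ennreal t * emeasure M {x : space M. ennreal (t / (2 * b)) < g x}" by (rule distrib_left)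
 also have "... <= ennreal (2 * a) * P + ennreal (2 * b) * Q" proof (rule add_mono)
  have "ennreal t = ennreal (2 * a) * ennreal (t / (2 * a))" using a t by (simp add: ennreal_mult'[symmetric])
  then have "ennreal t * emeasure M {x : space M. ennreal (t / (2 * a)) < f x} =
    ennreal (2 * a) * (ennreal (t / (2 * a)) * emeasure M {x : space M. ennreal (t / (2 * a)) < f x})" by (simp only: mult.assoc)
  also have "... <= ennreal (2 * a) * P" using a t by (intro mult_left_mono f) auto
  finally show "ennreal t * emeasure M {x : space M. ennreal (t / (2 * a)) < f x} <= ennreal (2 * a) * P" .
  have "ennreal t = ennreal (2 * b) * ennreal (t / (2 * b))" using a t by (simp add: ennreal_mult'[symmetric])
  then have "ennreal t * emeasure M {x : space M. ennreal (t / (2 * b)) < g x} =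
    ennreal (2 * b) * (ennreal (t / (2 * b)) * emeasure M {x : space M. ennreal (t / (2 * b)) < g x})" by (simp only: mult.assoc)
  also have "... <= ennreal (2 * b) * Q" using a t by (intro mult_left_mono g) auto
  finally show "ennreal t * emeasure M {x : space M. ennreal (t / (2 * b)) < g x} <= ennreal (2 * b) * Q" .
 qed
 finally show ?thesis .
qed

context cz_op
begin

definition trunc_majorant_const :: "real => real => real" where
 "trunc_majorant_const q D = 3 powr q * ((A * tail_const TYPE('n) \<delta>) powr q + D * 2 ^ CARD('n)) + 1"

text \<open>A bound for the maximal truncation, raised to the power \<open>q\<close>.\<close>

definition trunc_majorant :: "real => real => (real ^ 'n => complex) => real ^ 'n => ennreal" where
 "trunc_majorant q D f x = ennreal (trunc_majorant_const q D) * hl_power q f x + ennreal (3 powr q) * hl_power q (T f) x"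

lemma trunc_majorant_measurable [measurable]: "trunc_majorant q D f : Lmeas" unfolding trunc_majorant_def by measurable

lemma trunc_majorant_const_pos: "0 <= D ==> 0 < trunc_majorant_const q D" unfolding trunc_majorant_const_def by (intro add_nonneg_pos mult_nonneg_nonneg add_nonneg_nonneg) auto

text \<open>The average of \<open>trunc_le_average\<close> over \<open>z\<close> in \<open>B(x,\<eta>/2)\<close>, after taking \<open>q\<close>-th powers.\<close>

lemma trunc_le_majorant:
 assumes q: "1 < q" and D: "0 <= D" and bd: "!!f. f : Linf_c ==> lpow q (T f) <= ennreal D * lpow q f"
  and f: "f : Linf_c" and \<eta>: "0 < \<eta>"
 shows "ennreal (norm (trunc K \<eta> f x) powr q) <= trunc_majorant q D f x" proof -
 note [measurable] = Linf_c_measurable[OF f] T_measurable[OF Linf_c_L2[OF f]]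
 let ?f1 = "%y. ind (ball x \<eta>) y * f y"
 have f1: "?f1 : Linf_c" by (intro Linf_c_indicator f) simp
 note [measurable] = T_measurable[OF Linf_c_L2[OF f1]]
 obtain Mf where Mf: "!!x. norm (f x) <= Mf" using f by (rule Linf_cE) blast
 have "hl_power q f x <= ennreal (Mf powr q)" unfolding hl_power_def using Mf q by (intro hl_maximal_le_bound) (auto intro!: powr_mono2)
 then obtain h where h: "0 <= h" "hl_power q f x = ennreal h" by (metis ennreal_cases ennreal_less_top leD less_top top_unique)
 let ?c = "A * tail_const TYPE('n) \<delta>"
 have c: "0 <= ?c" using A_pos tail_const_nonneg[OF \<delta>_pos, where 'n='n] by simp
 let ?B = "ball x (\<eta> / 2)"
 have \<eta>2: "0 < \<eta> / 2" using \<eta> by simp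
 define E where "E = vol ?B"
 have E: "E ~= 0" "E ~= top" unfolding E_def by (rule emeasure_ball_pos_finite[OF \<eta>2])+
 have E2: "vol (ball x \<eta>) = 2 ^ CARD('n) * E" proof -
  have "(2::ennreal) ^ CARD('n) = ennreal (2 ^ CARD('n))" by (simp flip: ennreal_power)
  then show ?thesis using \<eta> by (simp add: E_def emeasure_lebesgue_ball power_divide ennreal_mult'[symmetric])
 qed
 define m where "m = norm (trunc K \<eta> f x) powr q"
 have "AEL z. z : ?B -->
  norm (trunc K \<eta> f x) <= ?c * h powr (1 / q) + norm (T f z) + norm (T ?f1 z)" proof (rule trunc_le_average[OF f \<eta>])
  fix \<rho> assume \<rho>: "\<eta> <= \<rho>"
  then have "0 < \<rho>" using \<eta> by simp
  then show "(\<I> y. ennreal (norm (f y)) * ind (ball x \<rho>) y) <= ennreal (h powr (1 / q)) * vol (ball x \<rho>)" using hl_power_ge[of \<rho> x x f q] by (intro jensen_ball q h) (simp_all add: h(2))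
 qed simp
 then have ae: "AEL z. ennreal m * ind ?B z <=
  ennreal (3 powr q) * ((ennreal (?c powr q * h) * ind ?B z + ennreal (norm (T f z) powr q) * ind ?B z) + ennreal (norm (T ?f1 z) powr q))" proof eventually_elim
  case (elim z)
  show ?case proof (cases "z : ?B")
   case True
   have "m <= (?c * h powr (1 / q) + norm (T f z) + norm (T ?f1 z)) powr q" unfolding m_def using elim True q by (intro powr_mono2) auto
   also have "... <= 3 powr q * ((?c * h powr (1 / q)) powr q + norm (T f z) powr q + norm (T ?f1 z) powr q)" using c q by (intro powr_add_le) auto
   also have "(?c * h powr (1 / q)) powr q = ?c powr q * h" using q h by (simp add: powr_mult powr_powr)
   finally have "ennreal m <= ennreal (3 powr q * (?c powr q * h + norm (T f z) powr q + norm (T ?f1 z) powr q))" by (rule ennreal_leI)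
   then show ?thesis using True h by (simp add: ennreal_mult')
  qed simp
 qed
 have "ennreal m * E = (\<I> z. ennreal m * ind ?B z)" by (simp add: E_def nn_integral_cmult_indicator)
 also have "... <= (\<I> z. ennreal (3 powr q) * ((ennreal (?c powr q * h) * ind ?B z + ennreal (norm (T f z) powr q) * ind ?B z) + ennreal (norm (T ?f1 z) powr q)))" by (rule nn_integral_mono_AE[OF ae])
 also have "... = ennreal (3 powr q) * ((ennreal (?c powr q * h) * E + (\<I> z. ennreal (norm (T f z) powr q) * ind ?B z)) + lpow q (T ?f1))" unfolding E_def lpow_def by (subst nn_integral_cmult, measurable, subst nn_integral_add, measurable, subst nn_integral_add, measurable)
   (simp add: nn_integral_cmult_indicator)
 also have "... <= ennreal (3 powr q) * ((ennreal (?c powr q * h) * E + hl_power q (T f) x * E) + ennreal D * (ennreal h * (2 ^ CARD('n) * E)))" proof (intro mult_left_mono add_mono order.refl)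
  show "(\<I> z. ennreal (norm (T f z) powr q) * ind ?B z) <= hl_power q (T f) x * E" unfolding E_def by (rule hl_power_ge) (use \<eta> in auto)
  have "lpow q ?f1 <= ennreal h * (2 ^ CARD('n) * E)" unfolding E2[symmetric] using hl_power_ge[of \<eta> x x f q] q \<eta> h by (simp add: lpow_indicator)
  then have "ennreal D * lpow q ?f1 <= ennreal D * (ennreal h * (2 ^ CARD('n) * E))" by (rule mult_left_mono) simp
  then show "lpow q (T ?f1) <= ennreal D * (ennreal h * (2 ^ CARD('n) * E))" using bd[OF f1] by simp
 qed auto
 also have "... = (ennreal (3 powr q * (?c powr q + D * 2 ^ CARD('n))) * ennreal h + ennreal (3 powr q) * hl_power q (T f) x) * E" using h(1) D by (simp add: ennreal_mult' ennreal_power[symmetric] algebra_simps)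
 also have "... <= trunc_majorant q D f x * E" unfolding trunc_majorant_def trunc_majorant_const_def h(2) by (intro mult_right_mono add_mono ennreal_leI) auto
 finally show ?thesis unfolding m_def[symmetric] using E by (metis divide_right_mono_ennreal ennreal_mult_divide_eq)
qed

lemma trunc_majorant_weak:
 assumes q: "1 < q" and D: "0 <= D" and bd: "!!f. f : Linf_c ==> lpow q (T f) <= ennreal D * lpow q f"
  and f: "f : Linf_c" and t: "0 < t"
 shows "ennreal t * vol {x. ennreal t < trunc_majorant q D f x} <=
  ennreal (2 * 5 ^ CARD('n) * (trunc_majorant_const q D + 3 powr q * D)) * lpow q f" proof -
 note [measurable] = Linf_c_measurable[OF f] T_measurable[OF Linf_c_L2[OF f]]
 have "ennreal t * vol {x : space lebesgue. ennreal t < trunc_majorant q D f x} <=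
  ennreal (2 * trunc_majorant_const q D) * (5 ^ CARD('n) * lpow q f) + ennreal (2 * 3 powr q) * (5 ^ CARD('n) * lpow q (T f))" unfolding trunc_majorant_def proof (rule weak_type_add)
  show "ennreal t * vol {x : space lebesgue. ennreal t < hl_power q f x} <= 5 ^ CARD('n) * lpow q f" if "0 < t" for t using hl_power_weak[where f=f and t=t and q=q] that by simp
  show "ennreal t * vol {x : space lebesgue. ennreal t < hl_power q (T f) x} <= 5 ^ CARD('n) * lpow q (T f)" if "0 < t" for t using hl_power_weak[where f="T f" and t=t and q=q] that by simp
 qed (use t D trunc_majorant_const_pos[OF D] in auto)
 also have "... <= ennreal (2 * trunc_majorant_const q D) * (5 ^ CARD('n) * lpow q f) + ennreal (2 * 3 powr q) * (5 ^ CARD('n) * (ennreal D * lpow q f))" by (intro add_mono mult_left_mono bd f order.refl) auto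
 also have "... = ennreal (2 * 5 ^ CARD('n) * (trunc_majorant_const q D + 3 powr q * D)) * lpow q f" using D trunc_majorant_const_pos[OF D, of q] by (simp add: ennreal_mult' ennreal_mult distrib_left distrib_right mult_ac flip: ennreal_power ennreal_numeral)
 finally show ?thesis by simp
qed

end


section \<open>Duality\<close>

lemma integrable_pair_lebesgue:
 fixes F :: "'a::euclidean_space \<times> 'b::euclidean_space => complex"
 assumes [measurable]: "F : borel_measurable leb2"
  and u: "Lint (u :: 'a => real)" and v: "Lint (v :: 'b => real)"
  and nn: "!!x. 0 <= u x" "!!y. 0 <= v y"
  and le: "!!x y. norm (F (x, y)) <= u x * v y"
 shows "integrable leb2 F" proof -
 interpret L: sigma_finite_measure "lebesgue :: 'b measure" by (rule sigma_finite_lebesgue)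
 note [measurable] = borel_measurable_integrable[OF u] borel_measurable_integrable[OF v]
 have "(\<integral>\<^sup>+z. ennreal (norm (F z)) \<partial>leb2) = (\<I> x. \<integral>\<^sup>+y. ennreal (norm (F (x, y))) \<partial>lebesgue)" by (rule L.nn_integral_fst[symmetric]) measurable
 also have "... <= (\<I> x. \<integral>\<^sup>+y. ennreal (u x) * ennreal (v y) \<partial>lebesgue)" using nn by (intro nn_integral_mono) (auto simp: ennreal_mult[symmetric] intro!: ennreal_leI le)
 also have "... = (\<I> x. ennreal (u x) * (\<I> y. ennreal (v y)))" by (intro nn_integral_cong nn_integral_cmult) measurable
 also have "... = (\<I> x. ennreal (u x)) * (\<I> y. ennreal (v y))" by (rule nn_integral_multc) measurable
 also have "... < \<infinity>" using u v nn by (simp add: integrable_iff_bounded ennreal_mult_less_top)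
 finally show ?thesis by (simp add: integrable_iff_bounded)
qed

lemma measurable_fst_lebesgue: "f : Lmeas ==> (%z. f (fst z)) : borel_measurable (lebesgue \<Otimes>\<^sub>M N)" by (rule measurable_compose[OF measurable_fst])

lemma measurable_snd_lebesgue: "f : Lmeas ==> (%z. f (snd z)) : borel_measurable (N \<Otimes>\<^sub>M lebesgue)" by (rule measurable_compose[OF measurable_snd])

context cz_kernel
begin

lemma trunc_pair_measurable:
 assumes "f : Lmeas"
 shows "(%(x, y). K x y * (ind (- ball x \<eta>) y * f y)) : borel_measurable leb2" proof -
 have [measurable]: "(%z. K (fst z) (snd z)) : borel_measurable leb2" using borel_measurable_pair_lebesgue[OF K_measurable] by (simp add: case_prod_beta)
 have [measurable]: "(%z. f (snd z)) : borel_measurable leb2" by (rule measurable_snd_lebesgue[OF assms])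
 have "closed {z :: (real^'n) \<times> (real^'n). \<eta> <= dist (fst z) (snd z)}" by (intro closed_Collect_le continuous_intros)
 then have "(ind {z :: (real^'n) \<times> (real^'n). \<eta> <= dist (fst z) (snd z)} :: _ => complex) : borel_measurable borel" by (intro borel_measurable_indicator borel_closed)
 then have [measurable]: "(ind {z :: (real^'n) \<times> (real^'n). \<eta> <= dist (fst z) (snd z)} :: _ => complex) : borel_measurable leb2" by (rule borel_measurable_pair_lebesgue)
 have "(%z. K (fst z) (snd z) * (ind {z. \<eta> <= dist (fst z) (snd z)} z * f (snd z))) : borel_measurable leb2" by measurable
 also have "(%z. K (fst z) (snd z) * (ind {z. \<eta> <= dist (fst z) (snd z)} z * f (snd z))) = (%(x, y). K x y * (ind (- ball x \<eta>) y * f y))" by (auto simp: indicator_def)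
 finally show ?thesis .
qed

lemma trunc_measurable:
 assumes "f : Lmeas"
 shows "trunc K \<eta> f : Lmeas" proof -
 interpret L: sigma_finite_measure "lebesgue :: (real^'n) measure" by (rule sigma_finite_lebesgue)
 have "(%x. \<L> y. K x y * (ind (- ball x \<eta>) y * f y)) : Lmeas" by (rule L.borel_measurable_lebesgue_integral[OF trunc_pair_measurable[OF assms]])
 then show ?thesis by (simp add: trunc_eq cong: measurable_cong)
qed

lemma trunc_adjoint:
 assumes f: "Lint f" and g: "Lint g" and \<eta>: "0 < \<eta>"
 shows "(\<L> x. g x * trunc K \<eta> f x) = (\<L> y. f y * trunc (%x y. K y x) \<eta> g y)" proof -
 interpret P: pair_sigma_finite "lebesgue :: (real^'n) measure" "lebesgue :: (real^'n) measure" by (rule pair_sigma_finite_lebesgue)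
 interpret S: cz_kernel "%x y. K y x" A \<delta> by (rule swap)
 note [measurable] = borel_measurable_integrable[OF f] borel_measurable_integrable[OF g]
 define H where "H x y = g x * (K x y * (ind (- ball x \<eta>) y * f y))" for x y
 have m1: "(%z. g (fst z)) : borel_measurable (lebesgue \<Otimes>\<^sub>M (lebesgue :: (real^'n) measure))" by (rule measurable_fst_lebesgue) measurable
 have "(%z. g (fst z) * (%(x, y). K x y * (ind (- ball x \<eta>) y * f y)) z) : borel_measurable leb2" by (intro borel_measurable_times m1 trunc_pair_measurable) measurable
 then have Hm: "(%(x, y). H x y) : borel_measurable leb2" by (simp add: H_def case_prod_beta)
 have int: "integrable leb2 (%(x, y). H x y)" proof (rule integrable_pair_lebesgue[OF Hm, of "%x. (A / \<eta> ^ CARD('n)) * norm (g x)" "%y. norm (f y)"])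
  show "norm (case (x, y) of (x, y) => H x y) <= (A / \<eta> ^ CARD('n)) * norm (g x) * norm (f y)" for x y proof (cases "y : ball x \<eta>")
   case False
   have "norm (K x y) * (norm (g x) * norm (f y)) <= (A / \<eta> ^ CARD('n)) * (norm (g x) * norm (f y))" by (intro mult_right_mono K_off \<eta> False) simp
   then show ?thesis using False by (simp add: H_def norm_mult mult_ac)
  qed (use A_pos \<eta> in "simp add: H_def")
 qed (use f g A_pos \<eta> in auto)
 have "(\<L> x. g x * trunc K \<eta> f x) = (\<L> x. \<L> y. H x y)" by (simp add: trunc_eq H_def)
 also have "... = (\<L> y. \<L> x. H x y)" by (rule P.Fubini_integral[symmetric]) (use int in simp)
 also have "... = (\<L> y. \<L> x. f y * (K x y * (ind (- ball y \<eta>) x * g x)))" by (intro Lintegral_cong refl) (auto simp: H_def indicator_def dist_commute)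
 also have "... = (\<L> y. f y * trunc (%x y. K y x) \<eta> g y)" by (simp add: S.trunc_eq)
 finally show ?thesis .
qed

end

lemma weak_type_finite_AE:
 assumes [measurable]: "F : borel_measurable M" and c: "c < top"
  and weak: "!!t. 0 < t ==> ennreal t * emeasure M {x : space M. ennreal t < F x} <= c"
 shows "AE x in M. F x < top" proof -
 define e where "e = emeasure M {x : space M. F x = top}"
 have le: "ennreal t * e <= c" if "0 < t" for t proof -
  have "e <= emeasure M {x : space M. ennreal t < F x}" unfolding e_def by (intro emeasure_mono) auto
  then show ?thesis using weak[OF that] mult_left_mono[of e _ "ennreal t"] by (meson order_trans zero_le)
 qed
 have "e = 0" proof (rule ccontr)
  assume e0: "e ~= 0"
  obtain c' where c': "0 <= c'" "c = ennreal c'" using c by (cases c) auto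
  have "e < top" using le[of 1] c by (simp add: less_top[symmetric]) (metis neq_top_trans)
  then obtain r where r: "0 <= r" "e = ennreal r" by (cases e) auto
  then have r0: "0 < r" using e0 by (auto simp: ennreal_eq_0_iff order.strict_iff_order)
  have "ennreal ((c' + 1) / r) * ennreal r <= ennreal c'" using le[of "(c'+1)/r"] c' r r0 by simp
  then have "(c' + 1) / r * r <= c'" using c' r0 by (simp add: ennreal_mult[symmetric] del: times_divide_eq_left)
  then show False using r0 by simp
 qed
 then have "AE x in M. \<not> F x = top" unfolding e_def by (subst AE_iff_measurable[OF _ refl]) auto
 then show ?thesis by eventually_elim (simp add: less_top)
qed

lemma ennreal_term_le_suminf: "f k <= (\<Sum>k. f k)" for f :: "nat => ennreal" using sum_le_suminf[OF summableI, of "{k}" f] by simp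

text \<open>A function of weak type 1 has an integrable square root on sets of finite measure.\<close>

lemma weak_type_sqrt_integrable:
 assumes [measurable]: "F : borel_measurable M" "S : sets M" and c: "c < top" and S: "emeasure M S < top"
  and weak: "!!t. 0 < t ==> ennreal t * emeasure M {x : space M. ennreal t < F x} <= c"
 shows "(\<integral>\<^sup>+x. ennreal (sqrt (enn2real (F x))) * ind S x \<partial>M) < top" proof -
 have pt: "ennreal (sqrt (enn2real (F x))) * ind S x <=
  ind S x + (\<Sum>k. ennreal (2 ^ (k + 1)) * ind {x : space M. ennreal (4 ^ k) < F x} x)" if x: "x : space M" for x proof -
  define r where "r = enn2real (F x)"
  have r0: "0 <= r" by (simp add: r_def)
  show ?thesis proof (cases "r <= 1")
   case True
   then have "ennreal (sqrt r) <= 1" by (simp add: ennreal_le_1)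
   then have "ennreal (sqrt r) * ind S x <= ind S x" by (simp add: indicator_def)
   then show ?thesis unfolding r_def[symmetric] by (rule add_increasing2[rotated]) simp
  next
   case False
   then have "F x ~= top" by (auto simp: r_def)
   then have Fr: "F x = ennreal r" by (simp add: r_def less_top)
   define m where "m = (LEAST m. r <= 4 ^ m)"
   obtain j where j: "r < 4 ^ j" using real_arch_pow[of 4 r] by auto
   have m: "r <= 4 ^ m" unfolding m_def by (rule LeastI[of _ j]) (use j in simp)
   have "m ~= 0" using m False by (auto intro!: Nat.gr0I)
   then obtain k where k: "m = Suc k" by (cases m) auto
   have lo: "4 ^ k < r" using not_less_Least[of k "%m. r <= 4 ^ m"] k m_def by auto
   have "(4::real) ^ m = (2 ^ m)^2" by (simp add: power_mult[symmetric] power_even_eq)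
    (metis mult.commute numeral_Bit0_eq_double power2_eq_square power_mult_distrib mult_2 power_mult four_x_squared)
   then have "sqrt r <= 2 ^ m" using m by (intro real_le_lsqrt) auto
   then have "ennreal (sqrt r) * ind S x <= ennreal (2 ^ (k + 1)) * ind {x : space M. ennreal (4 ^ k) < F x} x" using lo Fr k x by (auto simp: indicator_def ennreal_less_iff intro!: ennreal_leI)
   also have "... <= (\<Sum>k. ennreal (2 ^ (k + 1)) * ind {x : space M. ennreal (4 ^ k) < F x} x)" by (rule ennreal_term_le_suminf)
   finally show ?thesis unfolding r_def[symmetric] by (rule add_increasing[rotated]) simp
  qed
 qed
 have "(\<integral>\<^sup>+x. ennreal (sqrt (enn2real (F x))) * ind S x \<partial>M) <=
  (\<integral>\<^sup>+x. ind S x + (\<Sum>k. ennreal (2 ^ (k + 1)) * ind {x : space M. ennreal (4 ^ k) < F x} x) \<partial>M)" by (rule nn_integral_mono[OF pt])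
 also have "... = emeasure M S + (\<Sum>k. ennreal (2 ^ (k + 1)) * emeasure M {x : space M. ennreal (4 ^ k) < F x})" by (subst nn_integral_add, measurable, subst nn_integral_suminf, measurable) (simp add: nn_integral_cmult_indicator)
 also have "... <= emeasure M S + (\<Sum>k. ennreal (2 * (1 / 2) ^ k) * c)" proof (intro add_left_mono suminf_le summableI)
  fix k
  have "ennreal (2 ^ (k + 1)) = ennreal (2 * (1 / 2) ^ k) * ennreal (4 ^ k)" proof -
   have "(2::real) ^ (k + 1) = 2 * (1 / 2) ^ k * 4 ^ k" by (simp add: power_mult_distrib[symmetric])
   then show ?thesis by (simp add: ennreal_mult[symmetric] del: power_Suc)
  qed
  then have "ennreal (2 ^ (k + 1)) * emeasure M {x : space M. ennreal (4 ^ k) < F x} =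
   ennreal (2 * (1 / 2) ^ k) * (ennreal (4 ^ k) * emeasure M {x : space M. ennreal (4 ^ k) < F x})" by (simp only: mult.assoc)
  also have "... <= ennreal (2 * (1 / 2) ^ k) * c" by (intro mult_left_mono weak) auto
  finally show "ennreal (2 ^ (k + 1)) * emeasure M {x : space M. ennreal (4 ^ k) < F x} <= ennreal (2 * (1 / 2) ^ k) * c" .
 qed
 also have "... = emeasure M S + ennreal (\<Sum>k. 2 * (1 / 2) ^ k) * c" by (subst ennreal_suminf_multc, subst suminf_ennreal2) (auto intro!: summable_mult summable_geometric)
 also have "... < top" using S c by (simp add: ennreal_mult_less_top)
 finally show ?thesis .
qed

lemma inverse_Suc_at_right_0: "filterlim (%n. inverse (real (Suc n))) (at_right 0) sequentially" using LIMSEQ_inverse_real_of_nat by (simp add: filterlim_at)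

context cz_op
begin

lemma L2_const: "f : Linf_c ==> lpow 2 (T f) <= ennreal B * lpow 2 f" by (intro T_bdd Linf_c_L2)

text \<open>The maximal truncation is the square root of a function of weak type 1, hence locally integrable, and
  the pairing converges by dominated convergence.\<close>

lemma trunc_pairing_tendsto:
 assumes f: "f : Linf_c" and g: "g : Linf_c"
 shows "(%n. \<L> x. g x * trunc K (inverse (real (Suc n))) f x) ----> (\<L> x. g x * T f x)" proof -
 note [measurable] = Linf_c_measurable[OF f] Linf_c_measurable[OF g] T_measurable[OF Linf_c_L2[OF f]]
  trunc_measurable[OF Linf_c_measurable[OF f]]
 obtain M R where g': "0 < M" "0 < R" "!!x. norm (g x) <= M" "!!x. x ~: ball 0 R ==> g x = 0" using g by (rule Linf_cE) blast
 let ?F = "trunc_majorant 2 B f"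
 let ?c = "ennreal (2 * 5 ^ CARD('n) * (trunc_majorant_const 2 B + 3 powr 2 * B)) * lpow 2 f"
 have c: "?c < top" using lpow_finite[OF f, of 2] by (simp add: ennreal_mult_less_top)
 have weak: "ennreal t * vol {x : space lebesgue. ennreal t < ?F x} <= ?c" if "0 < t" for t using trunc_majorant_weak[OF _ B_nonneg L2_const f that] by simp
 have fin: "AEL x. ?F x < top" by (rule weak_type_finite_AE[OF _ c weak]) auto
 let ?w = "%x. norm (g x) * sqrt (enn2real (?F x))"
 have "(\<I> x. ennreal (norm (?w x))) <= (\<I> x. ennreal M * (ennreal (sqrt (enn2real (?F x))) * ind (ball 0 R) x))" proof (intro nn_integral_mono)
  fix x
  show "ennreal (norm (?w x)) <= ennreal M * (ennreal (sqrt (enn2real (?F x))) * ind (ball 0 R) x)" using g'(1) g'(3)[of x] g'(4)[of x] by (cases "x : ball 0 R") (auto simp: ennreal_mult[symmetric] abs_mult intro!: ennreal_leI mult_right_mono)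
 qed
 also have "... = ennreal M * (\<I> x. ennreal (sqrt (enn2real (?F x))) * ind (ball 0 R) x)" by (rule nn_integral_cmult) measurable
 also have "... < top" proof -
  have "vol (ball (0 :: real ^ 'n) R) < top" using emeasure_ball_pos_finite(2)[OF g'(2), of "0 :: real ^ 'n"] by (simp only: less_top)
  from weak_type_sqrt_integrable[OF _ _ c this weak]
  show ?thesis by (simp add: ennreal_mult_less_top)
 qed
 finally have w: "Lint ?w" by (simp add: integrable_iff_bounded)
 show ?thesis proof (rule integral_dominated_convergence[OF _ _ w])
  show "AEL x. (%n. g x * trunc K (inverse (real (Suc n))) f x) ----> g x * T f x" using T_pv[OF Linf_c_L2[OF f]] proof eventually_elim
   case (elim x)
   show ?case by (intro tendsto_mult_left filterlim_compose[OF elim inverse_Suc_at_right_0])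
  qed
  show "AEL x. norm (g x * trunc K (inverse (real (Suc n))) f x) <= ?w x" for n using fin proof eventually_elim
   case (elim x)
   define r where "r = enn2real (?F x)"
   have Fr: "?F x = ennreal r" using elim by (simp add: r_def)
   have "ennreal (norm (trunc K (inverse (real (Suc n))) f x) powr 2) <= ennreal r" unfolding Fr[symmetric] by (rule trunc_le_majorant[OF _ B_nonneg L2_const f]) auto
   then have "(norm (trunc K (inverse (real (Suc n))) f x))^2 <= r" by (subst (asm) ennreal_le_iff) (auto simp: r_def powr_numeral)
   then have "norm (trunc K (inverse (real (Suc n))) f x) <= sqrt r" by (rule real_le_rsqrt)
   then show ?case unfolding r_def by (simp add: norm_mult mult_left_mono)
  qed
 qed measurable
qed

end

text \<open>Fubini's theorem for the truncations, followed by the passage to the limit.\<close>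

lemma adjoint_Linf_c:
 assumes T: "cz_op K A \<delta> T B" and T': "cz_op (%x y. K y x) A \<delta> T' B'" and f: "f : Linf_c" and g: "g : Linf_c"
 shows "(\<L> x. g x * T f x) = (\<L> y. f y * T' g y)" proof -
 interpret T: cz_op K A \<delta> T B by fact
 interpret T': cz_op "%x y. K y x" A \<delta> T' B' by fact
 have "(%n. \<L> x. f x * trunc (%x y. K y x) (inverse (real (Suc n))) g x) ----> (\<L> x. g x * T f x)" using T.trunc_pairing_tendsto[OF f g] by (subst (asm) T.trunc_adjoint) (auto intro: Linf_c_integrable f g)
 from LIMSEQ_unique[OF this T'.trunc_pairing_tendsto[OF g f]] show ?thesis .
qed

section \<open>Calderon--Zygmund decomposition\<close>

text \<open>Among the radii \<open>5\<^sup>j r\<^sub>0\<close>, the last one before the average of \<open>\<bar>f\<bar>\<close> drops below \<open>t\<close>. It exists because \<open>f\<close>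
  is continuous and large at \<open>x\<close>, and integrable.\<close>

lemma stopping_radius:
 fixes f :: "real ^ 'n => complex"
 assumes cont: "continuous_on UNIV f" and f: "f : Linf_c" and t: "0 < t" and x: "2 * t <= norm (f x)"
 shows "\<exists>r>0. ennreal t * vol (ball x r) <= (\<I> y. ennreal (norm (f y)) * ind (ball x r) y) &
  (\<I> y. ennreal (norm (f y)) * ind (ball x (5 * r)) y) <= ennreal t * vol (ball x (5 * r))" proof -
 let ?I = "%r. \<integral>\<^sup>+y. ennreal (norm (f y)) * ind (ball x r) y \<partial>lebesgue"
 define P where "P r \<longleftrightarrow> ennreal t * vol (ball x r) <= ?I r" for r
 note [measurable] = Linf_c_measurable[OF f]
 obtain r0 where r0: "0 < r0" "!!y. y : ball x r0 ==> norm (f y - f x) < t" using cont t unfolding continuous_on_iff by (metis UNIV_I dist_norm dist_commute mem_ball)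
 have "P r0" proof -
  have "ennreal t * vol (ball x r0) = (\<I> y. ennreal t * ind (ball x r0) y)" by (simp add: nn_integral_cmult_indicator)
  also have "... <= ?I r0" proof (intro nn_integral_mono)
   fix y show "ennreal t * ind (ball x r0) y <= ennreal (norm (f y)) * ind (ball x r0) y" using r0(2)[of y] x norm_triangle_sub[of "f x" "f y"] by (auto simp: indicator_def norm_minus_commute intro!: ennreal_leI)
  qed
  finally show ?thesis by (simp add: P_def)
 qed
 define L where "L = (\<L> y. norm (f y))"
 have L: "?I r <= ennreal L" for r proof -
  have "?I r <= (\<I> y. ennreal (norm (f y)))" by (intro nn_integral_mono) (auto simp: indicator_def)
  also have "... = ennreal L" unfolding L_def by (rule nn_integral_eq_integral) (auto intro!: integrable_norm Linf_c_integrable f)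
  finally show ?thesis .
 qed
 have L0: "0 <= L" by (simp add: L_def)
 let ?V = "unit_ball_vol (real CARD('n))"
 have V: "0 < ?V" by simp
 obtain k where k: "L / (t * ?V * r0 ^ CARD('n)) < (5 ^ CARD('n)) ^ k" using real_arch_pow[of "5 ^ CARD('n)" "L / (t * ?V * r0 ^ CARD('n))"] by auto
 have nP: "\<not> P (5 ^ k * r0)" proof
  assume "P (5 ^ k * r0)"
  then have "ennreal t * ennreal (?V * (5 ^ k * r0) ^ CARD('n)) <= ennreal L" using L[of "5 ^ k * r0"] r0 by (simp add: P_def emeasure_lebesgue_ball)
  then have "t * (?V * (5 ^ k * r0) ^ CARD('n)) <= L" using t L0 V r0 by (simp add: ennreal_mult'[symmetric])
  moreover have "L < t * (?V * (5 ^ k * r0) ^ CARD('n))" proof -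
   have "(5 ^ k) ^ CARD('n) = ((5::real) ^ CARD('n)) ^ k" by (simp add: power_mult[symmetric] mult.commute)
   then show ?thesis using k t V r0 by (simp add: power_mult_distrib divide_less_eq mult_ac)
  qed
  ultimately show False by simp
 qed
 define m where "m = (LEAST m. \<not> P (5 ^ m * r0))"
 have m: "\<not> P (5 ^ m * r0)" unfolding m_def by (rule LeastI[of _ k]) (rule nP)
 have "m ~= 0" using m \<open>P r0\<close> by (auto intro!: Nat.gr0I)
 then obtain j where j: "m = Suc j" by (cases m) auto
 have "P (5 ^ j * r0)" using not_less_Least[of j "%m. \<not> P (5 ^ m * r0)"] j m_def by auto
 then show ?thesis using m r0(1) j by (intro exI[of _ "5 ^ j * r0"]) (auto simp: P_def not_le mult.assoc intro: less_imp_le)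
qed

text \<open>A substitute for dyadic cubes: disjoint balls \<open>B\<^sub>i\<close> on which the average of \<open>\<bar>f\<bar>\<close> is comparable to \<open>t\<close>, and
  disjoint sets \<open>E\<^sub>i\<close> between \<open>B\<^sub>i\<close> and \<open>5 B\<^sub>i\<close> that cover the set where \<open>\<bar>f\<bar> \<ge> 2 t\<close>.\<close>

definition cz_family ::
 "(real ^ 'n => complex) => real => nat => (nat => real ^ 'n) => (nat => real) => (nat => (real ^ 'n) set) => bool" where
 "cz_family f t m c r E \<longleftrightarrow>
  (\<forall>i<m. 0 < r i & E i : sets lebesgue & E i \<subseteq> ball (c i) (5 * r i) & ball (c i) (r i) \<subseteq> E i &
   ennreal t * vol (ball (c i) (r i)) <= (\<I> y. ennreal (norm (f y)) * ind (ball (c i) (r i)) y) &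
   (\<I> y. ennreal (norm (f y)) * ind (ball (c i) (5 * r i)) y) <= ennreal t * vol (ball (c i) (5 * r i))) &
  disjoint_family_on E {..<m} & {x. 2 * t <= norm (f x)} \<subseteq> (\<Union>i<m. E i)"

lemma calderon_zygmund_sets:
 fixes f :: "real ^ 'n => complex"
 assumes cont: "continuous_on UNIV f" and f: "f : Linf_c" and t: "0 < t"
 shows "\<exists>m c r E. cz_family f t m c r E" proof -
 let ?S = "{x. 2 * t <= norm (f x)}"
 let ?I = "%x r. \<integral>\<^sup>+y. ennreal (norm (f y)) * ind (ball x r) y \<partial>lebesgue"
 have "closed ?S" using cont by (intro closed_Collect_le continuous_intros) auto
 moreover have "bounded ?S" proof -
  obtain M R where "!!x. x ~: ball 0 R ==> f x = 0" using f by (rule Linf_cE) blast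
  then have "?S \<subseteq> ball 0 R" using t by (auto simp del: mem_ball) (metis mult_pos_pos norm_zero not_le zero_less_numeral)
  then show ?thesis using bounded_ball bounded_subset by blast
 qed
 ultimately have S: "compact ?S" by (simp add: compact_eq_bounded_closed)
 have "\<forall>x\<in>?S. \<exists>r>0. ennreal t * vol (ball x r) <= ?I x r & ?I x (5 * r) <= ennreal t * vol (ball x (5 * r))" using stopping_radius[OF cont f t] by blast
 then obtain \<rho> where \<rho>: "\<forall>x\<in>?S. 0 < \<rho> x & ennreal t * vol (ball x (\<rho> x)) <= ?I x (\<rho> x) & ?I x (5 * \<rho> x) <= ennreal t * vol (ball x (5 * \<rho> x))" unfolding bchoice_iff by blast
 obtain C where C: "finite C" "C \<subseteq> ?S" "pairwise (%i j. disjnt (ball i (\<rho> i)) (ball j (\<rho> j))) C"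
  "?S \<subseteq> (\<Union>i\<in>C. ball i (5 * \<rho> i))" by (rule vitali_compact[OF S, of \<rho> "%x. x"]) (use \<rho> in auto)
 obtain c where c: "bij_betw c {..<card C} C" using ex_bij_betw_nat_finite[OF C(1)] by (auto simp: lessThan_atLeast0)
 define m where "m = card C"
 define r where "r i = \<rho> (c i)" for i
 have cC: "c i : C" if "i < m" for i using c that unfolding m_def by (auto simp: bij_betw_def)
 have surj: "\<exists>i<m. x = c i" if "x : C" for x using c that unfolding m_def bij_betw_def by blast
 have inj: "c i ~= c j" if "i < m" "j < m" "i ~= j" for i j using c that unfolding m_def bij_betw_def inj_on_def by auto
 have dis: "ball (c i) (r i) \<inter> ball (c j) (r j) = {}" if "i < m" "j < m" "i ~= j" for i j using C(3) cC[OF that(1)] cC[OF that(2)] inj[OF that] unfolding pairwise_def disjnt_def r_def by blast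
 have r: "0 < r i" if "i < m" for i using \<rho> cC[OF that] C(2) unfolding r_def by blast
 define E where "E i = ball (c i) (5 * r i) \<inter> (ball (c i) (r i) \<union> (- (\<Union>j<m. ball (c j) (r j)) \<inter> - (\<Union>j<i. ball (c j) (5 * r j))))" for i
 have "cz_family f t m c r E" unfolding cz_family_def proof (intro conjI allI impI)
  show "E i : sets lebesgue" for i unfolding E_def by (intro sets.Int sets.Un sets_lebesgue_ball sets.compl_sets[of _ lebesgue, simplified, folded Compl_eq_Diff_UNIV] sets.finite_UN finite_lessThan)
  show "ball (c i) (r i) \<subseteq> E i" if "i < m" for i using r[OF that] by (auto simp: E_def)
  show "disjoint_family_on E {..<m}" proof -
   have *: "E i \<inter> E j = {}" if ij: "i < m" "j < m" "i < j" for i j proof -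
    have False if x: "x : E i" "x : E j" for x proof (cases "x : (\<Union>j<m. ball (c j) (r j))")
    case True
    then have "x : ball (c i) (r i)" "x : ball (c j) (r j)" using x unfolding E_def by blast+
    then show False using dis[of i j] ij by blast
    next
    case False
    then have "x ~: ball (c j) (r j)" using ij by blast
    then show False using x ij unfolding E_def by blast
    qed
    then show ?thesis by blast
   qed
   show ?thesis unfolding disjoint_family_on_def proof (intro ballI impI)
    fix i j assume "i : {..<m}" "j : {..<m}" "i ~= j"
    then show "E i \<inter> E j = {}" using *[of i j] *[of j i] by (cases "i < j") auto
   qed
  qed
  show "?S \<subseteq> (\<Union>i<m. E i)" proof
   fix x assume "x : ?S"
   then obtain y where "y : C" "x : ball y (5 * \<rho> y)" using C(4) by blast
   then obtain i0 where i0: "i0 < m" "x : ball (c i0) (5 * r i0)" using surj unfolding r_def by blast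
   show "x : (\<Union>i<m. E i)" proof (cases "x : (\<Union>j<m. ball (c j) (r j))")
    case True
    then obtain j where "j < m" "x : ball (c j) (r j)" by blast
    moreover then have "x : ball (c j) (5 * r j)" using r[of j] by simp
    ultimately show ?thesis unfolding E_def by blast
   next
    case False
    define i where "i = (LEAST i. x : ball (c i) (5 * r i))"
    have "x : ball (c i) (5 * r i)" unfolding i_def by (rule LeastI) (rule i0)
    moreover have "i <= i0" unfolding i_def by (rule Least_le) (rule i0)
    moreover have "x ~: ball (c j) (5 * r j)" if "j < i" for j using not_less_Least that unfolding i_def by blast
    ultimately show ?thesis using False i0(1) unfolding E_def by (intro UN_I[of i]) auto
   qed
  qed
 qed (use \<rho> cC C(2) r in "auto simp: E_def r_def subset_eq")
 then show ?thesis by blast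
qed


lemma chebyshev_nn:
 assumes [measurable]: "h : borel_measurable M" and "0 <= t"
 shows "ennreal t * emeasure M {x : space M. ennreal t <= h x} <= (\<integral>\<^sup>+x. h x \<partial>M)" proof -
 have "ennreal t * emeasure M {x : space M. ennreal t <= h x} = (\<integral>\<^sup>+x. ennreal t * ind {x : space M. ennreal t <= h x} x \<partial>M)" by (simp add: nn_integral_cmult_indicator)
 also have "... <= (\<integral>\<^sup>+x. h x \<partial>M)" by (intro nn_integral_mono) (auto simp: indicator_def)
 finally show ?thesis .
qed

lemma chebyshev_lpow:
 assumes [measurable]: "h : Lmeas" and t: "0 < t" "0 < p"
 shows "ennreal (t powr p) * vol {x. t < norm (h x)} <= lpow p h" proof -
 have "vol {x. t < norm (h x)} <= vol {x : space lebesgue. ennreal (t powr p) <= ennreal (norm (h x) powr p)}" proof (rule emeasure_mono)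
  show "{x. t < norm (h x)} \<subseteq> {x : space lebesgue. ennreal (t powr p) <= ennreal (norm (h x) powr p)}" proof
   fix x assume "x : {x. t < norm (h x)}"
   then have "t powr p <= norm (h x) powr p" using t by (intro powr_mono2) auto
   then show "x : {x : space lebesgue. ennreal (t powr p) <= ennreal (norm (h x) powr p)}" by (simp add: ennreal_leI)
  qed
 qed measurable
 then have "ennreal (t powr p) * vol {x. t < norm (h x)} <=
   ennreal (t powr p) * vol {x : space lebesgue. ennreal (t powr p) <= ennreal (norm (h x) powr p)}" by (rule mult_left_mono) simp
 also have "... <= lpow p h" unfolding lpow_def by (rule chebyshev_nn) auto
 finally show ?thesis .
qed

lemma sum_indicator_disjoint:
 fixes h :: "nat => 'b::semiring_1"
 assumes "disjoint_family_on E {..<m}" "i < m" "x : E i"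
 shows "(\<Sum>j<m. ind (E j) x * h j) = h i" proof -
 have "(\<Sum>j<m. ind (E j) x * h j) = (\<Sum>j<m. if j = i then h j else 0)" using assms by (intro sum.cong) (auto simp: indicator_def disjoint_family_on_def)
 then show ?thesis using assms by simp
qed

context cz_op
begin

text \<open>Since \<open>b\<close> has mean zero, the kernel may be replaced by \<open>K(x,y) - K(x,c)\<close>, which is integrable in \<open>x\<close>
  away from \<open>c\<close>.\<close>

lemma atom_tail:
 assumes b: "b : Linf_c" and supp: "!!x. x ~: ball c \<rho> ==> b x = 0" and \<rho>: "0 < \<rho>" and zero: "(\<L> x. b x) = 0"
 shows "(\<I> x. ennreal (norm (T b x)) * ind (- ball c (2 * \<rho>)) x)
  <= ennreal (A * tail_const TYPE('n) \<delta>) * (\<I> x. ennreal (norm (b x)))" proof -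
 let ?n = "real CARD('n)"
 define I where "I = (\<I> x. ennreal (norm (b x)))"
 note [measurable] = Linf_c_measurable[OF b]
 have ib: "Lint b" by (rule Linf_c_integrable[OF b])
 have "AEL x. ennreal (norm (T b x)) * ind (- ball c (2 * \<rho>)) x <=
  ennreal (A * \<rho> powr \<delta>) * I * (1 * ennreal (1 / norm (x - c) powr (?n + \<delta>)) * ind (- ball c (2 * \<rho>)) x)" using T_off_support[OF Linf_c_L2[OF b]] proof eventually_elim
  case (elim x)
  show ?case proof (cases "x : ball c (2 * \<rho>)")
   case False
   then have d: "2 * \<rho> <= norm (x - c)" by (simp add: dist_norm norm_minus_commute)
   have sub: "y ~: ball x \<rho>" if "y : ball c \<rho>" for y using d that dist_triangle[of x c y] by (auto simp: dist_norm norm_minus_commute)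
   then have bx: "\<forall>y\<in>ball x \<rho>. b y = 0" using supp by blast
   then have Tb: "T b x = (\<L> y. K x y * b y)" using elim \<rho> by blast
   have "Lint (%y. K x y * (ind (- ball x \<rho>) y * b y))" by (rule trunc_integrable[OF ib \<rho>])
   also have "(%y. K x y * (ind (- ball x \<rho>) y * b y)) = (%y. K x y * b y)" using bx by (intro ext) (auto simp: indicator_def simp del: mem_ball)
   finally have i1: "Lint (%y. K x y * b y)" .
   have i2: "Lint (%y. K x c * b y)" using ib by (rule integrable_mult_right)
   have "ennreal (norm (T b x)) = ennreal (norm (\<L> y. K x y * b y - K x c * b y))" using i1 i2 zero by (simp add: Tb)
   also have "... <= (\<I> y. ennreal (norm (K x y * b y - K x c * b y)))" using i1 i2 by (intro integral_norm_bound_ennreal) auto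
   also have "... <= (\<I> y. ennreal (A * (\<rho> powr \<delta> / norm (x - c) powr (?n + \<delta>))) * ennreal (norm (b y)))" proof (intro nn_integral_mono)
    fix y
    show "ennreal (norm (K x y * b y - K x c * b y)) <= ennreal (A * (\<rho> powr \<delta> / norm (x - c) powr (?n + \<delta>))) * ennreal (norm (b y))" proof (cases "y : ball c \<rho>")
    case True
    then have dy: "norm (c - y) <= \<rho>" by (simp add: dist_norm)
    have "norm (K x c - K x y) <= A * (norm (c - y) powr \<delta> / norm (x - c) powr (?n + \<delta>))" using d dy \<rho> by (intro reg2) auto
    also have "... <= A * (\<rho> powr \<delta> / norm (x - c) powr (?n + \<delta>))" using dy \<rho> A_pos \<delta>_pos by (intro mult_left_mono divide_right_mono powr_mono2) auto
    finally have "norm (K x c - K x y) * norm (b y) <= A * (\<rho> powr \<delta> / norm (x - c) powr (?n + \<delta>)) * norm (b y)" by (rule mult_right_mono) simp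
    moreover have "norm (K x y * b y - K x c * b y) = norm (K x c - K x y) * norm (b y)" by (simp flip: left_diff_distrib add: norm_mult norm_minus_commute)
    ultimately have "ennreal (norm (K x y * b y - K x c * b y)) <= ennreal (A * (\<rho> powr \<delta> / norm (x - c) powr (?n + \<delta>)) * norm (b y))" by (intro ennreal_leI) linarith
    then show ?thesis using A_pos by (subst ennreal_mult[symmetric]) auto
    qed (simp add: supp)
   qed
   also have "... = ennreal (A * (\<rho> powr \<delta> / norm (x - c) powr (?n + \<delta>))) * I" unfolding I_def by (rule nn_integral_cmult) measurable
   also have "A * (\<rho> powr \<delta> / norm (x - c) powr (?n + \<delta>)) = (A * \<rho> powr \<delta>) * (1 / norm (x - c) powr (?n + \<delta>))" by simp
   also have "ennreal ... = ennreal (A * \<rho> powr \<delta>) * ennreal (1 / norm (x - c) powr (?n + \<delta>))" using A_pos by (intro ennreal_mult) auto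
   finally show ?thesis using False by (simp add: mult_ac)
  qed simp
 qed
 then have "(\<I> x. ennreal (norm (T b x)) * ind (- ball c (2 * \<rho>)) x)
  <= (\<I> x. ennreal (A * \<rho> powr \<delta>) * I * (1 * ennreal (1 / norm (x - c) powr (?n + \<delta>)) * ind (- ball c (2 * \<rho>)) x))" by (rule nn_integral_mono_AE)
 also have "... = ennreal (A * \<rho> powr \<delta>) * I * (\<I> x. 1 * ennreal (1 / norm (x - c) powr (?n + \<delta>)) * ind (- ball c (2 * \<rho>)) x)" by (rule nn_integral_cmult) measurable
 also have "... <= ennreal (A * \<rho> powr \<delta>) * I * (ennreal (tail_const TYPE('n) \<delta> / (2 * \<rho>) powr \<delta>) * 1)" using \<rho> \<delta>_pos by (intro mult_left_mono nn_integral_tail) auto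
 also have "... = ennreal (A * \<rho> powr \<delta> * (tail_const TYPE('n) \<delta> / (2 * \<rho>) powr \<delta>)) * I" using A_pos tail_const_nonneg[OF \<delta>_pos, where 'n='n] by (subst ennreal_mult) (auto simp: mult_ac)
 also have "... <= ennreal (A * tail_const TYPE('n) \<delta>) * I" proof (intro mult_right_mono ennreal_leI)
  have "tail_const TYPE('n) \<delta> / (2 * \<rho>) powr \<delta> <= tail_const TYPE('n) \<delta> / \<rho> powr \<delta>" using \<rho> \<delta>_pos tail_const_nonneg[OF \<delta>_pos, where 'n='n] by (intro divide_left_mono powr_mono2) auto
  then have "A * \<rho> powr \<delta> * (tail_const TYPE('n) \<delta> / (2 * \<rho>) powr \<delta>) <= A * \<rho> powr \<delta> * (tail_const TYPE('n) \<delta> / \<rho> powr \<delta>)" using A_pos by (intro mult_left_mono) auto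
  then show "A * \<rho> powr \<delta> * (tail_const TYPE('n) \<delta> / (2 * \<rho>) powr \<delta>) <= A * tail_const TYPE('n) \<delta>" using \<rho> by simp
 qed simp
 finally show ?thesis unfolding I_def .
qed

definition weak_const :: real where
 "weak_const = 2 * (10 ^ CARD('n) + 4 * B * 125 ^ CARD('n) + 4 * A * tail_const TYPE('n) \<delta> * 5 ^ CARD('n)) + 4 * B"

lemma weak_const_nonneg: "0 <= weak_const" unfolding weak_const_def using A_pos B_nonneg tail_const_nonneg[OF \<delta>_pos, where 'n='n] by (intro add_nonneg_nonneg mult_nonneg_nonneg) auto

text \<open>On each \<open>E\<^sub>i\<close> split \<open>f\<close> into its mean and a part of mean zero. The parts of mean zero are handled by
  \<open>atom_tail\<close> outside the dilated balls; the remaining function is at most a multiple of \<open>t\<close> and is handled on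
  \<open>L\<^sup>2\<close>. Restricting the two integrals to large and small values of \<open>f\<close> is what makes the bound integrable
  against \<open>t\<^sup>p\<^sup>-\<^sup>1\<close> for \<open>1 < p < 2\<close>.\<close>

lemma superlevel_bound:
 assumes cont: "continuous_on UNIV f" and f: "f : Linf_c" and t: "0 < t"
 shows "vol {x. t < norm (T f x)} <= ennreal weak_const *
  (ennreal (1 / t) * (\<I> x. ennreal (norm (f x)) * ind {x. t / 2 < norm (f x)} x)
  + ennreal (1 / t^2) * (\<I> x. ennreal ((norm (f x))^2) * ind {x. norm (f x) < 2 * t} x))" proof -
 let ?V = "unit_ball_vol (real CARD('n))" and ?N = "(5::real) ^ CARD('n)"
 define I1 where "I1 = (\<I> x. ennreal (norm (f x)) * ind {x. t / 2 < norm (f x)} x)"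
 define I2 where "I2 = (\<I> x. ennreal ((norm (f x))^2) * ind {x. norm (f x) < 2 * t} x)"
 note [measurable] = Linf_c_measurable[OF f]
 obtain m c r E where fam: "cz_family f t m c r E" using calderon_zygmund_sets[OF cont f t] by blast
 have CZ:
  "!!i. i < m ==> 0 < r i" "!!i. i < m ==> E i : sets lebesgue"
  "!!i. i < m ==> E i \<subseteq> ball (c i) (5 * r i)" "!!i. i < m ==> ball (c i) (r i) \<subseteq> E i"
  "disjoint_family_on E {..<m}" "{x. 2 * t <= norm (f x)} \<subseteq> (\<Union>i<m. E i)"
  "!!i. i < m ==> ennreal t * vol (ball (c i) (r i)) <= (\<I> y. ennreal (norm (f y)) * ind (ball (c i) (r i)) y)"
  "!!i. i < m ==> (\<I> y. ennreal (norm (f y)) * ind (ball (c i) (5 * r i)) y) <= ennreal t * vol (ball (c i) (5 * r i))" using fam unfolding cz_family_def by blast+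
 define v where "v i = ?V * r i ^ CARD('n)" for i :: nat
 have v: "0 < v i" if "i < m" for i using CZ(1)[OF that] by (simp add: v_def)
 have Ev: "vol (ball (c i) (r i)) = ennreal (v i)" if "i < m" for i using CZ(1)[OF that] by (simp add: v_def emeasure_lebesgue_ball)
 have Ev5: "vol (ball (c i) (5 * r i)) = ennreal (?N * v i)" if "i < m" for i using CZ(1)[OF that] by (simp add: v_def emeasure_lebesgue_ball power_mult_distrib mult_ac)
 have Ev10: "vol (ball (c i) (10 * r i)) = ennreal (10 ^ CARD('n) * v i)" if "i < m" for i using CZ(1)[OF that] by (simp add: v_def emeasure_lebesgue_ball power_mult_distrib mult_ac)
 define \<sigma> where "\<sigma> = (\<Sum>i<m. v i)"
 have \<sigma>0: "0 <= \<sigma>" unfolding \<sigma>_def by (intro sum_nonneg) (use v in "auto intro: less_imp_le")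
 have sv: "(\<Sum>i<m. ennreal (k * v i)) = ennreal (k * \<sigma>)" if "0 <= k" for k proof -
  have "(\<Sum>i<m. ennreal (k * v i)) = ennreal (\<Sum>i<m. k * v i)" proof (rule sum_ennreal)
   fix i assume "i : {..<m}"
   then show "0 <= k * v i" using v[of i] that by (intro mult_nonneg_nonneg) auto
  qed
  then show ?thesis by (simp add: \<sigma>_def sum_distrib_left)
 qed
 text \<open>The stopping balls have small total measure.\<close>
 have \<sigma>: "ennreal \<sigma> <= ennreal (2 / t) * I1" proof -
  have "ennreal (v i) <= ennreal (2 / t) * (\<I> y. (ennreal (norm (f y)) * ind {x. t / 2 < norm (f x)} y) * ind (ball (c i) (r i)) y)"
   (is "_ <= _ * ?J") if i: "i < m" for i proof -
   have "ennreal (t / 2 * v i) + ennreal (t / 2 * v i) = ennreal (t * v i)" using t v[OF i] by (simp flip: ennreal_plus)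
   also have "... = ennreal t * vol (ball (c i) (r i))" using t v[OF i] by (simp add: Ev[OF i] ennreal_mult)
   also have "... <= (\<I> y. ennreal (norm (f y)) * ind (ball (c i) (r i)) y)" by (rule CZ(7)[OF i])
   also have "... <= (\<I> y. (ennreal (t / 2) * ind (ball (c i) (r i)) y + (ennreal (norm (f y)) * ind {x. t / 2 < norm (f x)} y) * ind (ball (c i) (r i)) y))" using t by (intro nn_integral_mono) (auto simp: indicator_def intro!: ennreal_leI)
   also have "... = ennreal (t / 2) * vol (ball (c i) (r i)) + ?J" by (subst nn_integral_add) (auto simp: nn_integral_cmult_indicator)
   also have "... = ennreal (t / 2 * v i) + ?J" unfolding Ev[OF i] using t v[OF i] by (subst ennreal_mult) auto
   finally have "ennreal (t / 2 * v i) <= ?J" by (subst (asm) ennreal_add_left_cancel_le) simp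
   then have "ennreal (2 / t) * ennreal (t / 2 * v i) <= ennreal (2 / t) * ?J" by (rule mult_left_mono) simp
   moreover have "ennreal (2 / t) * ennreal (t / 2 * v i) = ennreal (v i)" using t v[OF i] by (simp flip: ennreal_mult')
   ultimately show ?thesis by simp
  qed
  then have "(\<Sum>i<m. ennreal (v i)) <= (\<Sum>i<m. ennreal (2 / t) * (\<I> y. (ennreal (norm (f y)) * ind {x. t / 2 < norm (f x)} y) * ind (ball (c i) (r i)) y))" by (intro sum_mono) auto
  also have "... = ennreal (2 / t) * (\<Sum>i<m. \<integral>\<^sup>+y. (ennreal (norm (f y)) * ind {x. t / 2 < norm (f x)} y) * ind (ball (c i) (r i)) y \<partial>lebesgue)" by (simp add: sum_distrib_left)
  also have "... <= ennreal (2 / t) * I1" unfolding I1_def proof (intro mult_left_mono nn_integral_sum_disjoint_le)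
   show "disjoint_family_on (%i. ball (c i) (r i)) {..<m}" unfolding disjoint_family_on_def proof (intro ballI impI)
    fix i j assume "i : {..<m}" "j : {..<m}" "i ~= j"
    then show "ball (c i) (r i) \<inter> ball (c j) (r j) = {}" using CZ(4)[of i] CZ(4)[of j] CZ(5) unfolding disjoint_family_on_def by blast
   qed
  qed auto
  finally show ?thesis using sv[of 1] by simp
 qed
 define \<mu> where "\<mu> i = measure lebesgue (E i)" for i
 have Efin: "vol (E i) <= ennreal (?N * v i)" if i: "i < m" for i using emeasure_mono[OF CZ(3)[OF i], of lebesgue] Ev5[OF i] by simp
 have E\<mu>: "vol (E i) = ennreal (\<mu> i)" if i: "i < m" for i unfolding \<mu>_def using Efin[OF i] by (intro emeasure_eq_ennreal_measure) (auto simp: top_unique)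
 have \<mu>1: "v i <= \<mu> i" if i: "i < m" for i using emeasure_mono[OF CZ(4)[OF i] CZ(2)[OF i]] unfolding Ev[OF i] E\<mu>[OF i] by (simp add: \<mu>_def)
 have \<mu>2: "\<mu> i <= ?N * v i" if i: "i < m" for i using Efin[OF i] v[OF i] unfolding E\<mu>[OF i] by simp
 have int: "Lint (%x. ind (E i) x * f x)" if i: "i < m" for i by (intro Linf_c_integrable Linf_c_indicator f CZ(2) i)
 have fE: "(\<I> x. ennreal (norm (ind (E i) x * f x))) <= ennreal (t * ?N * v i)" if i: "i < m" for i proof -
  have "(\<I> x. ennreal (norm (ind (E i) x * f x))) <= (\<I> y. ennreal (norm (f y)) * ind (ball (c i) (5 * r i)) y)" using CZ(3)[OF i] by (intro nn_integral_mono) (auto simp: indicator_def)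
  also have "... <= ennreal t * ennreal (?N * v i)" using CZ(8)[OF i] Ev5[OF i] by simp
  also have "... = ennreal (t * ?N * v i)" using t v[OF i] by (simp add: ennreal_mult'[symmetric] mult.assoc)
  finally show ?thesis .
 qed
 define a where "a i = (\<L> x. ind (E i) x * f x) / of_real (\<mu> i)" for i
 have a_int: "norm (\<L> x. ind (E i) x * f x) <= t * ?N * v i" if i: "i < m" for i using order_trans[OF integral_norm_bound_ennreal[OF int[OF i]] fE[OF i]] t v[OF i] by (subst (asm) ennreal_le_iff) auto
 have a1: "norm (a i) <= t * ?N" if i: "i < m" for i proof -
  have "norm (a i) <= t * ?N * v i / \<mu> i" unfolding a_def using a_int[OF i] \<mu>1[OF i] v[OF i] by (simp add: norm_divide divide_right_mono)
  also have "... <= t * ?N * v i / v i" using \<mu>1[OF i] v[OF i] t by (intro divide_left_mono) auto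
  finally show ?thesis using v[OF i] by simp
 qed
 have a2: "norm (a i) * \<mu> i <= t * ?N * v i" if i: "i < m" for i unfolding a_def using a_int[OF i] \<mu>1[OF i] v[OF i] by (simp add: norm_divide)
 define b where "b i x = ind (E i) x * (f x - a i)" for i x
 have EL: "(%x. ind (E i) x * (1::complex)) : Linf_c" if i: "i < m" for i proof (rule Linf_cI)
  show "(%x. ind (E i) x * (1::complex)) : Lmeas" using CZ(2)[OF i] by measurable
  show "norm (ind (E i) x * (1::complex)) <= 1" for x by (simp add: indicator_def)
  fix x :: "real ^ 'n" assume x: "x ~: ball 0 (norm (c i) + 5 * r i)"
  have "x ~: ball (c i) (5 * r i)" using x norm_triangle_sub[of x "c i"] by (auto simp: dist_norm norm_minus_commute)
  then show "ind (E i) x * (1::complex) = 0" using CZ(3)[OF i] by (auto simp: indicator_def)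
 qed
 have b_eq: "b i = (%x. ind (E i) x * f x - a i * (ind (E i) x * 1))" for i by (auto simp: b_def algebra_simps)
 have bL: "b i : Linf_c" if i: "i < m" for i unfolding b_eq by (intro Linf_c_diff Linf_c_indicator Linf_c_cmult EL f CZ(2) i)
 have b_supp: "b i x = 0" if "i < m" "x ~: ball (c i) (5 * r i)" for i and x :: "real ^ 'n" using CZ(3)[OF that(1)] that(2) by (auto simp: b_def indicator_def)
 have b_zero: "(\<L> x. b i x) = 0" if i: "i < m" for i proof -
  have "(\<L> x. b i x) = (\<L> x. ind (E i) x * f x) - (\<L> x. a i * (ind (E i) x * 1))" unfolding b_eq by (intro Lintegral_diff int i integrable_mult_right Linf_c_integrable EL)
  also have "(\<L> x. a i * (ind (E i) x * 1)) = a i * of_real (\<mu> i)" proof -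
   have "(%x. ind (E i) x * (1::complex)) = (%x. complex_of_real (ind (E i) x))" by (auto simp: indicator_def)
   then show ?thesis by (simp only: integral_mult_right_zero integral_complex_of_real) (simp add: \<mu>_def)
  qed
  finally show ?thesis using \<mu>1[OF i] v[OF i] by (simp add: a_def)
 qed
 have b_norm: "(\<I> x. ennreal (norm (b i x))) <= ennreal (2 * t * ?N * v i)" if i: "i < m" for i proof -
  note [measurable] = CZ(2)[OF i]
  have "(\<I> x. ennreal (norm (b i x))) <= (\<I> x. ennreal (norm (ind (E i) x * f x)) + ennreal (norm (a i)) * ind (E i) x)" by (intro nn_integral_mono) (auto simp: b_def indicator_def norm_triangle_ineq4 simp flip: ennreal_plus intro!: ennreal_leI)
  also have "... = (\<I> x. ennreal (norm (ind (E i) x * f x))) + ennreal (norm (a i)) * vol (E i)" by (subst nn_integral_add) (auto simp: nn_integral_cmult_indicator)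
  also have "... <= ennreal (t * ?N * v i) + ennreal (t * ?N * v i)" using a2[OF i] by (intro add_mono fE i) (auto simp: E\<mu>[OF i] ennreal_mult'[symmetric] intro!: ennreal_leI)
  also have "... = ennreal (2 * t * ?N * v i)" using t v[OF i] by (simp flip: ennreal_plus)
  finally show ?thesis .
 qed
 define g where "g x = f x - (\<Sum>i<m. b i x)" for x
 have sbL: "(%x. \<Sum>i<m. b i x) : Linf_c" by (intro Linf_c_sum bL) simp
 have gL: "g : Linf_c" unfolding g_def by (intro Linf_c_diff f sbL)
 have g_in: "g x = a i" if "i < m" "x : E i" for i and x :: "real ^ 'n" using sum_indicator_disjoint[OF CZ(5) that, of "%i. f x - a i"] by (simp add: g_def b_def)
 have g_out: "g x = f x" if "x ~: (\<Union>i<m. E i)" for x using that by (simp add: g_def b_def indicator_def)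
 have g2: "lpow 2 g <= I2 + ennreal (t^2 * ?N ^ 3 * \<sigma>)" proof -
  have "lpow 2 g <= (\<I> x. ennreal ((norm (f x))^2) * ind {x. norm (f x) < 2 * t} x + (\<Sum>i<m. ennreal ((t * ?N)^2) * ind (E i) x))" unfolding lpow_def proof (intro nn_integral_mono)
   fix x
   show "ennreal (norm (g x) powr 2) <= ennreal ((norm (f x))^2) * ind {x. norm (f x) < 2 * t} x + (\<Sum>i<m. ennreal ((t * ?N)^2) * ind (E i) x)" proof (cases "x : (\<Union>i<m. E i)")
    case True
    then obtain i where i: "i < m" "x : E i" by blast
    have "ennreal (norm (g x) powr 2) <= ennreal ((t * ?N)^2) * ind (E i) x" using a1[OF i(1)] t i(2) by (simp add: g_in[OF i] powr_numeral ennreal_leI power_mono)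
    also have "... <= (\<Sum>i<m. ennreal ((t * ?N)^2) * ind (E i) x)" by (rule member_le_sum) (use i in auto)
    finally show ?thesis by (rule add_increasing[rotated]) simp
   next
    case False
    then have "norm (f x) < 2 * t" using CZ(6) by (auto simp: not_le[symmetric])
    then show ?thesis by (intro add_increasing2) (auto simp: g_out[OF False] powr_numeral)
   qed
  qed
  also have "... = I2 + (\<Sum>i<m. ennreal ((t * ?N)^2) * vol (E i))" unfolding I2_def by (subst nn_integral_add, measurable, (use CZ(2) in simp)[1], subst nn_integral_sum, (use CZ(2) in auto)[1])
    (use CZ(2) in "simp add: nn_integral_cmult_indicator")
  also have "(\<Sum>i<m. ennreal ((t * ?N)^2) * vol (E i)) <= (\<Sum>i<m. ennreal (t^2 * ?N ^ 3 * v i))" proof (intro sum_mono)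
   fix i assume "i : {..<m}"
   then have i: "i < m" by simp
   have "ennreal ((t * ?N)^2) * vol (E i) <= ennreal ((t * ?N)^2) * ennreal (?N * v i)" by (intro mult_left_mono Efin i) simp
   also have "... = ennreal (t^2 * ?N ^ 3 * v i)" using t by (subst ennreal_mult'[symmetric]) (auto simp: power_mult_distrib power2_eq_square power3_eq_cube mult_ac)
   finally show "ennreal ((t * ?N)^2) * vol (E i) <= ennreal (t^2 * ?N ^ 3 * v i)" .
  qed
  also have "... = ennreal (t^2 * ?N ^ 3 * \<sigma>)" using t by (intro sv) auto
  finally show ?thesis by simp
 qed
 define U where "U = (\<Union>i<m. ball (c i) (10 * r i))"
 have U_meas [measurable]: "U : sets lebesgue" unfolding U_def by (intro sets.finite_UN) auto
 have U: "vol U <= ennreal (10 ^ CARD('n) * \<sigma>)" proof -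
  have "vol U <= (\<Sum>i<m. vol (ball (c i) (10 * r i)))" unfolding U_def by (intro emeasure_subadditive_finite) auto
  also have "... = (\<Sum>i<m. ennreal (10 ^ CARD('n) * v i))" using Ev10 by (intro sum.cong) auto
  also have "... = ennreal (10 ^ CARD('n) * \<sigma>)" by (rule sv) simp
  finally show ?thesis .
 qed
 have Tb_meas [measurable]: "T (b i) : Lmeas" if "i < m" for i by (intro T_measurable Linf_c_L2 bL that)
 define h where "h x = (\<Sum>i<m. ennreal (norm (T (b i) x)) * ind (- ball (c i) (10 * r i)) x)" for x
 have h_meas [measurable]: "h : Lmeas" unfolding h_def by (intro borel_measurable_sum borel_measurable_times_ennreal) (auto intro!: measurable_compose[OF Tb_meas])
 have h: "(\<I> x. h x) <= ennreal (A * tail_const TYPE('n) \<delta> * 2 * t * ?N * \<sigma>)" proof -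
  have "(\<I> x. h x) = (\<Sum>i<m. \<integral>\<^sup>+x. ennreal (norm (T (b i) x)) * ind (- ball (c i) (10 * r i)) x \<partial>lebesgue)" unfolding h_def by (intro nn_integral_sum borel_measurable_times_ennreal) (auto intro!: measurable_compose[OF Tb_meas])
  also have "... <= (\<Sum>i<m. ennreal (A * tail_const TYPE('n) \<delta> * (2 * t * ?N * v i)))" proof (intro sum_mono)
   fix i assume "i : {..<m}"
   then have i: "i < m" by simp
   have "(\<I> x. ennreal (norm (T (b i) x)) * ind (- ball (c i) (2 * (5 * r i))) x) <=
    ennreal (A * tail_const TYPE('n) \<delta>) * (\<I> x. ennreal (norm (b i x)))" by (rule atom_tail[OF bL[OF i] b_supp[OF i] _ b_zero[OF i]]) (use CZ(1)[OF i] in auto)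
   also have "... <= ennreal (A * tail_const TYPE('n) \<delta>) * ennreal (2 * t * ?N * v i)" by (intro mult_left_mono b_norm i) simp
   also have "... = ennreal (A * tail_const TYPE('n) \<delta> * (2 * t * ?N * v i))" using A_pos tail_const_nonneg[OF \<delta>_pos, where 'n='n] by (intro ennreal_mult'[symmetric]) auto
   finally show "(\<I> x. ennreal (norm (T (b i) x)) * ind (- ball (c i) (10 * r i)) x) <= ennreal (A * tail_const TYPE('n) \<delta> * (2 * t * ?N * v i))" by simp
  qed
  also have "... = (\<Sum>i<m. ennreal ((A * tail_const TYPE('n) \<delta> * 2 * t * ?N) * v i))" by (simp only: mult.assoc)
  also have "... = ennreal (A * tail_const TYPE('n) \<delta> * 2 * t * ?N * \<sigma>)" using A_pos tail_const_nonneg[OF \<delta>_pos, where 'n='n] t by (intro sv) simp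
  finally show ?thesis .
 qed
 note [measurable] = T_measurable[OF Linf_c_L2[OF f]] T_measurable[OF Linf_c_L2[OF gL]]
 let ?G = "{x. t / 2 < norm (T g x)}" and ?H = "{x : space lebesgue. ennreal (t / 2) <= h x}"
 have "{x : space lebesgue. t / 2 < norm (T g x)} : sets lebesgue" by measurable
 then have [measurable]: "?G : sets lebesgue" by simp
 have [measurable]: "?H : sets lebesgue" by measurable
 have "AEL x. x : {x. t < norm (T f x)} --> x : U \<union> (?G \<union> ?H)" proof -
  have "AEL x. T (%x. g x + (\<Sum>i<m. b i x)) x = T g x + T (%x. \<Sum>i<m. b i x) x" by (intro T_add Linf_c_L2 gL sbL)
  moreover have "AEL x. T (%x. \<Sum>i<m. b i x) x = (\<Sum>i<m. T (b i) x)" by (rule T_sum) (auto intro: bL)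
  ultimately show ?thesis proof eventually_elim
   case (elim x)
   show ?case proof
    assume "x : {x. t < norm (T f x)}"
    then have "t < norm (T g x + (\<Sum>i<m. T (b i) x))" using elim by (simp add: g_def)
    then have "t < norm (T g x) + norm (\<Sum>i<m. T (b i) x)" using norm_triangle_ineq[of "T g x" "\<Sum>i<m. T (b i) x"] by linarith
    moreover have "x : ?H" if "x ~: U" "t / 2 < norm (\<Sum>i<m. T (b i) x)" proof -
    have "h x = (\<Sum>i<m. ennreal (norm (T (b i) x)))" unfolding h_def using that(1) by (intro sum.cong) (auto simp: U_def indicator_def)
    then have "h x = ennreal (\<Sum>i<m. norm (T (b i) x))" by simp
    moreover have "t / 2 <= (\<Sum>i<m. norm (T (b i) x))" using that(2) norm_sum[of "%i. T (b i) x" "{..<m}"] by linarith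
    ultimately show ?thesis by (simp add: ennreal_leI)
    qed
    ultimately show "x : U \<union> (?G \<union> ?H)" by (cases "t / 2 < norm (T g x)") auto
   qed
  qed
 qed
 then have "vol {x. t < norm (T f x)} <= vol (U \<union> (?G \<union> ?H))" by (rule emeasure_mono_AE) (intro sets.Un U_meas \<open>?G : sets lebesgue\<close> \<open>?H : sets lebesgue\<close>)
 also have "... <= vol U + vol (?G \<union> ?H)" by (rule emeasure_subadditive) (intro sets.Un U_meas \<open>?G : sets lebesgue\<close> \<open>?H : sets lebesgue\<close>)+
 also have "... <= vol U + (vol ?G + vol ?H)" by (intro add_left_mono emeasure_subadditive \<open>?G : sets lebesgue\<close> \<open>?H : sets lebesgue\<close>)
 also have "... <= ennreal (10 ^ CARD('n) * \<sigma>) + ((ennreal (4 * B / t^2) * I2 + ennreal (4 * B * ?N ^ 3 * \<sigma>)) + ennreal (4 * A * tail_const TYPE('n) \<delta> * ?N * \<sigma>))" proof (intro add_mono U)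
  have "ennreal ((t / 2)^2) * vol ?G <= lpow 2 (T g)" using chebyshev_lpow[of "T g" "t / 2" 2] t by (simp add: powr_numeral)
  also have "... <= ennreal B * lpow 2 g" by (rule L2_const[OF gL])
  also have "... <= ennreal B * (I2 + ennreal (t^2 * ?N ^ 3 * \<sigma>))" by (intro mult_left_mono g2) simp
  finally have "ennreal (4 / t^2) * (ennreal ((t / 2)^2) * vol ?G) <= ennreal (4 / t^2) * (ennreal B * (I2 + ennreal (t^2 * ?N ^ 3 * \<sigma>)))" by (rule mult_left_mono) simp
  moreover have "ennreal (4 / t^2) * (ennreal ((t / 2)^2) * vol ?G) = vol ?G" using t by (simp add: mult.assoc[symmetric] ennreal_mult'[symmetric] power_divide)
  moreover have "ennreal (4 / t^2) * (ennreal B * (I2 + ennreal (t^2 * ?N ^ 3 * \<sigma>))) = ennreal (4 * B / t^2) * I2 + ennreal (4 * B * ?N ^ 3 * \<sigma>)" proof -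
   have "ennreal (4 / t^2) * (ennreal B * (I2 + ennreal (t^2 * ?N ^ 3 * \<sigma>))) = ennreal (4 / t^2 * B) * (I2 + ennreal (t^2 * ?N ^ 3 * \<sigma>))" using B_nonneg by (simp only: mult.assoc[symmetric] ennreal_mult'[symmetric, OF B_nonneg] ennreal_mult''[symmetric, OF B_nonneg])
   also have "... = ennreal (4 / t^2 * B) * I2 + ennreal (4 / t^2 * B * (t^2 * ?N ^ 3 * \<sigma>))" using B_nonneg \<sigma>0 by (simp add: distrib_left ennreal_mult''[symmetric])
   finally show ?thesis using t by (simp add: mult.assoc)
  qed
  ultimately show "vol ?G <= ennreal (4 * B / t^2) * I2 + ennreal (4 * B * ?N ^ 3 * \<sigma>)" by simp
  have "ennreal (t / 2) * vol ?H <= ennreal (A * tail_const TYPE('n) \<delta> * 2 * t * ?N * \<sigma>)" using chebyshev_nn[OF h_meas, of "t / 2"] h t by simp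
  then have "ennreal (2 / t) * (ennreal (t / 2) * vol ?H) <= ennreal (2 / t) * ennreal (A * tail_const TYPE('n) \<delta> * 2 * t * ?N * \<sigma>)" by (rule mult_left_mono) simp
  moreover have "ennreal (2 / t) * (ennreal (t / 2) * vol ?H) = vol ?H" using t by (simp add: mult.assoc[symmetric] ennreal_mult'[symmetric])
  moreover have "ennreal (2 / t) * ennreal (A * tail_const TYPE('n) \<delta> * 2 * t * ?N * \<sigma>) = ennreal (4 * A * tail_const TYPE('n) \<delta> * ?N * \<sigma>)" using t by (simp add: ennreal_mult'[symmetric] mult.assoc)
  ultimately show "vol ?H <= ennreal (4 * A * tail_const TYPE('n) \<delta> * ?N * \<sigma>)" by simp
 qed
 also have "... = ennreal (10 ^ CARD('n) + 4 * B * ?N ^ 3 + 4 * A * tail_const TYPE('n) \<delta> * ?N) * ennreal \<sigma> + ennreal (4 * B / t^2) * I2" proof -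
  have nn: "0 <= 4 * B * ?N ^ 3 * \<sigma>" "0 <= 4 * A * tail_const TYPE('n) \<delta> * ?N * \<sigma>" "0 <= 10 ^ CARD('n) * \<sigma>" using \<sigma>0 A_pos B_nonneg tail_const_nonneg[OF \<delta>_pos, where 'n='n] by auto
  have "ennreal (10 ^ CARD('n) + 4 * B * ?N ^ 3 + 4 * A * tail_const TYPE('n) \<delta> * ?N) * ennreal \<sigma> =
   ennreal (10 ^ CARD('n) * \<sigma> + 4 * B * ?N ^ 3 * \<sigma> + 4 * A * tail_const TYPE('n) \<delta> * ?N * \<sigma>)" by (subst ennreal_mult''[symmetric]) (use \<sigma>0 in "auto simp: algebra_simps")
  also have "... = ennreal (10 ^ CARD('n) * \<sigma>) + ennreal (4 * B * ?N ^ 3 * \<sigma>) + ennreal (4 * A * tail_const TYPE('n) \<delta> * ?N * \<sigma>)" using nn by (subst ennreal_plus[symmetric], simp, simp)+ simp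
  finally show ?thesis by (simp add: add_ac)
 qed
 also have "... <= ennreal (10 ^ CARD('n) + 4 * B * ?N ^ 3 + 4 * A * tail_const TYPE('n) \<delta> * ?N) * (ennreal (2 / t) * I1) + ennreal (4 * B / t^2) * I2" by (intro add_right_mono mult_left_mono \<sigma>) simp
 also have "... = ennreal (2 * (10 ^ CARD('n) + 4 * B * ?N ^ 3 + 4 * A * tail_const TYPE('n) \<delta> * ?N)) * (ennreal (1 / t) * I1) + ennreal (4 * B) * (ennreal (1 / t^2) * I2)" proof -
  have "ennreal (2 / t) = ennreal 2 * ennreal (1 / t)" using t by (subst ennreal_mult'[symmetric]) auto
  moreover have "ennreal (4 * B / t^2) = ennreal (4 * B) * ennreal (1 / t^2)" using B_nonneg by (subst ennreal_mult'[symmetric]) auto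
  moreover have "ennreal (2 * (10 ^ CARD('n) + 4 * B * ?N ^ 3 + 4 * A * tail_const TYPE('n) \<delta> * ?N)) = ennreal 2 * ennreal (10 ^ CARD('n) + 4 * B * ?N ^ 3 + 4 * A * tail_const TYPE('n) \<delta> * ?N)" by (rule ennreal_mult') simp
  ultimately show ?thesis by (simp only: mult_ac)
 qed
 also have "... <= ennreal weak_const * (ennreal (1 / t) * I1) + ennreal weak_const * (ennreal (1 / t^2) * I2)" proof -
  have "?N ^ 3 = 125 ^ CARD('n)" by (simp add: power_mult[symmetric] mult.commute[of "CARD('n)"]) (simp add: power_mult)
  then show ?thesis using A_pos B_nonneg tail_const_nonneg[OF \<delta>_pos, where 'n='n] by (intro add_mono mult_right_mono ennreal_leI) (auto simp: weak_const_def)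
 qed
 finally show ?thesis unfolding I1_def I2_def by (simp add: distrib_left)
qed

end


section \<open>Boundedness on \<open>L\<^sup>p\<close>\<close>

lemma nn_integral_powr_from_0:
 assumes a: "-1 < a" and b: "0 <= b"
 shows "(\<integral>\<^sup>+t. ennreal (t powr a) * ind {0<..<b} t \<partial>lborel) = ennreal (b powr (a + 1) / (a + 1))" proof -
 have "AE t in lborel. t ~= 0" "AE t in lborel. t ~= b" by (rule AE_lborel_singleton)+
 then have "AE t in lborel. ennreal (t powr a) * ind {0<..<b} t = ennreal (ind {0..b} t * t powr a)" by eventually_elim (auto simp: indicator_def)
 then have "(\<integral>\<^sup>+t. ennreal (t powr a) * ind {0<..<b} t \<partial>lborel) = (\<integral>\<^sup>+t. ennreal (ind {0..b} t * t powr a) \<partial>lborel)" by (rule nn_integral_cong_AE)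
 also have "... = ennreal (b powr (a + 1) / (a + 1))" using nn_integral_has_integral_lebesgue[OF _ has_integral_powr_from_0[OF a b]] by simp
 finally show ?thesis .
qed

lemma nn_integral_powr_to_inf:
 assumes a: "a < -1" and b: "0 < b"
 shows "(\<integral>\<^sup>+t. ennreal (t powr a) * ind {b<..} t \<partial>lborel) <= ennreal (b powr (a + 1) / (- a - 1))" proof -
 have "(\<integral>\<^sup>+t. ennreal (t powr a) * ind {b<..} t \<partial>lborel) <= (\<integral>\<^sup>+t. ennreal (ind {b..} t * t powr a) \<partial>lborel)" by (intro nn_integral_mono) (auto simp: indicator_def)
 also have "... = ennreal (- (b powr (a + 1)) / (a + 1))" using nn_integral_has_integral_lebesgue[OF _ has_integral_powr_to_inf[OF a b]] by simp
 also have "- (b powr (a + 1)) / (a + 1) = b powr (a + 1) / (- a - 1)" using a by (simp add: divide_simps) (simp add: algebra_simps)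
 finally show ?thesis .
qed

lemma sets_superlevel [measurable]:
 fixes h :: "'a::euclidean_space => complex"
 assumes [measurable]: "h : Lmeas"
 shows "{x. t < norm (h x)} : sets lebesgue" proof -
 have "{x : space lebesgue. t < norm (h x)} : sets lebesgue" by measurable
 then show ?thesis by simp
qed

lemma pair_lebesgue_lborel: "pair_sigma_finite (lebesgue :: 'a::euclidean_space measure) (lborel :: real measure)" unfolding pair_sigma_finite_def by (intro conjI sigma_finite_lebesgue sigma_finite_lborel)

lemma lpow_layer_cake:
 fixes h :: "'a::euclidean_space => complex"
 assumes [measurable]: "h : Lmeas" and p: "0 < p"
 shows "lpow p h = (\<integral>\<^sup>+t. ennreal (p * t powr (p - 1)) * ind {0<..} t * vol {x. t < norm (h x)} \<partial>lborel)" proof -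
 interpret P: pair_sigma_finite "lebesgue :: 'a measure" "lborel :: real measure" by (rule pair_lebesgue_lborel)
 define G where "G x t = (if 0 < t & t < norm (h x) then ennreal p * ennreal (t powr (p - 1)) else 0)" for x t
 have Gm: "case_prod G : borel_measurable (lebesgue \<Otimes>\<^sub>M lborel)" unfolding G_def case_prod_beta by measurable
 have "lpow p h = (\<I> x. \<integral>\<^sup>+t. G x t \<partial>lborel)" unfolding lpow_def proof (intro nn_integral_cong)
  fix x
  have "(\<integral>\<^sup>+t. G x t \<partial>lborel) = (\<integral>\<^sup>+t. ennreal p * (ennreal (t powr (p - 1)) * ind {0<..<norm (h x)} t) \<partial>lborel)" by (intro nn_integral_cong) (auto simp: G_def indicator_def)
  also have "... = ennreal p * (\<integral>\<^sup>+t. ennreal (t powr (p - 1)) * ind {0<..<norm (h x)} t \<partial>lborel)" by (rule nn_integral_cmult) measurable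
  also have "... = ennreal p * ennreal (norm (h x) powr p / p)" using nn_integral_powr_from_0[of "p - 1" "norm (h x)"] p by simp
  also have "... = ennreal (norm (h x) powr p)" using p by (simp add: ennreal_mult'[symmetric])
  finally show "ennreal (norm (h x) powr p) = (\<integral>\<^sup>+t. G x t \<partial>lborel)" ..
 qed
 also have "... = (\<integral>\<^sup>+t. \<integral>\<^sup>+x. G x t \<partial>lebesgue \<partial>lborel)" by (rule P.Fubini'[symmetric, OF Gm])
 also have "... = (\<integral>\<^sup>+t. ennreal (p * t powr (p - 1)) * ind {0<..} t * vol {x. t < norm (h x)} \<partial>lborel)" proof (intro nn_integral_cong)
  fix t :: real
  have "(\<I> x. G x t) = (\<I> x. (ennreal (p * t powr (p - 1)) * ind {0<..} t) * ind {x. t < norm (h x)} x)" using p by (intro nn_integral_cong) (auto simp: G_def indicator_def ennreal_mult')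
  also have "... = ennreal (p * t powr (p - 1)) * ind {0<..} t * vol {x. t < norm (h x)}" by (rule nn_integral_cmult_indicator[OF sets_superlevel[OF assms(1)]])
  finally show "(\<I> x. G x t) = ennreal (p * t powr (p - 1)) * ind {0<..} t * vol {x. t < norm (h x)}" .
 qed
 finally show ?thesis .
qed

context cz_op
begin

text \<open>Marcinkiewicz interpolation: integrate \<open>superlevel_bound\<close> against \<open>p t\<^sup>p\<^sup>-\<^sup>1 dt\<close>.\<close>

lemma Lp_continuous:
 assumes p: "1 < p" "p < 2" and cont: "continuous_on UNIV f" and f: "f : Linf_c"
 shows "lpow p (T f) <= ennreal (weak_const * p * (2 powr (p - 1) / (p - 1) + 2 powr (2 - p) / (2 - p))) * lpow p f" proof -
 interpret P: pair_sigma_finite "lebesgue :: (real^'n) measure" "lborel :: real measure" by (rule pair_lebesgue_lborel)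
 note [measurable] = Linf_c_measurable[OF f] T_measurable[OF Linf_c_L2[OF f]]
 define G1 where "G1 x t = (if 0 < t & t / 2 < norm (f x) then ennreal (t powr (p - 2)) * ennreal (norm (f x)) else 0)" for x t
 define G2 where "G2 x t = (if 0 < t & norm (f x) < 2 * t then ennreal (t powr (p - 3)) * ennreal ((norm (f x))^2) else 0)" for x t
 have G1m: "case_prod G1 : borel_measurable (lebesgue \<Otimes>\<^sub>M lborel)" unfolding G1_def case_prod_beta by measurable
 have G2m: "case_prod G2 : borel_measurable (lebesgue \<Otimes>\<^sub>M lborel)" unfolding G2_def case_prod_beta by measurable
 have G1m': "(%x. G1 x t) : Lmeas" "(%x. G2 x t) : Lmeas" for t unfolding G1_def G2_def by measurable
 have G1m'': "(%t. \<integral>\<^sup>+x. G1 x t \<partial>lebesgue) : borel_measurable lborel" "(%t. \<integral>\<^sup>+x. G2 x t \<partial>lebesgue) : borel_measurable lborel"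
  using P.M1.borel_measurable_nn_integral[of "%t x. G1 x t" lborel] P.M1.borel_measurable_nn_integral[of "%t x. G2 x t" lborel]
   measurable_pair_swap[OF G1m] measurable_pair_swap[OF G2m] by (simp_all add: case_prod_beta)
 have W: "0 <= weak_const" by (rule weak_const_nonneg)
 have "lpow p (T f) = (\<integral>\<^sup>+t. ennreal (p * t powr (p - 1)) * ind {0<..} t * vol {x. t < norm (T f x)} \<partial>lborel)" by (rule lpow_layer_cake) (use p in auto)
 also have "... <= (\<integral>\<^sup>+t. ennreal (weak_const * p) * ((\<I> x. G1 x t) + (\<I> x. G2 x t)) \<partial>lborel)" proof (intro nn_integral_mono)
  fix t :: real
  show "ennreal (p * t powr (p - 1)) * ind {0<..} t * vol {x. t < norm (T f x)} <=
   ennreal (weak_const * p) * ((\<I> x. G1 x t) + (\<I> x. G2 x t))" proof (cases "0 < t")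
   case True
   define I1 where "I1 = (\<I> x. ennreal (norm (f x)) * ind {x. t / 2 < norm (f x)} x)"
   define I2 where "I2 = (\<I> x. ennreal ((norm (f x))^2) * ind {x. norm (f x) < 2 * t} x)"
   have e1: "(\<I> x. G1 x t) = ennreal (t powr (p - 2)) * I1" proof -
    have "(\<I> x. G1 x t) = (\<I> x. ennreal (t powr (p - 2)) * (ennreal (norm (f x)) * ind {x. t / 2 < norm (f x)} x))" using True by (intro nn_integral_cong) (auto simp: G1_def indicator_def)
    also have "... = ennreal (t powr (p - 2)) * I1" unfolding I1_def by (rule nn_integral_cmult) measurable
    finally show ?thesis .
   qed
   have e2: "(\<I> x. G2 x t) = ennreal (t powr (p - 3)) * I2" proof -
    have "(\<I> x. G2 x t) = (\<I> x. ennreal (t powr (p - 3)) * (ennreal ((norm (f x))^2) * ind {x. norm (f x) < 2 * t} x))" using True by (intro nn_integral_cong) (auto simp: G2_def indicator_def)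
    also have "... = ennreal (t powr (p - 3)) * I2" unfolding I2_def by (rule nn_integral_cmult) measurable
    finally show ?thesis .
   qed
   have "vol {x. t < norm (T f x)} <= ennreal weak_const * (ennreal (1 / t) * I1 + ennreal (1 / t^2) * I2)" unfolding I1_def I2_def by (rule superlevel_bound[OF cont f True])
   then have "ennreal (p * t powr (p - 1)) * vol {x. t < norm (T f x)} <=
    ennreal (p * t powr (p - 1)) * (ennreal weak_const * (ennreal (1 / t) * I1 + ennreal (1 / t^2) * I2))" by (rule mult_left_mono) simp
   also have "... = ennreal (weak_const * p) * (ennreal (t powr (p - 1)) * ennreal (1 / t) * I1 + ennreal (t powr (p - 1)) * ennreal (1 / t^2) * I2)" proof -
    have "ennreal (p * t powr (p - 1)) * ennreal weak_const = ennreal (weak_const * p) * ennreal (t powr (p - 1))" using p W by (simp add: ennreal_mult'[symmetric] mult_ac)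
    then show ?thesis by (simp only: mult.assoc[symmetric] distrib_left)
   qed
   also have "ennreal (t powr (p - 1)) * ennreal (1 / t) = ennreal (t powr (p - 2))" proof -
    have "t powr (p - 1) = t powr (p - 2) * t powr 1" using powr_add[of t "p - 2" 1] by simp
    then show ?thesis using True by (simp add: ennreal_mult'[symmetric])
   qed
   also have "ennreal (t powr (p - 1)) * ennreal (1 / t^2) = ennreal (t powr (p - 3))" proof -
    have "t powr (p - 1) = t powr (p - 3) * t powr 2" using powr_add[of t "p - 3" 2] by simp
    then show ?thesis using True by (simp add: ennreal_mult'[symmetric] powr_numeral)
   qed
   finally show ?thesis using True by (simp add: e1 e2)
  qed simp
 qed
 also have "... = ennreal (weak_const * p) * ((\<integral>\<^sup>+t. \<integral>\<^sup>+x. G1 x t \<partial>lebesgue \<partial>lborel) + (\<integral>\<^sup>+t. \<integral>\<^sup>+x. G2 x t \<partial>lebesgue \<partial>lborel))"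
  using G1m'' by (subst nn_integral_cmult) (auto intro!: nn_integral_add arg_cong[where f="(*) (ennreal (weak_const * p))"])
 also have "(\<integral>\<^sup>+t. \<integral>\<^sup>+x. G1 x t \<partial>lebesgue \<partial>lborel) = (\<I> x. \<integral>\<^sup>+t. G1 x t \<partial>lborel)" by (rule P.Fubini'[OF G1m])
 also have "(\<integral>\<^sup>+t. \<integral>\<^sup>+x. G2 x t \<partial>lebesgue \<partial>lborel) = (\<I> x. \<integral>\<^sup>+t. G2 x t \<partial>lborel)" by (rule P.Fubini'[OF G2m])
 also have "(\<I> x. \<integral>\<^sup>+t. G1 x t \<partial>lborel) <= (\<I> x. ennreal (2 powr (p - 1) / (p - 1)) * ennreal (norm (f x) powr p))" proof (intro nn_integral_mono)
  fix x
  have "(\<integral>\<^sup>+t. G1 x t \<partial>lborel) = (\<integral>\<^sup>+t. (ennreal (t powr (p - 2)) * ind {0<..<2 * norm (f x)} t) * ennreal (norm (f x)) \<partial>lborel)" by (intro nn_integral_cong) (auto simp: G1_def indicator_def)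
  also have "... = ennreal ((2 * norm (f x)) powr (p - 1) / (p - 1)) * ennreal (norm (f x))" using nn_integral_powr_from_0[of "p - 2" "2 * norm (f x)"] p by (subst nn_integral_multc) auto
  also have "... = ennreal (2 powr (p - 1) / (p - 1) * (norm (f x) powr (p - 1) * norm (f x)))" using p by (simp add: ennreal_mult'[symmetric] powr_mult mult_ac)
  also have "norm (f x) powr (p - 1) * norm (f x) = norm (f x) powr p" using powr_add[of "norm (f x)" "p - 1" 1] p by simp
  finally show "(\<integral>\<^sup>+t. G1 x t \<partial>lborel) <= ennreal (2 powr (p - 1) / (p - 1)) * ennreal (norm (f x) powr p)" using p by (simp add: ennreal_mult'[symmetric])
 qed
 also have "(\<I> x. \<integral>\<^sup>+t. G2 x t \<partial>lborel) <= (\<I> x. ennreal (2 powr (2 - p) / (2 - p)) * ennreal (norm (f x) powr p))" proof (intro nn_integral_mono)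
  fix x
  show "(\<integral>\<^sup>+t. G2 x t \<partial>lborel) <= ennreal (2 powr (2 - p) / (2 - p)) * ennreal (norm (f x) powr p)" proof (cases "f x = 0")
   case True
   then have "G2 x t = 0" for t by (simp add: G2_def)
   then show ?thesis by simp
  next
   case False
   have "(\<integral>\<^sup>+t. G2 x t \<partial>lborel) = (\<integral>\<^sup>+t. (ennreal (t powr (p - 3)) * ind {norm (f x) / 2<..} t) * ennreal ((norm (f x))^2) \<partial>lborel)" proof (intro nn_integral_cong)
    fix t :: real
    have "0 < t" if "norm (f x) / 2 < t" using that norm_ge_zero[of "f x"] by linarith
    then show "G2 x t = (ennreal (t powr (p - 3)) * ind {norm (f x) / 2<..} t) * ennreal ((norm (f x))^2)" by (auto simp: G2_def indicator_def)
   qed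
   also have "... = (\<integral>\<^sup>+t. (ennreal (t powr (p - 3)) * ind {norm (f x) / 2<..} t) \<partial>lborel) * ennreal ((norm (f x))^2)" by (rule nn_integral_multc) measurable
   also have "... <= ennreal ((norm (f x) / 2) powr (p - 3 + 1) / (- (p - 3) - 1)) * ennreal ((norm (f x))^2)" by (intro mult_right_mono nn_integral_powr_to_inf) (use p False in auto)
   also have "... = ennreal ((norm (f x) / 2) powr (p - 2) * (norm (f x))^2 / (2 - p))" using p by (simp add: ennreal_mult'[symmetric])
   also have "(norm (f x) / 2) powr (p - 2) * (norm (f x))^2 = 2 powr (2 - p) * norm (f x) powr p" proof -
    have "norm (f x) powr p = norm (f x) powr (p - 2) * norm (f x) powr 2" using powr_add[of "norm (f x)" "p - 2" 2] by simp
    moreover have "(1 / 2 :: real) powr (p - 2) = 2 powr (2 - p)" by (simp add: powr_divide powr_minus_divide[symmetric])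
    ultimately show ?thesis using powr_mult[of "norm (f x)" "1/2" "p - 2"] by (simp add: powr_numeral)
   qed
   finally show ?thesis using p by (simp add: ennreal_mult'[symmetric])
  qed
 qed
 also have "(\<I> x. ennreal (2 powr (p - 1) / (p - 1)) * ennreal (norm (f x) powr p)) = ennreal (2 powr (p - 1) / (p - 1)) * lpow p f" unfolding lpow_def by (rule nn_integral_cmult) measurable
 also have "(\<I> x. ennreal (2 powr (2 - p) / (2 - p)) * ennreal (norm (f x) powr p)) = ennreal (2 powr (2 - p) / (2 - p)) * lpow p f" unfolding lpow_def by (rule nn_integral_cmult) measurable
 also have "ennreal (weak_const * p) * (ennreal (2 powr (p - 1) / (p - 1)) * lpow p f + ennreal (2 powr (2 - p) / (2 - p)) * lpow p f)
  = ennreal (weak_const * p * (2 powr (p - 1) / (p - 1) + 2 powr (2 - p) / (2 - p))) * lpow p f" using p W by (simp add: ennreal_mult' ennreal_plus[symmetric] distrib_right[symmetric] mult.assoc del: ennreal_plus)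
 finally show ?thesis by (simp add: add_mono mult_left_mono)
qed

end

lemma lpow_fatou:
 fixes h :: "nat => 'a::euclidean_space => complex"
 assumes [measurable]: "!!k. h k : Lmeas" and p: "0 < p"
  and conv: "AEL x. (%k. h k x) ----> H x"
  and le: "!!k. lpow p (h k) <= a k" and a: "a ----> c"
 shows "lpow p H <= c" proof -
 have "lpow p H = (\<I> x. liminf (%k. ennreal (norm (h k x) powr p)))" unfolding lpow_def proof (rule nn_integral_cong_AE)
  show "AEL x. ennreal (norm (H x) powr p) = liminf (%k. ennreal (norm (h k x) powr p))" using conv proof eventually_elim
   case (elim x)
   have "(%k. ennreal (norm (h k x) powr p)) ----> ennreal (norm (H x) powr p)" by (intro tendsto_ennrealI tendsto_powr2 tendsto_norm elim tendsto_const) (use p in auto)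
   then show ?case by (rule lim_imp_Liminf[OF trivial_limit_sequentially, symmetric])
  qed
 qed
 also have "... <= liminf (%k. lpow p (h k))" unfolding lpow_def by (rule nn_integral_liminf) measurable
 also have "... <= liminf a" by (intro Liminf_mono always_eventually allI le)
 also have "... = c" using a by (simp add: lim_imp_Liminf)
 finally show ?thesis .
qed

lemma lpow_dominated:
 fixes h :: "nat => 'a::euclidean_space => complex"
 assumes [measurable]: "!!k. h k : Lmeas" "H : Lmeas" "w : Lmeas" and p: "0 < p"
  and conv: "AEL x. (%k. h k x) ----> H x"
  and dom: "!!k x. norm (h k x) <= norm (w x)" and w: "lpow p w < top"
 shows "(%k. lpow p (h k)) ----> lpow p H" unfolding lpow_def proof (rule nn_integral_dominated_convergence[where w="%x. ennreal (norm (w x) powr p)"])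
 show "AEL x. (%k. ennreal (norm (h k x) powr p)) ----> ennreal (norm (H x) powr p)" using conv proof eventually_elim
  case (elim x)
  show ?case by (intro tendsto_ennrealI tendsto_powr2 tendsto_norm elim tendsto_const) (use p in auto)
 qed
 show "AEL x. ennreal (norm (h k x) powr p) <= ennreal (norm (w x) powr p)" for k using dom p by (intro AE_I2 ennreal_leI powr_mono2) auto
 show "(\<I> x. ennreal (norm (w x) powr p)) < \<infinity>" using w by (simp add: lpow_def)
qed measurable

text \<open>The stopping argument needs continuous functions, so \<open>f\<close> is approximated by bounded continuous ones
  with a common majorant.\<close>

lemma continuous_approximation:
 fixes f :: "'a::euclidean_space => complex"
 assumes f: "f : Linf_c"
 shows "\<exists>g w. w : Linf_c & (\<forall>k::nat. continuous_on UNIV (g k)) & (\<forall>k. g k : Linf_c) & (\<forall>k x. norm (g k x) <= norm (w x)) &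
  (\<forall>x. norm (f x) <= norm (w x)) & (AEL x. (%k. g k x) ----> f x)" proof -
 obtain M R where MR: "0 < M" "0 < R" "!!x. norm (f x) <= M" "!!x. x ~: ball 0 R ==> f x = 0" using f by (rule Linf_cE) blast
 have "f measurable_on UNIV" by (rule lebesgue_measurable_imp_measurable_on[OF Linf_c_measurable[OF f]]) simp
 then obtain N g where N: "negligible N" and g: "!!n. continuous_on UNIV (g n)"
  "!!x. x ~: N ==> (%n. g n x) ----> f x" unfolding measurable_on_def by auto
 define cl :: "complex => complex" where "cl z = of_real (M / max M (norm z)) * z" for z
 define cut :: "'a => real" where "cut x = max 0 (min 1 (R + 1 - norm x))" for x
 define G where "G k x = of_real (cut x) * cl (g k x)" for k x
 define w where "w x = of_real M * (ind (ball 0 (R + 1)) x :: complex)" for x :: 'a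
 have cl_cont: "continuous_on UNIV cl" unfolding cl_def using MR(1) by (intro continuous_intros) (auto simp: max_def)
 have cut_cont: "continuous_on UNIV cut" unfolding cut_def by (intro continuous_intros)
 have cl_le: "norm (cl z) <= M" for z proof -
  have "norm (cl z) = M * (norm z / max M (norm z))" using MR(1) by (simp add: cl_def norm_mult norm_divide)
  also have "... <= M * 1" using MR(1) by (intro mult_left_mono) (auto simp: divide_le_eq)
  finally show ?thesis by simp
 qed
 have cl_id: "cl z = z" if "norm z <= M" for z using that MR(1) by (simp add: cl_def max_def)
 have cut: "0 <= cut x" "cut x <= 1" "x ~: ball 0 (R + 1) ==> cut x = 0" "x : ball 0 R ==> cut x = 1" for x by (auto simp: cut_def)
 have Gw: "norm (G k x) <= norm (w x)" for k x proof (cases "x : ball 0 (R + 1)")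
  case True
  have "norm (G k x) <= 1 * M" unfolding G_def norm_mult using cut[of x] cl_le by (intro mult_mono) auto
  then show ?thesis using True MR(1) by (simp add: w_def)
 qed (simp add: G_def cut(3))
 have Gcont: "continuous_on UNIV (G k)" for k unfolding G_def by (intro continuous_intros cut_cont continuous_on_compose2[OF cl_cont g(1)]) auto
 have wL: "w : Linf_c" proof (rule Linf_cI)
  show "w : Lmeas" unfolding w_def by measurable
  show "norm (w x) <= M" for x using MR(1) by (simp add: w_def indicator_def)
  show "w x = 0" if "x ~: ball 0 (R + 1)" for x using that by (simp add: w_def)
 qed
 show ?thesis proof (intro exI[of _ G] exI[of _ w] conjI allI)
  show "G k : Linf_c" for k proof (rule Linf_c_dominated[OF wL, of _ 1])
   show "G k : Lmeas" by (intro borel_measurable_lebesgueI borel_measurable_continuous_onI Gcont)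
  qed (use Gw in auto)
  show "norm (f x) <= norm (w x)" for x using MR(1) MR(3)[of x] MR(4)[of x] by (cases "x : ball 0 R") (auto simp: w_def indicator_def)
  have "AEL x. x ~: N" using N by (simp add: AE_not_in negligible_iff_null_sets)
  then show "AEL x. (%k. G k x) ----> f x" proof eventually_elim
   case (elim x)
   have "(%k. cl (g k x)) ----> cl (f x)" by (rule continuous_on_tendsto_compose[OF cl_cont g(2)[OF elim]]) auto
   then have "(%k. G k x) ----> of_real (cut x) * cl (f x)" unfolding G_def by (rule tendsto_mult_left)
   moreover have "of_real (cut x) * cl (f x) = f x" using cl_id[OF MR(3)[of x]] cut(4)[of x] MR(4)[of x] by (cases "x : ball 0 R") auto
   ultimately show ?case by simp
  qed
 qed (use Gcont wL Gw in auto)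
qed

text \<open>Convergence in \<open>L\<^sup>p\<close> gives convergence almost everywhere along a subsequence.\<close>

lemma lpow_AE_subseq:
 fixes h :: "nat => 'a::euclidean_space => complex"
 assumes [measurable]: "!!k. h k : Lmeas" and p: "0 < p"
  and lim: "(%k. lpow p (h k)) ----> 0" and fin: "!!k. lpow p (h k) < top"
 shows "\<exists>r::nat=>nat. strict_mono r & (AEL x. (%k. h (r k) x) ----> 0)" proof -
 define u where "u k x = norm (h k x) powr p" for k x
 have um: "u k : Lmeas" for k unfolding u_def by measurable
 have ui: "Lint (u k)" for k using fin[of k] um[of k] by (simp add: integrable_iff_bounded lpow_def u_def)
 have "(%k. ennreal (\<integral>x. norm (u k x) \<partial>lebesgue)) ----> ennreal 0" proof -
  have "ennreal (\<integral>x. norm (u k x) \<partial>lebesgue) = lpow p (h k)" for k using nn_integral_eq_integral[OF ui[of k]] by (simp add: lpow_def u_def[abs_def])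
  then show ?thesis using lim by simp
 qed
 then have "(%k. \<integral>x. norm (u k x) \<partial>lebesgue) ----> 0" by (subst (asm) tendsto_ennreal_iff) auto
 from tendsto_L1_AE_subseq[OF ui this] obtain r where r: "strict_mono r" "AEL x. (%k. u (r k) x) ----> 0" by auto
 have "AEL x. (%k. h (r k) x) ----> 0" using r(2) proof eventually_elim
  case (elim x)
  have "(%k. (u (r k) x) powr (1 / p)) ----> 0 powr (1 / p)" by (intro tendsto_powr2 elim tendsto_const) (use p in "auto simp: u_def")
  then have "(%k. norm (h (r k) x)) ----> 0" using p by (simp add: u_def powr_powr)
  then show ?case by (rule tendsto_norm_zero_cancel)
 qed
 with r(1) show ?thesis by blast
qed

lemma (in cz_op) Lp_less_2:
 assumes p: "1 < p" "p < 2" and f: "f : Linf_c"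
 shows "lpow p (T f) <= ennreal (weak_const * p * (2 powr (p - 1) / (p - 1) + 2 powr (2 - p) / (2 - p))) * lpow p f" proof -
 obtain g w where g: "!!k. continuous_on UNIV (g k)" "!!k. g k : Linf_c" "w : Linf_c"
  "!!k x. norm (g k x) <= norm (w x)" "!!x. norm (f x) <= norm (w x)" "AEL x. (%k. g k x) ----> f x" using continuous_approximation[OF f] by blast
 note [measurable] = Linf_c_measurable[OF f] Linf_c_measurable[OF g(2)] Linf_c_measurable[OF g(3)]
  T_measurable[OF Linf_c_L2[OF f]] T_measurable[OF Linf_c_L2[OF g(2)]]
 have d: "(%x. g k x - f x) : Linf_c" for k by (intro Linf_c_diff f g)
 note [measurable] = Linf_c_measurable[OF d] T_measurable[OF Linf_c_L2[OF d]]
 have "(%k. lpow 2 (%x. g k x - f x)) ----> lpow 2 (%x::real^'n. 0)" proof (rule lpow_dominated[where w="%x. 2 * w x"])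
  show "AEL x. (%k. g k x - f x) ----> 0" using g(6) by eventually_elim (simp add: LIM_zero)
  show "norm (g k x - f x) <= norm (2 * w x)" for k x using norm_triangle_ineq4[of "g k x" "f x"] g(4)[of k x] g(5)[of x] by (simp add: norm_mult)
  show "lpow 2 (%x. 2 * w x) < top" by (intro lpow_finite Linf_c_cmult g) simp
 qed (auto intro: Linf_c_measurable Linf_c_cmult g)
 then have "(%k. ennreal B * lpow 2 (%x. g k x - f x)) ----> ennreal B * 0" by (intro tendsto_mult_ennreal) (auto simp: lpow_def)
 then have lim: "(%k. ennreal B * lpow 2 (%x. g k x - f x)) ----> 0" by simp
 have "(%k. lpow 2 (T (%x. g k x - f x))) ----> 0" proof (rule tendsto_sandwich[OF _ _ tendsto_const lim])
  show "\<forall>\<^sub>F k in sequentially. 0 <= lpow 2 (T (%x. g k x - f x))" by simp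
  show "\<forall>\<^sub>F k in sequentially. lpow 2 (T (%x. g k x - f x)) <= ennreal B * lpow 2 (%x. g k x - f x)" by (intro always_eventually allI L2_const d)
 qed
 moreover have "lpow 2 (T (%x. g k x - f x)) < top" for k using T_L2[OF Linf_c_L2[OF d]] by (simp add: L2_iff_lpow)
 ultimately have "\<exists>r::nat=>nat. strict_mono r & (AEL x. (%k. T (%x. g (r k) x - f x) x) ----> 0)" by (intro lpow_AE_subseq[where h="%k. T (%x. g k x - f x)"] T_measurable Linf_c_L2 d) auto
 then obtain r where r: "strict_mono r" "AEL x. (%k. T (%x. g (r k) x - f x) x) ----> 0" by blast
 have "AEL x. \<forall>k. T (%x. g (r k) x - f x) x = T (g (r k)) x - T f x" by (intro AE_all_countable[THEN iffD2] allI T_diff Linf_c_L2 f g)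
 with r(2) have conv: "AEL x. (%k. T (g (r k)) x) ----> T f x" by eventually_elim (simp add: LIM_zero_iff)
 show ?thesis proof (rule lpow_fatou[OF _ _ conv])
  show "lpow p (T (g (r k))) <= ennreal (weak_const * p * (2 powr (p - 1) / (p - 1) + 2 powr (2 - p) / (2 - p))) * lpow p (g (r k))" for k by (rule Lp_continuous[OF p g(1,2)])
  have "(%k. lpow p (g k)) ----> lpow p f" by (rule lpow_dominated[OF _ _ _ _ g(6) g(4)]) (use p in "auto intro: lpow_finite g")
  then have "(%k. lpow p (g (r k))) ----> lpow p f" using LIMSEQ_subseq_LIMSEQ[OF _ r(1), of "%k. lpow p (g k)"] by (simp add: o_def)
  then show "(%k. ennreal (weak_const * p * (2 powr (p - 1) / (p - 1) + 2 powr (2 - p) / (2 - p))) * lpow p (g (r k)))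
    ----> ennreal (weak_const * p * (2 powr (p - 1) / (p - 1) + 2 powr (2 - p) / (2 - p))) * lpow p f" by (intro ennreal_tendsto_cmult) auto
 qed (use p in auto)
qed

lemma conjugate_exponent:
 assumes p: "1 < (p::real)" "1 / p + 1 / p' = 1"
 shows "p' = p / (p - 1)" "1 < p'" "1 / p' = 1 - 1 / p" proof -
 have nz: "p' ~= 0" using p by auto
 have "p * p' = p + p'" using p nz by (simp add: field_simps)
 then have "p' * (p - 1) = p" by (simp add: algebra_simps)
 then show eq: "p' = p / (p - 1)" using p by (simp add: eq_divide_eq)
 show "1 < p'" unfolding eq using p by simp
 show "1 / p' = 1 - 1 / p" using p by simp
qed

lemma measurable_cnj_lebesgue [measurable]:
 "h : borel_measurable M ==> (%x. cnj (h x)) : borel_measurable M" by (rule measurable_compose[OF _ borel_measurable_continuous_onI]) (auto intro: continuous_intros)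

text \<open>Test with \<open>\<bar>h\<bar>\<^sup>p\<^sup>-\<^sup>2\<close> times the conjugate of \<open>h\<close>, cut off where \<open>h\<close> or the variable is large.\<close>

lemma lpow_by_duality:
 fixes h :: "'a::euclidean_space => complex"
 assumes [measurable]: "h : Lmeas" and p: "1 < p" "1 / p + 1 / p' = 1" and F: "0 <= F"
  and dual: "!!g. g : Linf_c ==> (!!x. h x = 0 ==> g x = 0) ==>
   norm (\<L> x. g x * h x) <= F * enn2real (lpow p' g) powr (1 / p')"
 shows "lpow p h <= ennreal (F powr p)" proof -
 note p' = conjugate_exponent(1,3)[OF p]
 have p'0: "0 < p'" using conjugate_exponent(2)[OF p] by simp
 define S where "S k = {x. norm (h x) <= real k} \<inter> ball 0 (real k)" for k
 have Sm [measurable]: "S k : sets lebesgue" for k proof -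
  have "{x : space lebesgue. norm (h x) <= real k} : sets lebesgue" by measurable
  then show ?thesis unfolding S_def by (intro sets.Int) auto
 qed
 have le: "lpow p (%x. ind (S k) x * h x) <= ennreal (F powr p)" for k proof -
  define g where "g x = ind (S k) x * (cnj (h x) * of_real (norm (h x) powr (p - 2)))" for x
  have gn: "norm (g x) = ind (S k) x * norm (h x) powr (p - 1)" for x using powr_add[of "norm (h x)" "p - 2" 1] by (simp add: g_def norm_mult indicator_def)
  have gm: "g : Lmeas" unfolding g_def by measurable
  have gL: "g : Linf_c" proof (rule Linf_cI[OF gm])
   show "norm (g x) <= real k powr (p - 1)" for x unfolding gn using p by (auto simp: indicator_def S_def intro!: powr_mono2)
   show "g x = 0" if "x ~: ball 0 (real k)" for x using that by (simp add: g_def S_def indicator_def)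
  qed
  have hL: "(%x. ind (S k) x * h x) : Linf_c" proof (rule Linf_cI)
   show "(%x. ind (S k) x * h x) : Lmeas" by measurable
   show "norm (ind (S k) x * h x) <= real k" for x by (auto simp: indicator_def S_def)
   show "ind (S k) x * h x = 0" if "x ~: ball 0 (real k)" for x using that by (simp add: S_def indicator_def)
  qed
  define J where "J = enn2real (lpow p (%x. ind (S k) x * h x))"
  have J: "lpow p (%x. ind (S k) x * h x) = ennreal J" unfolding J_def using lpow_finite[OF hL, of p] p by simp
  have J0: "0 <= J" by (simp add: J_def)
  have "lpow p' g = lpow p (%x. ind (S k) x * h x)" unfolding lpow_def proof (intro nn_integral_cong)
   fix x
   have "(p - 1) * p' = p" using p' p by simp
   then have "norm (g x) powr p' = norm (ind (S k) x * h x) powr p" using p'0 p by (simp add: gn indicator_def powr_powr)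
   then show "ennreal (norm (g x) powr p') = ennreal (norm (ind (S k) x * h x) powr p)" by simp
  qed
  then have lg: "lpow p' g = ennreal J" using J by simp
  have gh: "g x * h x = of_real (norm (ind (S k) x * h x) powr p)" for x proof (cases "x : S k")
   case True
   have "cnj (h x) * of_real (norm (h x) powr (p - 2)) * h x = of_real (norm (h x) powr (p - 2)) * (h x * cnj (h x))" by (simp add: mult_ac)
   also have "... = of_real (norm (h x) powr (p - 2)) * of_real ((norm (h x))^2)" by (simp only: complex_norm_square)
   also have "... = of_real (norm (h x) powr (p - 2) * norm (h x) powr 2)" by (simp add: powr_numeral)
   also have "norm (h x) powr (p - 2) * norm (h x) powr 2 = norm (h x) powr p" using powr_add[of "norm (h x)" "p - 2" 2] by simp
   finally show ?thesis using True by (simp add: g_def)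
  qed (use p in "simp add: g_def")
  have "(\<L> x. g x * h x) = of_real (\<L> x. norm (ind (S k) x * h x) powr p)" unfolding gh by (rule integral_complex_of_real)
  also have "(\<L> x. norm (ind (S k) x * h x) powr p) = J" unfolding J_def lpow_def by (subst integral_eq_nn_integral) auto
  finally have "norm (\<L> x. g x * h x) = J" using J0 by simp
  moreover have "norm (\<L> x. g x * h x) <= F * enn2real (lpow p' g) powr (1 / p')" by (rule dual[OF gL]) (simp add: g_def)
  ultimately have le: "J <= F * J powr (1 / p')" using J0 by (simp add: lg)
  have "J <= F powr p" proof (cases "J = 0")
   case False
   then have Jp: "0 < J" using J0 by simp
   have "J powr (1 / p) * J powr (1 / p') = J" using Jp p by (simp flip: powr_add)
   then have "J powr (1 / p) * J powr (1 / p') <= F * J powr (1 / p')" using le by simp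
   then have "J powr (1 / p) <= F" using Jp by simp
   then have "(J powr (1 / p)) powr p <= F powr p" using p by (intro powr_mono2) auto
   then show ?thesis using Jp p by (simp add: powr_powr)
  qed simp
  then show ?thesis unfolding J by (rule ennreal_leI)
 qed
 show ?thesis proof (rule lpow_fatou[OF _ _ _ le tendsto_const])
  show "AEL x. (%k. ind (S k) x * h x) ----> h x" proof (rule AE_I2)
   fix x :: 'a
   obtain m where m: "norm (h x) + norm x < real m" using reals_Archimedean2 by blast
   have "\<forall>\<^sub>F k in sequentially. ind (S k) x * h x = h x" using eventually_ge_at_top[of m] proof eventually_elim
    case (elim k)
    then have "norm (h x) + norm x < real k" using m by linarith
    then have "norm (h x) <= real k" "norm x < real k" using norm_ge_zero[of x] norm_ge_zero[of "h x"] by linarith+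
    then have "x : S k" unfolding S_def by simp
    then show ?case by simp
   qed
   then show "(%k. ind (S k) x * h x) ----> h x" by (rule tendsto_eventually)
  qed
  show "(%x. ind (S k) x * h x) : Lmeas" for k by measurable
 qed (use p in simp)
qed

lemma holder_lpow:
 fixes f g :: "'a::euclidean_space => complex"
 assumes "f : Lmeas" "g : Lmeas" and p: "1 < p" "1 / p + 1 / p' = 1"
  and fin: "lpow p f < top" "lpow p' g < top"
 shows "(\<I> x. ennreal (norm (f x) * norm (g x))) <= ennreal (enn2real (lpow p f) powr (1 / p) * enn2real (lpow p' g) powr (1 / p'))" proof -
 have p'0: "0 < p'" using conjugate_exponent(2)[OF p] by simp
 show ?thesis by (rule holder_nn_integral[OF assms(1,2) p]) (use p p'0 fin in "auto simp: powr_powr lpow_def[symmetric]")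
qed

text \<open>Exponents above \<open>2\<close> are reduced to those below \<open>2\<close> by duality, and this is why the transposed kernel must also
  belong to a bounded operator.\<close>

lemma Lp_boundedness:
 fixes K :: "real ^ 'n => real ^ 'n => complex"
 assumes T: "cz_op K A \<delta> T B" and T': "cz_op (%x y. K y x) A \<delta> T' B'" and p: "1 < p"
 shows "\<exists>D\<ge>0. \<forall>f\<in>Linf_c. lpow p (T f) <= ennreal D * lpow p f" proof -
 interpret T: cz_op K A \<delta> T B by fact
 interpret T': cz_op "%x y. K y x" A \<delta> T' B' by fact
 consider "p < 2" | "p = 2" | "2 < p" by linarith
 then show ?thesis proof cases
  case 1
  define D where "D = T.weak_const * p * (2 powr (p - 1) / (p - 1) + 2 powr (2 - p) / (2 - p))"
  have "0 <= D" unfolding D_def using T.weak_const_nonneg p 1 by (intro mult_nonneg_nonneg add_nonneg_nonneg divide_nonneg_nonneg) auto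
  then show ?thesis using T.Lp_less_2[OF p 1] unfolding D_def by blast
 next
  case 2
  then show ?thesis using T.L2_const T.B_nonneg by blast
 next
  case 3
  define p' where "p' = p / (p - 1)"
  have p': "1 < p'" "p' < 2" "1 / p + 1 / p' = 1" using 3 by (auto simp: p'_def field_simps)
  define D where "D = T'.weak_const * p' * (2 powr (p' - 1) / (p' - 1) + 2 powr (2 - p') / (2 - p'))"
  have D0: "0 <= D" unfolding D_def using T'.weak_const_nonneg p' by (intro mult_nonneg_nonneg add_nonneg_nonneg divide_nonneg_nonneg) auto
  have D: "lpow p' (T' g) <= ennreal D * lpow p' g" if "g : Linf_c" for g unfolding D_def by (rule T'.Lp_less_2[OF p'(1,2) that])
  have "lpow p (T f) <= ennreal (D powr (p - 1)) * lpow p f" if f: "f : Linf_c" for f proof -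
   define L where "L = enn2real (lpow p f)"
   have L: "lpow p f = ennreal L" "0 <= L" using lpow_finite[OF f, of p] p by (simp_all add: L_def)
   have "lpow p (T f) <= ennreal ((L powr (1 / p) * D powr (1 / p')) powr p)" proof (rule lpow_by_duality[OF T.T_measurable[OF Linf_c_L2[OF f]] p p'(3)])
    fix g :: "real ^ 'n => complex" assume g: "g : Linf_c"
    define G where "G = enn2real (lpow p' g)"
    have G: "lpow p' g = ennreal G" "0 <= G" using lpow_finite[OF g, of p'] p' by (simp_all add: G_def)
    have TG: "lpow p' (T' g) <= ennreal (D * G)" using D[OF g] D0 by (simp add: G ennreal_mult')
    then have fin: "lpow p' (T' g) < top" by (simp add: le_less_trans)
    have eG: "enn2real (lpow p' (T' g)) <= D * G" using TG D0 G fin by (metis enn2real_leI mult_nonneg_nonneg)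
    have "ennreal (norm (\<L> x. g x * T f x)) = ennreal (norm (\<L> y. f y * T' g y))" by (simp add: adjoint_Linf_c[OF T T' f g])
    also have "... <= (\<I> y. ennreal (norm (f y * T' g y)))" proof (cases "Lint (%y. f y * T' g y)")
    case True
    then show ?thesis by (rule integral_norm_bound_ennreal)
    qed (simp add: not_integrable_integral_eq)
    also have "... <= ennreal (L powr (1 / p) * enn2real (lpow p' (T' g)) powr (1 / p'))" using holder_lpow[OF Linf_c_measurable[OF f] T'.T_measurable[OF Linf_c_L2[OF g]] p p'(3) _ fin] lpow_finite[OF f, of p] p by (simp add: norm_mult L_def)
    finally have "norm (\<L> x. g x * T f x) <= L powr (1 / p) * enn2real (lpow p' (T' g)) powr (1 / p')" by (subst (asm) ennreal_le_iff) auto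
    also have "... <= L powr (1 / p) * (D * G) powr (1 / p')" using eG p' by (intro mult_left_mono powr_mono2) auto
    also have "... = L powr (1 / p) * D powr (1 / p') * enn2real (lpow p' g) powr (1 / p')" by (simp add: powr_mult G_def)
    finally show "norm (\<L> x. g x * T f x) <= L powr (1 / p) * D powr (1 / p') * enn2real (lpow p' g) powr (1 / p')" .
   qed simp
   also have "(L powr (1 / p) * D powr (1 / p')) powr p = D powr (p - 1) * L" proof -
    have "1 / p' * p = p - 1" using 3 by (simp add: p'_def)
    then show ?thesis using L p by (simp add: powr_mult powr_powr)
   qed
   finally show ?thesis by (simp add: L ennreal_mult')
  qed
  then show ?thesis by (intro exI[of _ "D powr (p - 1)"]) auto
 qed
qed


section \<open>Extension to \<open>L\<^sup>q\<close> with compact support\<close>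

lemma (in cz_kernel) trunc_diff:
 assumes "Lint f" "Lint g" "0 < \<eta>"
 shows "trunc K \<eta> (%y. f y - g y) x = trunc K \<eta> f x - trunc K \<eta> g x" proof -
 have "trunc K \<eta> f x - trunc K \<eta> g x = (\<L> y. K x y * (ind (- ball x \<eta>) y * f y) - K x y * (ind (- ball x \<eta>) y * g y))" unfolding trunc_eq by (rule Lintegral_diff[symmetric]) (intro trunc_integrable assms)+
 also have "... = trunc K \<eta> (%y. f y - g y) x" unfolding trunc_eq by (intro Lintegral_cong) (auto simp: algebra_simps)
 finally show ?thesis ..
qed

lemma lpow_ball_integrable:
 fixes g :: "real ^ 'n => complex"
 assumes [measurable]: "g : Lmeas" and q: "1 < q" and fin: "lpow q g < top" and supp: "!!x. x ~: ball c R ==> g x = 0"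
 shows "Lint g" proof -
 define i :: "real ^ 'n => complex" where "i x = ind (ball c R) x" for x
 define q' where "q' = q / (q - 1)"
 have q': "1 < q'" "1 / q + 1 / q' = 1" using q by (auto simp: q'_def field_simps)
 have im [measurable]: "i : Lmeas" unfolding i_def by measurable
 have "lpow q' i = (\<I> x. ind (ball c R) x)" unfolding lpow_def i_def by (intro nn_integral_cong) (auto simp: indicator_def)
 also have "... < top" using emeasure_lborel_ball_finite[of c R] by simp
 finally have "(\<I> x. ennreal (norm (g x) * norm (i x))) <= ennreal (enn2real (lpow q g) powr (1 / q) * enn2real (lpow q' i) powr (1 / q'))" by (intro holder_lpow q q' fin) auto
 also have "(\<I> x. ennreal (norm (g x) * norm (i x))) = (\<I> x. ennreal (norm (g x)))" using supp by (intro nn_integral_cong) (auto simp: i_def indicator_def)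
 finally show ?thesis by (simp add: integrable_iff_bounded le_less_trans)
qed

lemma holder_integrable:
 fixes f g :: "'a::euclidean_space => complex"
 assumes [measurable]: "f : Lmeas" "g : Lmeas" and p: "1 < p" "1 / p + 1 / p' = 1"
  and fin: "lpow p f < top" "lpow p' g < top"
 shows "Lint (%x. f x * g x)"
  and "norm (\<L> x. f x * g x) <= enn2real (lpow p f) powr (1 / p) * enn2real (lpow p' g) powr (1 / p')" proof -
 have le: "(\<I> x. ennreal (norm (f x * g x))) <= ennreal (enn2real (lpow p f) powr (1 / p) * enn2real (lpow p' g) powr (1 / p'))" using holder_lpow[OF assms(1,2) p fin] by (simp add: norm_mult)
 then show int: "Lint (%x. f x * g x)" by (simp add: integrable_iff_bounded le_less_trans)
 show "norm (\<L> x. f x * g x) <= enn2real (lpow p f) powr (1 / p) * enn2real (lpow p' g) powr (1 / p')" using order_trans[OF integral_norm_bound_ennreal[OF int] le] by (subst (asm) ennreal_le_iff) auto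
qed

text \<open>The limit of a telescoping sequence with geometrically small steps, uniformly in a parameter.\<close>

lemma geometric_steps:
 fixes a :: "nat => complex"
 assumes "!!k. k0 <= k ==> norm (a (Suc k) - a k) <= (1 / 2) ^ k" and "k0 <= k" "k <= m"
 shows "norm (a m - a k) <= 2 * (1 / 2) ^ k" proof -
 have "norm (a m - a k) <= 2 * (1 / 2) ^ k - 2 * (1 / 2) ^ m" using \<open>k <= m\<close> proof (induction rule: dec_induct)
  case base then show ?case by simp
 next
  case (step m)
  have "norm (a (Suc m) - a k) <= norm (a (Suc m) - a m) + norm (a m - a k)" using norm_triangle_ineq[of "a (Suc m) - a m" "a m - a k"] by simp
  also have "... <= (1 / 2) ^ m + (2 * (1 / 2) ^ k - 2 * (1 / 2) ^ m)" using step assms(1)[of m] \<open>k0 <= k\<close> by (intro add_mono) auto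
  finally show ?case by simp
 qed
 moreover have "0 <= 2 * (1 / 2 :: real) ^ m" by simp
 ultimately show ?thesis by linarith
qed

text \<open>Approximate \<open>g\<close> in \<open>L\<^sup>q\<close> by bounded functions at a geometric rate. The maximal truncations of the successive
  differences are geometrically small outside sets of summable measure, so by Borel--Cantelli the truncations
  of \<open>g\<close> inherit convergence at almost every point.\<close>

lemma pv_extension:
 fixes K :: "real ^ 'n => real ^ 'n => complex"
 assumes T: "cz_op K A \<delta> T B" and T': "cz_op (%x y. K y x) A \<delta> T' B'" and q: "1 < q"
  and D: "0 <= D" "!!f. f : Linf_c ==> lpow q (T f) <= ennreal D * lpow q f"
  and gm [measurable]: "g : Lmeas" and fin: "lpow q g < top" and supp: "!!x. x ~: ball 0 R ==> g x = 0"
 shows "\<exists>h. h : Lmeas & lpow q h <= ennreal D * lpow q g &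
  (AEL x. ((%\<eta>. trunc K \<eta> g x) \<longlongrightarrow> h x) (at_right 0)) &
  (\<forall>a\<in>Linf_c. (\<L> x. h x * a x) = (\<L> x. g x * T' a x))" proof -
 interpret T: cz_op K A \<delta> T B by fact
 interpret T': cz_op "%x y. K y x" A \<delta> T' B' by fact
 define q' where "q' = q / (q - 1)"
 have q': "1 < q'" "1 / q + 1 / q' = 1" using q by (auto simp: q'_def field_simps)
 have q0: "0 < q" using q by simp
 have gi: "Lint g" by (rule lpow_ball_integrable[OF gm q fin supp])
 obtain G where G: "0 <= G" "lpow q g = ennreal G" using fin by (cases "lpow q g") auto
 define S where "S k = {x. norm (g x) <= real k}" for k
 have Sm [measurable]: "S k : sets lebesgue" for k proof -
  have "{x : space lebesgue. norm (g x) <= real k} : sets lebesgue" by measurable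
  then show ?thesis by (simp add: S_def)
 qed
 define g0 where "g0 k x = ind (S k) x * g x" for k x
 have g0m [measurable]: "g0 k : Lmeas" for k unfolding g0_def by measurable
 have g0L: "g0 k : Linf_c" for k proof (rule Linf_cI[OF g0m])
  show "norm (g0 k x) <= real k" for x by (auto simp: g0_def S_def indicator_def)
  show "g0 k x = 0" if "x ~: ball 0 R" for x using supp[OF that] by (simp add: g0_def)
 qed
 have g0ev: "\<forall>\<^sub>F k in sequentially. g0 k x = g x" for x proof -
  obtain m where m: "norm (g x) < real m" using reals_Archimedean2 by blast
  show ?thesis using eventually_ge_at_top[of m] by eventually_elim (use m in "auto simp: g0_def S_def")
 qed
 have "(%k. lpow q (%x. g x - g0 k x)) ----> lpow q (%x::real^'n. 0)" proof (rule lpow_dominated[OF _ _ gm q0])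
  show "AEL x. (%k. g x - g0 k x) ----> 0" proof (rule AE_I2)
   fix x show "(%k. g x - g0 k x) ----> 0" by (rule tendsto_eventually) (use g0ev[of x] in "auto elim: eventually_mono")
  qed
  show "norm (g x - g0 k x) <= norm (g x)" for k x by (auto simp: g0_def indicator_def)
 qed (use fin in auto)
 then have lim0: "(%k. lpow q (%x. g x - g0 k x)) ----> 0" using q0 by (simp add: lpow_def)
 define \<epsilon> :: "nat => real" where "\<epsilon> k = ((1 / 2) ^ k) powr q * (1 / 2) ^ k" for k
 have \<epsilon>0: "0 < \<epsilon> k" for k by (simp add: \<epsilon>_def)
 have "\<exists>n. \<forall>m\<ge>n. lpow q (%x. g x - g0 m x) <= ennreal (\<epsilon> k)" for k proof -
  have "\<forall>\<^sub>F m in sequentially. lpow q (%x. g x - g0 m x) < ennreal (\<epsilon> k)" using order_tendstoD(2)[OF lim0, of "ennreal (\<epsilon> k)"] \<epsilon>0[of k] by simp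
  then show ?thesis unfolding eventually_sequentially using less_imp_le by blast
 qed
 then obtain N where N: "!!k m. N k <= m ==> lpow q (%x. g x - g0 m x) <= ennreal (\<epsilon> k)" by metis
 define n where "n k = k + (\<Sum>j\<le>k. N j)" for k
 have nN: "N k <= n k" for k proof -
  have "N k <= (\<Sum>j\<le>k. N j)" by (rule member_le_sum) auto
  then show ?thesis by (simp add: n_def)
 qed
 have nmono: "n k <= n m" if "k <= m" for k m unfolding n_def using that by (intro add_mono sum_mono2) auto
 have nk: "k <= n k" for k by (simp add: n_def)
 define f where "f k = g0 (n k)" for k
 have fL: "f k : Linf_c" for k by (simp add: f_def g0L)
 note [measurable] = Linf_c_measurable[OF fL] T.T_measurable[OF Linf_c_L2[OF fL]]
 have fle: "norm (f k x) <= norm (g x)" for k x by (auto simp: f_def g0_def indicator_def)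
 have fdiff: "norm (f m x - f k x) <= norm (g x - f k x)" if "k <= m" for k m x using nmono[OF that] by (auto simp: f_def g0_def S_def indicator_def)
 have fconv: "(%k. f k x) ----> g x" for x proof (rule tendsto_eventually)
  obtain m where m: "!!k. m <= k ==> g0 k x = g x" using g0ev[of x] unfolding eventually_sequentially by blast
  show "\<forall>\<^sub>F k in sequentially. f k x = g x" using eventually_ge_at_top[of m] proof eventually_elim
   case (elim k)
   then have "m <= n k" using nk[of k] by linarith
   then show ?case unfolding f_def by (rule m)
  qed
 qed
 have f\<epsilon>: "lpow q (%x. g x - f k x) <= ennreal (\<epsilon> k)" for k unfolding f_def by (rule N[OF nN])
 define u where "u k x = f (Suc k) x - f k x" for k x
 have uL: "u k : Linf_c" for k unfolding u_def by (intro Linf_c_diff fL)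
 have u\<epsilon>: "lpow q (u k) <= ennreal (\<epsilon> k)" for k by (rule order_trans[OF lpow_mono f\<epsilon>[of k]]) (use fdiff[of k "Suc k"] q0 in "auto simp: u_def")
 text \<open>Borel--Cantelli for the sets where the maximal truncation of \<open>u k\<close> is large.\<close>
 define C where "C = 2 * 5 ^ CARD('n) * (T.trunc_majorant_const q D + 3 powr q * D)"
 have C0: "0 <= C" unfolding C_def using T.trunc_majorant_const_pos[OF D(1), of q] D(1) by simp
 define F where "F k = T.trunc_majorant q D (u k)" for k
 define E where "E k = {x : space lebesgue. ennreal (((1 / 2) ^ k) powr q) < F k x}" for k
 have Em [measurable]: "E k : sets lebesgue" for k unfolding E_def F_def by measurable
 have Ele: "vol (E k) <= ennreal (C * (1 / 2) ^ k)" for k proof -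
  define t where "t = ((1 / 2 :: real) ^ k) powr q"
  have t: "0 < t" by (simp add: t_def)
  have "ennreal t * vol (E k) <= ennreal C * lpow q (u k)" unfolding E_def F_def C_def t_def[symmetric] using T.trunc_majorant_weak[OF q D uL t] by simp
  also have "... <= ennreal C * ennreal (\<epsilon> k)" by (intro mult_left_mono u\<epsilon>) simp
  also have "... = ennreal t * ennreal (C * (1 / 2) ^ k)" using C0 t by (simp add: \<epsilon>_def t_def[symmetric] ennreal_mult'[symmetric] mult_ac)
  finally have "ennreal (1 / t) * (ennreal t * vol (E k)) <= ennreal (1 / t) * (ennreal t * ennreal (C * (1 / 2) ^ k))" by (rule mult_left_mono) simp
  then show ?thesis using t by (simp add: mult.assoc[symmetric] ennreal_mult'[symmetric])
 qed
 have BC: "AEL x. eventually (%k. x : space lebesgue - E k) sequentially" proof (rule borel_cantelli_AE1)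
  show "vol (E k) < \<infinity>" for k using Ele[of k] by (simp add: le_less_trans)
  show "summable (%k. measure lebesgue (E k))" proof (rule summable_comparison_test')
   show "summable (%k. C * (1 / 2) ^ k)" by (intro summable_mult summable_geometric) simp
   show "norm (measure lebesgue (E k)) <= C * (1 / 2) ^ k" if "0 <= k" for k using Ele[of k] C0 by (simp add: measure_def enn2real_leI)
  qed
 qed measurable
 have fint: "Lint (f k)" for k by (rule Linf_c_integrable[OF fL])
 have pvf: "AEL x. \<forall>k. ((%\<eta>. trunc K \<eta> (f k) x) \<longlongrightarrow> T (f k) x) (at_right 0)" by (intro AE_all_countable[THEN iffD2] allI T.T_pv Linf_c_L2 fL)
 have trlim: "(%k. trunc K \<eta> (f k) x) ----> trunc K \<eta> g x" if \<eta>: "0 < \<eta>" for \<eta> x unfolding T.trunc_eq proof (rule integral_dominated_convergence[where w="%y. norm (K x y * (ind (- ball x \<eta>) y * g y))"])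
  show "Lint (%y. norm (K x y * (ind (- ball x \<eta>) y * g y)))" by (intro integrable_norm T.trunc_integrable gi \<eta>)
  show "(%y. K x y * (ind (- ball x \<eta>) y * g y)) : Lmeas" by measurable
  show "(%y. K x y * (ind (- ball x \<eta>) y * f k y)) : Lmeas" for k by measurable
  show "AEL y. (%k. K x y * (ind (- ball x \<eta>) y * f k y)) ----> K x y * (ind (- ball x \<eta>) y * g y)" by (intro AE_I2 tendsto_mult_left fconv)
  show "AEL y. norm (K x y * (ind (- ball x \<eta>) y * f k y)) <= norm (K x y * (ind (- ball x \<eta>) y * g y))" for k by (intro AE_I2) (auto simp: norm_mult intro!: mult_left_mono fle)
 qed
 define h where "h x = lim (%k. T (f k) x)" for x
 have hm [measurable]: "h : Lmeas" unfolding h_def by measurable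
 have main: "AEL x. ((%\<eta>. trunc K \<eta> g x) \<longlongrightarrow> h x) (at_right 0) & (%k. T (f k) x) ----> h x" using BC pvf proof eventually_elim
  case (elim x)
  obtain k0 where k0: "!!k. k0 <= k ==> x ~: E k" using elim(1) unfolding eventually_sequentially by blast
  have step: "norm (trunc K \<eta> (f (Suc k)) x - trunc K \<eta> (f k) x) <= (1 / 2) ^ k" if "0 < \<eta>" "k0 <= k" for \<eta> k proof -
   have "ennreal (norm (trunc K \<eta> (u k) x) powr q) <= F k x" unfolding F_def by (rule T.trunc_le_majorant[OF q D uL that(1)])
   also have "... <= ennreal (((1 / 2) ^ k) powr q)" using k0[OF that(2)] by (simp add: E_def not_less)
   finally have "norm (trunc K \<eta> (u k) x) powr q <= ((1 / 2) ^ k) powr q" by (subst (asm) ennreal_le_iff) auto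
   then have "norm (trunc K \<eta> (u k) x) <= (1 / 2) ^ k" using q0 by (meson not_le norm_ge_zero powr_less_mono2 zero_le_power divide_nonneg_nonneg zero_le_one zero_le_numeral)
   then show ?thesis unfolding u_def using T.trunc_diff[OF fint fint that(1)] by simp
  qed
  have st: "norm (trunc K \<eta> (f m) x - trunc K \<eta> (f k) x) <= 2 * (1 / 2) ^ k" if "0 < \<eta>" "k0 <= k" "k <= m" for \<eta> k m by (rule geometric_steps[of k0 "%k. trunc K \<eta> (f k) x"]) (use step that in auto)
  have sg: "norm (trunc K \<eta> g x - trunc K \<eta> (f k) x) <= 2 * (1 / 2) ^ k" if "0 < \<eta>" "k0 <= k" for \<eta> k proof (rule LIMSEQ_le_const2)
   show "(%m. norm (trunc K \<eta> (f m) x - trunc K \<eta> (f k) x)) ----> norm (trunc K \<eta> g x - trunc K \<eta> (f k) x)" by (intro tendsto_intros trlim that)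
   show "\<exists>N. \<forall>m\<ge>N. norm (trunc K \<eta> (f m) x - trunc K \<eta> (f k) x) <= 2 * (1 / 2) ^ k" using st[OF that] by blast
  qed
  have sT: "norm (T (f m) x - T (f k) x) <= 2 * (1 / 2) ^ k" if "k0 <= k" "k <= m" for k m proof (rule tendsto_upperbound)
   show "((%\<eta>. norm (trunc K \<eta> (f m) x - trunc K \<eta> (f k) x)) \<longlongrightarrow> norm (T (f m) x - T (f k) x)) (at_right 0)" using elim(2) by (intro tendsto_intros) auto
   show "\<forall>\<^sub>F \<eta> in at_right 0. norm (trunc K \<eta> (f m) x - trunc K \<eta> (f k) x) <= 2 * (1 / 2) ^ k" by (rule eventually_at_rightI[of 0 1]) (use st that in auto)
  qed simp
  have half: "(%k. 2 * (1 / 2 :: real) ^ k) ----> 0" by (rule tendsto_mult_right_zero) (rule LIMSEQ_power_zero, simp)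
  have "Cauchy (%k. T (f k) x)" proof (rule CauchyI)
   fix e :: real assume e: "0 < e"
   have "\<forall>\<^sub>F k in sequentially. 2 * (1 / 2 :: real) ^ k < e / 2" using order_tendstoD(2)[OF half, of "e / 2"] e by simp
   then obtain k1 where k1: "!!k. k1 <= k ==> 2 * (1 / 2 :: real) ^ k < e / 2" unfolding eventually_sequentially by blast
   define M where "M = max k0 k1"
   show "\<exists>M. \<forall>m\<ge>M. \<forall>n\<ge>M. norm (T (f m) x - T (f n) x) < e" proof (intro exI[of _ M] allI impI)
    fix m n assume "M <= m" "M <= n"
    then have "norm (T (f m) x - T (f M) x) < e / 2" "norm (T (f n) x - T (f M) x) < e / 2" using sT[of M m] sT[of M n] k1[of M] by (auto simp: M_def)
    then show "norm (T (f m) x - T (f n) x) < e" using norm_triangle_ineq4[of "T (f m) x - T (f M) x" "T (f n) x - T (f M) x"] by simp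
   qed
  qed
  then have conv: "(%k. T (f k) x) ----> h x" unfolding h_def by (simp add: Cauchy_convergent_iff convergent_LIMSEQ_iff)
  have sh: "norm (h x - T (f k) x) <= 2 * (1 / 2) ^ k" if "k0 <= k" for k proof (rule LIMSEQ_le_const2)
   show "(%m. norm (T (f m) x - T (f k) x)) ----> norm (h x - T (f k) x)" by (intro tendsto_intros conv)
   show "\<exists>N. \<forall>m\<ge>N. norm (T (f m) x - T (f k) x) <= 2 * (1 / 2) ^ k" using sT[OF that] by blast
  qed
  have "((%\<eta>. trunc K \<eta> g x) \<longlongrightarrow> h x) (at_right 0)" proof (rule tendstoI)
   fix e :: real assume e: "0 < e"
   have "\<forall>\<^sub>F k in sequentially. 2 * (1 / 2 :: real) ^ k < e / 3" using order_tendstoD(2)[OF half, of "e / 3"] e by simp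
   then obtain k1 where k1: "!!k. k1 <= k ==> 2 * (1 / 2 :: real) ^ k < e / 3" unfolding eventually_sequentially by blast
   define M where "M = max k0 k1"
   have M: "k0 <= M" "2 * (1 / 2 :: real) ^ M < e / 3" using k1[of M] by (auto simp: M_def)
   have "\<forall>\<^sub>F \<eta> in at_right 0. dist (trunc K \<eta> (f M) x) (T (f M) x) < e / 3" using elim(2) e by (intro tendstoD) auto
   moreover have "\<forall>\<^sub>F \<eta> in at_right (0::real). 0 < \<eta>" by (rule eventually_at_right_less)
   ultimately show "\<forall>\<^sub>F \<eta> in at_right 0. dist (trunc K \<eta> g x) (h x) < e" proof eventually_elim
    case (elim \<eta>)
    have "dist (trunc K \<eta> g x) (trunc K \<eta> (f M) x) < e / 3" using sg[OF elim(2) M(1)] M(2) by (simp add: dist_norm)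
    moreover have "dist (T (f M) x) (h x) < e / 3" using sh[OF M(1)] M(2) by (simp add: dist_norm norm_minus_commute)
    ultimately show ?case using elim(1)
    dist_triangle[of "trunc K \<eta> g x" "h x" "trunc K \<eta> (f M) x"] dist_triangle[of "trunc K \<eta> (f M) x" "h x" "T (f M) x"] by linarith
   qed
  qed
  then show ?case using conv by blast
 qed
 then have pv: "AEL x. ((%\<eta>. trunc K \<eta> g x) \<longlongrightarrow> h x) (at_right 0)" by eventually_elim blast
 from main have conv: "AEL x. (%k. T (f k) x) ----> h x" by eventually_elim blast
 have hq: "lpow q h <= ennreal D * lpow q g" proof (rule lpow_fatou[OF _ q0 conv _ tendsto_const])
  fix k
  have "lpow q (T (f k)) <= ennreal D * lpow q (f k)" by (rule D(2)[OF fL])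
  also have "... <= ennreal D * lpow q g" by (intro mult_left_mono lpow_mono fle) (use q0 in auto)
  finally show "lpow q (T (f k)) <= ennreal D * lpow q g" .
 qed measurable
 have hd: "lpow q (%x. h x - T (f k) x) <= ennreal (D * \<epsilon> k)" for k proof (rule lpow_fatou[OF _ q0 _ _ tendsto_const])
  show "AEL x. (%m. T (f (m + k)) x - T (f k) x) ----> h x - T (f k) x" using conv proof eventually_elim
   case (elim x)
   show ?case by (intro tendsto_diff tendsto_const LIMSEQ_ignore_initial_segment elim)
  qed
  show "(%x. T (f (m + k)) x - T (f k) x) : Lmeas" for m by measurable
  show "lpow q (%x. T (f (m + k)) x - T (f k) x) <= ennreal (D * \<epsilon> k)" for m proof -
   have d: "(%x. f (m + k) x - f k x) : Linf_c" by (intro Linf_c_diff fL)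
   have "lpow q (%x. T (f (m + k)) x - T (f k) x) = lpow q (T (%x. f (m + k) x - f k x))" unfolding lpow_def by (rule nn_integral_cong_AE) (use T.T_diff[OF Linf_c_L2[OF fL] Linf_c_L2[OF fL], of "m + k" k] in "auto elim: eventually_mono")
   also have "... <= ennreal D * lpow q (%x. f (m + k) x - f k x)" by (rule D(2)[OF d])
   also have "... <= ennreal D * lpow q (%x. g x - f k x)" by (intro mult_left_mono lpow_mono fdiff) (use q0 in auto)
   also have "... <= ennreal D * ennreal (\<epsilon> k)" by (intro mult_left_mono f\<epsilon>) simp
   also have "... = ennreal (D * \<epsilon> k)" using D(1) by (simp add: ennreal_mult')
   finally show ?thesis .
  qed
 qed
 show ?thesis proof (intro exI[of _ h] conjI hm hq pv ballI)
  fix a :: "real ^ 'n => complex" assume a: "a : Linf_c"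
  note [measurable] = Linf_c_measurable[OF a] T'.T_measurable[OF Linf_c_L2[OF a]]
  have afin: "lpow q' a < top" by (rule lpow_finite[OF a]) (use q' in simp)
  obtain D' where D': "0 <= D'" "\<forall>f\<in>Linf_c. lpow q' (T' f) <= ennreal D' * lpow q' f" using Lp_boundedness[OF T' T q'(1)] by auto
  have Tafin: "lpow q' (T' a) < top" using D'(2) a afin by (meson ennreal_less_top ennreal_mult_less_top le_less_trans)
  have hfin: "lpow q h < top" using hq by (simp add: G le_less_trans ennreal_mult_less_top)
  have Tffin: "lpow q (T (f k)) < top" for k using D(2)[OF fL[of k]] lpow_finite[OF fL[of k] q0] by (meson ennreal_less_top ennreal_mult_less_top le_less_trans)
  have i1: "Lint (%x. h x * a x)" by (rule holder_integrable(1)[OF _ _ q q'(2) hfin afin]) measurable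
  have i2: "Lint (%x. T (f k) x * a x)" for k by (rule holder_integrable(1)[OF _ _ q q'(2) Tffin afin]) measurable
  have i3: "Lint (%x. g x * T' a x)" by (rule holder_integrable(1)[OF _ _ q q'(2) fin Tafin]) measurable
  have dle: "norm ((\<L> x. T (f k) x * a x) - (\<L> x. h x * a x)) <= (D * \<epsilon> k) powr (1 / q) * enn2real (lpow q' a) powr (1 / q')" for k proof -
   have fd: "lpow q (%x. h x - T (f k) x) < top" using hd[of k] by (simp add: le_less_trans)
   have "(\<L> x. h x * a x) - (\<L> x. T (f k) x * a x) = (\<L> x. (h x - T (f k) x) * a x)" using i1 i2 by (simp add: left_diff_distrib)
   then have "norm ((\<L> x. h x * a x) - (\<L> x. T (f k) x * a x)) <=
    enn2real (lpow q (%x. h x - T (f k) x)) powr (1 / q) * enn2real (lpow q' a) powr (1 / q')" using holder_integrable(2)[OF _ _ q q'(2) fd afin] by simp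
   also have "... <= (D * \<epsilon> k) powr (1 / q) * enn2real (lpow q' a) powr (1 / q')" using hd[of k] D(1) \<epsilon>0[of k] q0 by (intro mult_right_mono powr_mono2) (auto intro!: enn2real_leI)
   finally show ?thesis by (simp add: norm_minus_commute)
  qed
  have \<epsilon>lim: "\<epsilon> ----> 0" proof (rule tendsto_sandwich[of "%_. 0"])
   show "\<forall>\<^sub>F k in sequentially. \<epsilon> k <= (1 / 2) ^ k" proof (intro always_eventually allI)
    fix k
    have "((1 / 2 :: real) ^ k) powr q <= 1 powr q" using q0 by (intro powr_mono2) (auto simp: power_le_one)
    then show "\<epsilon> k <= (1 / 2) ^ k" by (simp add: \<epsilon>_def mult_left_le_one_le)
   qed
   show "(%k. (1 / 2 :: real) ^ k) ----> 0" by (rule LIMSEQ_power_zero) simp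
  qed (use \<epsilon>0 in "auto intro!: always_eventually less_imp_le")
  have "(%k. (D * \<epsilon> k) powr (1 / q)) ----> (D * 0) powr (1 / q)" proof (rule tendsto_powr2[OF tendsto_mult_left[OF \<epsilon>lim] tendsto_const])
   show "\<forall>\<^sub>F k in sequentially. 0 <= D * \<epsilon> k" by (intro always_eventually allI mult_nonneg_nonneg D(1) less_imp_le[OF \<epsilon>0])
   show "0 < 1 / q" using q0 by simp
  qed
  then have "(%k. (D * \<epsilon> k) powr (1 / q) * enn2real (lpow q' a) powr (1 / q')) ----> 0" by (intro tendsto_mult_left_zero) simp
  then have "(%k. (\<L> x. T (f k) x * a x) - (\<L> x. h x * a x)) ----> 0" by (rule Lim_null_comparison[rotated]) (intro always_eventually allI dle)
  then have l1: "(%k. \<L> x. T (f k) x * a x) ----> (\<L> x. h x * a x)" by (simp add: LIM_zero_iff)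
  have l2: "(%k. \<L> x. f k x * T' a x) ----> (\<L> x. g x * T' a x)" proof (rule integral_dominated_convergence[where w="%x. norm (g x * T' a x)"])
   show "AEL x. (%k. f k x * T' a x) ----> g x * T' a x" by (intro AE_I2 tendsto_mult_right fconv)
   show "AEL x. norm (f k x * T' a x) <= norm (g x * T' a x)" for k by (intro AE_I2) (auto simp: norm_mult intro!: mult_right_mono fle)
  qed (use i3 in auto)
  have "(\<L> x. T (f k) x * a x) = (\<L> x. f k x * T' a x)" for k using adjoint_Linf_c[OF T T' fL a] by (simp add: mult.commute)
  then show "(\<L> x. h x * a x) = (\<L> x. g x * T' a x)" using LIMSEQ_unique[OF l1] l2 by simp
 qed
qed


section \<open>Polynomials and the projections \<open>P\<^sub>B\<close>\<close>

abbreviation cmono :: "('n::finite => nat) => real ^ 'n => complex" where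
 "cmono \<gamma> x \<equiv> complex_of_real (mi_pow x \<gamma>)"

lemma poly_spaceE:
 assumes "P : poly_space s"
 obtains c where "P = (%x. \<Sum>\<gamma> | mi_abs \<gamma> <= s. c \<gamma> * cmono \<gamma> x)" using assms by (auto simp: poly_space_def)

lemma poly_spaceI: "P = (%x. \<Sum>\<gamma> | mi_abs \<gamma> <= s. c \<gamma> * cmono \<gamma> x) ==> P : poly_space s" by (auto simp: poly_space_def)

lemma poly_space_monomial: "mi_abs \<gamma> <= s ==> (%x. cmono \<gamma> x) : poly_space s" proof (rule poly_spaceI[where c="%\<gamma>'. if \<gamma>' = \<gamma> then 1 else 0"])
 assume g: "mi_abs \<gamma> <= s"
 show "(%x. cmono \<gamma> x) = (%x. \<Sum>\<gamma>' | mi_abs \<gamma>' <= s. (if \<gamma>' = \<gamma> then 1 else 0) * cmono \<gamma>' x)" proof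
  fix x :: "real ^ 'a"
  have "(\<Sum>\<gamma>' | mi_abs \<gamma>' <= s. (if \<gamma>' = \<gamma> then 1 else 0) * cmono \<gamma>' x) = (\<Sum>\<gamma>' | mi_abs \<gamma>' <= s. if \<gamma>' = \<gamma> then cmono \<gamma>' x else 0)" by (intro sum.cong) auto
  then show "cmono \<gamma> x = (\<Sum>\<gamma>' | mi_abs \<gamma>' <= s. (if \<gamma>' = \<gamma> then 1 else 0) * cmono \<gamma>' x)" using g by (simp add: sum.delta finite_mi_abs_le)
 qed
qed

lemma poly_space_add: "P : poly_space s ==> Q : poly_space s ==> (%x. P x + Q x) : poly_space s" by (elim poly_spaceE, rule poly_spaceI[where c="%\<gamma>. _ \<gamma> + _ \<gamma>"]) (auto simp: distrib_right sum.distrib)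

lemma poly_space_cmult: "P : poly_space s ==> (%x. a * P x) : poly_space s" by (elim poly_spaceE, rule poly_spaceI[where c="%\<gamma>. a * _ \<gamma>"]) (auto simp: sum_distrib_left mult.assoc)

lemma poly_space_diff: "P : poly_space s ==> Q : poly_space s ==> (%x. P x - Q x) : poly_space s" using poly_space_add[OF _ poly_space_cmult[of Q s "-1"], of P] by simp

lemma poly_space_zero: "(%x. 0) : poly_space s" by (rule poly_spaceI[where c="%_. 0"]) auto

lemma poly_space_sum: "(!!i. i : I ==> P i : poly_space s) ==> (%x. \<Sum>i\<in>I. P i x) : poly_space s" by (induction I rule: infinite_finite_induct) (auto intro: poly_space_add poly_space_zero)

lemma poly_space_cnj: "P : poly_space s ==> (%x. cnj (P x)) : poly_space s" by (elim poly_spaceE, rule poly_spaceI[where c="%\<gamma>. cnj (_ \<gamma>)"]) auto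

lemma poly_space_mono: "s <= t ==> (poly_space s :: (real ^ 'n => complex) set) \<subseteq> poly_space t" proof
 fix P :: "real ^ 'n => complex" assume st: "s <= t" and "P : poly_space s"
 then obtain c where P: "P = (%x. \<Sum>\<gamma> | mi_abs \<gamma> <= s. c \<gamma> * cmono \<gamma> x)" by (auto elim: poly_spaceE)
 show "P : poly_space t" unfolding P by (intro poly_space_sum poly_space_cmult poly_space_monomial) (use st in auto)
qed

lemma mi_pow_add: "mi_pow x (%i. \<gamma> i + \<gamma>' i) = mi_pow x \<gamma> * mi_pow x \<gamma>'" by (simp add: mi_pow_def power_add prod.distrib)

lemma poly_space_mult:
 assumes "P : poly_space s" "Q : poly_space t"
 shows "(%x. P x * Q x) : poly_space (s + t)" proof -
 obtain c where P: "P = (%x. \<Sum>\<gamma> | mi_abs \<gamma> <= s. c \<gamma> * cmono \<gamma> x)" using assms(1) by (rule poly_spaceE)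
 obtain d where Q: "Q = (%x. \<Sum>\<gamma> | mi_abs \<gamma> <= t. d \<gamma> * cmono \<gamma> x)" using assms(2) by (rule poly_spaceE)
 have "(%x. P x * Q x) = (%x. \<Sum>\<gamma> | mi_abs \<gamma> <= s. \<Sum>\<gamma>' | mi_abs \<gamma>' <= t. (c \<gamma> * d \<gamma>') * cmono (%i. \<gamma> i + \<gamma>' i) x)" unfolding P Q by (simp add: sum_product mi_pow_add mult_ac)
 also have "... : poly_space (s + t)" by (intro poly_space_sum poly_space_cmult poly_space_monomial) (auto simp: mi_abs_def sum.distrib)
 finally show ?thesis .
qed

lemma poly_space_const: "(%x :: real ^ 'n. a) : poly_space s" proof -
 have "(%x::real^'n. a * cmono (%_. 0) x) : poly_space s" by (intro poly_space_cmult poly_space_monomial) (simp add: mi_abs_def)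
 then show ?thesis by (simp add: mi_pow_def)
qed

lemma poly_space_coord: "(%x :: real ^ 'n. complex_of_real (x $ i)) : poly_space 1" proof -
 have "(%x::real^'n. cmono (%j. if j = i then 1 else 0) x) : poly_space 1" by (intro poly_space_monomial) (simp add: mi_abs_def)
 moreover have "mi_pow x (%j. if j = i then 1 else 0) = x $ i" for x :: "real ^ 'n" proof -
  have "mi_pow x (%j. if j = i then 1 else 0) = (\<Prod>j\<in>UNIV. if j = i then x $ j else 1)" unfolding mi_pow_def by (intro prod.cong) auto
  then show ?thesis by simp
 qed
 ultimately show ?thesis by simp
qed

lemma poly_space_power: "P : poly_space s ==> (%x. P x ^ k) : poly_space (k * s)" proof (induction k)
 case 0 show ?case using poly_space_const[of 1 0] by simp
next
 case (Suc k)
 then show ?case using poly_space_mult[of P s "%x. P x ^ k" "k * s"] by simp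
qed

lemma poly_space_prod:
 "finite I ==> (!!i. i : I ==> P i : poly_space (s i)) ==> (%x. \<Prod>i\<in>I. P i x) : poly_space (\<Sum>i\<in>I. s i)" proof (induction I rule: finite_induct)
 case empty show ?case using poly_space_const[of 1 0] by simp
next
 case (insert i I)
 then show ?case using poly_space_mult[of "P i" "s i" "%x. \<Prod>i\<in>I. P i x" "\<Sum>i\<in>I. s i"] by simp
qed

lemma poly_space_affine:
 assumes "P : poly_space s"
 shows "(%x. P (b + a *\<^sub>R x)) : poly_space s" proof -
 obtain c where P: "P = (%x. \<Sum>\<gamma> | mi_abs \<gamma> <= s. c \<gamma> * cmono \<gamma> x)" using assms by (rule poly_spaceE)
 have "(%x. cmono \<gamma> (b + a *\<^sub>R x)) : poly_space s" if "mi_abs \<gamma> <= s" for \<gamma> proof -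
  have aff: "(%x. complex_of_real (b $ i) + of_real a * complex_of_real (x $ i)) : poly_space 1" for i by (intro poly_space_add poly_space_const poly_space_cmult poly_space_coord)
  have "(%x. \<Prod>i\<in>UNIV. (complex_of_real (b $ i) + of_real a * complex_of_real (x $ i)) ^ \<gamma> i) : poly_space (\<Sum>i\<in>UNIV. \<gamma> i)" using poly_space_prod[of UNIV "%i x. (complex_of_real (b $ i) + of_real a * complex_of_real (x $ i)) ^ \<gamma> i" \<gamma>]
    poly_space_power[OF aff] by simp
  also have "(%x. \<Prod>i\<in>UNIV. (complex_of_real (b $ i) + of_real a * complex_of_real (x $ i)) ^ \<gamma> i) = (%x. cmono \<gamma> (b + a *\<^sub>R x))" by (simp add: mi_pow_def)
  finally show ?thesis using poly_space_mono[OF that] by (auto simp: mi_abs_def)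
 qed
 then show ?thesis unfolding P by (intro poly_space_sum poly_space_cmult) auto
qed

lemma continuous_poly_space: "P : poly_space s ==> continuous_on UNIV P" by (elim poly_spaceE) (auto simp: mi_pow_def intro!: continuous_intros)

lemma measurable_poly_space: "P : poly_space s ==> P : Lmeas" by (intro borel_measurable_lebesgueI borel_measurable_continuous_onI continuous_poly_space)

lemma mi_pow_le: "\<bar>mi_pow x \<gamma>\<bar> <= norm x ^ mi_abs \<gamma>" proof -
 have "\<bar>mi_pow x \<gamma>\<bar> = (\<Prod>i\<in>UNIV. \<bar>x $ i\<bar> ^ \<gamma> i)" by (simp add: mi_pow_def abs_prod power_abs)
 also have "... <= (\<Prod>i\<in>UNIV. norm x ^ \<gamma> i)" by (intro prod_mono conjI power_mono component_le_norm_cart) auto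
 also have "... = norm x ^ mi_abs \<gamma>" by (simp add: mi_abs_def power_sum)
 finally show ?thesis .
qed

lemma poly_space_growth:
 fixes P :: "real ^ 'n => complex"
 assumes "P : poly_space s"
 shows "\<exists>M\<ge>0. \<forall>x. norm (P x) <= M * (1 + norm x) ^ s" proof -
 obtain c where P: "P = (%x. \<Sum>\<gamma> | mi_abs \<gamma> <= s. c \<gamma> * cmono \<gamma> x)" using assms by (rule poly_spaceE)
 have "norm (P x) <= (\<Sum>\<gamma> | mi_abs \<gamma> <= s. norm (c \<gamma>)) * (1 + norm x) ^ s" for x proof -
  have "norm (P x) <= (\<Sum>\<gamma> | mi_abs \<gamma> <= s. norm (c \<gamma> * cmono \<gamma> x))" unfolding P by (rule norm_sum)
  also have "... <= (\<Sum>\<gamma> | mi_abs \<gamma> <= s. norm (c \<gamma>) * (1 + norm x) ^ s)" proof (intro sum_mono)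
   fix \<gamma> :: "'n => nat" assume "\<gamma> : {\<gamma>. mi_abs \<gamma> <= s}"
   then have g: "mi_abs \<gamma> <= s" by simp
   have "\<bar>mi_pow x \<gamma>\<bar> <= (1 + norm x) ^ mi_abs \<gamma>" by (rule order_trans[OF mi_pow_le power_mono]) auto
   also have "... <= (1 + norm x) ^ s" using g by (intro power_increasing) auto
   finally show "norm (c \<gamma> * cmono \<gamma> x) <= norm (c \<gamma>) * (1 + norm x) ^ s" by (simp add: norm_mult mult_left_mono)
  qed
  finally show ?thesis by (simp add: sum_distrib_right)
 qed
 then show ?thesis by (intro exI[of _ "\<Sum>\<gamma> | mi_abs \<gamma> <= s. norm (c \<gamma>)"]) (auto intro: sum_nonneg)
qed

text \<open>A polynomial that vanishes on a ball vanishes on every line through the centre.\<close>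

lemma mi_pow_scaleR: "mi_pow (t *\<^sub>R x) \<gamma> = t ^ mi_abs \<gamma> * mi_pow x \<gamma>" by (simp add: mi_pow_def mi_abs_def power_mult_distrib prod.distrib power_sum)

lemma poly_space_identity:
 fixes P :: "real ^ 'n => complex"
 assumes P: "P : poly_space s" and r: "0 < r" and zero: "!!x. x : ball c r ==> P x = 0"
 shows "P = (%x. 0)" proof
 fix z :: "real ^ 'n"
 define Q where "Q x = P (c + 1 *\<^sub>R x)" for x
 have "Q : poly_space s" unfolding Q_def by (rule poly_space_affine[OF P])
 then obtain d where Q: "Q = (%x. \<Sum>\<gamma> | mi_abs \<gamma> <= s. d \<gamma> * cmono \<gamma> x)" by (rule poly_spaceE)
 define x where "x = z - c"
 define e where "e k = (\<Sum>\<gamma> | mi_abs \<gamma> = k. d \<gamma> * cmono \<gamma> x)" for k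
 have Qt: "Q (t *\<^sub>R x) = (\<Sum>k\<le>s. e k * of_real t ^ k)" for t proof -
  have "Q (t *\<^sub>R x) = (\<Sum>\<gamma> | mi_abs \<gamma> <= s. of_real t ^ mi_abs \<gamma> * (d \<gamma> * cmono \<gamma> x))" unfolding Q by (intro sum.cong) (auto simp: mi_pow_scaleR)
  also have "... = (\<Sum>k\<le>s. \<Sum>\<gamma> | \<gamma> : {\<gamma>. mi_abs \<gamma> <= s} & mi_abs \<gamma> = k. of_real t ^ mi_abs \<gamma> * (d \<gamma> * cmono \<gamma> x))" by (rule sum.group[symmetric]) (auto intro: finite_mi_abs_le)
  also have "... = (\<Sum>k\<le>s. e k * of_real t ^ k)" proof (intro sum.cong refl)
   fix k assume "k : {..s}"
   then have "{\<gamma> :: 'n => nat. \<gamma> : {\<gamma>. mi_abs \<gamma> <= s} & mi_abs \<gamma> = k} = {\<gamma>. mi_abs \<gamma> = k}" by auto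
   then show "(\<Sum>\<gamma> | \<gamma> : {\<gamma>. mi_abs \<gamma> <= s} & mi_abs \<gamma> = k. of_real t ^ mi_abs \<gamma> * (d \<gamma> * cmono \<gamma> x)) = e k * of_real t ^ k" unfolding e_def sum_distrib_right by (intro sum.cong) auto
  qed
  finally show ?thesis .
 qed
 have e0: "\<forall>k\<le>s. e k = 0" proof (rule ccontr)
  assume "\<not> ?thesis"
  then obtain k where k: "k <= s" "e k ~= 0" by auto
  have fin: "finite {w::complex. (\<Sum>i\<le>s. e i * w ^ i) = 0}" using polyfun_roots_finite[of e k s] k by simp
  define \<tau> where "\<tau> = r / (1 + norm x)"
  have \<tau>: "0 < \<tau>" using r by (simp add: \<tau>_def add_pos_nonneg)
  have "complex_of_real ` {0<..<\<tau>} \<subseteq> {w. (\<Sum>i\<le>s. e i * w ^ i) = 0}" proof (clarify)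
   fix t assume t: "t : {0<..<\<tau>}"
   have "t * norm x <= \<tau> * norm x" using t by (intro mult_right_mono) auto
   also have "\<tau> * norm x < r" using r by (simp add: \<tau>_def divide_less_eq add_pos_nonneg)
   finally have "c + 1 *\<^sub>R (t *\<^sub>R x) : ball c r" using t by (simp add: dist_norm)
   then have "Q (t *\<^sub>R x) = 0" unfolding Q_def by (rule zero)
   then show "(\<Sum>i\<le>s. e i * of_real t ^ i) = 0" by (simp add: Qt)
  qed
  then have "finite (complex_of_real ` {0<..<\<tau>})" using fin finite_subset by blast
  then have "finite {0<..<\<tau>}" by (rule finite_imageD) (simp add: inj_on_def)
  then show False using \<tau> infinite_Ioo[of 0 \<tau>] by simp
 qed
 have "Q (1 *\<^sub>R x) = 0" unfolding Qt using e0 by simp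
 then show "P z = 0" by (simp add: Q_def x_def)
qed

section \<open>Orthonormal polynomials on the unit ball\<close>

lemma set_lint_mult: "(LINT x:S|M. f x) = (LINT x|M. ind S x * (f x :: complex))" unfolding set_lebesgue_integral_def by (intro Lintegral_cong) (auto simp: indicator_def)

lemma continuous_ball_Linf_c:
 fixes f :: "real ^ 'n => complex"
 assumes "continuous_on UNIV f"
 shows "(%x. ind (ball c r) x * f x) : Linf_c" proof -
 have [measurable]: "f : Lmeas" by (intro borel_measurable_lebesgueI borel_measurable_continuous_onI assms)
 have "compact (f ` cball c r)" by (intro compact_continuous_image continuous_on_subset[OF assms]) auto
 then have "bounded (f ` cball c r)" by (rule compact_imp_bounded)
 then obtain M where M: "!!x. x : cball c r ==> norm (f x) <= M" unfolding bounded_iff by blast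
 show ?thesis proof (rule Linf_cI)
  show "(%x. ind (ball c r) x * f x) : Lmeas" by measurable
  show "norm (ind (ball c r) x * f x) <= max 0 M" for x using M[of x] by (auto simp: indicator_def)
  fix x :: "real ^ 'n" assume "x ~: ball 0 (norm c + r)"
  then have "x ~: ball c r" using norm_triangle_sub[of x c] by (auto simp: dist_norm norm_minus_commute)
  then show "ind (ball c r) x * f x = 0" by simp
 qed
qed

lemmas continuous_ball_integrable = Linf_c_integrable[OF continuous_ball_Linf_c]

lemma not_AE_outside_ball:
 fixes z :: "real ^ 'n"
 assumes "0 < \<rho>"
 shows "\<not> (AEL x. x ~: ball z \<rho>)" proof
 assume "AEL x. x ~: ball z \<rho>"
 then have "ball z \<rho> : null_sets lebesgue" by (subst AE_iff_null_sets) auto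
 then show False using emeasure_ball_pos_finite(1)[OF assms, of z] by (simp only: null_sets_def mem_Collect_eq) blast
qed

lemma continuous_AE_zero_ball:
 fixes P :: "real ^ 'n => complex"
 assumes cont: "continuous_on UNIV P" and ae: "AEL x. x : ball c r --> P x = 0" and z: "z : ball c r"
 shows "P z = 0" proof (rule ccontr)
 assume nz: "P z ~= 0"
 have "open (ball c r \<inter> {x. P x ~= 0})" using cont by (intro open_Int open_ball open_Collect_neq continuous_on_const)
 then obtain \<rho> where \<rho>: "0 < \<rho>" "ball z \<rho> \<subseteq> ball c r \<inter> {x. P x ~= 0}" using z nz unfolding open_contains_ball by blast
 have "AEL x. x ~: ball z \<rho>" using ae by eventually_elim (use \<rho>(2) in blast)
 then show False using not_AE_outside_ball[OF \<rho>(1)] by blast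
qed

definition bip :: "real ^ 'n => real => (real ^ 'n => complex) => (real ^ 'n => complex) => complex" where
 "bip c r f g = (\<L> x. ind (ball c r) x * (f x * cnj (g x)))"

lemma bip_cmult: "bip c r (%x. a * f x) g = a * bip c r f g" unfolding bip_def by (subst integral_mult_right_zero[symmetric]) (simp add: mult_ac)

lemma bip_add:
 assumes "continuous_on UNIV f" "continuous_on UNIV g" "continuous_on UNIV h"
 shows "bip c r (%x. f x + g x) h = bip c r f h + bip c r g h" proof -
 have "bip c r (%x. f x + g x) h = (\<L> x. ind (ball c r) x * (f x * cnj (h x)) + ind (ball c r) x * (g x * cnj (h x)))" unfolding bip_def by (intro Lintegral_cong) (auto simp: algebra_simps)
 also have "... = bip c r f h + bip c r g h" unfolding bip_def by (rule Bochner_Integration.integral_add; intro continuous_ball_integrable continuous_intros assms)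
 finally show ?thesis .
qed

lemma bip_cnj: "bip c r g f = cnj (bip c r f g)" unfolding bip_def Bochner_Integration.integral_cnj[symmetric] by (intro Lintegral_cong) (auto simp: indicator_def mult.commute)

lemma bip_sum:
 assumes "finite I" "!!i. i : I ==> continuous_on UNIV (f i)" "continuous_on UNIV h"
 shows "bip c r (%x. \<Sum>i\<in>I. a i * f i x) h = (\<Sum>i\<in>I. a i * bip c r (f i) h)" using assms(1,2) proof (induction I rule: finite_induct)
 case empty then show ?case by (simp add: bip_def)
next
 case (insert i I)
 have "bip c r (%x. a i * f i x + (\<Sum>i\<in>I. a i * f i x)) h = bip c r (%x. a i * f i x) h + bip c r (%x. \<Sum>i\<in>I. a i * f i x) h" proof -
  have c1: "continuous_on UNIV (f i)" and c2: "!!j. j : I ==> continuous_on UNIV (f j)" using insert.prems by auto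
  show ?thesis by (intro bip_add continuous_on_mult continuous_on_const continuous_on_sum c1 c2 assms(3))
 qed
 then show ?case using insert by (simp add: bip_cmult)
qed

lemma bip_self: "bip c r f f = of_real (\<L> x. ind (ball c r) x * (norm (f x))^2)" proof -
 have "bip c r f f = (\<L> x. complex_of_real (ind (ball c r) x * (norm (f x))^2))" unfolding bip_def by (intro Lintegral_cong) (auto simp: indicator_def complex_norm_square[symmetric])
 then show ?thesis by (simp only: integral_complex_of_real)
qed

lemma bip_self_zero:
 assumes P: "P : poly_space s" and r: "0 < r" and zero: "bip c r P P = 0"
 shows "P = (%x. 0)" proof (rule poly_space_identity[OF P r])
 have cont: "continuous_on UNIV P" by (rule continuous_poly_space[OF P])
 have "Lint (%x. norm (ind (ball c r) x * (P x * P x)))" by (intro integrable_norm continuous_ball_integrable continuous_intros cont)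
 then have int: "Lint (%x. ind (ball c r) x * (norm (P x))^2)" by (rule Lintegrable_cong[THEN iffD1, rotated -1]) (auto simp: norm_mult indicator_def power2_eq_square)
 have "(\<L> x. ind (ball c r) x * (norm (P x))^2) = 0" using zero by (simp add: bip_self)
 then have "AEL x. ind (ball c r) x * (norm (P x))^2 = 0" using integral_nonneg_eq_0_iff_AE[OF int] by simp
 then have ae: "AEL x. x : ball c r --> P x = 0" by eventually_elim (auto simp: indicator_def)
 show "P x = 0" if "x : ball c r" for x by (rule continuous_AE_zero_ball[OF cont ae that])
qed

text \<open>Orthonormalisation with respect to the inner product \<open>bip\<close> of \<open>L\<^sup>2\<close> of the ball.\<close>

lemma gram_schmidt:
 assumes "finite \<Gamma>" "\<Gamma> \<subseteq> {\<gamma> :: 'n::finite => nat. mi_abs \<gamma> <= s}"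
 shows "\<exists>(m::nat) \<phi>. (\<forall>j<m. \<phi> j : poly_space s) & (\<forall>i<m. \<forall>j<m. bip 0 1 (\<phi> i) (\<phi> j) = (if i = j then 1 else 0)) &
  (\<forall>\<gamma>\<in>\<Gamma>. \<exists>a. \<forall>x. cmono \<gamma> x = (\<Sum>j<m. a j * \<phi> j x))" using assms proof (induction \<Gamma> rule: finite_induct)
 case empty
 show ?case by (intro exI[of _ "0::nat"]) auto
next
 case (insert \<gamma> \<Gamma>)
 have "\<Gamma> \<subseteq> {\<gamma>. mi_abs \<gamma> <= s}" using insert.prems by blast
 from insert.IH[OF this] obtain m :: nat and \<phi> :: "nat => real ^ 'n => complex" where
  \<phi>0: "\<forall>j<m. \<phi> j : poly_space s" "\<forall>i<m. \<forall>j<m. bip 0 1 (\<phi> i) (\<phi> j) = (if i = j then 1 else 0)"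
  "\<forall>\<gamma>\<in>\<Gamma>. \<exists>a. \<forall>x. cmono \<gamma> x = (\<Sum>j<m. a j * \<phi> j x)" by (elim exE conjE) (rule that)
 have \<phi>: "!!j. j < m ==> \<phi> j : poly_space s" "!!i j. i < m ==> j < m ==> bip 0 1 (\<phi> i) (\<phi> j) = (if i = j then 1 else 0)"
  "!!\<gamma>. \<gamma> : \<Gamma> ==> \<exists>a. \<forall>x. cmono \<gamma> x = (\<Sum>j<m. a j * \<phi> j x)" using \<phi>0 by blast+
 have \<phi>c: "continuous_on UNIV (\<phi> j)" if "j < m" for j by (rule continuous_poly_space[OF \<phi>(1)[OF that]])
 have mon: "(%x. cmono \<gamma> x) : poly_space s" by (rule poly_space_monomial) (use insert in auto)
 define b where "b j = bip 0 1 (%x. cmono \<gamma> x) (\<phi> j)" for j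
 define v where "v x = cmono \<gamma> x - (\<Sum>j<m. b j * \<phi> j x)" for x
 have v: "v : poly_space s" unfolding v_def by (intro poly_space_diff mon poly_space_sum poly_space_cmult \<phi>) auto
 have vc: "continuous_on UNIV v" by (rule continuous_poly_space[OF v])
 have orth: "bip 0 1 v (\<phi> i) = 0" if i: "i < m" for i proof -
  have "bip 0 1 (%x. cmono \<gamma> x + (-1) * (\<Sum>j<m. b j * \<phi> j x)) (\<phi> i) = b i + (-1) * (\<Sum>j<m. b j * bip 0 1 (\<phi> j) (\<phi> i))" unfolding b_def by (subst bip_add, rule continuous_poly_space[OF mon], (intro continuous_intros \<phi>c; simp), rule \<phi>c[OF i],
    subst bip_cmult, subst bip_sum) (use \<phi>c i in auto)
  also have "(\<Sum>j<m. b j * bip 0 1 (\<phi> j) (\<phi> i)) = (\<Sum>j<m. if j = i then b j else 0)" by (intro sum.cong) (use \<phi>(2) i in auto)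
  also have "... = b i" using i by simp
  finally show ?thesis by (simp add: v_def[abs_def])
 qed
 show ?case proof (cases "bip 0 1 v v = 0")
  case True
  then have "v = (%x. 0)" by (intro bip_self_zero[OF v, of 1 0]) auto
  then have "v x = 0" for x by simp
  then have "cmono \<gamma> x = (\<Sum>j<m. b j * \<phi> j x)" for x by (simp add: v_def)
  then show ?thesis using \<phi> by (intro exI[of _ m] exI[of _ \<phi>]) auto
 next
  case False
  define \<nu> where "\<nu> = (\<L> x. ind (ball 0 1) x * (norm (v x))^2)"
  have \<nu>: "bip 0 1 v v = of_real \<nu>" unfolding \<nu>_def by (rule bip_self)
  have "0 <= \<nu>" unfolding \<nu>_def by (rule Lintegral_nonneg) simp
  then have \<nu>0: "0 < \<nu>" using False \<nu> by (cases "\<nu> = 0") auto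
  define \<psi> where "\<psi> x = of_real (1 / sqrt \<nu>) * v x" for x
  define \<phi>' where "\<phi>' j = (if j < m then \<phi> j else \<psi>)" for j
  have \<psi>: "\<psi> : poly_space s" unfolding \<psi>_def by (rule poly_space_cmult[OF v])
  have \<psi>\<phi>: "bip 0 1 \<psi> (\<phi> i) = 0" if "i < m" for i unfolding \<psi>_def bip_cmult using orth[OF that] by simp
  have \<psi>\<psi>: "bip 0 1 \<psi> \<psi> = 1" proof -
   have "bip 0 1 \<psi> \<psi> = of_real (1 / sqrt \<nu>) * bip 0 1 v \<psi>" unfolding \<psi>_def[abs_def] by (rule bip_cmult)
   also have "bip 0 1 v \<psi> = cnj (of_real (1 / sqrt \<nu>) * bip 0 1 v v)" unfolding bip_cnj[of 0 1 v \<psi>] unfolding \<psi>_def[abs_def] bip_cmult ..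
   also have "of_real (1 / sqrt \<nu>) * cnj (of_real (1 / sqrt \<nu>) * bip 0 1 v v) = of_real ((1 / sqrt \<nu>) * (1 / sqrt \<nu>) * \<nu>)" unfolding \<nu> by (simp only: complex_cnj_mult complex_cnj_complex_of_real of_real_mult mult.assoc)
   also have "(1 / sqrt \<nu>) * (1 / sqrt \<nu>) * \<nu> = 1" using \<nu>0 by (simp add: real_sqrt_mult[symmetric] divide_simps) 
   finally show ?thesis by simp
  qed
  have "bip 0 1 (\<phi>' i) (\<phi>' j) = (if i = j then 1 else 0)" if "i < Suc m" "j < Suc m" for i j proof (cases "i < m"; cases "j < m")
   assume "i < m" "\<not> j < m"
   then show ?thesis using \<psi>\<phi>[of i] bip_cnj[of 0 1 "\<phi> i" \<psi>] that by (simp add: \<phi>'_def)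
  qed (use \<phi>(2) \<psi>\<phi> \<psi>\<psi> that in "auto simp: \<phi>'_def")
  moreover have "\<phi>' j : poly_space s" for j unfolding \<phi>'_def using \<phi>(1) \<psi> by auto
  moreover have "\<exists>a. \<forall>x. cmono \<gamma>' x = (\<Sum>j<Suc m. a j * \<phi>' j x)" if \<gamma>': "\<gamma>' : insert \<gamma> \<Gamma>" for \<gamma>' proof (cases "\<gamma>' = \<gamma>")
   case True
   have "cmono \<gamma> x = (\<Sum>j<Suc m. (if j < m then b j else of_real (sqrt \<nu>)) * \<phi>' j x)" for x proof -
    have "(\<Sum>j<m. (if j < m then b j else of_real (sqrt \<nu>)) * \<phi>' j x) = (\<Sum>j<m. b j * \<phi> j x)" by (intro sum.cong) (auto simp: \<phi>'_def)
    moreover have "of_real (sqrt \<nu>) * \<psi> x = v x" using \<nu>0 by (simp add: \<psi>_def)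
    ultimately show ?thesis by (simp add: \<phi>'_def v_def)
   qed
   then show ?thesis unfolding True by (intro exI[of _ "%j. if j < m then b j else of_real (sqrt \<nu>)"] allI)
  next
   case False
   then obtain a where a: "!!x. cmono \<gamma>' x = (\<Sum>j<m. a j * \<phi> j x)" using \<phi>(3) \<gamma>' by blast
   have "cmono \<gamma>' x = (\<Sum>j<Suc m. (if j < m then a j else 0) * \<phi>' j x)" for x proof -
    have "(\<Sum>j<m. (if j < m then a j else 0) * \<phi>' j x) = (\<Sum>j<m. a j * \<phi> j x)" by (intro sum.cong) (auto simp: \<phi>'_def)
    then show ?thesis by (simp add: a)
   qed
   then show ?thesis by (intro exI[of _ "%j. if j < m then a j else 0"] allI)
  qed
  ultimately show ?thesis by (intro exI[of _ "Suc m"] exI[of _ \<phi>']) blast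
 qed
qed

lemma orthonormal_basis:
 "\<exists>(m::nat) \<phi>. (\<forall>j<m. \<phi> j : poly_space s) & (\<forall>i<m. \<forall>j<m. bip (0 :: real ^ 'n) 1 (\<phi> i) (\<phi> j) = (if i = j then 1 else 0)) &
  (\<forall>Q\<in>poly_space s. \<exists>a. \<forall>x. Q x = (\<Sum>j<m. a j * \<phi> j x))" proof -
 from gram_schmidt[OF finite_mi_abs_le order.refl, where s=s] obtain m :: nat and \<phi> :: "nat => real ^ 'n => complex" where
  \<phi>: "\<forall>j<m. \<phi> j : poly_space s" "\<forall>i<m. \<forall>j<m. bip 0 1 (\<phi> i) (\<phi> j) = (if i = j then 1 else 0)"
  "\<forall>\<gamma>\<in>{\<gamma>. mi_abs \<gamma> <= s}. \<exists>a. \<forall>x. cmono \<gamma> x = (\<Sum>j<m. a j * \<phi> j x)" by (elim exE conjE) (rule that)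
 from \<phi>(3) obtain a where a': "\<forall>\<gamma>\<in>{\<gamma>. mi_abs \<gamma> <= s}. \<forall>x. cmono \<gamma> x = (\<Sum>j<m. a \<gamma> j * \<phi> j x)" unfolding bchoice_iff by blast
 then have a: "!!\<gamma> x. mi_abs \<gamma> <= s ==> cmono \<gamma> x = (\<Sum>j<m. a \<gamma> j * \<phi> j x)" by blast
 have "\<exists>b. \<forall>x. Q x = (\<Sum>j<m. b j * \<phi> j x)" if Q0: "Q : poly_space s" for Q proof -
  obtain d where Q: "Q = (%x. \<Sum>\<gamma> | mi_abs \<gamma> <= s. d \<gamma> * cmono \<gamma> x)" using Q0 by (rule poly_spaceE)
  have "Q x = (\<Sum>j<m. (\<Sum>\<gamma> | mi_abs \<gamma> <= s. d \<gamma> * a \<gamma> j) * \<phi> j x)" for x proof -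
   have "Q x = (\<Sum>\<gamma> | mi_abs \<gamma> <= s. \<Sum>j<m. d \<gamma> * a \<gamma> j * \<phi> j x)" unfolding Q by (intro sum.cong refl) (simp add: a sum_distrib_left mult.assoc)
   also have "... = (\<Sum>j<m. \<Sum>\<gamma> | mi_abs \<gamma> <= s. d \<gamma> * a \<gamma> j * \<phi> j x)" by (rule sum.swap)
   finally show ?thesis by (simp add: sum_distrib_right)
  qed
  then show ?thesis by (intro exI[of _ "%j. \<Sum>\<gamma> | mi_abs \<gamma> <= s. d \<gamma> * a \<gamma> j"] allI)
 qed
 then show ?thesis using \<phi>(1,2) by blast
qed

lemma lebesgue_integral_affine:
 fixes f :: "real ^ 'n => complex"
 assumes f [measurable]: "f : borel_measurable borel" and r: "0 < r"
 shows "(\<L> x. f x) = of_real (r ^ CARD('n)) * (\<L> x. f (c + r *\<^sub>R x))" proof -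
 have "(\<L> x. f x) = (LINT x|lborel. f x)" by (rule integral_completion) simp
 also have "... = (LINT x|density (distr lborel borel (%x. c + r *\<^sub>R x)) (%_. \<bar>r\<bar> ^ DIM(real ^ 'n)). f x)" by (subst lborel_affine[of r c]) (use r in auto)
 also have "... = (LINT x|distr lborel borel (%x. c + r *\<^sub>R x). \<bar>r\<bar> ^ DIM(real ^ 'n) *\<^sub>R f x)" by (rule integral_density) auto
 also have "... = (LINT x|lborel. \<bar>r\<bar> ^ DIM(real ^ 'n) *\<^sub>R f (c + r *\<^sub>R x))" by (rule integral_distr) measurable
 also have "... = (\<L> x. \<bar>r\<bar> ^ DIM(real ^ 'n) *\<^sub>R f (c + r *\<^sub>R x))" by (rule integral_completion[symmetric]) measurable
 finally show ?thesis using r by (simp add: scaleR_conv_of_real)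
qed

text \<open>The difference of two candidates is a polynomial orthogonal to itself on the ball.\<close>

lemma campanato_proj_eqI:
 assumes r: "0 < r" and g: "Lint (%x. ind (ball c r) x * g x)" and P: "P : poly_space s"
  and orth: "!!Q. Q : poly_space s ==> (\<L> x. ind (ball c r) x * ((g x - P x) * Q x)) = 0"
 shows "proj s c r g = P" unfolding campanato_proj_def proof (rule the_equality)
 show "P : poly_space s & (\<forall>Q\<in>poly_space s. (LINT x:ball c r|lebesgue. (g x - P x) * Q x) = 0)" using P orth by (simp add: set_lint_mult)
 fix P' assume P': "P' : poly_space s & (\<forall>Q\<in>poly_space s. (LINT x:ball c r|lebesgue. (g x - P' x) * Q x) = 0)"
 define R where "R x = P x - P' x" for x
 have R: "R : poly_space s" unfolding R_def using P P' by (intro poly_space_diff) auto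
 have cR: "(%x. cnj (R x)) : poly_space s" by (rule poly_space_cnj[OF R])
 have gm: "(%x. ind (ball c r) x * g x) : Lmeas" using g by (rule borel_measurable_integrable)
 have int: "Lint (%x. ind (ball c r) x * ((g x - S x) * cnj (R x)))" if S: "S : poly_space s" for S proof -
  obtain M where M: "!!x. norm (ind (ball c r) x * cnj (R x)) <= M" using continuous_ball_Linf_c[OF continuous_poly_space[OF cR], of c r] by (rule Linf_cE) blast
  note [measurable] = measurable_poly_space[OF cR] gm
  have "Lint (%x. (ind (ball c r) x * g x) * (ind (ball c r) x * cnj (R x)))" proof (rule Lintegrable_bound[where f="%x. M * norm (ind (ball c r) x * g x)"])
   show "Lint (%x. M * norm (ind (ball c r) x * g x))" by (intro integrable_mult_right integrable_norm g)
   show "AEL x. norm ((ind (ball c r) x * g x) * (ind (ball c r) x * cnj (R x))) <= norm (M * norm (ind (ball c r) x * g x))" proof (rule AE_I2)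
    fix x
    have "norm (ind (ball c r) x * cnj (R x)) * norm (ind (ball c r) x * g x) <= M * norm (ind (ball c r) x * g x)" by (rule mult_right_mono[OF M]) simp
    also have "... <= norm (M * norm (ind (ball c r) x * g x))" by simp
    finally show "norm ((ind (ball c r) x * g x) * (ind (ball c r) x * cnj (R x))) <= norm (M * norm (ind (ball c r) x * g x))" by (simp only: norm_mult mult.commute)
   qed
  qed measurable
  moreover have "Lint (%x. ind (ball c r) x * (S x * cnj (R x)))" by (intro continuous_ball_integrable continuous_on_mult continuous_poly_space[OF S] continuous_poly_space[OF cR])
  ultimately have "Lint (%x. (ind (ball c r) x * g x) * (ind (ball c r) x * cnj (R x)) - ind (ball c r) x * (S x * cnj (R x)))" by (rule Lintegrable_diff)
  then show ?thesis by (rule Lintegrable_cong[THEN iffD1, rotated -1]) (auto simp: indicator_def algebra_simps)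
 qed
 have "bip c r R R = (\<L> x. ind (ball c r) x * ((g x - P' x) * cnj (R x)) - ind (ball c r) x * ((g x - P x) * cnj (R x)))" unfolding bip_def by (intro Lintegral_cong) (auto simp: R_def algebra_simps)
 also have "... = (\<L> x. ind (ball c r) x * ((g x - P' x) * cnj (R x))) - (\<L> x. ind (ball c r) x * ((g x - P x) * cnj (R x)))" by (rule Lintegral_diff) (use int P P' in auto)
 also have "... = 0" using orth[OF cR] P' cR by (simp add: set_lint_mult)
 finally have "R = (%x. 0)" by (rule bip_self_zero[OF R r])
 then have "R x = 0" for x by simp
 then show "P' = P" by (auto simp: R_def)
qed

lemma campanato_proj_poly:
 assumes r: "0 < r" and P: "P : poly_space s"
 shows "proj s c r P = P" by (rule campanato_proj_eqI[OF r _ P]) (auto intro!: continuous_ball_integrable continuous_poly_space[OF P])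

text \<open>One constant serves all balls; the factor \<open>(1 + \<bar>x - c\<bar> / r)\<^sup>s\<close> measures the projection outside the ball.\<close>

definition proj_bound :: "nat => 'n::finite itself => real => bool" where
 "proj_bound s _ C \<longleftrightarrow> 0 < C & (\<forall>(c :: real ^ 'n) r g. 0 < r --> Lint (%x. ind (ball c r) x * g x) -->
  proj s c r g : poly_space s &
  (\<forall>Q\<in>poly_space s. (\<L> x. ind (ball c r) x * ((g x - proj s c r g x) * Q x)) = 0) &
  (\<forall>x. norm (proj s c r g x) <=
    C * (1 + norm (x - c) / r) ^ s * ((\<L> y. norm (ind (ball c r) y * g y)) / r ^ CARD('n))))"

text \<open>On the unit ball the projection is integration against an orthonormal basis; an affine change of
  variables transports it to \<open>B(c,r)\<close>.\<close>

lemma proj_bound_exists: "\<exists>C. proj_bound s TYPE('n::finite) C" proof -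
 from orthonormal_basis[where s=s and 'n='n] obtain m :: nat and \<phi> :: "nat => real ^ 'n => complex" where
  \<phi>0: "\<forall>j<m. \<phi> j : poly_space s" "\<forall>i<m. \<forall>j<m. bip 0 1 (\<phi> i) (\<phi> j) = (if i = j then 1 else 0)"
  "\<forall>Q\<in>poly_space s. \<exists>a. \<forall>x. Q x = (\<Sum>j<m. a j * \<phi> j x)" by (elim exE conjE) (rule that)
 have \<phi>: "!!j. j < m ==> \<phi> j : poly_space s" "!!i j. i < m ==> j < m ==> bip 0 1 (\<phi> i) (\<phi> j) = (if i = j then 1 else 0)"
  "!!Q. Q : poly_space s ==> \<exists>a. \<forall>x. Q x = (\<Sum>j<m. a j * \<phi> j x)" using \<phi>0 by blast+
 have "\<forall>j. \<exists>M. 0 <= M & (j < m --> (\<forall>x. norm (\<phi> j x) <= M * (1 + norm x) ^ s))" using poly_space_growth[OF \<phi>(1)] by blast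
 then obtain Mf where Mf: "\<forall>j. 0 <= Mf j & (j < m --> (\<forall>x. norm (\<phi> j x) <= Mf j * (1 + norm x) ^ s))" unfolding choice_iff by blast
 define C where "C = (\<Sum>j<m. Mf j * Mf j * 2 ^ s) + 1"
 have C0: "0 < C" unfolding C_def by (intro add_nonneg_pos sum_nonneg mult_nonneg_nonneg) (use Mf in auto)
 have "proj_bound s TYPE('n) C" unfolding proj_bound_def proof (intro conjI C0 allI impI)
  fix c :: "real ^ 'n" and r :: real and g :: "real ^ 'n => complex"
  assume r: "0 < r" and g: "Lint (%x. ind (ball c r) x * g x)"
  define \<sigma> where "\<sigma> x = (- (1 / r)) *\<^sub>R c + (1 / r) *\<^sub>R x" for x
  define \<psi> where "\<psi> j x = \<phi> j (\<sigma> x)" for j x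
  have \<sigma>n: "norm (\<sigma> x) = norm (x - c) / r" for x proof -
   have "\<sigma> x = (1 / r) *\<^sub>R (x - c)" by (simp add: \<sigma>_def algebra_simps)
   then show ?thesis using r by simp
  qed
  have \<sigma>i: "\<sigma> (c + r *\<^sub>R z) = z" for z using r by (simp add: \<sigma>_def algebra_simps)
  have \<psi>P: "\<psi> j : poly_space s" if "j < m" for j unfolding \<psi>_def \<sigma>_def by (rule poly_space_affine[OF \<phi>(1)[OF that]])
  have \<psi>c: "continuous_on UNIV (\<psi> j)" if "j < m" for j by (rule continuous_poly_space[OF \<psi>P[OF that]])
  have \<psi>o: "bip c r (\<psi> i) (\<psi> j) = (if i = j then of_real (r ^ CARD('n)) else 0)" if ij: "i < m" "j < m" for i j proof -
   have cont: "continuous_on UNIV (%x. \<psi> i x * cnj (\<psi> j x))" by (intro continuous_intros \<psi>c ij)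
   have mb: "(%x. ind (ball c r) x * (\<psi> i x * cnj (\<psi> j x))) : borel_measurable borel" by (intro borel_measurable_times borel_measurable_continuous_onI[OF cont] borel_measurable_indicator) simp
   have "bip c r (\<psi> i) (\<psi> j) = of_real (r ^ CARD('n)) * (\<L> x. ind (ball c r) (c + r *\<^sub>R x) * (\<psi> i (c + r *\<^sub>R x) * cnj (\<psi> j (c + r *\<^sub>R x))))" unfolding bip_def by (rule lebesgue_integral_affine[OF mb r])
   also have "(\<L> x. ind (ball c r) (c + r *\<^sub>R x) * (\<psi> i (c + r *\<^sub>R x) * cnj (\<psi> j (c + r *\<^sub>R x)))) = bip 0 1 (\<phi> i) (\<phi> j)" unfolding bip_def \<psi>_def \<sigma>i using r by (intro Lintegral_cong) (auto simp: indicator_def dist_norm)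
   finally show ?thesis using \<phi>(2)[OF ij] by simp
  qed
  have gm [measurable]: "(%x. ind (ball c r) x * g x) : Lmeas" using g by (rule borel_measurable_integrable)
  have gint: "Lint (%x. ind (ball c r) x * (g x * Q x))" if Q: "continuous_on UNIV Q" for Q proof -
   obtain M where M: "!!x. norm (ind (ball c r) x * Q x) <= M" using continuous_ball_Linf_c[OF Q, of c r] by (rule Linf_cE) blast
   have [measurable]: "Q : Lmeas" by (intro borel_measurable_lebesgueI borel_measurable_continuous_onI Q)
   have "Lint (%x. (ind (ball c r) x * g x) * (ind (ball c r) x * Q x))" proof (rule Lintegrable_bound[where f="%x. M * norm (ind (ball c r) x * g x)"])
    show "Lint (%x. M * norm (ind (ball c r) x * g x))" by (intro integrable_mult_right integrable_norm g)
    show "AEL x. norm ((ind (ball c r) x * g x) * (ind (ball c r) x * Q x)) <= norm (M * norm (ind (ball c r) x * g x))" proof (rule AE_I2)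
    fix x
    have "norm (ind (ball c r) x * Q x) * norm (ind (ball c r) x * g x) <= M * norm (ind (ball c r) x * g x)" by (rule mult_right_mono[OF M]) simp
    also have "... <= norm (M * norm (ind (ball c r) x * g x))" by simp
    finally show "norm ((ind (ball c r) x * g x) * (ind (ball c r) x * Q x)) <= norm (M * norm (ind (ball c r) x * g x))" by (simp only: norm_mult mult.commute)
    qed
   qed measurable
   then show ?thesis by (rule Lintegrable_cong[THEN iffD1, rotated -1]) (auto simp: indicator_def)
  qed
  define N where "N = (\<L> y. norm (ind (ball c r) y * g y))"
  have N0: "0 <= N" unfolding N_def by (rule Lintegral_nonneg) simp
  define G where "G j = bip c r g (\<psi> j) / of_real (r ^ CARD('n))" for j
  define P where "P x = (\<Sum>j<m. G j * \<psi> j x)" for x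
  have P: "P : poly_space s" unfolding P_def by (intro poly_space_sum poly_space_cmult \<psi>P) simp
  have Pc: "continuous_on UNIV P" by (rule continuous_poly_space[OF P])
  have o1: "(\<L> x. ind (ball c r) x * ((g x - P x) * cnj (\<psi> j x))) = 0" if j: "j < m" for j proof -
   have "(\<L> x. ind (ball c r) x * ((g x - P x) * cnj (\<psi> j x))) = bip c r g (\<psi> j) - bip c r P (\<psi> j)" proof -
    have "(\<L> x. ind (ball c r) x * ((g x - P x) * cnj (\<psi> j x))) =
    (\<L> x. ind (ball c r) x * (g x * cnj (\<psi> j x)) - ind (ball c r) x * (P x * cnj (\<psi> j x)))" by (intro Lintegral_cong) (auto simp: algebra_simps)
    also have "... = bip c r g (\<psi> j) - bip c r P (\<psi> j)" unfolding bip_def by (rule Bochner_Integration.integral_diff; intro gint continuous_ball_integrable continuous_intros \<psi>c j Pc)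
    finally show ?thesis .
   qed
   also have "bip c r P (\<psi> j) = (\<Sum>i<m. G i * bip c r (\<psi> i) (\<psi> j))" unfolding P_def[abs_def] by (rule bip_sum) (use \<psi>c j in auto)
   also have "... = (\<Sum>i<m. if i = j then bip c r g (\<psi> j) else 0)" by (intro sum.cong) (use \<psi>o j r in "auto simp: G_def")
   also have "... = bip c r g (\<psi> j)" using j by simp
   finally show ?thesis by simp
  qed
  have orth: "(\<L> x. ind (ball c r) x * ((g x - P x) * Q x)) = 0" if Q: "Q : poly_space s" for Q proof -
   have "(%z. cnj (Q (c + r *\<^sub>R z))) : poly_space s" by (intro poly_space_cnj poly_space_affine Q)
   then obtain a where a: "!!z. cnj (Q (c + r *\<^sub>R z)) = (\<Sum>j<m. a j * \<phi> j z)" using \<phi>(3) by blast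
   have Qx: "Q x = (\<Sum>j<m. cnj (a j) * cnj (\<psi> j x))" for x proof -
    have "c + r *\<^sub>R \<sigma> x = x" using r by (simp add: \<sigma>_def algebra_simps)
    then have "cnj (Q x) = (\<Sum>j<m. a j * \<psi> j x)" using a[of "\<sigma> x"] by (simp add: \<psi>_def)
    then have "cnj (cnj (Q x)) = cnj (\<Sum>j<m. a j * \<psi> j x)" by simp
    then show ?thesis by simp
   qed
   have i0: "Lint (%x. ind (ball c r) x * ((g x - P x) * cnj (\<psi> j x)))" if j: "j < m" for j proof -
    have "Lint (%x. ind (ball c r) x * (g x * cnj (\<psi> j x)) - ind (ball c r) x * (P x * cnj (\<psi> j x)))" by (intro Lintegrable_diff gint continuous_ball_integrable continuous_intros \<psi>c j Pc)
    then show ?thesis by (simp add: algebra_simps)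
   qed
   have "(\<L> x. ind (ball c r) x * ((g x - P x) * Q x)) = (\<L> x. (\<Sum>j<m. cnj (a j) * (ind (ball c r) x * ((g x - P x) * cnj (\<psi> j x)))))" unfolding Qx by (simp add: sum_distrib_left mult_ac)
   also have "... = (\<Sum>j<m. cnj (a j) * (\<L> x. ind (ball c r) x * ((g x - P x) * cnj (\<psi> j x))))" by (subst Lintegral_sum) (use i0 in auto)
   also have "... = 0" using o1 by simp
   finally show ?thesis .
  qed
  have eq: "proj s c r g = P" by (rule campanato_proj_eqI[OF r g P orth])
  show "proj s c r g : poly_space s" unfolding eq by (rule P)
  show "\<forall>Q\<in>poly_space s. (\<L> x. ind (ball c r) x * ((g x - proj s c r g x) * Q x)) = 0" unfolding eq using orth by blast
  fix x
  have Gj: "norm (G j) <= Mf j * 2 ^ s * (N / r ^ CARD('n))" if j: "j < m" for j proof -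
   have i: "Lint (%x. ind (ball c r) x * (g x * cnj (\<psi> j x)))" by (intro gint continuous_intros \<psi>c j)
   have "norm (bip c r g (\<psi> j)) <= (\<L> x. norm (ind (ball c r) x * (g x * cnj (\<psi> j x))))" unfolding bip_def by (rule integral_norm_bound)
   also have "... <= (\<L> x. Mf j * 2 ^ s * norm (ind (ball c r) x * g x))" proof (rule integral_mono)
    show "Lint (%x. Mf j * 2 ^ s * norm (ind (ball c r) x * g x))" by (intro integrable_mult_right integrable_norm g)
    fix x
    show "norm (ind (ball c r) x * (g x * cnj (\<psi> j x))) <= Mf j * 2 ^ s * norm (ind (ball c r) x * g x)" proof (cases "x : ball c r")
    case True
    then have "norm (\<sigma> x) <= 1" using r by (simp add: \<sigma>n dist_norm norm_minus_commute)
    then have "(1 + norm (\<sigma> x)) ^ s <= 2 ^ s" by (intro power_mono) auto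
    then have "Mf j * (1 + norm (\<sigma> x)) ^ s <= Mf j * 2 ^ s" using Mf by (intro mult_left_mono) auto
    then have "norm (\<psi> j x) <= Mf j * 2 ^ s" using Mf j unfolding \<psi>_def by (meson order_trans)
    then have "norm (\<psi> j x) * norm (g x) <= Mf j * 2 ^ s * norm (g x)" by (rule mult_right_mono) simp
    then show ?thesis using True by (simp add: norm_mult mult.commute)
    qed simp
   qed (use i in auto)
   also have "... = Mf j * 2 ^ s * N" by (simp add: N_def)
   finally show ?thesis using r by (simp add: G_def norm_divide norm_power divide_right_mono)
  qed
  have "norm (P x) <= (\<Sum>j<m. norm (G j * \<psi> j x))" unfolding P_def by (rule norm_sum)
  also have "... <= (\<Sum>j<m. (Mf j * 2 ^ s * (N / r ^ CARD('n))) * (Mf j * (1 + norm (x - c) / r) ^ s))" proof (intro sum_mono)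
   fix j assume "j : {..<m}"
   then have j: "j < m" by simp
   have "norm (\<psi> j x) <= Mf j * (1 + norm (x - c) / r) ^ s" using Mf j unfolding \<psi>_def \<sigma>n[symmetric] by blast
   then show "norm (G j * \<psi> j x) <= (Mf j * 2 ^ s * (N / r ^ CARD('n))) * (Mf j * (1 + norm (x - c) / r) ^ s)" unfolding norm_mult using Gj[OF j] Mf N0 r by (intro mult_mono) (auto intro!: mult_nonneg_nonneg)
  qed
  also have "... = (\<Sum>j<m. Mf j * Mf j * 2 ^ s) * ((1 + norm (x - c) / r) ^ s * (N / r ^ CARD('n)))" unfolding sum_distrib_right by (intro sum.cong refl) (simp only: mult_ac)
  also have "... <= C * ((1 + norm (x - c) / r) ^ s * (N / r ^ CARD('n)))" unfolding C_def using N0 r by (intro mult_right_mono mult_nonneg_nonneg) auto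
  finally show "norm (proj s c r g x) <= C * (1 + norm (x - c) / r) ^ s * ((\<L> y. norm (ind (ball c r) y * g y)) / r ^ CARD('n))" unfolding eq N_def by (simp add: mult.assoc)
 qed
 then show ?thesis by blast
qed


section \<open>Taylor expansion of the kernel\<close>

lemma coords: "distinct (coords :: 'n::finite list)" "set (coords :: 'n list) = UNIV" proof -
 have "\<exists>js :: 'n list. distinct js & set js = UNIV" using finite_distinct_list[of "UNIV :: 'n set"] by auto
 then have "distinct (coords :: 'n list) & set (coords :: 'n list) = UNIV" unfolding coords_def by (rule someI_ex)
 then show "distinct (coords :: 'n list)" "set (coords :: 'n list) = UNIV" by auto
qed

text \<open>The directions of the iterated derivative that belongs to \<open>\<gamma>\<close>.\<close>

definition mi_list :: "('n => nat) => 'n list => 'n list" where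
 "mi_list \<gamma> is = concat (map (%i. replicate (\<gamma> i) i) is)"

lemma foldr_partial_replicate: "foldr partial (replicate k i) f = (partial i ^^ k) f" by (induction k) auto

lemma foldr_partial_mi_list: "foldr partial (mi_list \<gamma> is) f = foldr (%i. partial i ^^ \<gamma> i) is f" by (induction "is") (auto simp: mi_list_def foldr_partial_replicate)

lemma mpartial_eq: "mpartial \<gamma> f = foldr partial (mi_list \<gamma> coords) f" by (simp add: mpartial_def foldr_partial_mi_list)

lemma length_mi_list: "length (mi_list \<gamma> is) = sum_list (map \<gamma> is)" by (induction "is") (auto simp: mi_list_def)

lemma mpartial_zero: "mpartial (%_. 0) f = f" proof -
 have "foldr (%i. partial i ^^ 0) is f = f" for "is" by (induction "is") auto
 then show ?thesis by (simp add: mpartial_def)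
qed

lemma partial_has_derivative:
 assumes ex: "partials_exist_on s S F" and js: "length js < s" and x: "x + t *\<^sub>R axis i 1 : S"
 shows "((%\<tau>. foldr partial js F (x + \<tau> *\<^sub>R axis i 1)) has_vector_derivative foldr partial (i # js) F (x + t *\<^sub>R axis i 1)) (at t)" proof -
 let ?y = "x + t *\<^sub>R axis i (1::real)"
 have "(%\<tau>. foldr partial js F (?y + \<tau> *\<^sub>R axis i 1)) differentiable (at (0::real))" using ex js x unfolding partials_exist_on_def by blast
 then have d: "((%\<tau>. foldr partial js F (?y + \<tau> *\<^sub>R axis i 1)) has_vector_derivative foldr partial (i # js) F ?y) (at 0)" by (simp add: vector_derivative_works partial_def)
 have "((%\<tau>. \<tau> - t) has_vector_derivative 1) (at t)" by (auto intro!: derivative_eq_intros simp flip: has_real_derivative_iff_has_vector_derivative)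
 moreover have "((%\<tau>. foldr partial js F (?y + \<tau> *\<^sub>R axis i 1)) has_vector_derivative foldr partial (i # js) F ?y) (at (t - t))" using d by simp
 ultimately have "((%\<tau>. foldr partial js F (?y + \<tau> *\<^sub>R axis i 1)) \<circ> (%\<tau>. \<tau> - t) has_vector_derivative 1 *\<^sub>R foldr partial (i # js) F ?y) (at t)" by (rule vector_diff_chain_at)
 moreover have "(%\<tau>. foldr partial js F (?y + \<tau> *\<^sub>R axis i 1)) \<circ> (%\<tau>. \<tau> - t) = (%\<tau>. foldr partial js F (x + \<tau> *\<^sub>R axis i 1))" by (auto simp: o_def algebra_simps simp flip: scaleR_add_left)
 ultimately show ?thesis by simp
qed

text \<open>Taylor's formula in one variable, with the remainder controlled by the oscillation of the
  highest derivative; that derivative need not be differentiable.\<close>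

lemma taylor_oscillation:
 fixes g :: "nat => real => complex"
 assumes "!!j t. j < m ==> \<bar>t\<bar> <= \<bar>h\<bar> ==> (g j has_vector_derivative g (Suc j) t) (at t)"
  and "!!t. \<bar>t\<bar> <= \<bar>h\<bar> ==> norm (g m t - g m 0) <= \<omega>" and "0 <= \<omega>"
 shows "norm (g 0 h - (\<Sum>j\<le>m. of_real (h ^ j / fact j) * g j 0)) <= \<omega> * \<bar>h\<bar> ^ m" using assms proof (induction m arbitrary: g h)
 case 0
 then show ?case using "0.prems"(2)[of h] by simp
next
 case (Suc m)
 define \<phi> where "\<phi> t = g 0 t - (g 0 0 + (\<Sum>j\<le>m. (t ^ Suc j / fact (Suc j)) *\<^sub>R g (Suc j) 0))" for t
 define \<phi>' where "\<phi>' t = g 1 t - (\<Sum>j\<le>m. of_real (t ^ j / fact j) * g (Suc j) 0)" for t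
 have der: "(\<phi> has_vector_derivative \<phi>' t) (at t)" if t: "\<bar>t\<bar> <= \<bar>h\<bar>" for t proof -
  have p: "((%t. (t ^ Suc j / fact (Suc j)) *\<^sub>R g (Suc j) 0) has_vector_derivative (t ^ j / fact j) *\<^sub>R g (Suc j) 0) (at t)" for j proof -
   have "((%t. t ^ Suc j / fact (Suc j)) has_real_derivative (real (Suc j) * t ^ j) / fact (Suc j)) (at t)" using DERIV_cdivide[OF DERIV_pow[of "Suc j" t UNIV], of "fact (Suc j)"] by (simp del: of_nat_Suc fact_Suc)
   also have "(real (Suc j) * t ^ j) / fact (Suc j) = t ^ j / fact j" by (simp add: fact_Suc del: of_nat_Suc)
   finally show ?thesis using has_vector_derivative_scaleR[of "%t. t ^ Suc j / fact (Suc j)" "t ^ j / fact j" t UNIV "%_. g (Suc j) 0" 0] by simp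
  qed
  have "(g 0 has_vector_derivative g 1 t) (at t)" using Suc.prems(1)[of 0 t] t by simp
  then have "(\<phi> has_vector_derivative (g 1 t - (0 + (\<Sum>j\<le>m. (t ^ j / fact j) *\<^sub>R g (Suc j) 0)))) (at t)" unfolding \<phi>_def by (intro has_vector_derivative_diff has_vector_derivative_add has_vector_derivative_const has_vector_derivative_sum p)
  then show ?thesis by (simp add: \<phi>'_def scaleR_conv_of_real)
 qed
 have bd: "norm (\<phi>' t) <= \<omega> * \<bar>h\<bar> ^ m" if t: "\<bar>t\<bar> <= \<bar>h\<bar>" for t proof -
  have "norm (g (Suc 0) t - (\<Sum>j\<le>m. of_real (t ^ j / fact j) * g (Suc j) 0)) <= \<omega> * \<bar>t\<bar> ^ m" by (rule Suc.IH[of t "%j. g (Suc j)"]) (use Suc.prems t in auto)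
  also have "... <= \<omega> * \<bar>h\<bar> ^ m" using t Suc.prems(3) by (intro mult_left_mono power_mono) auto
  finally show ?thesis by (simp add: \<phi>'_def)
 qed
 have seg: "\<bar>t\<bar> <= \<bar>h\<bar>" if "t : closed_segment 0 h" for t using that by (auto simp: closed_segment_eq_real_ivl split: if_splits)
 have "norm (\<phi> h - \<phi> 0) <= \<omega> * \<bar>h\<bar> ^ m * norm (h - 0)" proof (rule differentiable_bound[where S="closed_segment 0 h" and f'="%t u. u *\<^sub>R \<phi>' t"])
  show "(\<phi> has_derivative (%u. u *\<^sub>R \<phi>' t)) (at t within closed_segment 0 h)" if "t : closed_segment 0 h" for t using der[OF seg[OF that]] unfolding has_vector_derivative_def by (rule has_derivative_at_withinI)
  show "onorm (%u. u *\<^sub>R \<phi>' t) <= \<omega> * \<bar>h\<bar> ^ m" if "t : closed_segment 0 h" for t proof (rule onorm_le)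
   fix u :: real
   show "norm (u *\<^sub>R \<phi>' t) <= \<omega> * \<bar>h\<bar> ^ m * norm u" using mult_left_mono[OF bd[OF seg[OF that]], of "\<bar>u\<bar>"] by (simp add: mult.commute)
  qed
 qed auto
 moreover have "\<phi> 0 = 0" by (simp add: \<phi>_def)
 moreover have "\<phi> h = g 0 h - (\<Sum>j\<le>Suc m. of_real (h ^ j / fact j) * g j 0)" unfolding \<phi>_def sum.atMost_Suc_shift by (simp add: scaleR_conv_of_real)
 ultimately show ?case by (simp add: mult_ac)
qed

text \<open>Taylor polynomial built one coordinate at a time; \<open>m\<close> is the degree still available and \<open>js\<close> lists the derivatives
  already taken.\<close>

fun tpoly :: "(real ^ 'n => complex) => real ^ 'n => real ^ 'n => 'n list => nat => 'n list => complex" where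
 "tpoly F x0 h [] m js = foldr partial js F x0"
| "tpoly F x0 h (i # is) m js = (\<Sum>j\<le>m. of_real ((h $ i) ^ j / fact j) * tpoly F x0 h is (m - j) (replicate j i @ js))"

fun tconst :: "nat => nat => real" where
 "tconst s 0 = 1"
| "tconst s (Suc k) = 2 + real (Suc s) * tconst s k"

lemma tconst_nonneg: "0 <= tconst s k" by (induction k) auto

lemma mi_list_snoc: "mi_list \<gamma> (is @ [i]) = mi_list \<gamma> is @ replicate (\<gamma> i) i" by (simp add: mi_list_def)

lemma mi_list_cong: "(!!i. i : set is ==> \<gamma> i = \<gamma>' i) ==> mi_list \<gamma> is = mi_list \<gamma>' is" unfolding mi_list_def by (intro arg_cong[where f=concat] map_cong) auto

lemma mi_list_zero: "(!!i. i : set is ==> \<gamma> i = 0) ==> mi_list \<gamma> is = []" unfolding mi_list_def by auto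

text \<open>Iterated partial derivatives do not provide differentiability in several variables. Therefore one coordinate
  is moved at a time, and the one-variable formula is applied to each mixed derivative. The derivatives are always taken in the
  order of the list, as in \<open>mpartial\<close>.\<close>

lemma taylor_coordinates:
 fixes F :: "real ^ 'n => complex"
 assumes ex: "partials_exist_on s S F" and S: "cball x0 (norm h) \<subseteq> S" and \<omega>: "0 <= \<omega>"
  and "distinct is" "length js + m = s"
  and "!!\<gamma> z. sum_list (map \<gamma> (rev is)) + length js = s ==> norm (z - x0) <= norm h ==>
   norm (foldr partial (mi_list \<gamma> (rev is) @ js) F z - foldr partial (mi_list \<gamma> (rev is) @ js) F x0) <= \<omega>"
 shows "norm (foldr partial js F (x0 + (\<Sum>i\<in>set is. (h $ i) *\<^sub>R axis i 1)) - tpoly F x0 h is m js) <= tconst s (length is) * \<omega> * norm h ^ m" using assms(4-) proof (induction "is" arbitrary: m js)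
 case Nil
 then show ?case using \<omega> by simp
next
 case (Cons i "is")
 define b where "b = x0 + (\<Sum>i\<in>set is. (h $ i) *\<^sub>R axis i 1)"
 define g where "g j t = foldr partial (replicate j i @ js) F (b + t *\<^sub>R axis i 1)" for j t
 have i: "i ~: set is" using Cons.prems by simp
 have hi: "\<bar>h $ i\<bar> <= norm h" by (rule component_le_norm_cart)
 have bt: "norm (b + t *\<^sub>R axis i 1 - x0) <= norm h" if t: "\<bar>t\<bar> <= \<bar>h $ i\<bar>" for t proof (rule norm_le_componentwise_cart)
  fix k
  have "(\<Sum>j\<in>set is. (h $ j) *\<^sub>R axis j 1) $ k = (\<Sum>j\<in>set is. if j = k then h $ j else 0)" unfolding sum_component by (intro sum.cong) (auto simp: axis_def)
  then have "(\<Sum>j\<in>set is. (h $ j) *\<^sub>R axis j 1) $ k = (if k : set is then h $ k else 0)" by simp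
  then show "norm ((b + t *\<^sub>R axis i 1 - x0) $ k) <= norm (h $ k)" using t i by (auto simp: b_def axis_def)
 qed
 have btS: "b + t *\<^sub>R axis i 1 : S" if t: "\<bar>t\<bar> <= \<bar>h $ i\<bar>" for t using bt[OF t] S by (auto simp: dist_norm norm_minus_commute subset_eq)
 have t1: "norm (g 0 (h $ i) - (\<Sum>j\<le>m. of_real ((h $ i) ^ j / fact j) * g j 0)) <= 2 * \<omega> * \<bar>h $ i\<bar> ^ m" proof (rule taylor_oscillation)
  show "(g j has_vector_derivative g (Suc j) t) (at t)" if "j < m" "\<bar>t\<bar> <= \<bar>h $ i\<bar>" for j t unfolding g_def using partial_has_derivative[OF ex _ btS[OF that(2)], of "replicate j i @ js"] that(1) Cons.prems(2) by simp
  define \<gamma> where "\<gamma> = (%k. if k = i then m else 0)"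
  have \<gamma>0: "mi_list \<gamma> (rev is) = []" by (rule mi_list_zero) (use i in "auto simp: \<gamma>_def")
  have \<gamma>1: "mi_list \<gamma> (rev (i # is)) @ js = replicate m i @ js" by (simp add: mi_list_snoc \<gamma>0) (simp add: \<gamma>_def)
  have \<gamma>2: "sum_list (map \<gamma> (rev (i # is))) + length js = s" using length_mi_list[of \<gamma> "rev (i # is)"] arg_cong[OF \<gamma>1, of length] Cons.prems(2) by simp
  have osc: "norm (g m t - foldr partial (replicate m i @ js) F x0) <= \<omega>" if "\<bar>t\<bar> <= \<bar>h $ i\<bar>" for t unfolding g_def using Cons.prems(3)[OF \<gamma>2 bt[OF that]] unfolding \<gamma>1 .
  show "norm (g m t - g m 0) <= 2 * \<omega>" if "\<bar>t\<bar> <= \<bar>h $ i\<bar>" for t using osc[OF that] osc[of 0] norm_triangle_ineq4[of "g m t - foldr partial (replicate m i @ js) F x0" "g m 0 - foldr partial (replicate m i @ js) F x0"] by simp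
 qed (use \<omega> in simp)
 have t2: "norm (g j 0 - tpoly F x0 h is (m - j) (replicate j i @ js)) <= tconst s (length is) * \<omega> * norm h ^ (m - j)" if j: "j <= m" for j proof -
  have "norm (foldr partial (replicate j i @ js) F (x0 + (\<Sum>i\<in>set is. (h $ i) *\<^sub>R axis i 1)) - tpoly F x0 h is (m - j) (replicate j i @ js)) <= tconst s (length is) * \<omega> * norm h ^ (m - j)" proof (rule Cons.IH)
   show "distinct is" using Cons.prems by simp
   show "length (replicate j i @ js) + (m - j) = s" using Cons.prems j by simp
   fix \<gamma> z assume \<gamma>: "sum_list (map \<gamma> (rev is)) + length (replicate j i @ js) = s" and z: "norm (z - x0) <= norm h"
   define \<gamma>' where "\<gamma>' = \<gamma>(i := j)"
   have a: "mi_list \<gamma>' (rev is) = mi_list \<gamma> (rev is)" by (rule mi_list_cong) (use i in "auto simp: \<gamma>'_def")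
   have b: "mi_list \<gamma>' (rev (i # is)) @ js = mi_list \<gamma> (rev is) @ replicate j i @ js" by (simp add: mi_list_snoc a) (simp add: \<gamma>'_def)
   have c: "sum_list (map \<gamma>' (rev (i # is))) + length js = s" using length_mi_list[of \<gamma>' "rev (i # is)"] arg_cong[OF b, of length] \<gamma> length_mi_list[of \<gamma> "rev is"] by simp
   show "norm (foldr partial (mi_list \<gamma> (rev is) @ replicate j i @ js) F z - foldr partial (mi_list \<gamma> (rev is) @ replicate j i @ js) F x0) <= \<omega>" using Cons.prems(3)[OF c z] unfolding b .
  qed
  then show ?thesis by (simp add: g_def b_def)
 qed
 have t3: "norm ((\<Sum>j\<le>m. of_real ((h $ i) ^ j / fact j) * g j 0) - tpoly F x0 h (i # is) m js) <= real (Suc s) * tconst s (length is) * \<omega> * norm h ^ m" proof -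
  have "(\<Sum>j\<le>m. of_real ((h $ i) ^ j / fact j) * g j 0) - tpoly F x0 h (i # is) m js =
   (\<Sum>j\<le>m. of_real ((h $ i) ^ j / fact j) * (g j 0 - tpoly F x0 h is (m - j) (replicate j i @ js)))" by (simp add: sum_subtractf right_diff_distrib)
  also have "norm ... <= (\<Sum>j\<le>m. tconst s (length is) * \<omega> * norm h ^ m)" proof (rule sum_norm_le)
   fix j assume "j : {..m}"
   then have j: "j <= m" by simp
   have "\<bar>h $ i\<bar> ^ j / fact j <= \<bar>h $ i\<bar> ^ j / 1" by (intro divide_left_mono) (auto simp: fact_ge_1)
   also have "... <= norm h ^ j" using hi by (simp add: power_mono)
   finally have "norm (complex_of_real ((h $ i) ^ j / fact j)) <= norm h ^ j" by (simp add: norm_divide norm_power)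
   then have "norm (of_real ((h $ i) ^ j / fact j) * (g j 0 - tpoly F x0 h is (m - j) (replicate j i @ js))) <= norm h ^ j * (tconst s (length is) * \<omega> * norm h ^ (m - j))" unfolding norm_mult by (intro mult_mono t2 j) auto
   also have "... = tconst s (length is) * \<omega> * norm h ^ m" using j by (simp add: power_add[symmetric] mult_ac)
   finally show "norm (of_real ((h $ i) ^ j / fact j) * (g j 0 - tpoly F x0 h is (m - j) (replicate j i @ js))) <= tconst s (length is) * \<omega> * norm h ^ m" .
  qed
  also have "... = real (Suc m) * (tconst s (length is) * \<omega> * norm h ^ m)" by simp
  also have "... <= real (Suc s) * (tconst s (length is) * \<omega> * norm h ^ m)" using Cons.prems(2) \<omega> tconst_nonneg by (intro mult_right_mono) (auto intro!: mult_nonneg_nonneg)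
  finally show ?thesis by (simp add: mult.assoc)
 qed
 have "x0 + (\<Sum>k\<in>set (i # is). (h $ k) *\<^sub>R axis k 1) = b + (h $ i) *\<^sub>R axis i 1" using i by (simp add: b_def)
 then have e: "foldr partial js F (x0 + (\<Sum>k\<in>set (i # is). (h $ k) *\<^sub>R axis k 1)) = g 0 (h $ i)" by (simp add: g_def)
 have "norm (g 0 (h $ i) - tpoly F x0 h (i # is) m js) <= 2 * \<omega> * \<bar>h $ i\<bar> ^ m + real (Suc s) * tconst s (length is) * \<omega> * norm h ^ m"
  using norm_triangle_ineq[of "g 0 (h $ i) - (\<Sum>j\<le>m. of_real ((h $ i) ^ j / fact j) * g j 0)" "(\<Sum>j\<le>m. of_real ((h $ i) ^ j / fact j) * g j 0) - tpoly F x0 h (i # is) m js"] t1 t3 by simp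
 also have "... <= 2 * \<omega> * norm h ^ m + real (Suc s) * tconst s (length is) * \<omega> * norm h ^ m" using hi \<omega> by (intro add_right_mono mult_left_mono power_mono) auto
 also have "... = tconst s (length (i # is)) * \<omega> * norm h ^ m" by (simp add: algebra_simps)
 finally show ?case unfolding e .
qed

definition mi_set :: "'n::finite list => nat => ('n => nat) set" where
 "mi_set is m = {\<gamma>. (\<forall>i. i ~: set is --> \<gamma> i = 0) & (\<Sum>i\<in>set is. \<gamma> i) <= m}"

lemma finite_mi_set: "finite (mi_set is m)" proof (rule finite_subset[OF _ finite_mi_abs_le[of m]])
 show "mi_set is m \<subseteq> {\<gamma>. mi_abs \<gamma> <= m}" proof
  fix \<gamma> assume "\<gamma> : mi_set is m"
  then have "(\<Sum>i\<in>UNIV. \<gamma> i) = (\<Sum>i\<in>set is. \<gamma> i)" "(\<Sum>i\<in>set is. \<gamma> i) <= m" by (auto simp: mi_set_def intro!: sum.mono_neutral_right)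
  then show "\<gamma> : {\<gamma>. mi_abs \<gamma> <= m}" by (simp add: mi_abs_def)
 qed
qed

lemma tpoly_eq:
 assumes "distinct is"
 shows "tpoly F x0 h is m js = (\<Sum>\<gamma>\<in>mi_set is m. (\<Prod>i\<in>set is. complex_of_real ((h $ i) ^ \<gamma> i / fact (\<gamma> i))) * foldr partial (mi_list \<gamma> (rev is) @ js) F x0)" using assms proof (induction "is" arbitrary: m js)
 case Nil
 have "mi_set [] m = {%_::'a. 0}" by (auto simp: mi_set_def)
 then show ?case by (simp add: mi_list_def)
next
 case (Cons i "is")
 have i: "i ~: set is" and d: "distinct is" using Cons.prems by auto
 let ?w = "%is \<gamma>. (\<Prod>i\<in>set is. complex_of_real ((h $ i) ^ \<gamma> i / fact (\<gamma> i)))"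
 let ?D = "%\<gamma> js. foldr partial (mi_list \<gamma> (rev is) @ js) F x0"
 have "tpoly F x0 h (i # is) m js = (\<Sum>j\<le>m. \<Sum>\<gamma>\<in>mi_set is (m - j). of_real ((h $ i) ^ j / fact j) * (?w is \<gamma> * ?D \<gamma> (replicate j i @ js)))" by (simp add: Cons.IH[OF d] sum_distrib_left)
 also have "... = (\<Sum>(j, \<gamma>)\<in>Sigma {..m} (%j. mi_set is (m - j)). of_real ((h $ i) ^ j / fact j) * (?w is \<gamma> * ?D \<gamma> (replicate j i @ js)))" by (rule sum.Sigma) (auto intro: finite_mi_set)
 also have "... = (\<Sum>\<gamma>\<in>mi_set (i # is) m. ?w (i # is) \<gamma> * foldr partial (mi_list \<gamma> (rev (i # is)) @ js) F x0)" proof (rule sum.reindex_bij_witness[where i="%\<gamma>. (\<gamma> i, \<gamma>(i := 0))" and j="%(j, \<gamma>). \<gamma>(i := j)"])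
  fix a assume a: "a : Sigma {..m} (%j. mi_set is (m - j))"
  obtain j \<gamma> where ag: "a = (j, \<gamma>)" by (cases a)
  have \<gamma>: "j <= m" "!!k. k ~: set is ==> \<gamma> k = 0" "(\<Sum>i\<in>set is. \<gamma> i) <= m - j" using a ag by (auto simp: mi_set_def)
  have \<gamma>i: "\<gamma> i = 0" using \<gamma>(2) i by blast
  show "(%\<gamma>. (\<gamma> i, \<gamma>(i := 0))) (case a of (j, \<gamma>) => \<gamma>(i := j)) = a" using \<gamma>i ag by (auto simp: fun_upd_idem)
  have s: "(\<Sum>k\<in>set is. (\<gamma>(i := j)) k) = (\<Sum>k\<in>set is. \<gamma> k)" using i by (intro sum.cong) auto
  show "(case a of (j, \<gamma>) => \<gamma>(i := j)) : mi_set (i # is) m" using \<gamma> s i ag by (auto simp: mi_set_def)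
  have l: "mi_list (\<gamma>(i := j)) (rev (i # is)) @ js = mi_list \<gamma> (rev is) @ replicate j i @ js" proof -
   have "mi_list (\<gamma>(i := j)) (rev is) = mi_list \<gamma> (rev is)" by (rule mi_list_cong) (use i in auto)
   then show ?thesis by (simp add: mi_list_snoc)
  qed
  have w: "?w is (\<gamma>(i := j)) = ?w is \<gamma>" using i by (intro prod.cong) auto
  have w2: "?w (i # is) (\<gamma>(i := j)) = of_real ((h $ i) ^ j / fact j) * ?w is \<gamma>" using i w by simp
  show "?w (i # is) (case a of (j, \<gamma>) => \<gamma>(i := j)) * foldr partial (mi_list (case a of (j, \<gamma>) => \<gamma>(i := j)) (rev (i # is)) @ js) F x0 =
   (case a of (j, \<gamma>) => of_real ((h $ i) ^ j / fact j) * (?w is \<gamma> * ?D \<gamma> (replicate j i @ js)))" unfolding ag prod.case l w2 by (simp only: mult.assoc)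
 next
  fix \<gamma> assume "\<gamma> : mi_set (i # is) m"
  then have \<gamma>: "!!k. k ~: set (i # is) ==> \<gamma> k = 0" "\<gamma> i + (\<Sum>k\<in>set is. \<gamma> k) <= m" using i by (auto simp: mi_set_def)
  show "(case (\<gamma> i, \<gamma>(i := 0)) of (j, \<gamma>) => \<gamma>(i := j)) = \<gamma>" by simp
  have s: "(\<Sum>k\<in>set is. (\<gamma>(i := 0)) k) = (\<Sum>k\<in>set is. \<gamma> k)" using i by (intro sum.cong) auto
  show "(\<gamma> i, \<gamma>(i := 0)) : Sigma {..m} (%j. mi_set is (m - j))" using \<gamma> s by (auto simp: mi_set_def)
 qed
 finally show ?case .
qed

definition taylor :: "nat => (real ^ 'n => complex) => real ^ 'n => real ^ 'n => complex" where
 "taylor s F c x = (\<Sum>\<gamma> | mi_abs \<gamma> <= s. mpartial \<gamma> F c / of_real (mi_fact \<gamma>) * of_real (mi_pow (x - c) \<gamma>))"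

lemma taylor_remainder:
 fixes F :: "real ^ 'n => complex"
 assumes ex: "partials_exist_on s S F" and S: "cball x0 (norm h) \<subseteq> S" and \<omega>: "0 <= \<omega>"
  and osc: "!!\<gamma> z. mi_abs \<gamma> = s ==> norm (z - x0) <= norm h ==> norm (mpartial \<gamma> F z - mpartial \<gamma> F x0) <= \<omega>"
 shows "norm (F (x0 + h) - taylor s F x0 (x0 + h)) <= tconst s CARD('n) * \<omega> * norm h ^ s" proof -
 let ?is = "rev coords :: 'n list"
 have d: "distinct ?is" and set: "set ?is = UNIV" using coords by auto
 have sl: "sum_list (map \<gamma> (coords :: 'n list)) = mi_abs \<gamma>" for \<gamma> unfolding sum_list_distinct_conv_sum_set[OF coords(1)] coords(2) by (simp add: mi_abs_def)
 have "norm (foldr partial [] F (x0 + (\<Sum>i\<in>set ?is. (h $ i) *\<^sub>R axis i 1)) - tpoly F x0 h ?is s []) <= tconst s (length ?is) * \<omega> * norm h ^ s" proof (rule taylor_coordinates[OF ex S \<omega> d])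
  fix \<gamma> z assume "sum_list (map \<gamma> (rev ?is)) + length ([]::'n list) = s" "norm (z - x0) <= norm h"
  then show "norm (foldr partial (mi_list \<gamma> (rev ?is) @ []) F z - foldr partial (mi_list \<gamma> (rev ?is) @ []) F x0) <= \<omega>" using osc[of \<gamma> z] by (simp add: mpartial_eq sl)
 qed simp
 moreover have "(\<Sum>i\<in>set ?is. (h $ i) *\<^sub>R axis i 1) = h" unfolding set using basis_expansion[of h] by (simp add: scalar_mult_eq_scaleR)
 moreover have "length ?is = CARD('n)" using distinct_card[OF d] set by simp
 moreover have "tpoly F x0 h ?is s [] = taylor s F x0 (x0 + h)" proof -
  have "mi_set ?is s = {\<gamma>. mi_abs \<gamma> <= s}" using set by (simp add: mi_set_def mi_abs_def)
  moreover have "(\<Prod>i\<in>UNIV. complex_of_real ((h $ i) ^ \<gamma> i / fact (\<gamma> i))) = of_real (mi_pow h \<gamma>) / of_real (mi_fact \<gamma>)" for \<gamma> by (simp add: mi_pow_def mi_fact_def prod_dividef)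
  ultimately show ?thesis unfolding tpoly_eq[OF d] set taylor_def by (intro sum.cong) (auto simp: mpartial_eq)
 qed
 ultimately show ?thesis by simp
qed

definition kernel_const :: "nat => real => (real ^ 'n => real ^ 'n => complex) => real => bool" where
 "kernel_const s \<delta> K C \<longleftrightarrow> (\<forall>\<gamma>. mi_abs \<gamma> <= s -->
    (\<forall>x y. x ~= y -->
    norm (mpartial \<gamma> (%u. K u y) x) <= C / norm (x - y) ^ (CARD('n) + mi_abs \<gamma>) &
    norm (mpartial \<gamma> (%v. K x v) y) <= C / norm (x - y) ^ (CARD('n) + mi_abs \<gamma>)) &
    (\<forall>x y z. x ~= y & norm (x - y) \<ge> 2 * norm (y - z) -->
    norm (mpartial \<gamma> (%v. K x v) y - mpartial \<gamma> (%v. K x v) z)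
    <= C * (norm (y - z) powr \<delta> / norm (x - y) powr (real CARD('n) + real (mi_abs \<gamma>) + \<delta>)) &
    norm (mpartial \<gamma> (%u. K u x) y - mpartial \<gamma> (%u. K u x) z)
    <= C * (norm (y - z) powr \<delta> / norm (x - y) powr (real CARD('n) + real (mi_abs \<gamma>) + \<delta>))))"

lemma kernel_const_exists: "standard_kernel s \<delta> K ==> \<exists>C>0. kernel_const s \<delta> K C" unfolding standard_kernel_def kernel_const_def by blast

text \<open>The remainder only involves the oscillation of the derivatives of order \<open>s\<close>, which the regularity condition
  bounds on the ball of radius \<open>\<bar>x - c\<bar> / 2\<close> about \<open>c\<close>.\<close>

lemma kernel_taylor:
 fixes K :: "real ^ 'n => real ^ 'n => complex"
 assumes K: "standard_kernel s \<delta> K" and \<delta>: "0 < \<delta>"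
 shows "\<exists>C>0. (\<forall>x c z. x ~= c --> 2 * norm (z - c) <= norm (x - c) -->
   norm (K x z - taylor s (%v. K x v) c z) <= C * (norm (z - c) powr (real s + \<delta>) / norm (x - c) powr (real CARD('n) + real s + \<delta>))) &
  (\<forall>\<gamma> x c. mi_abs \<gamma> <= s --> x ~= c --> norm (mpartial \<gamma> (%v. K x v) c) <= C / norm (x - c) ^ (CARD('n) + mi_abs \<gamma>))" proof -
 obtain C where C0: "0 < C" "kernel_const s \<delta> K C" using kernel_const_exists[OF K] by blast
 note C = C0(1) C0(2)[unfolded kernel_const_def, rule_format]
 have ex: "partials_exist_on s (- {x}) (%y. K x y)" for x using K unfolding standard_kernel_def by blast
 define C' where "C' = max C (tconst s CARD('n) * C)"
 show ?thesis proof (intro exI[of _ C'] conjI allI impI)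
  show "0 < C'" using C(1) by (simp add: C'_def)
  show "norm (mpartial \<gamma> (%v. K x v) c) <= C' / norm (x - c) ^ (CARD('n) + mi_abs \<gamma>)" if "mi_abs \<gamma> <= s" "x ~= c" for \<gamma> x c proof -
   have "norm (mpartial \<gamma> (%v. K x v) c) <= C / norm (x - c) ^ (CARD('n) + mi_abs \<gamma>)" using C(2)[OF that(1)] that(2) by blast
   also have "... <= C' / norm (x - c) ^ (CARD('n) + mi_abs \<gamma>)" by (intro divide_right_mono) (auto simp: C'_def)
   finally show ?thesis .
  qed
  fix x c z :: "real ^ 'n" assume xc: "x ~= c" and far: "2 * norm (z - c) <= norm (x - c)"
  define h where "h = z - c"
  define \<omega> where "\<omega> = C * (norm h powr \<delta> / norm (x - c) powr (real CARD('n) + real s + \<delta>))"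
  have \<omega>: "0 <= \<omega>" using C(1) by (simp add: \<omega>_def)
  have "norm (K x (c + h) - taylor s (%v. K x v) c (c + h)) <= tconst s CARD('n) * \<omega> * norm h ^ s" proof (rule taylor_remainder[OF ex[of x] _ \<omega>])
   have "0 < norm (x - c)" using xc by simp
   then have "norm h < norm (x - c)" using far norm_ge_zero[of h] unfolding h_def by linarith
   then show "cball c (norm h) \<subseteq> - {x}" by (auto simp: dist_norm norm_minus_commute)
   fix \<gamma> :: "'n => nat" and w assume g: "mi_abs \<gamma> = s" and w: "norm (w - c) <= norm h"
   have "norm (mpartial \<gamma> (%v. K x v) c - mpartial \<gamma> (%v. K x v) w) <= C * (norm (c - w) powr \<delta> / norm (x - c) powr (real CARD('n) + real (mi_abs \<gamma>) + \<delta>))" proof -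
    have "2 * norm (c - w) <= norm (x - c)" using far w unfolding h_def by (simp add: norm_minus_commute)
    then show ?thesis using C(2)[OF eq_imp_le[OF g]] xc by blast
   qed
   also have "... <= \<omega>" unfolding \<omega>_def g using w C(1) \<delta> by (intro mult_left_mono divide_right_mono powr_mono2) (auto simp: norm_minus_commute)
   finally show "norm (mpartial \<gamma> (%v. K x v) w - mpartial \<gamma> (%v. K x v) c) <= \<omega>" by (simp add: norm_minus_commute)
  qed
  also have "tconst s CARD('n) * \<omega> * norm h ^ s = tconst s CARD('n) * C * (norm h powr (real s + \<delta>) / norm (x - c) powr (real CARD('n) + real s + \<delta>))" proof (cases "h = 0")
   case False
   then have "norm h powr (real s + \<delta>) = norm h ^ s * norm h powr \<delta>" by (simp add: powr_add powr_realpow)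
   then show ?thesis by (simp add: \<omega>_def)
  qed (use \<delta> in "simp add: \<omega>_def")
  also have "... <= C' * (norm h powr (real s + \<delta>) / norm (x - c) powr (real CARD('n) + real s + \<delta>))" by (intro mult_right_mono) (auto simp: C'_def)
  finally show "norm (K x z - taylor s (%v. K x v) c z) <= C' * (norm (z - c) powr (real s + \<delta>) / norm (x - c) powr (real CARD('n) + real s + \<delta>))" by (simp add: h_def)
 qed
qed


section \<open>Growth of the quasi-norm on balls\<close>

lemma bqb_D:
 assumes "ball_quasi_banach N"
 shows "f : Lmeas ==> N (%x. c * f x) = ennreal (norm c) * N f"
  and "f : Lmeas ==> N f = 0 ==> (AEL x. f x = 0)"
  and "f : Lmeas ==> g : Lmeas ==> (!!x. norm (g x) <= norm (f x)) ==> N g <= N f"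
  and "0 < r ==> N (ind (ball c' r)) < top" using assms unfolding ball_quasi_banach_def by blast+

lemma indicator_ball_measurable: "(ind (ball c r) :: 'a::euclidean_space => complex) : Lmeas" by (intro borel_measurable_indicator) simp

lemma bqb_ball_pos:
 fixes N :: "(real ^ 'n => complex) => ennreal"
 assumes N: "ball_quasi_banach N" and r: "0 < r"
 shows "N (ind (ball c r)) ~= 0" proof
 assume "N (ind (ball c r)) = 0"
 then have "AEL x. (ind (ball c r) x :: complex) = 0" by (rule bqb_D(2)[OF N indicator_ball_measurable])
 then have "AEL x. x ~: ball c r" by eventually_elim (auto simp: indicator_def)
 then show False using not_AE_outside_ball[OF r] by blast
qed

lemma ennpowr_ennreal: "0 <= x ==> ennpowr (ennreal x) a = ennreal (x powr a)" by (simp add: ennpowr_def)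

lemma ennpowr_indicator: "ennpowr (ind S x) a = ind S x" using ennpowr_ennreal[of 1 a] ennpowr_ennreal[of 0 a] by (auto simp: indicator_def)

lemma borel_measurable_ennpowr [measurable]:
 assumes [measurable]: "f : borel_measurable M"
 shows "(%x. ennpowr (f x) a) : borel_measurable M" unfolding ennpowr_def by measurable

text \<open>The maximal function of \<open>1\<^sub>B\<close> is at least \<open>2\<^sup>-\<^sup>k\<^sup>n\<close> on \<open>2\<^sup>k B\<close>. The vector-valued inequality is applied to the
  sequence \<open>1\<^sub>B, 0, 0, \<dots>\<close>, and the exponent \<open>p\<close> comes from the convexification.\<close>

lemma bqb_ball_growth:
 fixes N :: "(real ^ 'n => complex) => ennreal"
 assumes N: "ball_quasi_banach N" and FS: "fefferman_stein N p0" and p: "0 < p" "p < p0"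
 shows "\<exists>C>0. \<forall>c r k. 0 < r -->
  enn2real (N (ind (ball c (2 ^ k * r)))) <= C * 2 powr (real k * real CARD('n) / p) * enn2real (N (ind (ball c r)))" proof -
 obtain C where C: "0 < C" "!!f :: nat => real ^ 'n => complex. (\<forall>j. f j : Lmeas) ==>
    convexification_norm N (1 / p) (%x. ennpowr (\<Sum>j. ennpowr (hl_maximal (f j) x) 2) (1 / 2))
    <= ennreal C * convexification_norm N (1 / p)
    (%x. ennpowr (\<Sum>j. ennpowr (ennreal (norm (f j x))) 2) (1 / 2))" proof -
  have "\<exists>C::real. C > 0 & (\<forall>f :: nat => real ^ 'n => complex. (\<forall>j. f j : Lmeas) -->
    convexification_norm N (1 / p) (%x. ennpowr (\<Sum>j. ennpowr (hl_maximal (f j) x) 2) (1 / 2))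
    <= ennreal C * convexification_norm N (1 / p)
    (%x. ennpowr (\<Sum>j. ennpowr (ennreal (norm (f j x))) 2) (1 / 2)))" using FS[unfolded fefferman_stein_def, rule_format, of p 2] p by simp
  then show ?thesis using that by blast
 qed
 have main: "enn2real (N (ind (ball c (2 ^ k * r)))) <= C powr (1 / p) * 2 powr (real k * real CARD('n) / p) * enn2real (N (ind (ball c r)))"
  if r: "0 < r" for c :: "real ^ 'n" and r :: real and k :: nat proof -
  let ?B = "ball c r" and ?B' = "ball c (2 ^ k * r)"
  have r': "0 < 2 ^ k * r" using r by simp
  define f :: "nat => real ^ 'n => complex" where "f j = (if j = 0 then ind ?B else (%_. 0))" for j
  define a where "a = enn2real (N (ind ?B'))"
  define b where "b = enn2real (N (ind ?B))"
  have a: "N (ind ?B') = ennreal a" "0 <= a" using bqb_D(4)[OF N r', of c] by (simp_all add: a_def)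
  have b: "N (ind ?B) = ennreal b" "0 <= b" using bqb_D(4)[OF N r, of c] by (simp_all add: b_def)
  have single: "(\<Sum>j. g j) = g 0" if "!!j. j ~= 0 ==> g j = 0" for g :: "nat => ennreal" using suminf_finite[of "{0}" g] that by simp
  have hl0: "hl_maximal (%_. 0) x = 0" for x :: "real ^ 'n" using hl_maximal_le_bound[of "%_. 0" 0 x] by simp
  have z2: "ennpowr 0 2 = 0" using ennpowr_ennreal[of 0 2] by simp
  define m where "m x = enn2real (hl_maximal (ind ?B) x)" for x
  have hm: "hl_maximal (ind ?B) x = ennreal (m x)" "0 <= m x" for x proof -
   have "hl_maximal (ind ?B) x <= ennreal 1" by (rule hl_maximal_le_bound) (simp add: indicator_def)
   then have "hl_maximal (ind ?B) x < top" by (simp add: le_less_trans)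
   then show "hl_maximal (ind ?B) x = ennreal (m x)" "0 <= m x" by (simp_all add: m_def)
  qed
  have rhs: "convexification_norm N (1 / p) (%x. ennpowr (\<Sum>j. ennpowr (ennreal (norm (f j x))) 2) (1 / 2)) = ennreal (b powr p)" proof -
   have si: "(\<Sum>j. ennpowr (ennreal (norm (f j x))) 2) = ind ?B x" for x proof -
    have "(\<Sum>j. ennpowr (ennreal (norm (f j x))) 2) = ennpowr (ennreal (norm (f 0 x))) 2" by (rule single) (simp add: f_def z2)
    also have "ennreal (norm (f 0 x)) = ind ?B x" by (simp add: f_def indicator_def)
    finally show ?thesis by (simp add: ennpowr_indicator)
   qed
   have "convexification_norm N (1 / p) (%x. ennpowr (\<Sum>j. ennpowr (ennreal (norm (f j x))) 2) (1 / 2)) =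
    ennpowr (N (%x. complex_of_real (enn2real (ind ?B x)))) p" proof -
    have "ind ?B x < (top :: ennreal)" for x by (simp add: indicator_def)
    then have "AEL x. ind ?B x < (top :: ennreal)" by simp
    then show ?thesis by (simp add: si convexification_norm_def ext_norm_def ennpowr_indicator)
   qed
   also have "(%x. complex_of_real (enn2real (ind ?B x))) = ind ?B" by (auto simp: indicator_def)
   finally show ?thesis using b by (simp add: ennpowr_ennreal)
  qed
  have lhs: "convexification_norm N (1 / p) (%x. ennpowr (\<Sum>j. ennpowr (hl_maximal (f j) x) 2) (1 / 2)) =
    ennpowr (N (%x. complex_of_real (m x powr (1 / p)))) p" proof -
   have "ennpowr (\<Sum>j. ennpowr (hl_maximal (f j) x) 2) (1 / 2) = ennreal (m x)" for x proof -
    have "(\<Sum>j. ennpowr (hl_maximal (f j) x) 2) = ennpowr (hl_maximal (f 0) x) 2" by (rule single) (simp add: f_def hl0 z2)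
    also have "... = ennreal (m x powr 2)" using hm[of x] by (simp add: f_def ennpowr_ennreal)
    finally show ?thesis using hm(2)[of x] by (simp add: ennpowr_ennreal powr_powr del: powr_numeral)
   qed
   then show ?thesis using hm(2) by (simp add: convexification_norm_def ext_norm_def ennpowr_ennreal)
  qed
  have m_low: "(1 / 2 ^ k) ^ CARD('n) <= m x" if x: "x : ?B'" for x proof -
   have "vol ?B <= (\<I> y. ennreal (norm (ind ?B y :: complex)) * ind ?B' y)" proof -
    have "r <= 2 ^ k * r" using r by simp
    then have sub: "?B \<subseteq> ?B'" by auto
    have "vol ?B = (\<I> y. ind ?B y)" by simp
    also have "... <= (\<I> y. ennreal (norm (ind ?B y :: complex)) * ind ?B' y)" using sub by (intro nn_integral_mono) (auto simp: indicator_def)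
    finally show ?thesis .
   qed
   also have "... <= hl_maximal (ind ?B) x * vol ?B'" by (rule hl_maximal_ge[OF r' x])
   finally have "ennreal (unit_ball_vol (real CARD('n)) * r ^ CARD('n)) <= ennreal (m x) * ennreal (unit_ball_vol (real CARD('n)) * (2 ^ k * r) ^ CARD('n))" unfolding hm using r by (simp add: emeasure_lebesgue_ball)
   then have "unit_ball_vol (real CARD('n)) * r ^ CARD('n) <= m x * (unit_ball_vol (real CARD('n)) * (2 ^ k * r) ^ CARD('n))" using hm(2)[of x] r by (simp add: ennreal_mult[symmetric])
   then have "1 <= m x * (2 ^ k) ^ CARD('n)" using r by (simp add: power_mult_distrib mult.left_commute[of "m x"] mult.commute)
   then show ?thesis by (simp add: power_one_over divide_le_eq)
  qed
  define t where "t = ((1 / 2 ^ k) ^ CARD('n)) powr (1 / p)"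
  have t: "0 < t" by (simp add: t_def)
  have tp: "t = 2 powr (- (real k * real CARD('n) / p))" proof -
   have "(1 / 2 ^ k :: real) ^ CARD('n) = 2 powr (- (real k * real CARD('n)))" by (simp add: powr_minus_divide power_one_over powr_realpow[symmetric] powr_powr flip: power_mult)
   then show ?thesis by (simp add: t_def powr_powr)
  qed
  have mm: "(%x. complex_of_real (m x powr (1 / p))) : Lmeas" unfolding m_def by measurable
  have "ennreal t * ennreal a = N (%x. complex_of_real t * ind ?B' x)" unfolding a(1)[symmetric] using bqb_D(1)[OF N indicator_ball_measurable, of "complex_of_real t"] t by simp
  also have "... <= N (%x. complex_of_real (m x powr (1 / p)))" proof (rule bqb_D(3)[OF N mm])
   show "(%x. complex_of_real t * ind ?B' x) : Lmeas" by (intro borel_measurable_times indicator_ball_measurable) simp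
   show "norm (complex_of_real t * ind ?B' x) <= norm (complex_of_real (m x powr (1 / p)))" for x proof (cases "x : ?B'")
    case True
    then have "t <= m x powr (1 / p)" unfolding t_def using m_low[OF True] p by (intro powr_mono2) auto
    then show ?thesis using t by (simp add: norm_mult indicator_def)
   qed simp
  qed
  finally have le: "ennreal (t * a) <= N (%x. complex_of_real (m x powr (1 / p)))" (is "_ <= ?M") using t a by (simp add: ennreal_mult)
  have "\<forall>j. f j : Lmeas" using indicator_ball_measurable[of c r] by (auto simp: f_def)
  from C(2)[OF this] have fs: "ennpowr ?M p <= ennreal C * ennreal (b powr p)" unfolding lhs rhs .
  have "?M ~= top" proof
   assume "?M = top"
   then have "top <= ennreal C * ennreal (b powr p)" using fs by (simp add: ennpowr_def)
   then show False by (simp add: ennreal_mult_eq_top_iff top_unique)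
  qed
  then obtain M where M: "?M = ennreal M" "0 <= M" by (cases ?M) auto
  have "t * a <= M" using le M t a by simp
  then have "(t * a) powr p <= M powr p" using t a p by (intro powr_mono2) auto
  also have "M powr p <= C * b powr p" using fs M C(1) b by (simp add: ennpowr_ennreal ennreal_mult[symmetric])
  finally have "((t * a) powr p) powr (1 / p) <= (C * b powr p) powr (1 / p)" using p by (intro powr_mono2) auto
  then have "t * a <= C powr (1 / p) * b" using t a b p C(1) by (simp add: powr_powr powr_mult)
  then have "(1 / t) * (t * a) <= (1 / t) * (C powr (1 / p) * b)" using t by (intro mult_left_mono) auto
  moreover have "1 / t = 2 powr (real k * real CARD('n) / p)" unfolding tp by (simp add: powr_minus_divide)
  moreover have "(1 / t) * (t * a) = a" using t by simp
  ultimately have "a <= 2 powr (real k * real CARD('n) / p) * (C powr (1 / p) * b)" by (simp only:)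
  then show ?thesis unfolding a_def b_def by (simp only: mult_ac)
 qed
 show ?thesis by (rule exI[of _ "C powr (1 / p)"]) (use main C(1) in auto)
qed


section \<open>Campanato functions: oscillation, telescoping and decay\<close>

lemma lpow_add_le:
 assumes [measurable]: "f : Lmeas" "g : Lmeas" and q: "0 < q"
 shows "lpow q (%x. f x + g x) <= ennreal (3 powr q) * (lpow q f + lpow q g)" proof -
 have "lpow q (%x. f x + g x) <= (\<I> x. ennreal (3 powr q) * (ennreal (norm (f x) powr q) + ennreal (norm (g x) powr q)))" unfolding lpow_def proof (intro nn_integral_mono)
  fix x
  have "norm (f x + g x) powr q <= (norm (f x) + norm (g x) + 0) powr q" using q norm_triangle_ineq[of "f x" "g x"] by (intro powr_mono2) auto
  also have "... <= 3 powr q * (norm (f x) powr q + norm (g x) powr q + 0 powr q)" by (rule powr_add_le) (use q in auto)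
  finally have "ennreal (norm (f x + g x) powr q) <= ennreal (3 powr q * (norm (f x) powr q + norm (g x) powr q))" by (intro ennreal_leI) simp
  then show "ennreal (norm (f x + g x) powr q) <= ennreal (3 powr q) * (ennreal (norm (f x) powr q) + ennreal (norm (g x) powr q))" by (simp add: ennreal_mult')
 qed
 also have "... = ennreal (3 powr q) * (\<I> x. ennreal (norm (f x) powr q) + ennreal (norm (g x) powr q))" by (rule nn_integral_cmult) measurable
 also have "(\<I> x. ennreal (norm (f x) powr q) + ennreal (norm (g x) powr q)) = lpow q f + lpow q g" unfolding lpow_def by (rule nn_integral_add) measurable
 finally show ?thesis .
qed

lemma lpow_minus: "lpow q (%x. - f x) = lpow q f" by (simp add: lpow_def)

lemma Lq_loc_iff:
 fixes f :: "real ^ 'n => complex"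
 assumes q: "0 < q"
 shows "f : Lq_loc q \<longleftrightarrow> f : Lmeas & (\<forall>c r. lpow q (%x. ind (ball c r) x * f x) < top)" proof safe
 assume f: "f : Lq_loc q"
 then show [measurable]: "f : Lmeas" by (simp add: Lq_loc_def)
 fix c :: "real ^ 'n" and r
 have "set_integrable lebesgue (cball c r) (%x. norm (f x) powr q)" using f by (simp add: Lq_loc_def)
 then have "(\<I> x. ennreal (norm (ind (cball c r) x *\<^sub>R (norm (f x) powr q)))) < top" unfolding set_integrable_def integrable_iff_bounded by simp
 moreover have "lpow q (%x. ind (ball c r) x * f x) <= (\<I> x. ennreal (norm (ind (cball c r) x *\<^sub>R (norm (f x) powr q))))" unfolding lpow_def using q by (intro nn_integral_mono) (auto simp: indicator_def)
 ultimately show "lpow q (%x. ind (ball c r) x * f x) < top" by (simp add: le_less_trans)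
next
 assume [measurable]: "f : Lmeas" and fin: "\<forall>c r. lpow q (%x. ind (ball c r) x * f x) < top"
 have "set_integrable lebesgue S (%x. norm (f x) powr q)" if S: "compact S" for S proof -
  have [measurable]: "S : sets lebesgue" using S by (simp add: lmeasurable_compact fmeasurableD)
  obtain r where r: "S \<subseteq> ball 0 r" using compact_imp_bounded[OF S] bounded_subset_ballD[of S 0] by blast
  have "(\<I> x. ennreal (norm (ind S x *\<^sub>R (norm (f x) powr q)))) <= lpow q (%x. ind (ball 0 r) x * f x)" unfolding lpow_def using r by (intro nn_integral_mono) (auto simp: indicator_def)
  then show ?thesis unfolding set_integrable_def integrable_iff_bounded using fin by (auto simp: le_less_trans)
 qed
 then show "f : Lq_loc q" by (simp add: Lq_loc_def)
qed

lemma Lq_loc_integrable: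
 fixes f :: "real ^ 'n => complex"
 assumes f: "f : Lq_loc q" and q: "1 < q"
 shows "Lint (%x. ind (ball c r) x * f x)" proof (rule lpow_ball_integrable[OF _ q, of _ c r])
 have "0 < q" using q by simp
 note iff = Lq_loc_iff[OF this, THEN iffD1, OF f]
 then show "lpow q (%x. ind (ball c r) x * f x) < top" by blast
 have [measurable]: "f : Lmeas" using iff by blast
 show "(%x. ind (ball c r) x * f x) : Lmeas" by measurable
qed simp

lemma poly_Lq_loc: "P : poly_space s ==> 0 < q ==> P : Lq_loc q" by (simp add: Lq_loc_iff measurable_poly_space lpow_finite continuous_ball_Linf_c continuous_poly_space)

lemma Lq_loc_diff:
 fixes f g :: "real ^ 'n => complex"
 assumes f: "f : Lq_loc q" and g: "g : Lq_loc q" and q: "0 < q"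
 shows "(%x. f x - g x) : Lq_loc q" proof -
 note iff = Lq_loc_iff[OF q, THEN iffD1]
 have [measurable]: "f : Lmeas" "g : Lmeas" using iff f g by blast+
 have "lpow q (%x. ind (ball c r) x * (f x - g x)) < top" for c r proof -
  have "lpow q (%x. ind (ball c r) x * f x + - (ind (ball c r) x * g x)) <=
   ennreal (3 powr q) * (lpow q (%x. ind (ball c r) x * f x) + lpow q (%x. - (ind (ball c r) x * g x)))" by (intro lpow_add_le q) measurable
  also have "... < top" using iff[OF f] iff[OF g] by (simp add: lpow_minus ennreal_mult_less_top)
  finally show ?thesis by (simp add: algebra_simps)
 qed
 then show ?thesis by (simp add: Lq_loc_iff[OF q])
qed

lemma borel_measurable_by_balls:
 fixes F :: "real ^ 'n => complex"
 assumes "!!k::nat. (%x. ind (ball c (real k)) x * F x) : Lmeas"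
 shows "F : Lmeas" proof (rule borel_measurable_LIMSEQ_metric[OF assms])
 fix y
 obtain k0 where k0: "dist c y < real k0" using reals_Archimedean2 by blast
 have "\<forall>\<^sub>F k in sequentially. ind (ball c (real k)) y * F y = F y" by (rule eventually_mono[OF eventually_ge_at_top[of k0]]) (use k0 in simp)
 then show "(%k. ind (ball c (real k)) y * F y) ----> F y" by (rule tendsto_eventually)
qed

lemma proj_bound_D:
 fixes g :: "real ^ 'n => complex"
 assumes "proj_bound s TYPE('n) C" "0 < r" "Lint (%x. ind (ball c r) x * g x)"
 shows "proj s c r g : poly_space s"
  and "Q : poly_space s ==> (\<L> x. ind (ball c r) x * ((g x - proj s c r g x) * Q x)) = 0"
  and "norm (proj s c r g x) <=
    C * (1 + norm (x - c) / r) ^ s * ((\<L> y. norm (ind (ball c r) y * g y)) / r ^ CARD('n))" using assms unfolding proj_bound_def by blast+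

text \<open>The \<open>q\<close>-th power of the local oscillation in the Campanato norm.\<close>

definition osc :: "real => nat => (real ^ 'n => complex) => real ^ 'n => real => ennreal" where
 "osc q s f c r = lpow q (%x. ind (ball c r) x * (f x - proj s c r f x))"

lemma osc_integral:
 fixes f :: "real ^ 'n => complex"
 assumes pb: "proj_bound s TYPE('n) Cp" and f: "f : Lq_loc q" and q: "1 < q" and r: "0 < r"
 shows "osc q s f c r < top"
  and "(LINT x:ball c r|lebesgue. norm (f x - proj s c r f x) powr q) = enn2real (osc q s f c r)" proof -
 have q0: "0 < q" using q by simp
 have P: "proj s c r f : poly_space s" by (rule proj_bound_D(1)[OF pb r Lq_loc_integrable[OF f q]])
 have d: "(%x. f x - proj s c r f x) : Lq_loc q" by (intro Lq_loc_diff f poly_Lq_loc[OF P] q0)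
 note iff = Lq_loc_iff[OF q0, THEN iffD1, OF d]
 then show "osc q s f c r < top" unfolding osc_def by blast
 have [measurable]: "(%x. f x - proj s c r f x) : Lmeas" using iff by blast
 have "(LINT x:ball c r|lebesgue. norm (f x - proj s c r f x) powr q) =
  (\<L> x. norm (ind (ball c r) x * (f x - proj s c r f x)) powr q)" unfolding set_lebesgue_integral_def using q by (intro Lintegral_cong) (auto simp: indicator_def)
 also have "... = enn2real (osc q s f c r)" unfolding osc_def lpow_def by (subst integral_eq_nn_integral) auto
 finally show "(LINT x:ball c r|lebesgue. norm (f x - proj s c r f x) powr q) = enn2real (osc q s f c r)" .
qed

lemma campanato_term:
 fixes f :: "real ^ 'n => complex"
 assumes N: "ball_quasi_banach N" and pb: "proj_bound s TYPE('n) Cp" and f: "f : Lq_loc q" and q: "1 < q" and r: "0 < r"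
 shows "vol (ball c r) / N (ind (ball c r)) *
    ennreal ((1 / measure lebesgue (ball c r) *
    (LINT x:ball c r|lebesgue. norm (f x - proj s c r f x) powr q)) powr (1 / q))
  = ennreal (measure lebesgue (ball c r) / enn2real (N (ind (ball c r))) * (enn2real (osc q s f c r) / measure lebesgue (ball c r)) powr (1 / q))" proof -
 have E: "vol (ball c r) = ennreal (measure lebesgue (ball c r))" using emeasure_ball_pos_finite(2)[OF r, of c] by (intro emeasure_eq_ennreal_measure) auto
 have Nf: "N (ind (ball c r)) = ennreal (enn2real (N (ind (ball c r))))" using bqb_D(4)[OF N r, of c] by simp
 have "0 < enn2real (N (ind (ball c r)))" using bqb_ball_pos[OF N r, of c] bqb_D(4)[OF N r, of c] by (simp add: enn2real_positive_iff less_top zero_less_iff_neq_zero)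
 then have "vol (ball c r) / N (ind (ball c r)) = ennreal (measure lebesgue (ball c r) / enn2real (N (ind (ball c r))))" unfolding E by (subst Nf) (rule divide_ennreal, auto)
 then show ?thesis unfolding osc_integral(2)[OF pb f q r] by (simp add: ennreal_mult'[symmetric])
qed

lemma measure_ball_pos: "0 < r ==> 0 < measure lebesgue (ball (c :: real ^ 'n) r)" by (simp add: measure_lebesgue_ball)

lemma campanato_osc:
 fixes f :: "real ^ 'n => complex"
 assumes N: "ball_quasi_banach N" and pb: "proj_bound s TYPE('n) Cp" and f: "f : campanato N q s" and q: "1 < q" and r: "0 < r"
 shows "osc q s f c r <= ennreal ((enn2real (campanato_norm N q s f) * enn2real (N (ind (ball c r))) / measure lebesgue (ball c r)) powr q * measure lebesgue (ball c r))" proof -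
 define nf where "nf = enn2real (campanato_norm N q s f)"
 define m where "m = measure lebesgue (ball c r)"
 define b where "b = enn2real (N (ind (ball c r)))"
 define I where "I = enn2real (osc q s f c r)"
 have fL: "f : Lq_loc q" and fin: "campanato_norm N q s f < top" using f by (auto simp: campanato_def)
 have nf: "campanato_norm N q s f = ennreal nf" "0 <= nf" using fin by (simp_all add: nf_def)
 have m: "0 < m" unfolding m_def by (rule measure_ball_pos[OF r])
 have b: "0 < b" unfolding b_def using bqb_ball_pos[OF N r, of c] bqb_D(4)[OF N r, of c] by (simp add: enn2real_positive_iff less_top zero_less_iff_neq_zero)
 have I: "osc q s f c r = ennreal I" "0 <= I" using osc_integral(1)[OF pb fL q r, of c] by (simp_all add: I_def)
 have "ennreal (m / b * (I / m) powr (1 / q)) <= campanato_norm N q s f" unfolding m_def b_def I_def campanato_term[OF N pb fL q r, symmetric] campanato_norm_def by (rule SUP_upper2[of "(c, r)"]) (use r in auto)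
 then have "m / b * (I / m) powr (1 / q) <= nf" using nf by simp
 then have "b / m * (m / b * (I / m) powr (1 / q)) <= b / m * nf" using m b by (intro mult_left_mono) auto
 then have "(I / m) powr (1 / q) <= nf * b / m" using m b by (simp add: mult.commute)
 then have "((I / m) powr (1 / q)) powr q <= (nf * b / m) powr q" using q by (intro powr_mono2) auto
 then have "I / m <= (nf * b / m) powr q" using q m I(2) by (simp add: powr_powr)
 then have "I <= (nf * b / m) powr q * m" using m by (simp add: divide_le_eq)
 then show ?thesis unfolding I(1) nf_def m_def b_def by (rule ennreal_leI)
qed

lemma campanato_norm_le:
 fixes f :: "real ^ 'n => complex"
 assumes N: "ball_quasi_banach N" and pb: "proj_bound s TYPE('n) Cp" and f: "f : Lq_loc q" and q: "1 < q" and X: "0 <= X"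
  and le: "!!c r. 0 < r ==> osc q s f c r <= ennreal ((X * enn2real (N (ind (ball c r))) / measure lebesgue (ball c r)) powr q * measure lebesgue (ball c r))"
 shows "campanato_norm N q s f <= ennreal X" unfolding campanato_norm_def proof (rule SUP_least, clarify)
 fix c :: "real ^ 'n" and r :: real assume r: "0 < r"
 define m where "m = measure lebesgue (ball c r)"
 define b where "b = enn2real (N (ind (ball c r)))"
 define I where "I = enn2real (osc q s f c r)"
 have m: "0 < m" unfolding m_def by (rule measure_ball_pos[OF r])
 have b: "0 < b" unfolding b_def using bqb_ball_pos[OF N r, of c] bqb_D(4)[OF N r, of c] by (simp add: enn2real_positive_iff less_top zero_less_iff_neq_zero)
 have "I <= (X * b / m) powr q * m" unfolding I_def m_def b_def using le[OF r, of c] by (intro enn2real_leI) auto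
 then have "I / m <= (X * b / m) powr q" using m by (simp add: divide_le_eq)
 then have "(I / m) powr (1 / q) <= ((X * b / m) powr q) powr (1 / q)" using q m by (intro powr_mono2) (auto simp: I_def)
 also have "... = X * b / m" using q m b X by (simp add: powr_powr)
 finally have "m / b * (I / m) powr (1 / q) <= m / b * (X * b / m)" using m b by (intro mult_left_mono) auto
 then have "m / b * (I / m) powr (1 / q) <= X" using m b by simp
 then show "vol (ball c r) / N (ind (ball c r)) *
    ennreal ((1 / measure lebesgue (ball c r) *
    (LINT x:ball c r|lebesgue. norm (f x - proj s c r f x) powr q)) powr (1 / q)) <= ennreal X" unfolding campanato_term[OF N pb f q r] m_def b_def I_def by (rule ennreal_leI)
qed

definition osc1 :: "nat => (real ^ 'n => complex) => real ^ 'n => real => real" where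
 "osc1 s f c r = (\<L> x. norm (ind (ball c r) x * (f x - proj s c r f x)))"

definition telescope_bound :: "nat => real => real => 'n::finite itself => real => bool" where
 "telescope_bound s \<delta> \<beta> _ C \<longleftrightarrow> (\<forall>(f :: real ^ 'n => complex) c r W. 0 < r --> 0 <= W -->
  (\<forall>\<rho>. Lint (%x. ind (ball c \<rho>) x * f x)) -->
  (\<forall>k. osc1 s f c (2 ^ k * r) <= W * 2 powr (real k * \<beta>) * (2 ^ k * r) ^ CARD('n)) -->
  (\<forall>x\<in>ball c (2 * r). norm (proj s c (2 * r) f x - proj s c r f x) <= C * W) &
  (\<I> y. ennreal (norm (f y - proj s c r f y)) * ennreal (1 / norm (y - c) powr (real CARD('n) + (real s + \<delta>))) * ind (- ball c r) y)
   <= ennreal (C * W / r powr (real s + \<delta>)))"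

text \<open>The projections on consecutive balls \<open>2\<^sup>k B\<close> differ by at most the oscillation on the larger one, and summing these
  differences compares \<open>f - P\<^sub>B f\<close> with \<open>f - P\<close> for the projection on \<open>2\<^sup>k B\<close>. The polynomials themselves grow like
  \<open>2\<^sup>k\<^sup>s\<close>, so the exponent \<open>s + \<delta>\<close> of the weight has to exceed both \<open>s\<close> and \<open>\<beta>\<close>.\<close>

lemma campanato_telescope:
 assumes pb: "proj_bound s TYPE('n::finite) Cp" and \<beta>: "\<beta> < real s + \<delta>" and \<delta>: "0 < \<delta>"
 shows "\<exists>C>0. telescope_bound s \<delta> \<beta> TYPE('n) C" proof -
 let ?n = "CARD('n)" and ?V = "unit_ball_vol (real CARD('n))"
 have V: "0 < ?V" by simp
 have Cp: "0 < Cp" using pb by (simp add: proj_bound_def)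
 define m where "m = max (real s) \<beta>"
 \<comment> \<open>The exponent of growth: any number strictly between \<open>max s \<beta>\<close> and \<open>s + \<delta>\<close> leads to geometric series.\<close>
 define \<theta> where "\<theta> = (m + (real s + \<delta>)) / 2"
 have m: "m < real s + \<delta>" using \<beta> \<delta> by (simp add: m_def)
 then have \<theta>: "m < \<theta>" "\<theta> < real s + \<delta>" by (auto simp: \<theta>_def)
 have ms: "real s <= m" "\<beta> <= m" by (auto simp: m_def)
 define G where "G = (\<Sum>k::nat. 2 powr (- (\<theta> - m) * real k))"
 define H where "H = (\<Sum>k::nat. 2 powr (- (real s + \<delta> - \<theta>) * real k))"
 have Gs: "summable (%k::nat. 2 powr (- (\<theta> - m) * real k))" by (rule geometric_powr_summable) (use \<theta> in simp)
 have Hs: "summable (%k::nat. 2 powr (- (real s + \<delta> - \<theta>) * real k))" by (rule geometric_powr_summable) (use \<theta> in simp)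
 have G0: "0 <= G" unfolding G_def by (intro suminf_nonneg Gs) auto
 have H0: "0 <= H" unfolding H_def by (intro suminf_nonneg Hs) auto
 define C0 where "C0 = Cp * 2 ^ s * 2 ^ ?n * 2 powr \<beta>"
 have C0: "0 < C0" using Cp by (simp add: C0_def)
 define C1 where "C1 = C0 * G"
 have C1: "0 <= C1" using C0 G0 by (simp add: C1_def)
 define C2 where "C2 = 1 + C1 * ?V"
 have C2: "0 < C2" using C1 V by (simp add: C2_def add_pos_nonneg)
 define C3 where "C3 = C2 * 2 powr \<theta> * 2 ^ ?n * H"
 define C where "C = C1 * 2 powr \<theta> + C3 + 1"
 have C3: "0 <= C3" unfolding C3_def using C2 H0 by simp
 have C: "0 < C" using C1 C3 by (simp add: C_def add_nonneg_pos)
 show ?thesis unfolding telescope_bound_def proof (rule exI[of _ C], intro conjI ballI allI impI C)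
  fix f :: "real ^ 'n => complex" and c :: "real ^ 'n" and r W :: real
  assume r: "0 < r" and W: "0 <= W" and int': "\<forall>\<rho>. Lint (%x. ind (ball c \<rho>) x * f x)"
   and o1': "\<forall>k. osc1 s f c (2 ^ k * r) <= W * 2 powr (real k * \<beta>) * (2 ^ k * r) ^ CARD('n)"
  note int = int'[rule_format] and o1 = o1'[rule_format]
  define R where "R k = 2 ^ k * r" for k :: nat
  have R: "0 < R k" for k using r by (simp add: R_def)
  define P where "P k = proj s c (R k) f" for k
  have P: "P k : poly_space s" for k unfolding P_def by (rule proj_bound_D(1)[OF pb R int])
  have orth: "(\<L> x. ind (ball c (R k)) x * ((f x - P k x) * Q x)) = 0" if "Q : poly_space s" for k Q unfolding P_def by (rule proj_bound_D(2)[OF pb R int that])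
  have Pi: "Lint (%x. ind (ball c \<rho>) x * P k x)" for k \<rho> by (intro continuous_ball_integrable continuous_poly_space[OF P])
  have di: "Lint (%x. ind (ball c \<rho>) x * (f x - P k x))" for k \<rho> proof -
   have "Lint (%x. ind (ball c \<rho>) x * f x - ind (ball c \<rho>) x * P k x)" by (intro Lintegrable_diff int Pi)
   then show ?thesis by (simp add: right_diff_distrib)
  qed
  have o: "(\<L> x. norm (ind (ball c (R k)) x * (f x - P k x))) <= W * 2 powr (real k * \<beta>) * R k ^ ?n" for k using o1[of k] by (simp add: osc1_def P_def R_def)
  have step: "norm (P (Suc j) x - P j x) <= C0 * W * 2 powr (real k * \<theta>) * 2 powr (- (\<theta> - m) * real j)"
   if x: "x : ball c (R k)" and jk: "j < k" for j k x proof -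
   let ?g = "%x. P (Suc j) x - f x"
   have gi: "Lint (%x. ind (ball c (R j)) x * ?g x)" proof -
    have "Lint (%x. ind (ball c (R j)) x * P (Suc j) x - ind (ball c (R j)) x * f x)" by (intro Lintegrable_diff int Pi)
    then show ?thesis by (simp add: right_diff_distrib)
   qed
   have eq: "proj s c (R j) ?g = (%x. P (Suc j) x - P j x)" proof (rule campanato_proj_eqI[OF R gi])
    show "(%x. P (Suc j) x - P j x) : poly_space s" by (intro poly_space_diff P)
    fix Q :: "real ^ 'n => complex" assume Q: "Q : poly_space s"
    have "(\<L> x. ind (ball c (R j)) x * ((?g x - (P (Suc j) x - P j x)) * Q x)) =
    (\<L> x. - (ind (ball c (R j)) x * ((f x - P j x) * Q x)))" by (intro Lintegral_cong) (auto simp: algebra_simps)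
    also have "... = 0" using orth[OF Q, of j] by simp
    finally show "(\<L> x. ind (ball c (R j)) x * ((?g x - (P (Suc j) x - P j x)) * Q x)) = 0" .
   qed
   have I: "(\<L> y. norm (ind (ball c (R j)) y * ?g y)) <= W * 2 powr (real (Suc j) * \<beta>) * R (Suc j) ^ ?n" proof -
    have "R j <= R (Suc j)" using r by (simp add: R_def)
    then have sub: "ball c (R j) \<subseteq> ball c (R (Suc j))" by (rule subset_ball)
    have "(\<L> y. norm (ind (ball c (R j)) y * ?g y)) <= (\<L> x. norm (ind (ball c (R (Suc j))) x * (f x - P (Suc j) x)))" proof (rule integral_mono)
    show "norm (ind (ball c (R j)) x * ?g x) <= norm (ind (ball c (R (Suc j))) x * (f x - P (Suc j) x))" for x using sub by (cases "x : ball c (R j)") (auto simp: indicator_def norm_minus_commute simp del: mem_ball)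
    qed (use gi di in auto)
    also have "... <= W * 2 powr (real (Suc j) * \<beta>) * R (Suc j) ^ ?n" by (rule o)
    finally show ?thesis .
   qed
   have "norm (P (Suc j) x - P j x) <= Cp * (1 + norm (x - c) / R j) ^ s * ((\<L> y. norm (ind (ball c (R j)) y * ?g y)) / R j ^ ?n)" proof -
    have "\<forall>x. norm (proj s c (R j) ?g x) <= Cp * (1 + norm (x - c) / R j) ^ s * ((\<L> y. norm (ind (ball c (R j)) y * ?g y)) / R j ^ ?n)" by (intro allI proj_bound_D(3)[OF pb R gi])
    then show ?thesis unfolding eq by (rule spec)
   qed
   also have "... <= Cp * (2 * 2 ^ (k - j)) ^ s * ((W * 2 powr (real (Suc j) * \<beta>) * R (Suc j) ^ ?n) / R j ^ ?n)" proof (intro mult_mono mult_left_mono power_mono divide_right_mono I)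
    have "norm (x - c) <= R k" using x by (simp add: dist_norm norm_minus_commute)
    also have "R k = 2 ^ (k - j) * R j" using jk by (simp add: R_def power_add[symmetric])
    finally have "norm (x - c) / R j <= 2 ^ (k - j)" using R[of j] by (simp add: divide_le_eq)
    moreover have "1 <= (2::real) ^ (k - j)" by simp
    ultimately show "1 + norm (x - c) / R j <= 2 * 2 ^ (k - j)" by linarith
   qed (use Cp R[of j] W in "auto intro!: divide_nonneg_nonneg mult_nonneg_nonneg")
   also have "... = Cp * 2 ^ s * 2 ^ ?n * W * ((2 ^ (k - j)) ^ s * 2 powr (real (Suc j) * \<beta>))" proof -
    have "R (Suc j) ^ ?n / R j ^ ?n = 2 ^ ?n" using R[of j] r by (simp add: R_def power_mult_distrib)
    then have "(W * 2 powr (real (Suc j) * \<beta>) * R (Suc j) ^ ?n) / R j ^ ?n = W * 2 powr (real (Suc j) * \<beta>) * 2 ^ ?n" by (metis times_divide_eq_right)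
    then show ?thesis by (simp only: power_mult_distrib mult_ac)
   qed
   also have "(2 ^ (k - j)) ^ s * 2 powr (real (Suc j) * \<beta>) = 2 powr \<beta> * 2 powr (real (k - j) * real s + real j * \<beta>)" proof -
    have "((2::real) ^ (k - j)) ^ s = 2 powr (real (k - j) * real s)" by (simp add: powr_realpow[symmetric] powr_powr flip: power_mult)
    then show ?thesis by (simp add: powr_add[symmetric] algebra_simps)
   qed
   also have "Cp * 2 ^ s * 2 ^ ?n * W * (2 powr \<beta> * 2 powr (real (k - j) * real s + real j * \<beta>)) = C0 * W * 2 powr (real (k - j) * real s + real j * \<beta>)" by (simp add: C0_def mult_ac)
   also have "... <= C0 * W * 2 powr (real k * \<theta> + (- (\<theta> - m) * real j))" proof (intro mult_left_mono powr_mono)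
    have kj: "real (k - j) = real k - real j" using jk by simp
    have "(real k - real j) * real s <= (real k - real j) * \<theta>" using ms \<theta> jk by (intro mult_left_mono) auto
    moreover have "real j * \<beta> <= real j * m" using ms by (intro mult_left_mono) auto
    ultimately show "real (k - j) * real s + real j * \<beta> <= real k * \<theta> + (- (\<theta> - m) * real j)" unfolding kj by (simp add: algebra_simps)
   qed (use C0 W in auto)
   finally show ?thesis by (simp only: powr_add mult.assoc)
  qed
  have sup: "norm (P k x - P 0 x) <= C1 * W * 2 powr (real k * \<theta>)" if x: "x : ball c (R k)" for k x proof -
   have "P k x - P 0 x = (\<Sum>j<k. P (Suc j) x - P j x)" by (rule sum_lessThan_telescope[symmetric])
   also have "norm ... <= (\<Sum>j<k. C0 * W * 2 powr (real k * \<theta>) * 2 powr (- (\<theta> - m) * real j))" by (rule sum_norm_le) (use step[OF x] in auto)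
   also have "... = C0 * W * 2 powr (real k * \<theta>) * (\<Sum>j<k. 2 powr (- (\<theta> - m) * real j))" by (simp add: sum_distrib_left)
   also have "... <= C0 * W * 2 powr (real k * \<theta>) * G" unfolding G_def using C0 W by (intro mult_left_mono sum_le_suminf Gs) auto
   finally show ?thesis by (simp add: C1_def mult_ac)
  qed
  show "norm (proj s c (2 * r) f x - proj s c r f x) <= C * W" if "x : ball c (2 * r)" for x proof -
   have "norm (P 1 x - P 0 x) <= C1 * W * 2 powr \<theta>" using sup[of x 1] that by (simp add: R_def)
   also have "... <= C * W" proof -
    have "0 <= (C3 + 1) * W" using W C3 by simp
    then show ?thesis by (simp add: C_def algebra_simps)
   qed
   finally show ?thesis by (simp add: P_def R_def)
  qed
  have fP: "(\<I> y. ennreal (norm (f y - P 0 y)) * ind (ball c (R k)) y) <= ennreal (C2 * W * 2 powr (real k * \<theta>) * R k ^ ?n)" for k proof -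
   have "(\<I> y. ennreal (norm (f y - P 0 y)) * ind (ball c (R k)) y) <=
    (\<I> y. ennreal (norm (ind (ball c (R k)) y * (f y - P k y))) + ennreal (C1 * W * 2 powr (real k * \<theta>)) * ind (ball c (R k)) y)" proof (intro nn_integral_mono)
    fix y
    show "ennreal (norm (f y - P 0 y)) * ind (ball c (R k)) y <= ennreal (norm (ind (ball c (R k)) y * (f y - P k y))) + ennreal (C1 * W * 2 powr (real k * \<theta>)) * ind (ball c (R k)) y" proof (cases "y : ball c (R k)")
    case True
    have "norm (f y - P 0 y) <= norm (f y - P k y) + C1 * W * 2 powr (real k * \<theta>)" using sup[OF True] norm_triangle_ineq[of "f y - P k y" "P k y - P 0 y"] by simp
    then have "ennreal (norm (f y - P 0 y)) <= ennreal (norm (f y - P k y) + C1 * W * 2 powr (real k * \<theta>))" by (rule ennreal_leI)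
    also have "... = ennreal (norm (f y - P k y)) + ennreal (C1 * W * 2 powr (real k * \<theta>))" using C1 W by (intro ennreal_plus) auto
    finally show ?thesis using True by simp
    qed simp
   qed
   also have "... = (\<I> y. ennreal (norm (ind (ball c (R k)) y * (f y - P k y)))) + ennreal (C1 * W * 2 powr (real k * \<theta>)) * vol (ball c (R k))" proof -
    have "(%y. ind (ball c (R k)) y * (f y - P k y)) : Lmeas" using di by (rule borel_measurable_integrable)
    then show ?thesis by (subst nn_integral_add) (auto simp: nn_integral_cmult_indicator)
   qed
   also have "(\<I> y. ennreal (norm (ind (ball c (R k)) y * (f y - P k y)))) = ennreal (\<L> y. norm (ind (ball c (R k)) y * (f y - P k y)))" by (rule nn_integral_eq_integral) (use di in auto)
   also have "ennreal (\<L> y. norm (ind (ball c (R k)) y * (f y - P k y))) + ennreal (C1 * W * 2 powr (real k * \<theta>)) * vol (ball c (R k))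
    <= ennreal (W * 2 powr (real k * \<theta>) * R k ^ ?n) + ennreal (C1 * W * 2 powr (real k * \<theta>)) * ennreal (?V * R k ^ ?n)" proof (intro add_mono ennreal_leI)
    have "2 powr (real k * \<beta>) <= 2 powr (real k * \<theta>)" using ms \<theta> by (intro powr_mono mult_left_mono) auto
    then have "W * 2 powr (real k * \<beta>) * R k ^ ?n <= W * 2 powr (real k * \<theta>) * R k ^ ?n" using W R[of k] by (intro mult_right_mono mult_left_mono) auto
    then show "(\<L> y. norm (ind (ball c (R k)) y * (f y - P k y))) <= W * 2 powr (real k * \<theta>) * R k ^ ?n" using o[of k] by linarith
    show "ennreal (C1 * W * 2 powr (real k * \<theta>)) * vol (ball c (R k)) <= ennreal (C1 * W * 2 powr (real k * \<theta>)) * ennreal (?V * R k ^ ?n)" using R[of k] by (simp add: emeasure_lebesgue_ball)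
   qed
   also have "... = ennreal (C2 * W * 2 powr (real k * \<theta>) * R k ^ ?n)" using C1 W R[of k] V by (simp add: ennreal_mult'[symmetric] ennreal_plus[symmetric] C2_def algebra_simps del: ennreal_plus)
   finally show ?thesis .
  qed
  have hm: "(%y. ennreal (norm (f y - P 0 y))) : Lmeas" proof -
   have "(%y. f y - P 0 y) : Lmeas" by (rule borel_measurable_by_balls[OF borel_measurable_integrable[OF di]])
   then show ?thesis by measurable
  qed
  have "(\<I> y. ennreal (norm (f y - P 0 y)) * ennreal (1 / norm (y - c) powr (real ?n + (real s + \<delta>))) * ind (- ball c r) y)
   <= (\<Sum>k. ennreal (1 / (2 ^ k * r) powr (real ?n + (real s + \<delta>))) * (\<I> y. ennreal (norm (f y - P 0 y)) * ind (ball c (2 ^ (k + 1) * r)) y))" by (rule nn_integral_annuli[OF hm r]) (use \<delta> in simp)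
  also have "... <= (\<Sum>k. ennreal (C2 * W * 2 powr \<theta> * 2 ^ ?n / r powr (real s + \<delta>) * 2 powr (- (real s + \<delta> - \<theta>) * real k)))" proof (intro suminf_le summableI)
   fix k
   have "ennreal (1 / R k powr (real ?n + (real s + \<delta>))) * (\<I> y. ennreal (norm (f y - P 0 y)) * ind (ball c (R (k + 1))) y)
    <= ennreal (1 / R k powr (real ?n + (real s + \<delta>))) * ennreal (C2 * W * 2 powr (real (k + 1) * \<theta>) * R (k + 1) ^ ?n)" by (intro mult_left_mono fP) simp
   also have "... = ennreal (1 / R k powr (real ?n + (real s + \<delta>)) * (C2 * W * 2 powr (real (k + 1) * \<theta>) * R (k + 1) ^ ?n))" by (rule ennreal_mult'[symmetric]) simp
   also have "1 / R k powr (real ?n + (real s + \<delta>)) * (C2 * W * 2 powr (real (k + 1) * \<theta>) * R (k + 1) ^ ?n) =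
    C2 * W * 2 powr \<theta> * 2 ^ ?n / r powr (real s + \<delta>) * 2 powr (- (real s + \<delta> - \<theta>) * real k)" proof -
    have "R k powr (real ?n + (real s + \<delta>)) = R k ^ ?n * R k powr (real s + \<delta>)" using R[of k] by (simp add: powr_add powr_realpow)
    moreover have "R k powr (real s + \<delta>) = 2 powr (real k * (real s + \<delta>)) * r powr (real s + \<delta>)" unfolding R_def powr_mult powr_realpow[of 2, symmetric, OF zero_less_numeral] powr_powr ..
    moreover have "R (k + 1) ^ ?n = 2 ^ ?n * R k ^ ?n" by (simp add: R_def power_mult_distrib)
    moreover have "2 powr (real (k + 1) * \<theta>) = 2 powr \<theta> * 2 powr (real k * \<theta>)" by (simp add: powr_add[symmetric] algebra_simps)
    moreover have "2 powr (- (real s + \<delta> - \<theta>) * real k) = 2 powr (real k * \<theta>) / 2 powr (real k * (real s + \<delta>))" by (simp add: powr_diff[symmetric] algebra_simps)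
    ultimately show ?thesis using R[of k] r by (simp add: field_simps)
   qed
   finally show "ennreal (1 / (2 ^ k * r) powr (real ?n + (real s + \<delta>))) * (\<I> y. ennreal (norm (f y - P 0 y)) * ind (ball c (2 ^ (k + 1) * r)) y)
    <= ennreal (C2 * W * 2 powr \<theta> * 2 ^ ?n / r powr (real s + \<delta>) * 2 powr (- (real s + \<delta> - \<theta>) * real k))" unfolding R_def .
  qed
  also have "... = ennreal (\<Sum>k. C2 * W * 2 powr \<theta> * 2 ^ ?n / r powr (real s + \<delta>) * 2 powr (- (real s + \<delta> - \<theta>) * real k))" by (intro suminf_ennreal2 summable_mult Hs) (use C2 W in auto)
  also have "(\<Sum>k. C2 * W * 2 powr \<theta> * 2 ^ ?n / r powr (real s + \<delta>) * 2 powr (- (real s + \<delta> - \<theta>) * real k)) = C3 * W / r powr (real s + \<delta>)" by (subst suminf_mult[OF Hs]) (simp add: C3_def H_def mult_ac)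
  also have "ennreal (C3 * W / r powr (real s + \<delta>)) <= ennreal (C * W / r powr (real s + \<delta>))" using C1 W by (intro ennreal_leI divide_right_mono mult_right_mono) (auto simp: C_def)
  finally show "(\<I> y. ennreal (norm (f y - proj s c r f y)) * ennreal (1 / norm (y - c) powr (real CARD('n) + (real s + \<delta>))) * ind (- ball c r) y)
   <= ennreal (C * W / r powr (real s + \<delta>))" by (simp add: P_def R_def)
 qed
qed


section \<open>Molecules: the operator applied to functions with vanishing moments\<close>

text \<open>The value on the diagonal is set to \<open>0\<close>, so that the kernel bounds hold for all pairs of points.\<close>

definition offdiag :: "(real ^ 'n => real ^ 'n => complex) => real ^ 'n => real ^ 'n => complex" where
 "offdiag K x y = (if x = y then 0 else K x y)"

text \<open>The regularity condition makes the kernel continuous off the diagonal, whence joint Borel measurability.\<close>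

lemma cz_kernel_offdiag:
 fixes K :: "real ^ 'n => real ^ 'n => complex"
 assumes K: "standard_kernel s \<delta> K" and \<delta>: "0 < \<delta>"
 shows "\<exists>A. cz_kernel (offdiag K) A \<delta>" proof -
 have z: "mi_abs (%_::'n. 0) = 0" by (simp add: mi_abs_def)
 obtain C where C: "0 < C" and all: "kernel_const s \<delta> K C" using kernel_const_exists[OF K] by blast
 note all0 = all[unfolded kernel_const_def, rule_format, of "%_. 0", unfolded z mpartial_zero, OF le0]
 have sz: "norm (K x y) <= C / norm (x - y) ^ CARD('n)" if "x ~= y" for x y using all0 that by simp
 have r2: "norm (K x y - K x z) <= C * (norm (y - z) powr \<delta> / norm (x - y) powr (real CARD('n) + \<delta>))"
  if "x ~= y" "2 * norm (y - z) <= norm (x - y)" for x y z using all0 that by simp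
 have r1: "norm (K y x - K z x) <= C * (norm (y - z) powr \<delta> / norm (x - y) powr (real CARD('n) + \<delta>))"
  if "x ~= y" "2 * norm (y - z) <= norm (x - y)" for x y z using all0 that by simp
 have ne: "z ~= x" if "x ~= y" "2 * norm (y - z) <= norm (x - y)" for x y z :: "real ^ 'n" proof
  assume "z = x"
  then have "2 * norm (x - y) <= norm (x - y)" using that(2) by (simp add: norm_minus_commute)
  then show False using that(1) by simp
 qed
 have cont: "isCont (%w. K (fst w) (snd w)) (x, y)" if xy: "x ~= y" for x y proof -
  define g where "g w = C * (norm (x - fst w) powr \<delta> / norm (y - x) powr (real CARD('n) + \<delta>)) +
   C * (norm (y - snd w) powr \<delta> / norm (fst w - y) powr (real CARD('n) + \<delta>))" for w :: "(real ^ 'n) \<times> (real ^ 'n)"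
  have n0: "0 < norm (x - y)" using xy by simp
  have f1: "((%w. norm (x - fst w)) \<longlongrightarrow> 0) (at (x, y))" by (rule tendsto_eq_intros refl)+ simp
  have f2: "((%w. norm (y - snd w)) \<longlongrightarrow> 0) (at (x, y))" by (rule tendsto_eq_intros refl)+ simp
  have f3: "((%w. norm (fst w - y)) \<longlongrightarrow> norm (x - y)) (at (x, y))" by (rule tendsto_eq_intros refl)+ simp
  have p1: "((%w. norm (x - fst w) powr \<delta>) \<longlongrightarrow> 0) (at (x, y))" by (rule tendsto_zero_powrI[OF f1 tendsto_const _ \<delta>]) auto
  have p2: "((%w. norm (y - snd w) powr \<delta>) \<longlongrightarrow> 0) (at (x, y))" by (rule tendsto_zero_powrI[OF f2 tendsto_const _ \<delta>]) auto
  have p3: "((%w. norm (fst w - y) powr (real CARD('n) + \<delta>)) \<longlongrightarrow> norm (x - y) powr (real CARD('n) + \<delta>)) (at (x, y))" using n0 by (intro tendsto_powr f3 tendsto_const) simp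
  have "(g \<longlongrightarrow> C * (0 / norm (y - x) powr (real CARD('n) + \<delta>)) + C * (0 / norm (x - y) powr (real CARD('n) + \<delta>))) (at (x, y))" unfolding g_def using n0 by (intro tendsto_add tendsto_mult tendsto_const tendsto_divide p1 p2 p3) (auto simp: norm_minus_commute)
  then have g0: "(g \<longlongrightarrow> 0) (at (x, y))" by simp
  have e1: "\<forall>\<^sub>F w in at (x, y). norm (x - fst w) < norm (x - y) / 4" by (rule order_tendstoD(2)[OF f1]) (use n0 in simp)
  have e2: "\<forall>\<^sub>F w in at (x, y). norm (y - snd w) < norm (x - y) / 4" by (rule order_tendstoD(2)[OF f2]) (use n0 in simp)
  have "\<forall>\<^sub>F w in at (x, y). norm (K (fst w) (snd w) - K x y) <= g w" using e1 e2 proof eventually_elim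
   case (elim w)
   have a: "2 * norm (x - fst w) <= norm (y - x)" using elim norm_ge_zero[of "x - fst w"] unfolding norm_minus_commute[of y x] by linarith
   have "norm (x - y) <= norm (x - fst w) + norm (fst w - y)" using norm_triangle_ineq[of "x - fst w" "fst w - y"] by simp
   then have b: "2 * norm (y - snd w) <= norm (fst w - y)" and "0 < norm (fst w - y)" using elim n0 norm_ge_zero[of "y - snd w"] by linarith+
   then have b': "fst w ~= y" by auto
   have "norm (K (fst w) (snd w) - K x y) <= norm (K x y - K (fst w) y) + norm (K (fst w) y - K (fst w) (snd w))" using norm_triangle_ineq[of "K x y - K (fst w) y" "K (fst w) y - K (fst w) (snd w)"] by (simp add: norm_minus_commute)
   also have "... <= g w" unfolding g_def by (intro add_mono r1[OF _ a] r2[OF b' b]) (use xy in simp)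
   finally show ?case .
  qed
  then have "((%w. K (fst w) (snd w) - K x y) \<longlongrightarrow> 0) (at (x, y))" by (rule Lim_null_comparison[OF _ g0])
  then have "((%w. K (fst w) (snd w)) \<longlongrightarrow> K x y) (at (x, y))" by (rule LIM_zero_cancel)
  then show ?thesis by (simp add: isCont_def)
 qed
 have op: "open {w :: (real ^ 'n) \<times> (real ^ 'n). fst w ~= snd w}" by (intro open_Collect_neq continuous_intros)
 have "continuous_on {w. fst w ~= snd w} (%w. K (fst w) (snd w))" unfolding continuous_on_eq_continuous_at[OF op] using cont by auto
 then have "(%w. ind {w. fst w ~= snd w} w *\<^sub>R K (fst w) (snd w)) : borel_measurable borel" by (rule borel_measurable_continuous_on_indicator[rotated]) (use op in "rule borel_open")
 moreover have "(%w. ind {w. fst w ~= snd w} w *\<^sub>R K (fst w) (snd w)) = (%(x, y). offdiag K x y)" by (auto simp: offdiag_def fun_eq_iff indicator_def)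
 ultimately have m: "(%(x, y). offdiag K x y) : borel_measurable borel" by simp
 have "cz_kernel (offdiag K) C \<delta>" proof
  show "norm (offdiag K x y) <= C / norm (x - y) ^ CARD('n)" for x y using sz[of x y] C by (simp add: offdiag_def)
  show "norm (offdiag K x y - offdiag K z y) <= C * (norm (x - z) powr \<delta> / norm (x - y) powr (real CARD('n) + \<delta>))"
   if "x ~= y" "2 * norm (x - z) <= norm (x - y)" for x y z using r1[of y x z] ne[of y x z] that by (simp add: offdiag_def norm_minus_commute)
  show "norm (offdiag K x y - offdiag K x z) <= C * (norm (y - z) powr \<delta> / norm (x - y) powr (real CARD('n) + \<delta>))"
   if "x ~= y" "2 * norm (y - z) <= norm (x - y)" for x y z using r2[of x y z] ne[of x y z] that by (auto simp: offdiag_def)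
 qed (use C \<delta> m in "auto simp: offdiag_def")
 then show ?thesis by blast
qed

lemma offdiag_swap: "offdiag (%x y. K y x) = (%x y. offdiag K y x)" by (auto simp: offdiag_def fun_eq_iff)

lemma trunc_offdiag: "0 < \<eta> ==> trunc (offdiag K) \<eta> f x = (LINT y:- ball x \<eta>|lebesgue. K x y * f y)" unfolding trunc_def set_lebesgue_integral_def by (intro Lintegral_cong) (auto simp: offdiag_def indicator_def)

lemma cz_op_offdiag:
 fixes K :: "real ^ 'n => real ^ 'n => complex"
 assumes T: "cz_operator s \<delta> K T" and A: "cz_kernel (offdiag K) A \<delta>"
 shows "\<exists>B. cz_op (offdiag K) A \<delta> T B" proof -
 interpret cz_kernel "offdiag K" A \<delta> by (rule A)
 have lin: "AEL x. T (%y. a * f y + b * g y) x = a * T f x + b * T g x" if "f : L2" "g : L2" for a b f g using T that unfolding cz_operator_def by blast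
 have "\<exists>C::real. \<forall>f \<in> L2. T f : L2 & L2_norm (T f) <= C * L2_norm f" using T unfolding cz_operator_def by blast
 then obtain C :: real where C: "!!f. f : L2 ==> T f : L2" "!!f. f : L2 ==> L2_norm (T f) <= C * L2_norm f" by blast
 have pv: "AEL x. ((%\<eta>. LINT y:- ball x \<eta>|lebesgue. K x y * f y) \<longlongrightarrow> T f x) (at_right 0)" if "f : L2" for f using T that unfolding cz_operator_def by blast
 have L: "lpow 2 f = ennreal ((L2_norm f)^2)" if f: "f : L2" for f :: "real ^ 'n => complex" proof -
  have i: "Lint (%x. (norm (f x))^2)" using f by (simp add: L2_def)
  have "lpow 2 f = (\<I> x. ennreal ((norm (f x))^2))" by (simp add: lpow_def)
  also have "... = ennreal (\<L> x. (norm (f x))^2)" by (rule nn_integral_eq_integral[OF i]) simp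
  finally show ?thesis by (simp add: L2_norm_def)
 qed
 have "cz_op (offdiag K) A \<delta> T (C^2)" proof
  fix f :: "real ^ 'n => complex" assume f: "f : L2"
  show "T f : L2" by (rule C(1)[OF f])
  have "0 <= L2_norm (T f)" by (simp add: L2_norm_def)
  then have "(L2_norm (T f))^2 <= (C * L2_norm f)^2" by (intro power_mono C(2)[OF f])
  then have "ennreal ((L2_norm (T f))^2) <= ennreal (C^2 * (L2_norm f)^2)" by (simp add: power_mult_distrib)
  then show "lpow 2 (T f) <= ennreal (C^2) * lpow 2 f" unfolding L[OF f] L[OF C(1)[OF f]] by (simp add: ennreal_mult')
  show "AEL x. ((%\<eta>. trunc (offdiag K) \<eta> f x) \<longlongrightarrow> T f x) (at_right 0)" using pv[OF f] proof eventually_elim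
   case (elim x)
   have "\<forall>\<^sub>F \<eta> in at_right 0. (LINT y:- ball x \<eta>|lebesgue. K x y * f y) = trunc (offdiag K) \<eta> f x" using eventually_at_right_less by eventually_elim (simp add: trunc_offdiag)
   then show ?case using elim by (rule Lim_transform_eventually[rotated])
  qed
 qed (use lin in auto)
 then show ?thesis by blast
qed

lemma taylor_poly_space: "(%x. taylor s F c x) : poly_space s" proof -
 have "(%x. cmono \<gamma> (x - c)) : poly_space s" if "mi_abs \<gamma> <= s" for \<gamma> using poly_space_affine[OF poly_space_monomial[OF that], of "- c" 1] by simp
 then show ?thesis unfolding taylor_def by (intro poly_space_sum poly_space_cmult) auto
qed

definition moments_zero :: "nat => (real ^ 'n => complex) => bool" where
 "moments_zero s a \<longleftrightarrow> (\<forall>P\<in>poly_space s. (\<L> x. a x * P x) = 0)"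

lemma integrable_mult_poly:
 fixes a P :: "real ^ 'n => complex"
 assumes a: "Lint a" and supp: "\<forall>x. x ~: ball c r --> a x = 0" and P: "P : poly_space s"
 shows "Lint (%x. a x * P x)" proof -
 obtain M R where M: "!!x. norm (ind (ball c r) x * P x) <= M" "!!x. x ~: ball 0 R ==> ind (ball c r) x * P x = 0" using continuous_ball_Linf_c[OF continuous_poly_space[OF P], of c r] by (rule Linf_cE) blast
 note [measurable] = measurable_poly_space[OF P] borel_measurable_integrable[OF a]
 show ?thesis proof (rule Lintegrable_bound[where f="%x. M * norm (a x)"])
  show "Lint (%x. M * norm (a x))" by (intro integrable_mult_right integrable_norm a)
  show "AEL x. norm (a x * P x) <= norm (M * norm (a x))" proof (rule AE_I2)
   fix x
   show "norm (a x * P x) <= norm (M * norm (a x))" proof (cases "x : ball c r")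
    case True
    then have "norm (P x) <= M" using M(1)[of x] by simp
    then have "norm (P x) * norm (a x) <= M * norm (a x)" by (rule mult_right_mono) simp
    also have "... <= norm (M * norm (a x))" by simp
    finally show ?thesis by (simp only: norm_mult mult.commute)
   qed (use supp in simp)
  qed
 qed measurable
qed

lemma moments_zeroI:
 fixes a :: "real ^ 'n => complex"
 assumes a: "Lint a" and supp: "\<forall>x. x ~: ball c r --> a x = 0"
  and mom: "!!\<gamma>. mi_abs \<gamma> <= s ==> (\<L> x. a x * cmono \<gamma> x) = 0"
 shows "moments_zero s a" unfolding moments_zero_def proof
 fix P :: "real ^ 'n => complex" assume "P : poly_space s"
 then obtain b where P: "P = (%x. \<Sum>\<gamma> | mi_abs \<gamma> <= s. b \<gamma> * cmono \<gamma> x)" by (rule poly_spaceE)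
 have "(\<L> x. a x * P x) = (\<L> x. (\<Sum>\<gamma> | mi_abs \<gamma> <= s. b \<gamma> * (a x * cmono \<gamma> x)))" unfolding P by (intro Lintegral_cong) (auto simp: sum_distrib_left mult_ac)
 also have "... = (\<Sum>\<gamma> | mi_abs \<gamma> <= s. \<L> x. b \<gamma> * (a x * cmono \<gamma> x))" proof (rule Lintegral_sum)
  fix \<gamma> :: "'n => nat" assume "\<gamma> : {\<gamma>. mi_abs \<gamma> <= s}"
  then have "(%x. cmono \<gamma> x) : poly_space s" by (intro poly_space_monomial) simp
  then show "Lint (%x. b \<gamma> * (a x * cmono \<gamma> x))" by (intro integrable_mult_right integrable_mult_poly[OF a supp])
 qed
 also have "... = 0" by (rule sum.neutral) (simp add: mom)
 finally show "(\<L> x. a x * P x) = 0" .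
qed

text \<open>The Taylor polynomial integrates to zero against \<open>a\<close>.\<close>

lemma offdiag_taylor_integral:
 fixes K :: "real ^ 'n => real ^ 'n => complex"
 assumes kern: "cz_kernel (offdiag K) A \<delta>" and a: "Lint a" and supp: "\<forall>x. x ~: ball c r --> a x = 0"
  and mom: "moments_zero s a" and r: "0 < r" and y: "y ~: ball c (2 * r)"
 shows "(\<L> x. offdiag K y x * a x) = (\<L> x. (K y x - taylor s (K y) c x) * a x)"
  and "Lint (%x. (K y x - taylor s (K y) c x) * a x)" proof -
 interpret cz_kernel "offdiag K" A \<delta> by (rule kern)
 have far: "a x = 0" if "x : ball y r" for x proof (rule supp[rule_format])
  have "dist c y <= dist c x + dist y x" by (rule dist_triangle2)
  then show "x ~: ball c r" using y that by simp
 qed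
 have k: "K y x * a x = offdiag K y x * (ind (- ball y r) x * a x)" for x using far[of x] r by (cases "x : ball y r") (auto simp: offdiag_def)
 have i1: "Lint (%x. K y x * a x)" unfolding k by (rule trunc_integrable[OF a r])
 have i2: "Lint (%x. a x * taylor s (K y) c x)" by (rule integrable_mult_poly[OF a supp taylor_poly_space])
 have e: "(K y x - taylor s (K y) c x) * a x = K y x * a x - a x * taylor s (K y) c x" for x by (simp add: algebra_simps)
 show "Lint (%x. (K y x - taylor s (K y) c x) * a x)" unfolding e by (intro Lintegrable_diff i1 i2)
 have "(\<L> x. (K y x - taylor s (K y) c x) * a x) = (\<L> x. K y x * a x) - (\<L> x. a x * taylor s (K y) c x)" unfolding e by (rule Lintegral_diff[OF i1 i2])
 also have "(\<L> x. a x * taylor s (K y) c x) = 0" using mom taylor_poly_space unfolding moments_zero_def by blast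
 also have "(\<L> x. K y x * a x) = (\<L> x. offdiag K y x * a x)" proof (intro Lintegral_cong)
  show "K y x * a x = offdiag K y x * a x" for x using far[of x] r by (auto simp: offdiag_def)
 qed simp
 finally show "(\<L> x. offdiag K y x * a x) = (\<L> x. (K y x - taylor s (K y) c x) * a x)" by simp
qed

lemma molecule_representation:
 fixes K :: "real ^ 'n => real ^ 'n => complex"
 assumes T: "cz_op (offdiag K) A \<delta> T B" and a: "a : L2" "Lint a" and supp: "\<forall>x. x ~: ball c r --> a x = 0"
  and r: "0 < r"
 shows "AEL y. y ~: ball c (2 * r) --> T a y = (\<L> x. offdiag K y x * a x)" proof -
 interpret cz_op "offdiag K" A \<delta> T B by (rule T)
 show ?thesis using T_off_support[OF a(1)] proof eventually_elim
  case (elim y)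
  show ?case proof
   assume y: "y ~: ball c (2 * r)"
   have "a x = 0" if "x : ball y r" for x proof (rule supp[rule_format])
    have "dist c y <= dist c x + dist y x" by (rule dist_triangle2)
    then show "x ~: ball c r" using y that by simp
   qed
   then show "T a y = (\<L> x. offdiag K y x * a x)" using elim r by blast
  qed
 qed
qed

definition molecule_bound :: "nat => real => ((real ^ 'n => complex) => real ^ 'n => complex) => real => bool" where
 "molecule_bound s \<delta> T C \<longleftrightarrow> (\<forall>a c r. a : L2 --> Lint a --> (\<forall>x. x ~: ball c r --> a x = 0) --> moments_zero s a --> 0 < r -->
  (AEL y. y ~: ball c (2 * r) -->
   norm (T a y) <= C * r powr (real s + \<delta>) * (\<L> x. norm (a x)) * (1 / norm (y - c) powr (real CARD('n) + (real s + \<delta>)))))"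

text \<open>Subtract from the kernel its Taylor polynomial at the centre of the support.\<close>

lemma molecule_decay:
 fixes K :: "real ^ 'n => real ^ 'n => complex"
 assumes K: "standard_kernel s \<delta> K" and \<delta>: "0 < \<delta>" and T: "cz_op (offdiag K) A \<delta> T B"
 shows "\<exists>C>0. molecule_bound s \<delta> T C" proof -
 have kern: "cz_kernel (offdiag K) A \<delta>" using T by (rule cz_op.axioms(1))
 obtain C where C: "0 < C" and rem: "\<forall>x c z. x ~= c --> 2 * norm (z - c) <= norm (x - c) -->
   norm (K x z - taylor s (%v. K x v) c z) <= C * (norm (z - c) powr (real s + \<delta>) / norm (x - c) powr (real CARD('n) + real s + \<delta>))" using kernel_taylor[OF K \<delta>] by blast
 show ?thesis unfolding molecule_bound_def proof (rule exI[of _ C], intro conjI allI impI C)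
  fix a :: "real ^ 'n => complex" and c :: "real ^ 'n" and r :: real
  assume a: "a : L2" "Lint a" and supp: "\<forall>x. x ~: ball c r --> a x = 0" and mom: "moments_zero s a" and r: "0 < r"
  show "AEL y. y ~: ball c (2 * r) -->
   norm (T a y) <= C * r powr (real s + \<delta>) * (\<L> x. norm (a x)) * (1 / norm (y - c) powr (real CARD('n) + (real s + \<delta>)))" using molecule_representation[OF T a supp r] proof eventually_elim
   case (elim y)
   show ?case proof
    assume y: "y ~: ball c (2 * r)"
    let ?w = "C * r powr (real s + \<delta>) * (1 / norm (y - c) powr (real CARD('n) + (real s + \<delta>)))"
    have yc: "2 * r <= norm (y - c)" using y by (simp add: dist_norm norm_minus_commute)
    have ync: "y ~= c" using yc r by auto
    note tay = offdiag_taylor_integral[OF kern a(2) supp mom r y]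
    have "norm (T a y) = norm (\<L> x. (K y x - taylor s (K y) c x) * a x)" using elim y tay(1) by simp
    also have "... <= (\<L> x. norm ((K y x - taylor s (K y) c x) * a x))" by (rule integral_norm_bound)
    also have "... <= (\<L> x. ?w * norm (a x))" proof (rule integral_mono)
    show "Lint (%x. norm ((K y x - taylor s (K y) c x) * a x))" by (intro integrable_norm tay(2))
    show "Lint (%x. ?w * norm (a x))" by (intro integrable_mult_right integrable_norm a)
    show "norm ((K y x - taylor s (K y) c x) * a x) <= ?w * norm (a x)" for x proof (cases "x : ball c r")
    case True
    then have xc: "norm (x - c) <= r" by (simp add: dist_norm norm_minus_commute)
    have "norm (K y x - taylor s (K y) c x) <= C * (norm (x - c) powr (real s + \<delta>) / norm (y - c) powr (real CARD('n) + real s + \<delta>))" using rem ync xc yc by simp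
    also have "... <= C * (r powr (real s + \<delta>) / norm (y - c) powr (real CARD('n) + real s + \<delta>))" using C xc \<delta> by (intro mult_left_mono divide_right_mono powr_mono2) auto
    also have "... = ?w" by (simp add: add.assoc)
    finally show ?thesis unfolding norm_mult by (rule mult_right_mono) simp
    qed (use supp in simp)
    qed
    also have "... = ?w * (\<L> x. norm (a x))" by simp
    finally show "norm (T a y) <= C * r powr (real s + \<delta>) * (\<L> x. norm (a x)) * (1 / norm (y - c) powr (real CARD('n) + (real s + \<delta>)))" by (simp only: mult_ac)
   qed
  qed
 qed
qed

text \<open>Pairing identities extend from bounded functions to square integrable ones, by cutting off the large values.\<close>

lemma L2_pairing_density:
 fixes h g :: "real ^ 'n => complex"
 assumes T: "cz_op K A \<delta> T B" and h: "h : L2" and g: "g : L2"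
  and pair: "!!a. a : Linf_c ==> (\<L> x. h x * a x) = (\<L> x. g x * T a x)"
  and a: "a : L2" and supp: "\<forall>x. x ~: ball 0 R --> a x = 0"
 shows "(\<L> x. h x * a x) = (\<L> x. g x * T a x)" proof -
 interpret cz_op K A \<delta> T B by (rule T)
 have [measurable]: "h : Lmeas" "g : Lmeas" "a : Lmeas" using h g a by (auto simp: L2_def)
 have fin: "lpow 2 h < top" "lpow 2 g < top" "lpow 2 a < top" using h g a by (auto simp: L2_iff_lpow)
 \<comment> \<open>The cut-off functions \<open>b k\<close> are bounded and \<open>d k = a - b k\<close> tends to zero in \<open>L^2\<close>.\<close>
 define S where "S k = {x. norm (a x) <= real k}" for k :: nat
 have S [measurable]: "S k : sets lebesgue" for k proof -
  have "{x : space lebesgue. norm (a x) <= real k} : sets lebesgue" by measurable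
  then show ?thesis by (simp add: S_def)
 qed
 define b where "b k x = ind (S k) x * a x" for k x
 define d where "d k x = a x - b k x" for k x
 have bL: "b k : Linf_c" for k proof (rule Linf_cI)
  show "b k : Lmeas" unfolding b_def by measurable
  show "norm (b k x) <= real k" for x by (auto simp: b_def S_def indicator_def)
  show "b k x = 0" if "x ~: ball 0 R" for x using supp that by (simp add: b_def)
 qed
 have dm [measurable]: "d k : Lmeas" for k unfolding d_def b_def by measurable
 have dle: "norm (d k x) <= norm (a x)" for k x by (auto simp: d_def b_def indicator_def)
 have "(%k. lpow 2 (d k)) ----> lpow 2 (%x::real ^ 'n. 0)" proof (rule lpow_dominated[where w=a])
  show "AEL x. (%k. d k x) ----> 0" proof (rule AE_I2)
   fix x
   obtain k0 where k0: "norm (a x) < real k0" using reals_Archimedean2 by blast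
   have "\<forall>\<^sub>F k in sequentially. d k x = 0" by (rule eventually_mono[OF eventually_ge_at_top[of k0]]) (use k0 in "auto simp: d_def b_def S_def indicator_def")
   then show "(%k. d k x) ----> 0" by (rule tendsto_eventually)
  qed
 qed (use dle fin in auto)
 then have d0: "(%k. lpow 2 (d k)) ----> 0" by (simp add: lpow_def)
 have dfin: "lpow 2 (d k) < top" for k using lpow_mono[of "d k" a 2] dle fin(3) by (simp add: le_less_trans)
 have dL: "d k : L2" for k using dfin by (simp add: L2_iff_lpow)
 have bL2: "b k : L2" for k by (rule Linf_c_L2[OF bL])
 define z where "z = (\<L> x. h x * a x) - (\<L> x. g x * T a x)"
 define \<alpha> where "\<alpha> k = enn2real (lpow 2 (d k)) powr (1 / 2)" for k
 have half: "(1::real) < 2" "1 / 2 + 1 / 2 = (1::real)" by auto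
 have Tfin: "lpow 2 (T f) < top" if "f : L2" for f using T_L2[OF that] by (simp add: L2_iff_lpow)
 have "norm z <= (enn2real (lpow 2 h) powr (1 / 2) + enn2real (lpow 2 g) powr (1 / 2) * B powr (1 / 2)) * \<alpha> k" for k proof -
  note [measurable] = T_measurable[OF bL2] T_measurable[OF dL] T_measurable[OF a] Linf_c_measurable[OF bL]
  have i1: "Lint (%x. h x * b k x)" "Lint (%x. h x * d k x)" by (rule holder_integrable(1)[OF _ _ half]; use fin dfin lpow_finite[OF bL] in simp)+
  have i2: "Lint (%x. g x * T (b k) x)" "Lint (%x. g x * T (d k) x)" by (rule holder_integrable(1)[OF _ _ half]; use fin Tfin dL bL2 in simp)+
  have "(\<L> x. h x * a x) = (\<L> x. h x * b k x + h x * d k x)" by (intro Lintegral_cong) (auto simp: d_def algebra_simps)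
  also have "... = (\<L> x. h x * b k x) + (\<L> x. h x * d k x)" by (rule Lintegral_add[OF i1])
  finally have e1: "(\<L> x. h x * a x) = (\<L> x. h x * b k x) + (\<L> x. h x * d k x)" .
  have ae: "AEL x. g x * T a x = g x * T (b k) x + g x * T (d k) x" proof -
   have "(%y. b k y + d k y) = a" by (auto simp: d_def)
   then have "AEL x. T a x = T (b k) x + T (d k) x" using T_add[OF bL2[of k] dL[of k]] by simp
   then show ?thesis by eventually_elim (simp add: algebra_simps)
  qed
  have "(\<L> x. g x * T a x) = (\<L> x. g x * T (b k) x + g x * T (d k) x)" by (rule integral_cong_AE[OF _ _ ae]) measurable
  also have "... = (\<L> x. g x * T (b k) x) + (\<L> x. g x * T (d k) x)" by (rule Lintegral_add[OF i2])
  finally have e2: "(\<L> x. g x * T a x) = (\<L> x. g x * T (b k) x) + (\<L> x. g x * T (d k) x)" .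
  have TB: "enn2real (lpow 2 (T (d k))) powr (1 / 2) <= B powr (1 / 2) * \<alpha> k" proof -
   have "lpow 2 (T (d k)) <= ennreal B * lpow 2 (d k)" by (rule T_bdd[OF dL])
   also have "... = ennreal (B * enn2real (lpow 2 (d k)))" using dfin[of k] B_nonneg by (simp add: ennreal_mult)
   finally have "enn2real (lpow 2 (T (d k))) <= B * enn2real (lpow 2 (d k))" using B_nonneg by (intro enn2real_leI) auto
   then have "enn2real (lpow 2 (T (d k))) powr (1 / 2) <= (B * enn2real (lpow 2 (d k))) powr (1 / 2)" by (intro powr_mono2) auto
   then show ?thesis using B_nonneg by (simp add: \<alpha>_def powr_mult)
  qed
  have "z = (\<L> x. h x * d k x) - (\<L> x. g x * T (d k) x)" unfolding z_def e1 e2 using pair[OF bL[of k]] by simp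
  then have "norm z <= norm (\<L> x. h x * d k x) + norm (\<L> x. g x * T (d k) x)" by (simp add: norm_triangle_ineq4)
  also have "... <= enn2real (lpow 2 h) powr (1 / 2) * \<alpha> k + enn2real (lpow 2 g) powr (1 / 2) * enn2real (lpow 2 (T (d k))) powr (1 / 2)" unfolding \<alpha>_def by (intro add_mono holder_integrable(2)[OF _ _ half]) (use fin dfin Tfin dL in auto)
  also have "... <= enn2real (lpow 2 h) powr (1 / 2) * \<alpha> k + enn2real (lpow 2 g) powr (1 / 2) * (B powr (1 / 2) * \<alpha> k)" by (intro add_left_mono mult_left_mono TB) simp
  finally show ?thesis by (simp add: algebra_simps)
 qed
 moreover have "(%k. (enn2real (lpow 2 h) powr (1 / 2) + enn2real (lpow 2 g) powr (1 / 2) * B powr (1 / 2)) * \<alpha> k) ----> 0" proof -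
  have "(%k. enn2real (lpow 2 (d k))) ----> 0" using tendsto_enn2real[of "%k. lpow 2 (d k)" 0 sequentially] d0 by simp
  then have "\<alpha> ----> 0" unfolding \<alpha>_def by (intro tendsto_zero_powrI[OF _ tendsto_const]) auto
  then show ?thesis by (rule tendsto_mult_right_zero)
 qed
 ultimately have "norm z <= 0" by (intro LIMSEQ_le_const) auto
 then show ?thesis by (simp add: z_def)
qed


section \<open>The modified operator\<close>

text \<open>Each derivative is a pointwise limit of difference quotients. The exceptional point \<open>y = x\<close> is
  excluded at every stage, as the kernel has no derivative there.\<close>

lemma foldr_partial_measurable:
 fixes K :: "real ^ 'n => real ^ 'n => complex"
 assumes K: "standard_kernel s \<delta> K" and kern: "cz_kernel (offdiag K) A \<delta>" and js: "length js <= s"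
 shows "(%y. if y = x then 0 else foldr partial js (K y) x) : Lmeas" using js proof (induction js arbitrary: x)
 case Nil
 interpret cz_kernel "offdiag K" A \<delta> by (rule kern)
 show ?case using K_section2_measurable[of x] by (simp add: offdiag_def cong: if_cong)
next
 case (Cons i js)
 define D where "D y z = (if y = z then 0 else foldr partial js (K y) z)" for y z
 have [measurable]: "(%y. D y z) : Lmeas" for z unfolding D_def by (rule Cons.IH) (use Cons.prems in simp)
 define h where "h k = inverse (real (Suc k))" for k
 have h: "h k ~= 0" for k by (simp add: h_def)
 have [measurable]: "- {x} : sets lebesgue" by simp
 show ?case proof (rule borel_measurable_LIMSEQ_metric[of "%k y. ind (- {x}) y * ((D y (x + h k *\<^sub>R axis i 1) - D y x) / of_real (h k))"])
  show "(%y. ind (- {x}) y * ((D y (x + h k *\<^sub>R axis i 1) - D y x) / of_real (h k))) : Lmeas" for k by measurable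
  fix y
  show "(%k. ind (- {x}) y * ((D y (x + h k *\<^sub>R axis i 1) - D y x) / of_real (h k))) ---->
   (if y = x then 0 else foldr partial (i # js) (K y) x)" proof (cases "y = x")
   case False
   let ?\<phi> = "%t. foldr partial js (K y) (x + t *\<^sub>R axis i 1)" and ?d = "foldr partial (i # js) (K y) x"
   have ex: "partials_exist_on s (- {y}) (K y)" using K unfolding standard_kernel_def by blast
   have "(?\<phi> has_vector_derivative ?d) (at 0)" using partial_has_derivative[OF ex, of js x 0 i] False Cons.prems by simp
   then have "(%t. norm (?\<phi> (0 + t) - ?\<phi> 0 - t *\<^sub>R ?d) / norm t) \<midarrow>0\<rightarrow> 0" unfolding has_vector_derivative_def has_derivative_at by blast
   moreover have h0: "filterlim h (at 0) sequentially" unfolding h_def using inverse_Suc_at_right_0 by (rule filterlim_mono) (auto simp: at_le)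
   ultimately have "(%k. norm (?\<phi> (0 + h k) - ?\<phi> 0 - h k *\<^sub>R ?d) / norm (h k)) ----> 0" by (rule filterlim_compose)
   moreover have "norm (?\<phi> (0 + h k) - ?\<phi> 0 - h k *\<^sub>R ?d) / norm (h k) = norm ((?\<phi> (h k) - ?\<phi> 0) / of_real (h k) - ?d)" for k proof -
    have "(?\<phi> (h k) - ?\<phi> 0) / of_real (h k) - ?d = (?\<phi> (h k) - ?\<phi> 0 - h k *\<^sub>R ?d) / of_real (h k)" using h[of k] by (simp add: field_simps scaleR_conv_of_real)
    then show ?thesis by (simp add: norm_divide)
   qed
   ultimately have "(%k. (?\<phi> (h k) - ?\<phi> 0) / of_real (h k) - ?d) ----> 0" by (simp add: tendsto_norm_zero_iff)
   then have lim: "(%k. (?\<phi> (h k) - ?\<phi> 0) / of_real (h k)) ----> ?d" by (rule LIM_zero_cancel)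
   have "h ----> 0" using h0 by (rule filterlim_mono) (auto simp: at_within_def)
   then have "(%k. x + h k *\<^sub>R axis i 1) ----> x + 0 *\<^sub>R axis i (1::real)" by (intro tendsto_intros)
   then have "\<forall>\<^sub>F k in sequentially. x + h k *\<^sub>R axis i 1 ~= y" by (rule tendsto_imp_eventually_ne) (use False in simp)
   then have "\<forall>\<^sub>F k in sequentially. (?\<phi> (h k) - ?\<phi> 0) / of_real (h k) = ind (- {x}) y * ((D y (x + h k *\<^sub>R axis i 1) - D y x) / of_real (h k))" by eventually_elim (use False in "auto simp: D_def")
   then have "(%k. ind (- {x}) y * ((D y (x + h k *\<^sub>R axis i 1) - D y x) / of_real (h k))) ----> ?d" by (rule Lim_transform_eventually[OF lim])
   then show ?thesis using False by simp
  qed simp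
 qed
qed

lemma punctured_integral_tendsto:
 fixes u :: "real ^ 'n => complex"
 assumes u: "Lint u"
 shows "((%\<eta>. \<L> y. ind (- ball x \<eta>) y * u y) \<longlongrightarrow> (\<L> y. u y)) (at_right 0)" proof (rule tendsto_at_right_sequentially[of 0 1])
 fix S :: "nat => real" assume S: "!!n. 0 < S n" "S ----> 0"
 note [measurable] = borel_measurable_integrable[OF u]
 show "(%n. \<L> y. ind (- ball x (S n)) y * u y) ----> (\<L> y. u y)" proof (rule integral_dominated_convergence[where w="%y. norm (u y)"])
  have "AEL y. y ~= x" by (rule AE_completion[OF AE_lborel_singleton])
  then show "AEL y. (%n. ind (- ball x (S n)) y * u y) ----> u y" proof eventually_elim
   case (elim y)
   then have "\<forall>\<^sub>F n in sequentially. S n < dist x y" using order_tendstoD(2)[OF S(2), of "dist x y"] by auto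
   then have "\<forall>\<^sub>F n in sequentially. ind (- ball x (S n)) y * u y = u y" by eventually_elim (simp add: indicator_def)
   then show ?case by (rule tendsto_eventually)
  qed
  show "AEL y. norm (ind (- ball x (S n)) y * u y) <= norm (u y)" for n by (intro AE_I2) (auto simp: indicator_def)
 qed (use u in auto)
qed simp

text \<open>What remains of the modified kernel when its singular part, the kernel on \<open>B(x\<^sub>0, R)\<close>, is removed.\<close>

definition far_kernel ::
 "(real ^ 'n => real ^ 'n => complex) => nat => real ^ 'n => real => real => real ^ 'n => real ^ 'n => complex" where
 "far_kernel K s x0 r0 R x y =
  offdiag K y x * ind (- ball x0 R) y - taylor s (K y) x0 x * ind (- ball x0 r0) y"

definition tail_weight :: "nat => real => real ^ 'n => real => real ^ 'n => real" where
 "tail_weight s \<delta> x0 r0 y = 1 / norm (y - x0) powr (real CARD('n) + (real s + \<delta>)) * ind (- ball x0 r0) y"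

lemma tail_weight_nonneg: "0 <= tail_weight s \<delta> x0 r0 y" by (simp add: tail_weight_def)

lemma tail_weight_measurable [measurable]: "tail_weight s \<delta> x0 r0 : Lmeas" proof -
 have "(%y. 1 / norm (y - x0) powr (real CARD('a) + (real s + \<delta>)) * ind (- ball x0 r0) y) : Lmeas" by (intro borel_measurable_times borel_measurable_indicator sets_lebesgue_compl_ball) (intro borel_measurable_lebesgueI, measurable)
 then show ?thesis by (simp add: tail_weight_def[abs_def])
qed

lemma taylor_norm_bound:
 fixes F :: "real ^ 'n => complex"
 assumes "!!\<gamma>. mi_abs \<gamma> <= s ==> norm (mpartial \<gamma> F c) <= b \<gamma>" and x: "norm (x - c) <= R"
 shows "norm (taylor s F c x) <= (\<Sum>\<gamma> | mi_abs \<gamma> <= s. b \<gamma> * R ^ mi_abs \<gamma>)" unfolding taylor_def proof (rule sum_norm_le)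
 fix \<gamma> :: "'n => nat" assume "\<gamma> : {\<gamma>. mi_abs \<gamma> <= s}"
 then have b: "norm (mpartial \<gamma> F c) <= b \<gamma>" using assms(1) by simp
 have f: "1 <= mi_fact \<gamma>" unfolding mi_fact_def by (rule prod_ge_1) (simp add: fact_ge_1)
 have "\<bar>mi_pow (x - c) \<gamma>\<bar> <= norm (x - c) ^ mi_abs \<gamma>" by (rule mi_pow_le)
 also have "... <= R ^ mi_abs \<gamma>" using x by (intro power_mono) auto
 finally have p: "\<bar>mi_pow (x - c) \<gamma>\<bar> <= R ^ mi_abs \<gamma>" .
 have "norm (mpartial \<gamma> F c) / mi_fact \<gamma> <= norm (mpartial \<gamma> F c) / 1" using f by (intro divide_left_mono) auto
 then have "norm (mpartial \<gamma> F c) / mi_fact \<gamma> <= b \<gamma>" using b by simp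
 then have "norm (mpartial \<gamma> F c) / mi_fact \<gamma> * \<bar>mi_pow (x - c) \<gamma>\<bar> <= b \<gamma> * R ^ mi_abs \<gamma>" using p order_trans[OF norm_ge_zero b] by (intro mult_mono) auto
 then show "norm (mpartial \<gamma> F c / of_real (mi_fact \<gamma>) * of_real (mi_pow (x - c) \<gamma>)) <= b \<gamma> * R ^ mi_abs \<gamma>" using f by (simp add: norm_mult norm_divide)
qed

text \<open>Outside \<open>B(x\<^sub>0, 2 R\<^sub>1)\<close> this is the Taylor remainder. On the annulus in between only the Taylor polynomial is
  present, and there all powers of the distance are comparable.\<close>

lemma far_kernel_bound:
 fixes K :: "real ^ 'n => real ^ 'n => complex"
 assumes K: "standard_kernel s \<delta> K" and \<delta>: "0 < \<delta>" and r0: "0 < r0" and R1: "r0 <= R1"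
 shows "\<exists>C\<ge>0. \<forall>x\<in>ball x0 R1. \<forall>y. norm (far_kernel K s x0 r0 (2 * R1) x y) <= C * tail_weight s \<delta> x0 r0 y" proof -
 let ?n = "CARD('n)"
 obtain C where C: "0 < C" and rem: "\<forall>x c z. x ~= c --> 2 * norm (z - c) <= norm (x - c) -->
   norm (K x z - taylor s (%v. K x v) c z) <= C * (norm (z - c) powr (real s + \<delta>) / norm (x - c) powr (real CARD('n) + real s + \<delta>))"
  and size: "\<forall>\<gamma> x c. mi_abs \<gamma> <= s --> x ~= c --> norm (mpartial \<gamma> (%v. K x v) c) <= C / norm (x - c) ^ (CARD('n) + mi_abs \<gamma>)" using kernel_taylor[OF K \<delta>] by blast
 have R1p: "0 < R1" using r0 R1 by simp
 define C1 where "C1 = (\<Sum>\<gamma> :: 'n => nat | mi_abs \<gamma> <= s. C * (2 * R1) powr (real s + \<delta> - real (mi_abs \<gamma>)) * R1 ^ mi_abs \<gamma>)"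
 define C2 where "C2 = C * R1 powr (real s + \<delta>)"
 have C1: "0 <= C1" unfolding C1_def using C R1p by (intro sum_nonneg) simp
 have C2: "0 <= C2" using C by (simp add: C2_def)
 have "norm (far_kernel K s x0 r0 (2 * R1) x y) <= (C1 + C2) * tail_weight s \<delta> x0 r0 y" if x: "x : ball x0 R1" for x y proof -
  let ?\<rho> = "norm (y - x0)" and ?e = "real ?n + (real s + \<delta>)"
  have xR: "norm (x - x0) <= R1" using x by (simp add: dist_norm norm_minus_commute)
  consider "y : ball x0 r0" | "y ~: ball x0 r0" "y : ball x0 (2 * R1)" | "y ~: ball x0 (2 * R1)" by blast
  then show ?thesis proof cases
   case 1
   then have "dist x0 y < 2 * R1" using R1 R1p by simp
   then show ?thesis using 1 by (simp add: far_kernel_def tail_weight_def)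
  next
   case 2
   have \<rho>: "r0 <= ?\<rho>" "?\<rho> <= 2 * R1" using 2 by (auto simp: dist_norm norm_minus_commute)
   have \<rho>0: "0 < ?\<rho>" using \<rho> r0 by linarith
   have yx0: "y ~= x0" using \<rho>0 by auto
   have "norm (taylor s (K y) x0 x) <= (\<Sum>\<gamma> :: 'n => nat | mi_abs \<gamma> <= s. (C * (2 * R1) powr (real s + \<delta> - real (mi_abs \<gamma>)) / ?\<rho> powr ?e) * R1 ^ mi_abs \<gamma>)"
   proof (rule taylor_norm_bound[where b="%\<gamma>. C * (2 * R1) powr (real s + \<delta> - real (mi_abs \<gamma>)) / ?\<rho> powr ?e", OF _ xR])
    fix \<gamma> :: "'n => nat" assume g: "mi_abs \<gamma> <= s"
    have "norm (mpartial \<gamma> (K y) x0) <= C / ?\<rho> ^ (?n + mi_abs \<gamma>)" using size g yx0 by blast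
    also have "... = C * ?\<rho> powr (real s + \<delta> - real (mi_abs \<gamma>)) / ?\<rho> powr ?e" proof -
    have "?\<rho> powr ?e = ?\<rho> powr real (?n + mi_abs \<gamma>) * ?\<rho> powr (real s + \<delta> - real (mi_abs \<gamma>))" by (simp add: powr_add[symmetric])
    also have "?\<rho> powr real (?n + mi_abs \<gamma>) = ?\<rho> ^ (?n + mi_abs \<gamma>)" by (rule powr_realpow[OF \<rho>0])
    finally show ?thesis using \<rho>0 by simp
    qed
    also have "... <= C * (2 * R1) powr (real s + \<delta> - real (mi_abs \<gamma>)) / ?\<rho> powr ?e" using C \<rho> \<delta> g by (intro divide_right_mono mult_left_mono powr_mono2) auto
    finally show "norm (mpartial \<gamma> (K y) x0) <= C * (2 * R1) powr (real s + \<delta> - real (mi_abs \<gamma>)) / ?\<rho> powr ?e" .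
   qed
   also have "... = C1 * (1 / ?\<rho> powr ?e)" unfolding C1_def sum_distrib_right by (intro sum.cong) auto
   also have "... <= (C1 + C2) * (1 / ?\<rho> powr ?e)" using C2 by (intro mult_right_mono) auto
   finally show ?thesis using 2 by (simp add: far_kernel_def tail_weight_def)
  next
   case 3
   have \<rho>: "2 * R1 <= ?\<rho>" using 3 by (simp add: dist_norm norm_minus_commute)
   have yx0: "y ~= x0" using \<rho> R1p by auto
   have "norm (x - x0) < R1" using x by (simp add: dist_norm norm_minus_commute)
   then have yx: "y ~= x" using \<rho> R1p by auto
   have y0: "y ~: ball x0 r0" using 3 R1 R1p by simp
   have "far_kernel K s x0 r0 (2 * R1) x y = K y x - taylor s (K y) x0 x" using 3 y0 yx by (simp add: far_kernel_def offdiag_def)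
   also have "norm ... <= C * (norm (x - x0) powr (real s + \<delta>) / ?\<rho> powr (real CARD('n) + real s + \<delta>))" using rem yx0 xR \<rho> by simp
   also have "... <= C * (R1 powr (real s + \<delta>) / ?\<rho> powr (real CARD('n) + real s + \<delta>))" using C xR \<delta> by (intro mult_left_mono divide_right_mono powr_mono2) auto
   also have "... = C2 * (1 / ?\<rho> powr ?e)" by (simp add: C2_def add.assoc)
   also have "... <= (C1 + C2) * (1 / ?\<rho> powr ?e)" using C1 by (intro mult_right_mono) auto
   finally show ?thesis using y0 by (simp add: tail_weight_def)
  qed
 qed
 then show ?thesis using C1 C2 by (intro exI[of _ "C1 + C2"]) auto
qed

lemma far_kernel_measurable:
 fixes K :: "real ^ 'n => real ^ 'n => complex"
 assumes K: "standard_kernel s \<delta> K" and kern: "cz_kernel (offdiag K) A \<delta>" and r0: "0 < r0"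
 shows "(%z. far_kernel K s x0 r0 R (fst z) (snd z)) : borel_measurable leb2" proof -
 interpret S: cz_kernel "%x y. offdiag K y x" A \<delta> by (rule cz_kernel.swap[OF kern])
 have k: "(%z. offdiag K (snd z) (fst z)) : borel_measurable leb2" using borel_measurable_pair_lebesgue[OF S.K_measurable] by (simp add: case_prod_beta)
 define m where "m \<gamma> y = (if y = x0 then 0 else mpartial \<gamma> (K y) x0)" for \<gamma> y
 have m: "m \<gamma> : Lmeas" if "mi_abs \<gamma> <= s" for \<gamma> proof -
  have "length (mi_list \<gamma> (coords :: 'n list)) = mi_abs \<gamma>" unfolding length_mi_list mi_abs_def using sum_list_distinct_conv_sum_set[OF coords(1), of \<gamma>] unfolding coords(2) .
  then show ?thesis unfolding m_def mpartial_eq using foldr_partial_measurable[OF K kern] that by simp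
 qed
 have ind: "(%z. ind (- ball x0 \<rho>) (snd z) :: complex) : borel_measurable ((lebesgue :: (real ^ 'n) measure) \<Otimes>\<^sub>M lebesgue)" for \<rho> by (rule measurable_snd_lebesgue) measurable
 have t: "(%z. (\<Sum>\<gamma> | mi_abs \<gamma> <= s. m \<gamma> (snd z) / of_real (mi_fact \<gamma>) * cmono \<gamma> (fst z - x0)) * ind (- ball x0 r0) (snd z)) : borel_measurable leb2"
 proof (intro borel_measurable_times borel_measurable_sum borel_measurable_divide ind borel_measurable_const)
  fix \<gamma> :: "'n => nat" assume "\<gamma> : {\<gamma>. mi_abs \<gamma> <= s}"
  then have g: "mi_abs \<gamma> <= s" by simp
  show "(%z. m \<gamma> (snd z)) : borel_measurable leb2" by (rule measurable_snd_lebesgue[OF m[OF g]])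
  have "(%x. cmono \<gamma> (x - x0)) : poly_space s" using poly_space_affine[OF poly_space_monomial[OF g], of "- x0" 1] by simp
  then show "(%z. cmono \<gamma> (fst z - x0)) : borel_measurable leb2" by (rule measurable_fst_lebesgue[OF measurable_poly_space])
 qed
 have "far_kernel K s x0 r0 R (fst z) (snd z) = offdiag K (snd z) (fst z) * ind (- ball x0 R) (snd z) -
  (\<Sum>\<gamma> | mi_abs \<gamma> <= s. m \<gamma> (snd z) / of_real (mi_fact \<gamma>) * cmono \<gamma> (fst z - x0)) * ind (- ball x0 r0) (snd z)" for z using r0 by (cases "snd z = x0") (auto simp: far_kernel_def taylor_def m_def)
 then show ?thesis by (simp only:) (intro borel_measurable_diff borel_measurable_times k ind t)
qed

lemma modified_cz_representation:
 fixes K :: "real ^ 'n => real ^ 'n => complex"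
 assumes kern: "cz_kernel (offdiag K) A \<delta>" and r0: "0 < r0" "r0 <= R"
  and g: "Lint (%y. ind (ball x0 R) y * f y)"
  and far: "Lint (%y. far_kernel K s x0 r0 R x y * f y)"
  and lim: "((%\<eta>. trunc (%x y. offdiag K y x) \<eta> (%y. ind (ball x0 R) y * f y) x) \<longlongrightarrow> h) (at_right 0)"
 shows "modified_cz s (%x y. K y x) x0 r0 f x = h + (\<L> y. far_kernel K s x0 r0 R x y * f y)" proof -
 interpret S: cz_kernel "%x y. offdiag K y x" A \<delta> by (rule cz_kernel.swap[OF kern])
 have "((%\<eta>. trunc (%x y. offdiag K y x) \<eta> (%y. ind (ball x0 R) y * f y) x +
   (\<L> y. ind (- ball x \<eta>) y * (far_kernel K s x0 r0 R x y * f y))) \<longlongrightarrow> h + (\<L> y. far_kernel K s x0 r0 R x y * f y)) (at_right 0)" by (intro tendsto_add lim punctured_integral_tendsto far)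
 moreover have "\<forall>\<^sub>F \<eta> in at_right 0. trunc (%x y. offdiag K y x) \<eta> (%y. ind (ball x0 R) y * f y) x +
   (\<L> y. ind (- ball x \<eta>) y * (far_kernel K s x0 r0 R x y * f y)) =
   (LINT y:- ball x \<eta>|lebesgue. (K y x - (\<Sum>\<gamma> | mi_abs \<gamma> <= s.
    mpartial \<gamma> (%u. K y u) x0 / of_real (mi_fact \<gamma>) * of_real (mi_pow (x - x0) \<gamma>) * ind (- ball x0 r0) y)) * f y)" using eventually_at_right_less proof eventually_elim
  case (elim \<eta>)
  have i2: "Lint (%y. ind (- ball x \<eta>) y * (far_kernel K s x0 r0 R x y * f y))" proof (rule Lintegrable_bound[OF far])
   note [measurable] = borel_measurable_integrable[OF far]
   show "(%y. ind (- ball x \<eta>) y * (far_kernel K s x0 r0 R x y * f y)) : Lmeas" by measurable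
  qed (auto intro!: AE_I2 simp: indicator_def)
  have "trunc (%x y. offdiag K y x) \<eta> (%y. ind (ball x0 R) y * f y) x +
   (\<L> y. ind (- ball x \<eta>) y * (far_kernel K s x0 r0 R x y * f y)) =
   (\<L> y. offdiag K y x * (ind (- ball x \<eta>) y * (ind (ball x0 R) y * f y)) + ind (- ball x \<eta>) y * (far_kernel K s x0 r0 R x y * f y))" unfolding S.trunc_eq by (rule Lintegral_add[symmetric, OF S.trunc_integrable[OF g elim] i2])
  also have "... = (LINT y:- ball x \<eta>|lebesgue. (K y x - (\<Sum>\<gamma> | mi_abs \<gamma> <= s.
    mpartial \<gamma> (%u. K y u) x0 / of_real (mi_fact \<gamma>) * of_real (mi_pow (x - x0) \<gamma>) * ind (- ball x0 r0) y)) * f y)" unfolding set_lint_mult proof (intro Lintegral_cong refl)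
   fix y
   show "offdiag K y x * (ind (- ball x \<eta>) y * (ind (ball x0 R) y * f y)) + ind (- ball x \<eta>) y * (far_kernel K s x0 r0 R x y * f y) =
    ind (- ball x \<eta>) y * ((K y x - (\<Sum>\<gamma> | mi_abs \<gamma> <= s.
    mpartial \<gamma> (%u. K y u) x0 / of_real (mi_fact \<gamma>) * of_real (mi_pow (x - x0) \<gamma>) * ind (- ball x0 r0) y)) * f y)" proof (cases "y : ball x \<eta>")
    case False
    then have "y ~= x" using elim by auto
    then have o: "offdiag K y x = K y x" by (simp add: offdiag_def)
    have t: "(\<Sum>\<gamma> | mi_abs \<gamma> <= s. mpartial \<gamma> (%u. K y u) x0 / of_real (mi_fact \<gamma>) * of_real (mi_pow (x - x0) \<gamma>) * ind (- ball x0 r0) y)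
    = taylor s (K y) x0 x * ind (- ball x0 r0) y" unfolding taylor_def sum_distrib_right ..
    show ?thesis unfolding t far_kernel_def o using False by (cases "y : ball x0 R") (auto simp: algebra_simps)
   qed simp
  qed
  finally show ?case .
 qed
 ultimately have "((%\<eta>. LINT y:- ball x \<eta>|lebesgue. (K y x - (\<Sum>\<gamma> | mi_abs \<gamma> <= s.
    mpartial \<gamma> (%u. K y u) x0 / of_real (mi_fact \<gamma>) * of_real (mi_pow (x - x0) \<gamma>) * ind (- ball x0 r0) y)) * f y)
  \<longlongrightarrow> h + (\<L> y. far_kernel K s x0 r0 R x y * f y)) (at_right 0)" by (rule Lim_transform_eventually)
 then show ?thesis unfolding modified_cz_def by (intro tendsto_Lim) auto
qed

text \<open>On a large ball the modified operator is a principal value plus a bounded function. Against \<open>a\<close>, the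
  former is dual to \<open>T\<close> inside the ball of twice the radius, and the latter gives \<open>T a\<close> outside it by Fubini's theorem.\<close>

lemma modified_cz_pairing:
 fixes K :: "real ^ 'n => real ^ 'n => complex"
 assumes K: "standard_kernel s \<delta> K" and \<delta>: "0 < \<delta>" and T: "cz_op (offdiag K) A \<delta> T B"
  and r0: "0 < r0" "r0 <= R1" and fm: "f : Lmeas"
  and g: "Lint (%y. ind (ball x0 (2 * R1)) y * f y)"
  and tail: "Lint (%y. norm (f y) * tail_weight s \<delta> x0 r0 y)"
  and hm: "h : Lmeas"
  and lim: "AEL x. ((%\<eta>. trunc (%x y. offdiag K y x) \<eta> (%y. ind (ball x0 (2 * R1)) y * f y) x) \<longlongrightarrow> h x) (at_right 0)"
 defines "F \<equiv> modified_cz s (%x y. K y x) x0 r0 f"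
 shows "\<exists>W\<in>Linf_c. AEL x. x : ball x0 R1 --> F x = h x + W x"
  and "[| a : L2; Lint a; \<forall>x. x ~: ball x0 R1 --> a x = 0; moments_zero s a;
   Lint (%x. h x * a x); Lint (%x. ind (ball x0 (2 * R1)) x * f x * T a x);
   (\<L> x. h x * a x) = (\<L> x. ind (ball x0 (2 * R1)) x * f x * T a x) |] ==>
   Lint (%x. F x * a x) & Lint (%x. f x * T a x) &
   (\<L> x. F x * a x) = (\<L> x. f x * T a x)" proof -
 interpret cz_op "offdiag K" A \<delta> T B by (rule T)
 interpret P: pair_sigma_finite "lebesgue :: (real^'n) measure" "lebesgue :: (real^'n) measure" by (rule pair_sigma_finite_lebesgue)
 have kern: "cz_kernel (offdiag K) A \<delta>" using T by (rule cz_op.axioms(1))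
 note [measurable] = fm hm
 have R1: "0 < R1" using r0 by simp
 obtain C where C: "0 <= C" and bd: "!!x y. x : ball x0 R1 ==> norm (far_kernel K s x0 r0 (2 * R1) x y) <= C * tail_weight s \<delta> x0 r0 y" using far_kernel_bound[OF K \<delta> r0] by blast
 let ?v = "%y. norm (f y) * tail_weight s \<delta> x0 r0 y"
 have v0: "0 <= ?v y" for y by (simp add: tail_weight_nonneg)
 have pm: "(%z. far_kernel K s x0 r0 (2 * R1) (fst z) (snd z) * f (snd z)) : borel_measurable leb2" by (intro borel_measurable_times far_kernel_measurable[OF K kern r0(1)] measurable_snd_lebesgue fm)
 have bdf: "norm (far_kernel K s x0 r0 (2 * R1) x y * f y) <= C * ?v y" if "x : ball x0 R1" for x y using mult_right_mono[OF bd[OF that, of y] norm_ge_zero[of "f y"]] by (simp add: norm_mult mult_ac)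
 have fi: "Lint (%y. far_kernel K s x0 r0 (2 * R1) x y * f y)" if x: "x : ball x0 R1" for x proof (rule Lintegrable_bound[where f="%y. C * ?v y"])
  show "Lint (%y. C * ?v y)" by (intro integrable_mult_right tail)
  have "(%y. (%z. far_kernel K s x0 r0 (2 * R1) (fst z) (snd z) * f (snd z)) (x, y)) : Lmeas" by (rule measurable_compose[OF measurable_Pair1' pm]) simp
  then show "(%y. far_kernel K s x0 r0 (2 * R1) x y * f y) : Lmeas" by simp
  show "AEL y. norm (far_kernel K s x0 r0 (2 * R1) x y * f y) <= norm (C * ?v y)" using bdf[OF x] abs_ge_self order_trans by (intro AE_I2) (fastforce simp only: real_norm_def)
 qed
 define W where "W x = ind (ball x0 R1) x * (\<L> y. far_kernel K s x0 r0 (2 * R1) x y * f y)" for x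
 have Wm: "(%x. \<L> y. far_kernel K s x0 r0 (2 * R1) x y * f y) : Lmeas" by (rule sigma_finite_measure.borel_measurable_lebesgue_integral[OF sigma_finite_lebesgue]) (use pm in "simp add: split_def")
 have W: "W : Linf_c" proof (rule Linf_cI)
  show "W : Lmeas" unfolding W_def[abs_def] using Wm by measurable
  show "norm (W x) <= C * (\<L> y. ?v y)" for x proof (cases "x : ball x0 R1")
   case True
   have "norm (\<L> y. far_kernel K s x0 r0 (2 * R1) x y * f y) <= (\<L> y. norm (far_kernel K s x0 r0 (2 * R1) x y * f y))" by (rule integral_norm_bound)
   also have "... <= (\<L> y. C * ?v y)" by (rule integral_mono) (use fi[OF True] bdf[OF True] tail in "auto simp del: norm_mult")
   finally show ?thesis using True by (simp add: W_def)
  next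
   case False
   then show ?thesis using C v0 by (simp add: W_def)
  qed
  show "W x = 0" if "x ~: ball 0 (norm x0 + R1)" for x proof -
   have "norm x <= norm x0 + dist x0 x" using norm_triangle_sub[of x x0] by (simp add: dist_norm norm_minus_commute)
   then have "x ~: ball x0 R1" using that by auto
   then show ?thesis by (simp add: W_def)
  qed
 qed
 have rep: "AEL x. x : ball x0 R1 --> F x = h x + W x" using lim proof eventually_elim
  case (elim x)
  show ?case proof
   assume x: "x : ball x0 R1"
   have "r0 <= 2 * R1" using r0 by simp
   from modified_cz_representation[OF kern r0(1) this g fi[OF x] elim] x
   show "F x = h x + W x" by (simp add: F_def W_def)
  qed
 qed
 then show "\<exists>W\<in>Linf_c. AEL x. x : ball x0 R1 --> F x = h x + W x" using W by blast
 assume aL: "a : L2" and ai: "Lint a" and supp: "\<forall>x. x ~: ball x0 R1 --> a x = 0" and mom: "moments_zero s a"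
  and ha: "Lint (%x. h x * a x)" and gTa: "Lint (%x. ind (ball x0 (2 * R1)) x * f x * T a x)"
  and eq: "(\<L> x. h x * a x) = (\<L> x. ind (ball x0 (2 * R1)) x * f x * T a x)"
 note [measurable] = borel_measurable_integrable[OF ai] T_measurable[OF aL] Linf_c_measurable[OF W]
 define H where "H x y = far_kernel K s x0 r0 (2 * R1) x y * f y * a x" for x y
 have Hm: "(%z. H (fst z) (snd z)) : borel_measurable leb2" unfolding H_def by (intro borel_measurable_times[OF pm] measurable_fst_lebesgue) measurable
 have "integrable leb2 (%z. H (fst z) (snd z))" proof (rule integrable_pair_lebesgue[OF Hm, of "%x. C * norm (a x)" ?v])
  show "norm (H (fst (x, y)) (snd (x, y))) <= C * norm (a x) * ?v y" for x y proof (cases "x : ball x0 R1")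
   case True
   then show ?thesis using mult_right_mono[OF bdf[OF True, of y] norm_ge_zero[of "a x"]] by (simp add: H_def norm_mult mult_ac)
  qed (simp add: H_def supp)
 qed (use C v0 ai tail in auto)
 then have Hi: "integrable leb2 (%(x, y). H x y)" by (simp add: split_def)
 have inner_x: "(\<L> y. H x y) = W x * a x" for x proof (cases "x : ball x0 R1")
  case True
  then show ?thesis by (simp add: H_def W_def)
 qed (simp add: H_def W_def supp)
 have inner_y: "AEL y. (\<L> x. H x y) = ind (- ball x0 (2 * R1)) y * f y * T a y" using molecule_representation[OF T aL ai supp R1] proof eventually_elim
  case (elim y)
  have tz: "(\<L> x. a x * taylor s (K y) x0 x) = 0" using mom taylor_poly_space unfolding moments_zero_def by blast
  show ?case proof (cases "y : ball x0 (2 * R1)")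
   case True
   then have "H x y = - (f y * ind (- ball x0 r0) y) * (a x * taylor s (K y) x0 x)" for x by (simp add: H_def far_kernel_def)
   then have "(\<L> x. H x y) = - (f y * ind (- ball x0 r0) y) * (\<L> x. a x * taylor s (K y) x0 x)" by (simp only: integral_mult_right_zero)
   then show ?thesis using True tz by simp
  next
   case False
   have y0: "y ~: ball x0 r0" using False r0 by simp
   have far: "H x y = f y * ((K y x - taylor s (K y) x0 x) * a x)" for x proof (cases "x : ball x0 R1")
    case True
    then have "x ~= y" using False R1 by auto
    then show ?thesis using False y0 by (simp add: H_def far_kernel_def offdiag_def)
   qed (simp add: H_def supp)
   have "(\<L> x. H x y) = f y * (\<L> x. (K y x - taylor s (K y) x0 x) * a x)" unfolding far by (rule integral_mult_right_zero)
   also have "... = f y * T a y" using elim False offdiag_taylor_integral(1)[OF kern ai supp mom R1 False] by simp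
   finally show ?thesis using False by simp
  qed
 qed
 have Wa: "Lint (%x. W x * a x)" using P.integrable_fst[OF Hi] unfolding inner_x .
 have out: "Lint (%y. ind (- ball x0 (2 * R1)) y * f y * T a y)" by (rule integrable_cong_AE[THEN iffD1, OF _ _ inner_y P.integrable_snd[OF Hi]]) (use P.integrable_snd[OF Hi] in measurable)
 have outeq: "(\<L> x. W x * a x) = (\<L> y. ind (- ball x0 (2 * R1)) y * f y * T a y)" proof -
  have "(\<L> x. W x * a x) = (\<L> x. \<L> y. H x y)" by (simp add: inner_x)
  also have "... = (\<L> y. \<L> x. H x y)" by (rule P.Fubini_integral[symmetric, OF Hi])
  also have "... = (\<L> y. ind (- ball x0 (2 * R1)) y * f y * T a y)" by (rule integral_cong_AE[OF _ _ inner_y]) (use P.integrable_snd[OF Hi] in measurable)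
  finally show ?thesis .
 qed
 have Fa: "AEL x. h x * a x + W x * a x = F x * a x" using rep proof eventually_elim
  case (elim x)
  then show ?case using supp by (cases "x : ball x0 R1") (auto simp: algebra_simps)
 qed
 have Fam: "(%x. F x * a x) : Lmeas" proof (rule borel_measurable_AE[OF _ Fa])
  show "(%x. h x * a x + W x * a x) : Lmeas" by measurable
 qed
 have sum: "Lint (%x. h x * a x + W x * a x)" by (intro Lintegrable_add ha Wa)
 have FI: "Lint (%x. F x * a x)" by (rule integrable_cong_AE[THEN iffD1, OF _ Fam Fa sum]) measurable
 have split: "f x * T a x = ind (ball x0 (2 * R1)) x * f x * T a x + ind (- ball x0 (2 * R1)) x * f x * T a x" for x by (simp add: indicator_def)
 have FT: "Lint (%x. f x * T a x)" unfolding split by (intro Lintegrable_add gTa out)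
 have "(\<L> x. F x * a x) = (\<L> x. h x * a x + W x * a x)" by (rule integral_cong_AE[symmetric, OF _ Fam Fa]) measurable
 also have "... = (\<L> x. h x * a x) + (\<L> x. W x * a x)" by (rule Lintegral_add[OF ha Wa])
 also have "... = (\<L> x. f x * T a x)" unfolding eq outeq split by (rule Lintegral_add[symmetric, OF gTa out])
 finally show "Lint (%x. F x * a x) & Lint (%x. f x * T a x) &
   (\<L> x. F x * a x) = (\<L> x. f x * T a x)" using FI FT by blast
qed


section \<open>Tails and duality for the modified operator\<close>

text \<open>A polynomial of degree \<open>s\<close> leaves the decay \<open>n + \<delta>\<close>.\<close>

lemma poly_tail:
 fixes P :: "real ^ 'n => complex"
 assumes P: "P : poly_space s" and \<delta>: "0 < \<delta>" and r0: "0 < r0"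
 shows "Lint (%y. norm (P y) * tail_weight s \<delta> x0 r0 y)" proof -
 let ?n = "CARD('n)"
 obtain M where M: "0 <= M" "!!x. norm (P x) <= M * (1 + norm x) ^ s" using poly_space_growth[OF P] by blast
 define L where "L = (1 + norm x0) / r0 + 1"
 have L: "0 <= L" using r0 by (simp add: L_def)
 note [measurable] = measurable_poly_space[OF P]
 have bd: "norm (P y) * tail_weight s \<delta> x0 r0 y <= (M * L ^ s) * (1 / norm (y - x0) powr (real ?n + \<delta>) * ind (- ball x0 r0) y)" for y proof (cases "y : ball x0 r0")
  case False
  let ?\<rho> = "norm (y - x0)"
  have \<rho>: "r0 <= ?\<rho>" using False by (simp add: dist_norm norm_minus_commute)
  have \<rho>0: "0 < ?\<rho>" using \<rho> r0 by linarith
  have "norm y <= norm x0 + ?\<rho>" by (rule norm_triangle_sub)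
  moreover have "1 + norm x0 <= (1 + norm x0) / r0 * ?\<rho>" proof -
   have "(1 + norm x0) / r0 * r0 <= (1 + norm x0) / r0 * ?\<rho>" using \<rho> r0 by (intro mult_left_mono) auto
   then show ?thesis using r0 by simp
  qed
  ultimately have "1 + norm y <= L * ?\<rho>" by (simp add: L_def distrib_right)
  then have "(1 + norm y) ^ s <= (L * ?\<rho>) ^ s" by (intro power_mono) auto
  then have "norm (P y) <= M * (L * ?\<rho>) ^ s" using M(2)[of y] mult_left_mono[OF _ M(1)] by (meson order_trans)
  then have "norm (P y) * (1 / ?\<rho> powr (real ?n + (real s + \<delta>))) <= (M * (L * ?\<rho>) ^ s) * (1 / ?\<rho> powr (real ?n + (real s + \<delta>)))" by (rule mult_right_mono) simp
  also have "... = (M * L ^ s) * (1 / ?\<rho> powr (real ?n + \<delta>))" proof -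
   have "?\<rho> powr (real ?n + (real s + \<delta>)) = ?\<rho> powr real s * ?\<rho> powr (real ?n + \<delta>)" by (simp add: powr_add[symmetric] add_ac)
   also have "?\<rho> powr real s = ?\<rho> ^ s" by (rule powr_realpow[OF \<rho>0])
   finally show ?thesis using \<rho>0 by (simp add: power_mult_distrib)
  qed
  finally show ?thesis using False by (simp add: tail_weight_def)
 qed (simp add: tail_weight_def)
 have fin: "(\<I> y. 1 * ennreal (1 / norm (y - x0) powr (real ?n + \<delta>)) * ind (- ball x0 r0) y) <= ennreal (tail_const TYPE('n) \<delta> / r0 powr \<delta>) * 1" by (rule nn_integral_tail[OF _ r0 \<delta>]) auto
 show ?thesis proof (rule integrableI_bounded)
  show "(%y. norm (P y) * tail_weight s \<delta> x0 r0 y) : Lmeas" by measurable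
  have "(\<I> y. ennreal (norm (norm (P y) * tail_weight s \<delta> x0 r0 y))) <=
   (\<I> y. ennreal (M * L ^ s) * (1 * ennreal (1 / norm (y - x0) powr (real ?n + \<delta>)) * ind (- ball x0 r0) y))" proof (intro nn_integral_mono)
   fix y
   have "ennreal (norm (norm (P y) * tail_weight s \<delta> x0 r0 y)) = ennreal (norm (P y) * tail_weight s \<delta> x0 r0 y)" by (simp add: tail_weight_nonneg)
   also have "... <= ennreal ((M * L ^ s) * (1 / norm (y - x0) powr (real ?n + \<delta>) * ind (- ball x0 r0) y))" by (intro ennreal_leI bd)
   also have "... = ennreal (M * L ^ s) * (1 * ennreal (1 / norm (y - x0) powr (real ?n + \<delta>)) * ind (- ball x0 r0) y)" using M(1) L by (subst ennreal_mult) (auto simp: indicator_def)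
   finally show "ennreal (norm (norm (P y) * tail_weight s \<delta> x0 r0 y)) <= ennreal (M * L ^ s) * (1 * ennreal (1 / norm (y - x0) powr (real ?n + \<delta>)) * ind (- ball x0 r0) y)" .
  qed
  also have "... = ennreal (M * L ^ s) * (\<I> y. 1 * ennreal (1 / norm (y - x0) powr (real ?n + \<delta>)) * ind (- ball x0 r0) y)" by (rule nn_integral_cmult) measurable
  also have "... < \<infinity>" using le_less_trans[OF fin] by (simp add: ennreal_mult_less_top)
  finally show "(\<I> y. ennreal (norm (norm (P y) * tail_weight s \<delta> x0 r0 y))) < \<infinity>" .
 qed
qed

lemma lpow_root: "lpow p f < top ==> 0 < p ==> lpow p f = ennreal ((enn2real (lpow p f) powr (1 / p)) powr p)" by (simp add: powr_powr)

lemma ball_in_ball: "ball c r \<subseteq> ball x (dist x c + r)" proof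
 fix y assume "y : ball c r"
 then show "y : ball x (dist x c + r)" using dist_triangle[of x y c] by simp
qed

locale cz_setting =
 fixes K :: "real ^ 'n => real ^ 'n => complex" and s :: nat and \<delta> A B B' :: real and T T'
 assumes K: "standard_kernel s \<delta> K" and \<delta>: "0 < \<delta>"
  and T: "cz_op (offdiag K) A \<delta> T B" and T': "cz_op (%x y. offdiag K y x) A \<delta> T' B'"
begin

lemma T'': "cz_op (%x y. (%x y. offdiag K y x) y x) A \<delta> T B" using T by simp

text \<open>The modified operator has the transposed kernel, so its local part is the extension of \<open>T'\<close>, whose
  dual is \<open>T\<close>.\<close>

lemma principal_value_part:
 assumes q: "1 < q" and f: "f : Lq_loc q"
 shows "\<exists>h. h : Lmeas & lpow q h < top &
  (AEL x. ((%\<eta>. trunc (%x y. offdiag K y x) \<eta> (%y. ind (ball x0 R) y * f y) x) \<longlongrightarrow> h x) (at_right 0)) &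
  (\<forall>a\<in>Linf_c. (\<L> x. h x * a x) = (\<L> x. ind (ball x0 R) x * f x * T a x))" proof -
 have q0: "0 < q" using q by simp
 note iff = Lq_loc_iff[OF q0, THEN iffD1, OF f]
 obtain D where D: "0 <= D" "!!f. f : Linf_c ==> lpow q (T' f) <= ennreal D * lpow q f" using Lp_boundedness[OF T' T'' q] by blast
 have fm [measurable]: "f : Lmeas" using iff by blast
 have gm: "(%y. ind (ball x0 R) y * f y) : Lmeas" by measurable
 have fin: "lpow q (%y. ind (ball x0 R) y * f y) < top" using iff by blast
 have supp: "ind (ball x0 R) y * f y = 0" if "y ~: ball 0 (dist 0 x0 + R)" for y using that ball_in_ball[of x0 R 0] by (auto simp: indicator_def simp del: mem_ball)
 from pv_extension[OF T' T'' q D gm fin supp]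
 obtain h where h: "h : Lmeas" "lpow q h <= ennreal D * lpow q (%y. ind (ball x0 R) y * f y)"
  "AEL x. ((%\<eta>. trunc (%x y. offdiag K y x) \<eta> (%y. ind (ball x0 R) y * f y) x) \<longlongrightarrow> h x) (at_right 0)"
  "\<forall>a\<in>Linf_c. (\<L> x. h x * a x) = (\<L> x. ind (ball x0 R) x * f x * T a x)" by blast
 have "lpow q h < top" using h(2) fin by (simp add: ennreal_mult_less_top le_less_trans)
 then show ?thesis using h by blast
qed

lemma modified_cz_Lq_loc:
 assumes q: "1 < q" and f: "f : Lq_loc q" and r0: "0 < r0"
  and tail: "Lint (%y. norm (f y) * tail_weight s \<delta> x0 r0 y)"
 shows "modified_cz s (%x y. K y x) x0 r0 f : Lq_loc q" proof -
 have q0: "0 < q" using q by simp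
 let ?F = "modified_cz s (%x y. K y x) x0 r0 f"
 have fm: "f : Lmeas" using Lq_loc_iff[OF q0, THEN iffD1, OF f] by blast
 have loc: "(%x. ind (ball c r) x * ?F x) : Lmeas & lpow q (%x. ind (ball c r) x * ?F x) < top" for c r proof -
  define R1 where "R1 = max r0 (dist x0 c + r)"
  have R1: "r0 <= R1" by (simp add: R1_def)
  have sub: "ball c r \<subseteq> ball x0 R1" using ball_in_ball[of c r x0] by (auto simp: R1_def)
  obtain h where h: "h : Lmeas" "lpow q h < top"
   "AEL x. ((%\<eta>. trunc (%x y. offdiag K y x) \<eta> (%y. ind (ball x0 (2 * R1)) y * f y) x) \<longlongrightarrow> h x) (at_right 0)" using principal_value_part[OF q f, of x0 "2 * R1"] by blast
  obtain W where W: "W : Linf_c" and rep: "AEL x. x : ball x0 R1 --> ?F x = h x + W x" using modified_cz_pairing(1)[OF K \<delta> T r0 R1 fm Lq_loc_integrable[OF f q] tail h(1) h(3)] by blast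
  note [measurable] = h(1) Linf_c_measurable[OF W]
  have ae: "AEL x. ind (ball c r) x * (h x + W x) = ind (ball c r) x * ?F x" using rep proof eventually_elim
   case (elim x)
   show ?case proof (cases "x : ball c r")
    case True
    then have "x : ball x0 R1" using sub by blast
    then show ?thesis using elim by simp
   qed simp
  qed
  have m: "(%x. ind (ball c r) x * ?F x) : Lmeas" by (rule borel_measurable_AE[OF _ ae]) measurable
  have "lpow q (%x. ind (ball c r) x * ?F x) = lpow q (%x. ind (ball c r) x * (h x + W x))" unfolding lpow_def by (rule nn_integral_cong_AE) (use ae in eventually_elim, simp only:)
  also have "... <= lpow q (%x. h x + W x)" by (rule lpow_mono) (use q0 in "auto simp: indicator_def")
  also have "... <= ennreal (3 powr q) * (lpow q h + lpow q W)" by (intro lpow_add_le q0) measurable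
  also have "... < top" using h(2) lpow_finite[OF W q0] by (simp add: ennreal_mult_less_top)
  finally show ?thesis using m by blast
 qed
 have "?F : Lmeas" by (rule borel_measurable_by_balls) (use loc in blast)
 then show ?thesis using loc by (simp add: Lq_loc_iff[OF q0])
qed

lemma modified_cz_dual:
 assumes q: "1 < q" and f: "f : Lq_loc q" and r0: "0 < r0"
  and tail: "Lint (%y. norm (f y) * tail_weight s \<delta> x0 r0 y)"
  and a: "a : Linf_c" and mom: "moments_zero s a"
 shows "Lint (%x. modified_cz s (%x y. K y x) x0 r0 f x * a x) & Lint (%x. f x * T a x) &
   (\<L> x. modified_cz s (%x y. K y x) x0 r0 f x * a x) = (\<L> x. f x * T a x)" proof -
 interpret cz_op "offdiag K" A \<delta> T B by (rule T)
 have q0: "0 < q" using q by simp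
 define q' where "q' = q / (q - 1)"
 have qq: "1 / q + 1 / q' = 1" using q by (simp add: q'_def field_simps)
 have q': "1 < q'" by (rule conjugate_exponent(2)[OF q qq])
 note iff = Lq_loc_iff[OF q0, THEN iffD1, OF f]
 have fm [measurable]: "f : Lmeas" using iff by blast
 obtain R where R: "!!x. x ~: ball 0 R ==> a x = 0" using a by (rule Linf_cE) blast
 define R1 where "R1 = max r0 (dist x0 0 + R)"
 have R1: "r0 <= R1" by (simp add: R1_def)
 have "ball 0 R \<subseteq> ball x0 R1" using ball_in_ball[of 0 R x0] by (auto simp: R1_def)
 then have supp: "\<forall>x. x ~: ball x0 R1 --> a x = 0" using R by blast
 obtain h where h: "h : Lmeas" "lpow q h < top"
   "AEL x. ((%\<eta>. trunc (%x y. offdiag K y x) \<eta> (%y. ind (ball x0 (2 * R1)) y * f y) x) \<longlongrightarrow> h x) (at_right 0)"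
   "\<forall>a\<in>Linf_c. (\<L> x. h x * a x) = (\<L> x. ind (ball x0 (2 * R1)) x * f x * T a x)" using principal_value_part[OF q f, of x0 "2 * R1"] by blast
 obtain D where D: "0 <= D" "!!f. f : Linf_c ==> lpow q' (T f) <= ennreal D * lpow q' f" using Lp_boundedness[OF T T' q'] by blast
 have aL: "a : L2" by (rule Linf_c_L2[OF a])
 have "lpow q' a < top" by (rule lpow_finite[OF a]) (use q' in simp)
 moreover from this have "lpow q' (T a) < top" using D(2)[OF a] by (simp add: ennreal_mult_less_top le_less_trans)
 moreover have "lpow q (%x. ind (ball x0 (2 * R1)) x * f x) < top" using iff by blast
 ultimately have i: "Lint (%x. h x * a x)" "Lint (%x. ind (ball x0 (2 * R1)) x * f x * T a x)" using h(1,2) Linf_c_measurable[OF a] T_measurable[OF aL] by (intro holder_integrable(1)[OF _ _ q qq]; simp)+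
 show ?thesis by (rule modified_cz_pairing(2)[OF K \<delta> T r0 R1 fm Lq_loc_integrable[OF f q] tail h(1) h(3) aL Linf_c_integrable[OF a] supp mom i])
   (use h(4) a in blast)
qed

text \<open>For polynomials the test function may be merely square integrable, as the definition of vanishing
  moments requires.\<close>

lemma modified_cz_dual_poly:
 assumes P: "P : poly_space s" and r0: "0 < r0"
  and a: "a : L2" and R: "\<forall>x. x ~: ball 0 R --> a x = 0" and mom: "moments_zero s a"
 shows "(\<L> x. modified_cz s (%x y. K y x) x0 r0 P x * a x) = (\<L> x. P x * T a x)" proof -
 interpret cz_op "offdiag K" A \<delta> T B by (rule T)
 have half: "(1::real) < 2" "1 / 2 + 1 / 2 = (1::real)" by auto
 have f: "P : Lq_loc 2" by (rule poly_Lq_loc[OF P]) simp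
 note fm [measurable] = measurable_poly_space[OF P]
 define R1 where "R1 = max r0 (dist x0 0 + R)"
 have R1: "r0 <= R1" by (simp add: R1_def)
 have "ball 0 R \<subseteq> ball x0 R1" using ball_in_ball[of 0 R x0] by (auto simp: R1_def)
 then have supp: "\<forall>x. x ~: ball x0 R1 --> a x = 0" using R by blast
 obtain h where h: "h : Lmeas" "lpow 2 h < top"
   "AEL x. ((%\<eta>. trunc (%x y. offdiag K y x) \<eta> (%y. ind (ball x0 (2 * R1)) y * P y) x) \<longlongrightarrow> h x) (at_right 0)"
   "\<forall>a\<in>Linf_c. (\<L> x. h x * a x) = (\<L> x. ind (ball x0 (2 * R1)) x * P x * T a x)" using principal_value_part[OF half(1) f, of x0 "2 * R1"] by blast
 have hL: "h : L2" using h by (simp add: L2_iff_lpow)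
 have gL: "(%x. ind (ball x0 (2 * R1)) x * P x) : L2" by (intro Linf_c_L2 continuous_ball_Linf_c continuous_poly_space[OF P])
 have eq: "(\<L> x. h x * a x) = (\<L> x. ind (ball x0 (2 * R1)) x * P x * T a x)" by (rule L2_pairing_density[OF T hL gL _ a R]) (use h(4) in blast)
 have am: "a : Lmeas" and afin: "lpow 2 a < top" using a by (auto simp: L2_iff_lpow)
 have Tm: "T a : Lmeas" and Tfin: "lpow 2 (T a) < top" using T_L2[OF a] by (auto simp: L2_iff_lpow)
 have ai: "Lint a" by (rule lpow_ball_integrable[OF am _ afin, of 0 R]) (use R in auto)
 have i: "Lint (%x. h x * a x)" "Lint (%x. ind (ball x0 (2 * R1)) x * P x * T a x)" using hL gL am afin Tm Tfin by (intro holder_integrable(1)[OF _ _ half]; simp add: L2_iff_lpow)+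
 show ?thesis using modified_cz_pairing(2)[OF K \<delta> T r0 R1 fm Lq_loc_integrable[OF f half(1)] poly_tail[OF P \<delta> r0] h(1) h(3) a ai supp mom i eq] by blast
qed

end


section \<open>Boundedness on the Campanato space\<close>

lemma lpow_add_powr:
 assumes m: "f : Lmeas" "g : Lmeas" and q: "1 < q"
  and f: "lpow q f <= ennreal (a powr q)" and g: "lpow q g <= ennreal (b powr q)" and ab: "0 <= a" "0 <= b"
 shows "lpow q (%x. f x + g x) <= ennreal ((6 * (a + b)) powr q)" proof -
 have "lpow q (%x. f x + g x) <= ennreal (3 powr q) * (lpow q f + lpow q g)" using q by (intro lpow_add_le m) simp
 also have "... <= ennreal (3 powr q) * (ennreal (a powr q) + ennreal (b powr q))" by (intro mult_left_mono add_mono f g) simp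
 also have "... = ennreal (3 powr q * (a powr q + b powr q))" by (simp add: ennreal_mult' flip: ennreal_plus)
 also have "... <= ennreal ((6 * (a + b)) powr q)" proof (rule ennreal_leI)
  have p: "a powr q <= (a + b) powr q" "b powr q <= (a + b) powr q" using q ab by (intro powr_mono2; simp)+
  have "(2::real) powr 1 <= 2 powr q" using q by (intro powr_mono) auto
  then have "2 * (a + b) powr q <= 2 powr q * (a + b) powr q" by (intro mult_right_mono) auto
  then have "a powr q + b powr q <= 2 powr q * (a + b) powr q" using p by linarith
  then have "3 powr q * (a powr q + b powr q) <= 3 powr q * (2 powr q * (a + b) powr q)" by (intro mult_left_mono) auto
  also have "... = (3 * 2 * (a + b)) powr q" using ab by (simp only: powr_mult mult.assoc)
  finally show "3 powr q * (a powr q + b powr q) <= (6 * (a + b)) powr q" by simp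
 qed
 finally show ?thesis .
qed

lemma lpow_ball_bounded:
 fixes f :: "real ^ 'n => complex"
 assumes le: "!!x. x : ball c r ==> norm (f x) <= M" and M: "0 <= M" and p: "0 < p" and r: "0 < r"
 shows "lpow p (%x. ind (ball c r) x * f x) <= ennreal ((M * measure lebesgue (ball c r) powr (1 / p)) powr p)" proof -
 have "lpow p (%x. ind (ball c r) x * f x) <= (\<I> x. ennreal (M powr p) * ind (ball c r) x)" unfolding lpow_def using le M p by (intro nn_integral_mono) (auto simp: indicator_def intro!: ennreal_leI powr_mono2)
 also have "... = ennreal (M powr p) * vol (ball c r)" by (rule nn_integral_cmult_indicator) simp
 also have "vol (ball c r) = ennreal (measure lebesgue (ball c r))" using emeasure_ball_pos_finite(2)[OF r, of c] by (intro emeasure_eq_ennreal_measure) auto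
 also have "ennreal (M powr p) * ennreal (measure lebesgue (ball c r)) = ennreal ((M * measure lebesgue (ball c r) powr (1 / p)) powr p)" using M p by (simp add: powr_mult powr_powr flip: ennreal_mult')
 finally show ?thesis .
qed

lemma measure_ball_powr:
 assumes "0 < r"
 shows "measure lebesgue (ball (c :: real ^ 'n) r) powr t = unit_ball_vol (real CARD('n)) powr t * r powr (real CARD('n) * t)" proof -
 have "measure lebesgue (ball c r) = unit_ball_vol (real CARD('n)) * r powr real CARD('n)" using assms measure_lebesgue_ball[of r c] by (simp add: powr_realpow)
 then show ?thesis by (simp only: powr_mult powr_powr)
qed

lemma ball_L1_le:
 fixes a :: "real ^ 'n => complex"
 assumes a: "a : Linf_c" and q: "1 < q" and qq: "1 / q + 1 / q' = 1" and r: "0 < r"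
 shows "(\<L> x. norm (ind (ball c r) x * a x)) <=
  enn2real (lpow q' a) powr (1 / q') * (unit_ball_vol (real CARD('n)) powr (1 / q) * r powr (real CARD('n) / q))" proof -
 have q': "1 < q'" by (rule conjugate_exponent(2)[OF q qq])
 have qq2: "1 / q' + 1 / q = 1" using qq by simp
 note [measurable] = Linf_c_measurable[OF a]
 define \<alpha> where "\<alpha> = enn2real (lpow q' a) powr (1 / q')"
 have \<alpha>: "0 <= \<alpha>" by (simp add: \<alpha>_def)
 have la: "lpow q' a = ennreal (\<alpha> powr q')" unfolding \<alpha>_def using q' by (intro lpow_root lpow_finite[OF a]) auto
 define m where "m = measure lebesgue (ball c r) powr (1 / q)"
 have m: "0 <= m" by (simp add: m_def)
 have 1: "lpow q (%x::real ^ 'n. ind (ball c r) x * 1) <= ennreal ((1 * m) powr q)" unfolding m_def by (rule lpow_ball_bounded[OF _ _ _ r]) (use q in auto)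
 define I where "I = (\<L> x. norm (ind (ball c r) x * a x))"
 have "ennreal I = (\<I> x. ennreal (norm (ind (ball c r) x * a x)))" unfolding I_def by (rule nn_integral_eq_integral[symmetric]) (intro integrable_norm Linf_c_integrable Linf_c_indicator a, auto)
 also have "... = (\<I> x. ennreal (norm (a x) * norm (ind (ball c r) x * 1 :: complex)))" by (intro nn_integral_cong) (auto simp: indicator_def)
 also have "... <= ennreal (\<alpha> * m)" by (rule holder_nn_integral[OF _ _ q' qq2 \<alpha> m]) (use la 1 in "auto simp: lpow_def")
 finally have "I <= \<alpha> * m" using \<alpha> m by simp
 then show ?thesis unfolding I_def \<alpha>_def m_def measure_ball_powr[OF r] by simp
qed

lemma osc1_le:
 fixes f :: "real ^ 'n => complex"
 assumes N: "ball_quasi_banach N" and pb: "proj_bound s TYPE('n) Cp" and f: "f : campanato N q s" and q: "1 < q" and r: "0 < r"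
 shows "osc1 s f c r <= enn2real (campanato_norm N q s f) * enn2real (N (ind (ball c r)))" proof -
 let ?B = "ball c r" and ?P = "proj s c r f"
 define Y where "Y = enn2real (campanato_norm N q s f) * enn2real (N (ind (ball c r)))"
 have Y: "0 <= Y" by (simp add: Y_def)
 have fL: "f : Lq_loc q" using f by (simp add: campanato_def)
 define m where "m = measure lebesgue ?B"
 have m: "0 < m" unfolding m_def by (rule measure_ball_pos[OF r])
 have E: "vol ?B = ennreal m" unfolding m_def using emeasure_ball_pos_finite(2)[OF r, of c] by (intro emeasure_eq_ennreal_measure) auto
 have P: "?P : poly_space s" by (rule proj_bound_D(1)[OF pb r Lq_loc_integrable[OF fL q]])
 have "(%x. f x - ?P x) : Lq_loc q" by (intro Lq_loc_diff fL poly_Lq_loc[OF P]) (use q in auto)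
 then have wm [measurable]: "(%x. f x - ?P x) : Lmeas" by (simp add: Lq_loc_def)
 have "(\<I> y. ennreal (norm (f y - ?P y) powr q) * ind ?B y) = osc q s f c r" unfolding osc_def lpow_def using q by (intro nn_integral_cong) (auto simp: indicator_def)
 also have "... <= ennreal ((Y / m) powr q * m)" using campanato_osc[OF N pb f q r, of c] by (simp add: Y_def m_def)
 also have "... = ennreal ((Y / m) powr q) * vol ?B" unfolding E by (rule ennreal_mult') (use m in simp)
 finally have "(\<I> y. ennreal (norm (f y - ?P y)) * ind ?B y) <= ennreal (((Y / m) powr q) powr (1 / q)) * vol ?B" by (intro jensen_ball[OF wm q r]) simp
 also have "... = ennreal Y" unfolding E using Y m q by (simp add: powr_powr flip: ennreal_mult')
 finally have le: "(\<I> y. ennreal (norm (f y - ?P y)) * ind ?B y) <= ennreal Y" .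
 have "osc1 s f c r = enn2real (\<I> y. ennreal (norm (ind ?B y * (f y - ?P y))))" unfolding osc1_def by (rule integral_eq_nn_integral) auto
 also have "(\<I> y. ennreal (norm (ind ?B y * (f y - ?P y)))) = (\<I> y. ennreal (norm (f y - ?P y)) * ind ?B y)" by (intro nn_integral_cong) (auto simp: indicator_def)
 also have "enn2real ... <= Y" by (rule enn2real_leI[OF Y le])
 finally show ?thesis by (simp add: Y_def)
qed

text \<open>The number \<open>W\<close> is, up to a constant, the mean oscillation of \<open>f\<close> that its norm allows on \<open>B\<close>.\<close>

definition growth_bound :: "((real ^ 'n => complex) => ennreal) => real => nat => real => real => bool" where
 "growth_bound N q s \<delta> C \<longleftrightarrow> (\<forall>f\<in>campanato N q s. \<forall>c r W. 0 < r -->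
  W = enn2real (campanato_norm N q s f) * enn2real (N (ind (ball c r))) / r ^ CARD('n) -->
  lpow q (%x. ind (ball c (2 * r)) x * (f x - proj s c r f x)) <= ennreal ((C * W * r powr (real CARD('n) / q)) powr q) &
  (\<I> y. ennreal (norm (f y - proj s c r f y)) * ennreal (1 / norm (y - c) powr (real CARD('n) + (real s + \<delta>))) * ind (- ball c r) y)
   <= ennreal (C * W / r powr (real s + \<delta>)))"

text \<open>The growth of the quasi-norm on dilated balls bounds the oscillation on \<open>2\<^sup>k B\<close>, and telescoping turns this into
  control of \<open>f - P\<^sub>B f\<close> on \<open>2B\<close> and away from \<open>B\<close>.\<close>

lemma campanato_local_tail:
 assumes N: "ball_quasi_banach (N :: (real ^ 'n => complex) => ennreal)" and FS: "fefferman_stein N p0" and p0: "0 < p0"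
  and pb: "proj_bound s TYPE('n) Cp" and q: "1 < q" and \<delta>: "0 < \<delta>"
  and s: "real CARD('n) / p0 - real CARD('n) - \<delta> < real s"
 shows "\<exists>C>0. growth_bound N q s \<delta> C" proof -
 let ?n = "real CARD('n)" and ?V = "unit_ball_vol (real CARD('n))"
 have n: "0 < ?n" by simp
 define pc where "pc = ?n / (?n + real s + \<delta>)"
 have d: "0 < ?n + real s + \<delta>" using \<delta> by simp
 have pc: "0 < pc" using d n by (simp add: pc_def)
 have "?n / p0 < ?n + real s + \<delta>" using s by simp
 then have "pc < p0" using p0 d by (simp add: pc_def divide_less_eq mult.commute)
 \<comment> \<open>Above \<open>pc\<close> the exponent \<open>n / p - n\<close> is below \<open>s + \<delta>\<close>.\<close>
 define p where "p = (pc + p0) / 2"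
 have p: "0 < p" "p < p0" "pc < p" using pc \<open>pc < p0\<close> by (auto simp: p_def)
 define \<beta> where "\<beta> = ?n / p - ?n"
 have "?n / p < ?n + real s + \<delta>" using p(1,3) d by (simp add: pc_def divide_less_eq mult.commute)
 then have \<beta>: "\<beta> < real s + \<delta>" by (simp add: \<beta>_def)
 obtain Cg where Cg: "0 < Cg" and growth: "\<forall>c r k. 0 < r -->
  enn2real (N (ind (ball c (2 ^ k * r)))) <= Cg * 2 powr (real k * real CARD('n) / p) * enn2real (N (ind (ball c r)))" using bqb_ball_growth[OF N FS p(1,2)] by blast
 obtain Ct where Ct: "0 < Ct" and tele: "telescope_bound s \<delta> \<beta> TYPE('n) Ct" using campanato_telescope[OF pb \<beta> \<delta>] by blast
 define V2 where "V2 = ?V * 2 ^ CARD('n)"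
 have V2: "0 < V2" by (simp add: V2_def)
 define C1 where "C1 = 6 * (2 powr (?n / p) / V2 + Ct) * V2 powr (1 / q) * Cg"
 have C1: "0 < C1" unfolding C1_def using V2 Ct Cg by (intro mult_pos_pos add_pos_pos) auto
 define C where "C = max C1 (Ct * Cg)"
 have C: "0 < C" using C1 by (simp add: C_def)
 show ?thesis unfolding growth_bound_def proof (rule exI[of _ C], rule conjI[OF C], intro ballI allI impI)
  fix f :: "real ^ 'n => complex" and c :: "real ^ 'n" and r W :: real
  assume f: "f : campanato N q s" and r: "0 < r"
   and W: "W = enn2real (campanato_norm N q s f) * enn2real (N (ind (ball c r))) / r ^ CARD('n)"
  let ?P = "proj s c r f" and ?P2 = "proj s c (2 * r) f"
  have fL: "f : Lq_loc q" using f by (simp add: campanato_def)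
  note fi = Lq_loc_integrable[OF fL q]
  have r2: "0 < 2 * r" using r by simp
  have W0: "0 <= W" unfolding W using r by simp
  have CW: "0 <= Cg * W" using Cg W0 by simp
  have nN: "enn2real (campanato_norm N q s f) * enn2real (N (ind (ball c (2 ^ k * r)))) <= Cg * W * 2 powr (real k * ?n / p) * r ^ CARD('n)" for k proof -
   have "enn2real (campanato_norm N q s f) * enn2real (N (ind (ball c (2 ^ k * r)))) <=
    enn2real (campanato_norm N q s f) * (Cg * 2 powr (real k * ?n / p) * enn2real (N (ind (ball c r))))" using growth r by (intro mult_left_mono) auto
   also have "... = Cg * W * 2 powr (real k * ?n / p) * r ^ CARD('n)" unfolding W using r by simp
   finally show ?thesis .
  qed
  have o1: "osc1 s f c (2 ^ k * r) <= Cg * W * 2 powr (real k * \<beta>) * (2 ^ k * r) ^ CARD('n)" for k proof -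
   have "osc1 s f c (2 ^ k * r) <= enn2real (campanato_norm N q s f) * enn2real (N (ind (ball c (2 ^ k * r))))" by (rule osc1_le[OF N pb f q]) (use r in simp)
   also have "... <= Cg * W * 2 powr (real k * ?n / p) * r ^ CARD('n)" by (rule nN)
   also have "2 powr (real k * ?n / p) = 2 powr (real k * \<beta>) * (2 ^ k) ^ CARD('n)" proof -
    have "((2::real) ^ k) ^ CARD('n) = 2 powr (real k * ?n)" by (simp add: powr_realpow[symmetric] powr_powr flip: power_mult)
    moreover have "real k * ?n / p = real k * \<beta> + real k * ?n" by (simp add: \<beta>_def algebra_simps)
    ultimately show ?thesis by (simp add: powr_add)
   qed
   finally show ?thesis by (simp add: power_mult_distrib mult_ac)
  qed
  have tl: "(\<forall>x\<in>ball c (2 * r). norm (?P2 x - ?P x) <= Ct * (Cg * W)) &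
  (\<I> y. ennreal (norm (f y - ?P y)) * ennreal (1 / norm (y - c) powr (real CARD('n) + (real s + \<delta>))) * ind (- ball c r) y)
   <= ennreal (Ct * (Cg * W) / r powr (real s + \<delta>))" by (rule tele[unfolded telescope_bound_def, rule_format, OF r CW fi o1])
  have P: "?P : poly_space s" by (rule proj_bound_D(1)[OF pb r fi])
  have P2: "?P2 : poly_space s" by (rule proj_bound_D(1)[OF pb r2 fi])
  have [measurable]: "f : Lmeas" using fL by (simp add: Lq_loc_def)
  note [measurable] = measurable_poly_space[OF P] measurable_poly_space[OF P2]
  define m where "m = measure lebesgue (ball c (2 * r))"
  have m: "0 < m" unfolding m_def by (rule measure_ball_pos[OF r2])
  have mr: "m = V2 * r ^ CARD('n)" unfolding m_def V2_def using r measure_lebesgue_ball[of "2 * r" c] by (simp add: power_mult_distrib)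
  have mq: "m powr (1 / q) = V2 powr (1 / q) * r powr (?n / q)" unfolding mr using V2 r by (simp add: powr_mult powr_powr flip: powr_realpow)
  define a where "a = Cg * W * 2 powr (?n / p) / V2 * m powr (1 / q)"
  define b where "b = Ct * (Cg * W) * m powr (1 / q)"
  have ab: "0 <= a" "0 <= b" using CW V2 Ct by (auto simp: a_def b_def)
  have oa: "lpow q (%x. ind (ball c (2 * r)) x * (f x - ?P2 x)) <= ennreal (a powr q)" proof -
   define Y where "Y = enn2real (campanato_norm N q s f) * enn2real (N (ind (ball c (2 * r))))"
   have "osc q s f c (2 * r) <= ennreal ((Y / m) powr q * m)" using campanato_osc[OF N pb f q r2, of c] by (simp add: Y_def m_def)
   also have "... <= ennreal (a powr q)" proof (rule ennreal_leI)
    have "Y <= Cg * W * 2 powr (?n / p) * r ^ CARD('n)" using nN[of 1] by (simp add: Y_def)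
    then have "Y / m <= Cg * W * 2 powr (?n / p) * r ^ CARD('n) / m" using m by (intro divide_right_mono) auto
    also have "... = Cg * W * 2 powr (?n / p) / V2" unfolding mr using r by simp
    finally have "Y / m * m powr (1 / q) <= a" unfolding a_def by (rule mult_right_mono) simp
    then have "(Y / m * m powr (1 / q)) powr q <= a powr q" using q m by (intro powr_mono2) (auto simp: Y_def)
    also have "(Y / m * m powr (1 / q)) powr q = (Y / m) powr q * m" unfolding powr_mult powr_powr using q m by simp
    finally show "(Y / m) powr q * m <= a powr q" .
   qed
   finally show ?thesis by (simp add: osc_def)
  qed
  have ob: "lpow q (%x. ind (ball c (2 * r)) x * (?P2 x - ?P x)) <= ennreal (b powr q)" unfolding b_def m_def by (rule lpow_ball_bounded[OF _ _ _ r2]) (use tl CW Ct q in auto)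
  have "lpow q (%x. ind (ball c (2 * r)) x * (f x - ?P2 x) + ind (ball c (2 * r)) x * (?P2 x - ?P x)) <= ennreal ((6 * (a + b)) powr q)" by (rule lpow_add_powr[OF _ _ q oa ob ab]) measurable
  also have "... <= ennreal ((C * W * r powr (?n / q)) powr q)" proof (intro ennreal_leI powr_mono2)
   have "6 * (a + b) = C1 * W * r powr (?n / q)" unfolding a_def b_def mq C1_def by (simp add: algebra_simps)
   also have "... <= C * W * r powr (?n / q)" using W0 by (intro mult_right_mono) (auto simp: C_def)
   finally show "6 * (a + b) <= C * W * r powr (?n / q)" .
  qed (use q ab in auto)
  finally have one: "lpow q (%x. ind (ball c (2 * r)) x * (f x - ?P x)) <= ennreal ((C * W * r powr (?n / q)) powr q)" by (simp add: algebra_simps)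
  have "ennreal (Ct * (Cg * W) / r powr (real s + \<delta>)) <= ennreal (C * W / r powr (real s + \<delta>))" unfolding mult.assoc[symmetric] using W0 by (intro ennreal_leI divide_right_mono mult_right_mono) (auto simp: C_def)
  then show "lpow q (%x. ind (ball c (2 * r)) x * (f x - ?P x)) <= ennreal ((C * W * r powr (?n / q)) powr q) &
   (\<I> y. ennreal (norm (f y - ?P y)) * ennreal (1 / norm (y - c) powr (?n + (real s + \<delta>))) * ind (- ball c r) y)
   <= ennreal (C * W / r powr (real s + \<delta>))" using one tl order_trans by blast
 qed
qed

lemma campanato_tail:
 assumes N: "ball_quasi_banach (N :: (real ^ 'n => complex) => ennreal)" and FS: "fefferman_stein N p0" and p0: "0 < p0"
  and q: "1 < q" and \<delta>: "0 < \<delta>"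
  and s: "real CARD('n) / p0 - real CARD('n) - \<delta> < real s" and f: "f : campanato N q s" and r: "0 < r"
 shows "Lint (%y. norm (f y) * tail_weight s \<delta> c r y)" proof -
 obtain Cp where pb: "proj_bound s TYPE('n) Cp" using proj_bound_exists by blast
 let ?P = "proj s c r f"
 have fL: "f : Lq_loc q" using f by (simp add: campanato_def)
 have P: "?P : poly_space s" by (rule proj_bound_D(1)[OF pb r Lq_loc_integrable[OF fL q]])
 have [measurable]: "f : Lmeas" using fL by (simp add: Lq_loc_def)
 note [measurable] = measurable_poly_space[OF P]
 obtain C where "0 < C" and C: "growth_bound N q s \<delta> C" using campanato_local_tail[OF N FS p0 pb q \<delta> s] by blast
 have fin: "(\<I> y. ennreal (norm (f y - ?P y)) * ennreal (1 / norm (y - c) powr (real CARD('n) + (real s + \<delta>))) * ind (- ball c r) y) < top" using C[unfolded growth_bound_def, rule_format, OF f r refl, of c] le_less_trans ennreal_less_top by blast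
 have i1: "Lint (%y. norm (f y - ?P y) * tail_weight s \<delta> c r y)" proof (rule integrableI_bounded)
  show "(%y. norm (f y - ?P y) * tail_weight s \<delta> c r y) : Lmeas" by measurable
  have "(\<I> y. ennreal (norm (norm (f y - ?P y) * tail_weight s \<delta> c r y))) =
   (\<I> y. ennreal (norm (f y - ?P y)) * ennreal (1 / norm (y - c) powr (real CARD('n) + (real s + \<delta>))) * ind (- ball c r) y)" proof (intro nn_integral_cong)
   fix y
   show "ennreal (norm (norm (f y - ?P y) * tail_weight s \<delta> c r y)) =
    ennreal (norm (f y - ?P y)) * ennreal (1 / norm (y - c) powr (real CARD('n) + (real s + \<delta>))) * ind (- ball c r) y" by (cases "y : ball c r") (simp_all add: tail_weight_def abs_mult ennreal_mult'[symmetric])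
  qed
  then show "(\<I> y. ennreal (norm (norm (f y - ?P y) * tail_weight s \<delta> c r y))) < \<infinity>" using fin by simp
 qed
 have i2: "Lint (%y. norm (f y - ?P y) * tail_weight s \<delta> c r y + norm (?P y) * tail_weight s \<delta> c r y)" by (intro Lintegrable_add i1 poly_tail[OF P \<delta> r])
 show ?thesis proof (rule Lintegrable_bound[OF i2])
  show "(%y. norm (f y) * tail_weight s \<delta> c r y) : Lmeas" by measurable
  show "AEL y. norm (norm (f y) * tail_weight s \<delta> c r y) <= norm (norm (f y - ?P y) * tail_weight s \<delta> c r y + norm (?P y) * tail_weight s \<delta> c r y)" proof (rule AE_I2)
   fix y
   have "norm (f y) <= norm (f y - ?P y) + norm (?P y)" using norm_triangle_ineq[of "f y - ?P y" "?P y"] by simp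
   from mult_right_mono[OF this tail_weight_nonneg[of s \<delta> c r y]]
   show "norm (norm (f y) * tail_weight s \<delta> c r y) <= norm (norm (f y - ?P y) * tail_weight s \<delta> c r y + norm (?P y) * tail_weight s \<delta> c r y)" using tail_weight_nonneg[of s \<delta> c r y] by (simp add: distrib_right)
  qed
 qed
qed

context cz_setting
begin

definition atom_bound :: "((real ^ 'n => complex) => ennreal) => real => real => real => bool" where
 "atom_bound N q q' C \<longleftrightarrow> (\<forall>f\<in>campanato N q s. \<forall>c r a W. 0 < r --> a : Linf_c --> (\<forall>x. x ~: ball c r --> a x = 0) --> moments_zero s a -->
  Lint (%x. f x * T a x) -->
  W = enn2real (campanato_norm N q s f) * enn2real (N (ind (ball c r))) / r ^ CARD('n) -->
  norm (\<L> x. f x * T a x) <= C * W * r powr (real CARD('n) / q) * enn2real (lpow q' a) powr (1 / q'))"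

text \<open>Subtracting \<open>P\<^sub>B f\<close> does not change the pairing. Near \<open>B\<close> apply Hoelder's inequality, far away the
  decay of \<open>T a\<close>.\<close>

lemma atom_pairing:
 assumes N: "ball_quasi_banach (N :: (real ^ 'n => complex) => ennreal)" and FS: "fefferman_stein N p0" and p0: "0 < p0"
  and q: "1 < q" and qq: "1 / q + 1 / q' = 1"
  and s: "real CARD('n) / p0 - real CARD('n) - \<delta> < real s"
  and van: "!!a P. a : Linf_c ==> moments_zero s a ==> P : poly_space s ==>
   Lint (%x. P x * T a x) & (\<L> x. P x * T a x) = 0"
 shows "\<exists>C>0. atom_bound N q q' C" proof -
 interpret cz_op "offdiag K" A \<delta> T B by (rule T)
 let ?n = "real CARD('n)" and ?V = "unit_ball_vol (real CARD('n))"
 obtain Cp where pb: "proj_bound s TYPE('n) Cp" using proj_bound_exists by blast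
 have q': "1 < q'" by (rule conjugate_exponent(2)[OF q qq])
 have qq2: "1 / q' + 1 / q = 1" using qq by simp
 obtain D where D: "0 <= D" "!!f. f : Linf_c ==> lpow q' (T f) <= ennreal D * lpow q' f" using Lp_boundedness[OF T T' q'] by blast
 obtain Cm where Cm: "0 < Cm" and mol: "molecule_bound s \<delta> T Cm" using molecule_decay[OF K \<delta> T] by blast
 obtain C1 where C1: "0 < C1" and lt: "growth_bound N q s \<delta> C1" using campanato_local_tail[OF N FS p0 pb q \<delta> s] by blast
 define C where "C = C1 * (D powr (1 / q')) + C1 * Cm * ?V powr (1 / q)"
 have C: "0 < C"  proof -
  have "?V ~= 0" by (rule less_imp_neq[symmetric]) simp
  then have "0 < ?V powr (1 / q)" by (rule powr_gt_zero[THEN iffD2])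
  then show ?thesis unfolding C_def using C1 Cm by (intro add_nonneg_pos mult_pos_pos) auto
 qed
 show ?thesis unfolding atom_bound_def proof (rule exI[of _ C], rule conjI[OF C], intro ballI allI impI)
  fix f a :: "real ^ 'n => complex" and c :: "real ^ 'n" and r W :: real
  assume f: "f : campanato N q s" and r: "0 < r" and a: "a : Linf_c" and supp: "\<forall>x. x ~: ball c r --> a x = 0" and mom: "moments_zero s a"
   and fT: "Lint (%x. f x * T a x)"
   and W: "W = enn2real (campanato_norm N q s f) * enn2real (N (ind (ball c r))) / r ^ CARD('n)"
  let ?P = "proj s c r f"
  have W0: "0 <= W" unfolding W using r by simp
  have fL: "f : Lq_loc q" using f by (simp add: campanato_def)
  have P: "?P : poly_space s" by (rule proj_bound_D(1)[OF pb r Lq_loc_integrable[OF fL q]])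
  have aL: "a : L2" by (rule Linf_c_L2[OF a])
  have [measurable]: "f : Lmeas" using fL by (simp add: Lq_loc_def)
  note [measurable] = measurable_poly_space[OF P] T_measurable[OF aL] Linf_c_measurable[OF a]
  note lt' = lt[unfolded growth_bound_def, rule_format, OF f r W]
  define w where "w x = f x - ?P x" for x
  have [measurable]: "w : Lmeas" unfolding w_def[abs_def] by measurable
  define \<alpha> where "\<alpha> = enn2real (lpow q' a) powr (1 / q')"
  have \<alpha>: "0 <= \<alpha>" by (simp add: \<alpha>_def)
  have afin: "lpow q' a < top" by (rule lpow_finite[OF a]) (use q' in simp)
  have la: "lpow q' a = ennreal (\<alpha> powr q')" unfolding \<alpha>_def by (rule lpow_root[OF afin]) (use q' in simp)
  define I where "I = (\<L> x. norm (a x))"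
  have I0: "0 <= I" unfolding I_def by (rule Lintegral_nonneg) simp
  have I: "I <= \<alpha> * (?V powr (1 / q) * r powr (?n / q))" proof -
   have e: "ind (ball c r) x * a x = a x" for x using supp by (cases "x : ball c r") auto
   show ?thesis using ball_L1_le[OF a q qq r, of c] unfolding e I_def \<alpha>_def .
  qed
  have van': "Lint (%x. ?P x * T a x)" "(\<L> x. ?P x * T a x) = 0" using van[OF a mom P] by blast+
  have e: "w x * T a x = f x * T a x - ?P x * T a x" for x by (simp add: w_def algebra_simps)
  have "(\<L> x. w x * T a x) = (\<L> x. f x * T a x)" unfolding e using Lintegral_diff[OF fT van'(1)] van'(2) by simp
  then have "ennreal (norm (\<L> x. f x * T a x)) = ennreal (norm (\<L> x. w x * T a x))" by simp
  also have "... <= (\<I> x. ennreal (norm (w x * T a x)))" by (rule integral_norm_bound_ennreal) (unfold e, intro Lintegrable_diff fT van'(1))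
  also have "... = (\<I> x. ennreal (norm (ind (ball c (2 * r)) x * w x) * norm (T a x)) + ennreal (norm (w x) * norm (T a x)) * ind (- ball c (2 * r)) x)" by (intro nn_integral_cong) (auto simp: indicator_def norm_mult)
  also have "... = (\<I> x. ennreal (norm (ind (ball c (2 * r)) x * w x) * norm (T a x))) + (\<I> x. ennreal (norm (w x) * norm (T a x)) * ind (- ball c (2 * r)) x)" by (rule nn_integral_add) measurable
  also have "... <= ennreal (C1 * W * r powr (?n / q) * (D powr (1 / q') * \<alpha>)) + ennreal (Cm * r powr (real s + \<delta>) * I * (C1 * W / r powr (real s + \<delta>)))" proof (rule add_mono)
   have "lpow q' (T a) <= ennreal D * ennreal (\<alpha> powr q')" using D(2)[OF a] unfolding la .
   also have "... = ennreal ((D powr (1 / q') * \<alpha>) powr q')" using D(1) \<alpha> q' by (simp add: powr_mult powr_powr flip: ennreal_mult')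
   finally have TA: "lpow q' (T a) <= ennreal ((D powr (1 / q') * \<alpha>) powr q')" .
   show "(\<I> x. ennreal (norm (ind (ball c (2 * r)) x * w x) * norm (T a x))) <= ennreal (C1 * W * r powr (?n / q) * (D powr (1 / q') * \<alpha>))" by (rule holder_nn_integral[OF _ _ q qq]) (use lt' TA C1 W0 \<alpha> in "auto simp: lpow_def w_def")
   have "(\<I> x. ennreal (norm (w x) * norm (T a x)) * ind (- ball c (2 * r)) x) <=
    (\<I> y. ennreal (Cm * r powr (real s + \<delta>) * I) * (ennreal (norm (w y)) * ennreal (1 / norm (y - c) powr (?n + (real s + \<delta>))) * ind (- ball c r) y))" proof (rule nn_integral_mono_AE)
    have "AEL y. y ~: ball c (2 * r) -->
    norm (T a y) <= Cm * r powr (real s + \<delta>) * I * (1 / norm (y - c) powr (?n + (real s + \<delta>)))" unfolding I_def using mol[unfolded molecule_bound_def, rule_format, OF aL Linf_c_integrable[OF a] supp[rule_format] mom r] .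
    then show "AEL x. ennreal (norm (w x) * norm (T a x)) * ind (- ball c (2 * r)) x <=
    ennreal (Cm * r powr (real s + \<delta>) * I) * (ennreal (norm (w x)) * ennreal (1 / norm (x - c) powr (?n + (real s + \<delta>))) * ind (- ball c r) x)" proof eventually_elim
    case (elim y)
    show ?case proof (cases "y : ball c (2 * r)")
    case False
    then have yr: "y ~: ball c r" using r by simp
    have "norm (w y) * norm (T a y) <= norm (w y) * (Cm * r powr (real s + \<delta>) * I * (1 / norm (y - c) powr (?n + (real s + \<delta>))))" using elim False by (intro mult_left_mono) auto
    also have "... = Cm * r powr (real s + \<delta>) * I * (norm (w y) * (1 / norm (y - c) powr (?n + (real s + \<delta>))))" by (simp only: mult_ac)
    finally have "ennreal (norm (w y) * norm (T a y)) <= ennreal (Cm * r powr (real s + \<delta>) * I * (norm (w y) * (1 / norm (y - c) powr (?n + (real s + \<delta>)))))" by (rule ennreal_leI)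
    also have "... = ennreal (Cm * r powr (real s + \<delta>) * I) * (ennreal (norm (w y)) * ennreal (1 / norm (y - c) powr (?n + (real s + \<delta>))))" using Cm I0 by (simp only: ennreal_mult mult_nonneg_nonneg norm_ge_zero powr_ge_zero zero_le_divide_1_iff less_imp_le)
    finally show ?thesis using False yr by simp
    qed simp
    qed
   qed
   also have "... = ennreal (Cm * r powr (real s + \<delta>) * I) * (\<I> y. ennreal (norm (w y)) * ennreal (1 / norm (y - c) powr (?n + (real s + \<delta>))) * ind (- ball c r) y)" by (rule nn_integral_cmult) measurable
   also have "... <= ennreal (Cm * r powr (real s + \<delta>) * I) * ennreal (C1 * W / r powr (real s + \<delta>))" using lt' unfolding w_def by (intro mult_left_mono) auto
   also have "... = ennreal (Cm * r powr (real s + \<delta>) * I * (C1 * W / r powr (real s + \<delta>)))" by (rule ennreal_mult'[symmetric]) (use Cm I0 in simp)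
   finally show "(\<I> x. ennreal (norm (w x) * norm (T a x)) * ind (- ball c (2 * r)) x) <=
    ennreal (Cm * r powr (real s + \<delta>) * I * (C1 * W / r powr (real s + \<delta>)))" .
  qed
  also have "... = ennreal (C1 * W * r powr (?n / q) * (D powr (1 / q') * \<alpha>) + Cm * r powr (real s + \<delta>) * I * (C1 * W / r powr (real s + \<delta>)))" using C1 W0 \<alpha> Cm I0 by (intro ennreal_plus[symmetric]) auto
  finally have "norm (\<L> x. f x * T a x) <= C1 * W * r powr (?n / q) * (D powr (1 / q') * \<alpha>) + Cm * r powr (real s + \<delta>) * I * (C1 * W / r powr (real s + \<delta>))" using C1 W0 \<alpha> Cm I0 by (subst (asm) ennreal_le_iff) (auto intro!: add_nonneg_nonneg mult_nonneg_nonneg)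
  also have "Cm * r powr (real s + \<delta>) * I * (C1 * W / r powr (real s + \<delta>)) = Cm * C1 * W * I" using r by simp
  also have "... <= Cm * C1 * W * (\<alpha> * (?V powr (1 / q) * r powr (?n / q)))" using Cm C1 W0 by (intro mult_left_mono I) auto
  also have "C1 * W * r powr (?n / q) * (D powr (1 / q') * \<alpha>) + Cm * C1 * W * (\<alpha> * (?V powr (1 / q) * r powr (?n / q))) = C * W * r powr (?n / q) * \<alpha>" by (simp add: C_def algebra_simps)
  finally show "norm (\<L> x. f x * T a x) <= C * W * r powr (?n / q) * enn2real (lpow q' a) powr (1 / q')" by (simp add: \<alpha>_def)
 qed
qed

end


section \<open>The equivalence\<close>

context cz_setting
begin

text \<open>A polynomial is integrable against \<open>T a\<close> because it satisfies the hypotheses of \<open>modified_cz_dual\<close>.\<close>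

lemma vanishing_moments_pairing:
 assumes van: "vanishing_moments s T" and a: "a : Linf_c" and mom: "moments_zero s a" and P: "P : poly_space s"
 shows "Lint (%x. P x * T a x) & (\<L> x. P x * T a x) = 0" proof -
 have int: "Lint (%x. Q x * T a x)" if Q: "Q : poly_space s" for Q using modified_cz_dual[of 2 Q 1, OF _ poly_Lq_loc[OF Q] _ poly_tail[OF Q \<delta>] a mom] by auto
 obtain R where R: "!!x. x ~: ball 0 R ==> a x = 0" using a by (rule Linf_cE) blast
 have mono: "(\<L> x. T a x * cmono \<gamma> x) = 0" if \<gamma>: "mi_abs \<gamma> <= s" for \<gamma> proof -
  have "\<exists>S. compact S & (\<forall>x. x ~: S --> a x = 0)" using R by (intro exI[of _ "cball 0 R"]) auto
  moreover have "\<forall>\<gamma>. mi_abs \<gamma> <= s --> (\<L> x. a x * of_real (mi_pow x \<gamma>)) = 0" by (intro allI impI bspec[OF mom[unfolded moments_zero_def]] poly_space_monomial)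
  ultimately show ?thesis using van Linf_c_L2[OF a] \<gamma> unfolding vanishing_moments_def by blast
 qed
 obtain b where b: "P = (%x. \<Sum>\<gamma> | mi_abs \<gamma> <= s. b \<gamma> * cmono \<gamma> x)" using P by (rule poly_spaceE)
 have "(\<L> x. P x * T a x) = (\<L> x. (\<Sum>\<gamma> | mi_abs \<gamma> <= s. b \<gamma> * (T a x * cmono \<gamma> x)))" unfolding b by (intro Lintegral_cong) (auto simp: sum_distrib_left mult_ac)
 also have "... = (\<Sum>\<gamma> | mi_abs \<gamma> <= s. \<L> x. b \<gamma> * (T a x * cmono \<gamma> x))" proof (rule Lintegral_sum)
  fix \<gamma> :: "'n => nat" assume "\<gamma> : {\<gamma>. mi_abs \<gamma> <= s}"
  then have "Lint (%x. cmono \<gamma> x * T a x)" by (intro int poly_space_monomial) simp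
  then have "Lint (%x. T a x * cmono \<gamma> x)" by (simp only: mult.commute)
  then show "Lint (%x. b \<gamma> * (T a x * cmono \<gamma> x))" by (rule integrable_mult_right)
 qed
 also have "... = 0" by (rule sum.neutral) (simp add: mono)
 finally show ?thesis using int[OF P] by blast
qed

text \<open>Test the oscillation on \<open>B\<close> with \<open>g\<close>. Replacing \<open>g\<close> by \<open>a = 1\<^sub>B (g - P\<^sub>B g)\<close> changes neither the pairing with
  \<open>F - P\<^sub>B F\<close> nor, up to a constant, the norm in \<open>L\<^sup>q\<^sup>'\<close>, and provides the vanishing moments.\<close>

lemma modified_cz_bounded:
 assumes N: "ball_quasi_banach (N :: (real ^ 'n => complex) => ennreal)" and FS: "fefferman_stein N p0" and p0: "0 < p0"
  and q: "1 < q" and s: "real CARD('n) / p0 - real CARD('n) - \<delta> < real s" and r0: "0 < r0"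
  and van: "vanishing_moments s T"
 shows "\<exists>C>0. \<forall>f \<in> campanato N q s. modified_cz s (%x y. K y x) x0 r0 f : campanato N q s &
  campanato_norm N q s (modified_cz s (%x y. K y x) x0 r0 f) <= ennreal C * campanato_norm N q s f" proof -
 let ?n = "real CARD('n)" and ?V = "unit_ball_vol (real CARD('n))"
 have V: "0 < ?V" by simp
 have V0: "?V ~= 0" by (rule less_imp_neq[OF V, symmetric])
 obtain Cp where pb: "proj_bound s TYPE('n) Cp" using proj_bound_exists by blast
 have Cp: "0 < Cp" using pb by (simp add: proj_bound_def)
 define q' where "q' = q / (q - 1)"
 have qq: "1 / q + 1 / q' = 1" using q by (simp add: q'_def field_simps)
 have q': "1 < q'" by (rule conjugate_exponent(2)[OF q qq])
 have q0: "0 < q" using q by simp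
 obtain Ca where Ca: "0 < Ca" and atom: "atom_bound N q q' Ca" using atom_pairing[OF N FS p0 q qq s vanishing_moments_pairing[OF van]] by blast
 define C3 where "C3 = 6 * (1 + Cp * 2 ^ s * ?V)"
 have C3: "0 < C3" using Cp V by (simp add: C3_def add_pos_pos)
 define C where "C = Ca * C3 * ?V / ?V powr (1 / q)"
 have Vq: "0 < ?V powr (1 / q)" by (rule powr_gt_zero[THEN iffD2, OF V0])
 have C: "0 < C" unfolding C_def using Ca C3 V Vq by (intro divide_pos_pos mult_pos_pos)
 show ?thesis proof (rule exI[of _ C], rule conjI[OF C], intro ballI)
  fix f :: "real ^ 'n => complex" assume f: "f : campanato N q s"
  have fL: "f : Lq_loc q" and nfin: "campanato_norm N q s f < top" using f by (auto simp: campanato_def)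
  define nf where "nf = enn2real (campanato_norm N q s f)"
  have nf: "0 <= nf" "campanato_norm N q s f = ennreal nf" using nfin by (simp_all add: nf_def)
  note tail = campanato_tail[OF N FS p0 q \<delta> s f r0, of x0]
  define F where "F = modified_cz s (%x y. K y x) x0 r0 f"
  have FL: "F : Lq_loc q" unfolding F_def by (rule modified_cz_Lq_loc[OF q fL r0 tail])
  have osc: "osc q s F c r <= ennreal ((C * nf * enn2real (N (ind (ball c r))) / measure lebesgue (ball c r)) powr q * measure lebesgue (ball c r))"
   if r: "0 < r" for c :: "real ^ 'n" and r proof -
   let ?B = "ball c r"
   define W where "W = nf * enn2real (N (ind ?B)) / r ^ CARD('n)"
   have W: "0 <= W" using nf r by (simp add: W_def)
   define PF where "PF = campanato_proj s ?B F"
   have PF: "PF : poly_space s" unfolding PF_def by (rule proj_bound_D(1)[OF pb r Lq_loc_integrable[OF FL q]])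
   define E where "E = Ca * W * r powr (?n / q) * C3"
   have E: "0 <= E" using Ca W C3 by (simp add: E_def)
   have dL: "(%x. F x - PF x) : Lq_loc q" by (rule Lq_loc_diff[OF FL poly_Lq_loc[OF PF q0] q0])
   have dm [measurable]: "(%x. F x - PF x) : Lmeas" using dL by (simp add: Lq_loc_def)
   have "lpow q (%x. ind ?B x * (F x - PF x)) <= ennreal (E powr q)" proof (rule lpow_by_duality[OF _ q qq E])
    show "(%x. ind ?B x * (F x - PF x)) : Lmeas" by measurable
    fix g :: "real ^ 'n => complex" assume g: "g : Linf_c"
    note [measurable] = Linf_c_measurable[OF g]
    have gB: "(%x. ind ?B x * g x) : Linf_c" by (rule Linf_c_indicator[OF g]) simp
    note gi = Linf_c_integrable[OF gB]
    define Pg where "Pg = campanato_proj s ?B g"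
    have Pg: "Pg : poly_space s" unfolding Pg_def by (rule proj_bound_D(1)[OF pb r gi])
    have PgB: "(%x. ind ?B x * Pg x) : Linf_c" by (intro continuous_ball_Linf_c continuous_poly_space[OF Pg])
    define a where "a x = ind ?B x * g x - ind ?B x * Pg x" for x
    have a: "a : Linf_c" unfolding a_def[abs_def] by (rule Linf_c_diff[OF gB PgB])
    have supp: "\<forall>x. x ~: ?B --> a x = 0" by (simp add: a_def)
    have aQ: "a x * Q x = ind ?B x * ((g x - Pg x) * Q x)" for Q x by (simp add: a_def algebra_simps)
    have aQ0: "(\<L> x. a x * Q x) = 0" if Q: "Q : poly_space s" for Q unfolding aQ Pg_def by (rule proj_bound_D(2)[OF pb r gi Q])
    have mom: "moments_zero s a" using aQ0 by (simp add: moments_zero_def)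
    note dual = modified_cz_dual[OF q fL r0 tail a mom, folded F_def]
    define \<alpha> where "\<alpha> = enn2real (lpow q' g) powr (1 / q')"
    have \<alpha>: "0 <= \<alpha>" by (simp add: \<alpha>_def)
    have lg: "lpow q' g = ennreal (\<alpha> powr q')" unfolding \<alpha>_def using q' by (intro lpow_root lpow_finite[OF g]) auto
    define I where "I = (\<L> x. norm (ind ?B x * g x))"
    have I0: "0 <= I" unfolding I_def by (rule Lintegral_nonneg) simp
    have I: "I <= \<alpha> * (?V powr (1 / q) * r powr (?n / q))" unfolding I_def \<alpha>_def by (rule ball_L1_le[OF g q qq r])
    have la: "lpow q' a <= ennreal ((C3 * \<alpha>) powr q')" proof -
    have 1: "lpow q' (%x. ind ?B x * g x) <= ennreal (\<alpha> powr q')" unfolding lg[symmetric] by (rule lpow_mono) (use q' in "auto simp: indicator_def")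
    define M where "M = Cp * 2 ^ s * (I / r ^ CARD('n))"
    have M: "0 <= M" using Cp I0 r by (simp add: M_def)
    have 2: "lpow q' (%x. ind ?B x * (- Pg x)) <= ennreal ((M * measure lebesgue ?B powr (1 / q')) powr q')" proof (rule lpow_ball_bounded[OF _ M _ r])
    fix x assume x: "x : ?B"
    have "norm (Pg x) <= Cp * (1 + norm (x - c) / r) ^ s * (I / r ^ CARD('n))" unfolding Pg_def I_def by (rule proj_bound_D(3)[OF pb r gi])
    also have "... <= Cp * 2 ^ s * (I / r ^ CARD('n))" proof (intro mult_right_mono mult_left_mono power_mono)
    have "norm (x - c) < r" using x by (simp add: dist_norm norm_minus_commute)
    then have "norm (x - c) / r <= 1" using r by simp
    then show "1 + norm (x - c) / r <= 2" by simp
    qed (use Cp I0 r in auto)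
    finally show "norm (- Pg x) <= M" by (simp add: M_def)
    qed (use q' in simp)
    have "M * measure lebesgue ?B powr (1 / q') <= Cp * 2 ^ s * ?V * \<alpha>" proof -
    have "r powr (?n / q) * r powr (?n / q') = r powr ?n" proof -
    have "?n / q + ?n / q' = ?n * (1 / q + 1 / q')" by (simp add: algebra_simps)
    then show ?thesis by (simp add: qq powr_add[symmetric])
    qed
    then have rn: "r powr (?n / q) * r powr (?n / q') = r ^ CARD('n)" using r by (simp add: powr_realpow)
    have Vn: "?V powr (1 / q) * ?V powr (1 / q') = ?V" using V by (simp add: powr_add[symmetric] qq)
    have "M * measure lebesgue ?B powr (1 / q') = Cp * 2 ^ s / r ^ CARD('n) * I * (?V powr (1 / q') * r powr (?n / q'))" unfolding M_def measure_ball_powr[OF r] by simp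
    also have "... <= Cp * 2 ^ s / r ^ CARD('n) * (\<alpha> * (?V powr (1 / q) * r powr (?n / q))) * (?V powr (1 / q') * r powr (?n / q'))" using Cp r by (intro mult_right_mono mult_left_mono I) auto
    also have "... = Cp * 2 ^ s / r ^ CARD('n) * \<alpha> * (?V powr (1 / q) * ?V powr (1 / q')) * (r powr (?n / q) * r powr (?n / q'))" by (simp only: mult_ac)
    also have "... = Cp * 2 ^ s * ?V * \<alpha>" unfolding rn Vn using r by simp
    finally show ?thesis .
    qed
    then have "(M * measure lebesgue ?B powr (1 / q')) powr q' <= (Cp * 2 ^ s * ?V * \<alpha>) powr q'" using M q' by (intro powr_mono2) auto
    then have 3: "lpow q' (%x. ind ?B x * (- Pg x)) <= ennreal ((Cp * 2 ^ s * ?V * \<alpha>) powr q')" using 2 ennreal_leI order_trans by blast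
    note [measurable] = measurable_poly_space[OF Pg]
    have "lpow q' (%x. ind ?B x * g x + ind ?B x * (- Pg x)) <= ennreal ((6 * (\<alpha> + Cp * 2 ^ s * ?V * \<alpha>)) powr q')" by (rule lpow_add_powr[OF _ _ q' 1 3 \<alpha>]) (use Cp V \<alpha> in auto)
    also have "6 * (\<alpha> + Cp * 2 ^ s * ?V * \<alpha>) = C3 * \<alpha>" by (simp add: C3_def algebra_simps)
    finally show ?thesis by (simp add: a_def[abs_def])
    qed
    have aa: "enn2real (lpow q' a) powr (1 / q') <= C3 * \<alpha>" proof -
    have "enn2real (lpow q' a) <= (C3 * \<alpha>) powr q'" using la by (intro enn2real_leI) auto
    then have "enn2real (lpow q' a) powr (1 / q') <= ((C3 * \<alpha>) powr q') powr (1 / q')" using q' by (intro powr_mono2) auto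
    then show ?thesis using C3 \<alpha> q' by (simp add: powr_powr)
    qed
    have i1: "Lint (%x. F x * a x)" using dual by blast
    have di: "Lint (%x. ind ?B x * (F x - PF x))" by (rule Lq_loc_integrable[OF dL q])
    have i2: "Lint (%x. ind ?B x * ((F x - PF x) * Pg x))" using integrable_mult_poly[OF di _ Pg, of c r] by (simp add: mult.assoc)
    have i3: "Lint (%x. a x * PF x)" by (rule integrable_mult_poly[OF Linf_c_integrable[OF a] supp PF])
    have z2: "(\<L> x. ind ?B x * ((F x - PF x) * Pg x)) = 0" unfolding PF_def by (rule proj_bound_D(2)[OF pb r Lq_loc_integrable[OF FL q] Pg])
    \<comment> \<open>Both corrections vanish: \<open>F - PF\<close> is orthogonal to \<open>Pg\<close>, and \<open>g - Pg\<close> to \<open>PF\<close>.\<close>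
    have "(\<L> x. g x * (ind ?B x * (F x - PF x))) =
    (\<L> x. (F x * a x + ind ?B x * ((F x - PF x) * Pg x)) - a x * PF x)" by (intro Lintegral_cong) (auto simp: a_def algebra_simps)
    also have "... = (\<L> x. F x * a x + ind ?B x * ((F x - PF x) * Pg x)) - (\<L> x. a x * PF x)" by (intro Lintegral_diff Lintegrable_add i1 i2 i3)
    also have "(\<L> x. F x * a x + ind ?B x * ((F x - PF x) * Pg x)) = (\<L> x. F x * a x) + (\<L> x. ind ?B x * ((F x - PF x) * Pg x))" by (rule Lintegral_add[OF i1 i2])
    finally have "(\<L> x. g x * (ind ?B x * (F x - PF x))) = (\<L> x. f x * T a x)" using dual z2 aQ0[OF PF] by simp
    then have "norm (\<L> x. g x * (ind ?B x * (F x - PF x))) <= Ca * W * r powr (?n / q) * enn2real (lpow q' a) powr (1 / q')" using atom[unfolded atom_bound_def, rule_format, OF f r a supp[rule_format] mom _ refl] dual by (simp add: W_def nf_def)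
    also have "... <= Ca * W * r powr (?n / q) * (C3 * \<alpha>)" using Ca W by (intro mult_left_mono aa) auto
    finally show "norm (\<L> x. g x * (ind ?B x * (F x - PF x))) <= E * enn2real (lpow q' g) powr (1 / q')" by (simp add: E_def \<alpha>_def mult.assoc)
   qed
   then have "osc q s F c r <= ennreal (E powr q)" by (simp add: osc_def PF_def)
   also have "E powr q = (C * nf * enn2real (N (ind ?B)) / measure lebesgue ?B) powr q * measure lebesgue ?B" proof -
    define m where "m = measure lebesgue ?B"
    have m: "0 < m" unfolding m_def by (rule measure_ball_pos[OF r])
    have mr: "m = ?V * r ^ CARD('n)" unfolding m_def using r by (intro measure_lebesgue_ball) simp
    have mq: "m powr (1 / q) = ?V powr (1 / q) * r powr (?n / q)" unfolding m_def using measure_ball_powr[OF r, of c "1 / q"] by simp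
    have b: "0 <= C * nf * enn2real (N (ind ?B)) / m" using C nf m by simp
    have "C * nf * enn2real (N (ind ?B)) / m = C * W / ?V" unfolding mr W_def using r V0 by (simp add: mult_ac)
    also have "... * m powr (1 / q) = E" unfolding mq C_def E_def using V0 by simp
    finally have "E = C * nf * enn2real (N (ind ?B)) / m * m powr (1 / q)" ..
    then have "E powr q = (C * nf * enn2real (N (ind ?B)) / m) powr q * (m powr (1 / q)) powr q" using b m by (simp only: powr_mult)
    then show ?thesis using m q by (simp add: powr_powr m_def)
   qed
   finally show ?thesis .
  qed
  have Cn: "0 <= C * nf" using C nf by simp
  have "campanato_norm N q s F <= ennreal (C * nf)" by (rule campanato_norm_le[OF N pb FL q Cn osc])
  also have "... = ennreal C * campanato_norm N q s f" unfolding nf(2) using C by (simp add: ennreal_mult')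
  finally have le: "campanato_norm N q s F <= ennreal C * campanato_norm N q s f" .
  also have "... < top" using nfin by (simp add: ennreal_mult_less_top)
  finally have "F : campanato N q s" using FL by (simp add: campanato_def)
  then show "modified_cz s (%x y. K y x) x0 r0 f : campanato N q s &
   campanato_norm N q s (modified_cz s (%x y. K y x) x0 r0 f) <= ennreal C * campanato_norm N q s f" using le by (simp add: F_def)
 qed
qed

text \<open>Polynomials have norm zero, so they are mapped to polynomials.\<close>

lemma vanishing_moments_of_bounded:
 assumes N: "ball_quasi_banach (N :: (real ^ 'n => complex) => ennreal)" and q: "1 < q" and r0: "0 < r0"
  and bd: "!!f. f : campanato N q s ==> modified_cz s (%x y. K y x) x0 r0 f : campanato N q s &
  campanato_norm N q s (modified_cz s (%x y. K y x) x0 r0 f) <= ennreal C * campanato_norm N q s f"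
 shows "vanishing_moments s T" unfolding vanishing_moments_def proof (intro ballI impI allI, elim conjE exE)
 fix a :: "real ^ 'n => complex" and S and \<gamma> :: "'n => nat"
 assume a: "a : L2" and S: "compact S" "\<forall>x. x ~: S --> a x = 0"
  and mom0: "\<forall>\<gamma>. mi_abs \<gamma> <= s --> (\<L> x. a x * of_real (mi_pow x \<gamma>)) = 0" and \<gamma>: "mi_abs \<gamma> <= s"
 obtain Cp where pb: "proj_bound s TYPE('n) Cp" using proj_bound_exists by blast
 have q0: "0 < q" using q by simp
 obtain R where R: "0 < R" "S \<subseteq> ball 0 R" using compact_imp_bounded[OF S(1)] bounded_subset_ballD[of S 0] by blast
 have supp: "\<forall>x. x ~: ball 0 R --> a x = 0" using R(2) S(2) by blast
 have am [measurable]: "a : Lmeas" and afin: "lpow 2 a < top" using a by (auto simp: L2_iff_lpow)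
 have ai: "Lint a" by (rule lpow_ball_integrable[OF am _ afin, of 0 R]) (use supp in auto)
 have mom: "moments_zero s a" by (rule moments_zeroI[OF ai supp]) (use mom0 in blast)
 define P where "P = (%x :: real ^ 'n. cmono \<gamma> x)"
 have P: "P : poly_space s" unfolding P_def by (rule poly_space_monomial[OF \<gamma>])
 have PL: "P : Lq_loc q" by (rule poly_Lq_loc[OF P q0])
 have "campanato_norm N q s P <= ennreal 0" proof (rule campanato_norm_le[OF N pb PL q order_refl])
  fix c :: "real ^ 'n" and r :: real assume r: "0 < r"
  have "osc q s P c r = 0" using q by (simp add: osc_def campanato_proj_poly[OF r P] lpow_def)
  then show "osc q s P c r <= ennreal ((0 * enn2real (N (ind (ball c r))) / measure lebesgue (ball c r)) powr q * measure lebesgue (ball c r))" by simp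
 qed
 then have n0: "campanato_norm N q s P = 0" by simp
 then have Pc: "P : campanato N q s" using PL by (simp add: campanato_def)
 define F where "F = modified_cz s (%x y. K y x) x0 r0 P"
 have F: "F : campanato N q s" and F0: "campanato_norm N q s F = 0" using bd[OF Pc] n0 by (auto simp: F_def)
 have FL: "F : Lq_loc q" using F by (simp add: campanato_def)
 have Fm [measurable]: "F : Lmeas" using FL by (simp add: Lq_loc_def)
 define PF where "PF = proj s 0 R F"
 have PF: "PF : poly_space s" unfolding PF_def by (rule proj_bound_D(1)[OF pb R(1) Lq_loc_integrable[OF FL q]])
 note [measurable] = measurable_poly_space[OF PF]
 have "osc q s F 0 R <= 0" using campanato_osc[OF N pb F q R(1), of 0] q by (simp add: F0)
 then have "(\<I> x. ennreal (norm (ind (ball 0 R) x * (F x - PF x)) powr q)) = 0" by (simp add: osc_def lpow_def PF_def)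
 then have "AEL x. ennreal (norm (ind (ball 0 R) x * (F x - PF x)) powr q) = 0" by (subst (asm) nn_integral_0_iff_AE) measurable
 then have ae: "AEL x. F x * a x = a x * PF x" proof eventually_elim
  case (elim x)
  show ?case proof (cases "x : ball 0 R")
   case True
   then have "norm (F x - PF x) powr q <= 0" using elim by (simp add: ennreal_eq_0_iff)
   then have "F x = PF x" by (simp add: powr_eq_0_iff order_antisym_conv)
   then show ?thesis by simp
  qed (use supp in simp)
 qed
 have "(\<L> x. T a x * of_real (mi_pow x \<gamma>)) = (\<L> x. P x * T a x)" by (simp add: P_def mult.commute)
 also have "... = (\<L> x. F x * a x)" unfolding F_def by (rule modified_cz_dual_poly[OF P r0 a supp mom, symmetric])
 also have "... = (\<L> x. a x * PF x)" by (rule integral_cong_AE[OF _ _ ae]) measurable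
 also have "... = 0" using mom PF unfolding moments_zero_def by blast
 finally show "(\<L> x. T a x * of_real (mi_pow x \<gamma>)) = 0" .
qed

end

theorem theorem3p12:
  fixes N :: "(real ^ 'n \<Rightarrow> complex) \<Rightarrow> ennreal"
    and p_minus \<delta> q r0 :: real and s :: nat
    and K :: "real ^ 'n \<Rightarrow> real ^ 'n \<Rightarrow> complex"
    and T :: "(real ^ 'n \<Rightarrow> complex) \<Rightarrow> real ^ 'n \<Rightarrow> complex"
    and x0 :: "real ^ 'n"
  assumes "ball_quasi_banach N"
    and "0 < p_minus"
    and "fefferman_stein N p_minus"
    and "0 < \<delta>" and "\<delta> \<le> 1"
    and "1 < q"
    and "real CARD('n) / p_minus - real CARD('n) - \<delta> < real s"
    and "standard_kernel s \<delta> K"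
    and "cz_operator s \<delta> K T"
    and "\<exists>T'. cz_operator s \<delta> (\<lambda>x y. K y x) T'"
    and "0 < r0"
  shows "(\<exists>C::real. C > 0 \<and>
            (\<forall>f \<in> campanato N q s.
               modified_cz s (\<lambda>x y. K y x) x0 r0 f \<in> campanato N q s \<and>
               campanato_norm N q s (modified_cz s (\<lambda>x y. K y x) x0 r0 f)
                 \<le> ennreal C * campanato_norm N q s f))
         \<longleftrightarrow> vanishing_moments s T"
proof -
  obtain A where A: "cz_kernel (offdiag K) A \<delta>" using cz_kernel_offdiag[OF assms(8) assms(4)] by blast
  obtain B where T: "cz_op (offdiag K) A \<delta> T B" using cz_op_offdiag[OF assms(9) A] by blast
  obtain T' where "cz_operator s \<delta> (\<lambda>x y. K y x) T'" using assms(10) by blast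
  moreover have "cz_kernel (offdiag (\<lambda>x y. K y x)) A \<delta>" unfolding offdiag_swap[of K] by (rule cz_kernel.swap[OF A])
  ultimately obtain B' where "cz_op (offdiag (\<lambda>x y. K y x)) A \<delta> T' B'" using cz_op_offdiag by blast
  then have T': "cz_op (\<lambda>x y. offdiag K y x) A \<delta> T' B'" unfolding offdiag_swap[of K] .
  interpret cz_setting K s \<delta> A B B' T T' by (rule cz_setting.intro[OF assms(8,4) T T'])
  show ?thesis
    using vanishing_moments_of_bounded[OF assms(1,6,11), of x0] modified_cz_bounded[OF assms(1,3,2,6,7,11), of x0] by blast
qed

end
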